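(* Let $F_1,F_2,g,\sigma$ satisfy Assumptions (A1), (A2), (A3) listed in the context, and let $H_\varepsilon=H_0+\varepsilon H_1$, $\mathcal F$, $\mathcal G$, $\Gamma_a$, $\Gamma_u$, $\Phi^0_{\mathrm{up}}$, $M_{\mathrm{up}}$ and $\alpha_0$ be as defined there. Then there exists $\varepsilon_0>0$ such that, for every $|\varepsilon|<\varepsilon_0$, there exist hyperbolic trajectories $\Gamma_a^\varepsilon(t)$ and $\Gamma_u^\varepsilon(t)$, $t\in\mathbb R$, of the perturbed Hamiltonian system $$\dot\Phi=J\nabla_\Phi H_\varepsilon(t,\Phi)=\mathcal F(\Phi)+\varepsilon\,\mathcal G(t,\Phi)$$ satisfying $$\sup_{t\in\mathbb R}|\Gamma_a^\varepsilon(t)-\Gamma_a|+\sup_{t\in\mathbb R}|\Gamma_u^\varepsilon(t)-\Gamma_u|=O(\varepsilon).$$ Moreover, there exist $\alpha_\varepsilon=\alpha_0+O(\varepsilon)$ and a solution $\Phi^\varepsilon_{\mathrm{up}}(t;\alpha_\varepsilon)=(\phi^\varepsilon_{\mathrm{up}}(t;\alpha_\varepsilon),\psi^\varepsilon_{\mathrm{up}}(t;\alpha_\varepsilon))^\top$ of this perturbed Hamiltonian system such that $$\lim_{t\to-\infty}|\Phi^\varepsilon_{\mathrm{up}}(t;\alpha_\varepsilon)-\Gamma^\varepsilon_a(t)|=0,\qquad \lim_{t\to+\infty}|\Phi^\varepsilon_{\mathrm{up}}(t;\alpha_\varepsilon)-\Gamma^\varepsilon_u(t)|=0.$$ In particular,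 its configuration component $\phi^\varepsilon_{\mathrm{up}}$ gives a perturbed uphill connection from a neighborhood of $z_a$ to a neighborhood of $z_u$.
   Context: **Setting.** Consider the degenerate SDE on $\mathbb R^n\times\mathbb R^m$, with $z=(x,y)^\top$, $$dX_t=F_1(X_t,Y_t)\,dt,\qquad dY_t=[F_2(X_t,Y_t)+\varepsilon g(t,X_t,Y_t)]\,dt+\sqrt{\mu}\,\sigma(X_t,Y_t)\,dB_t,$$ where $F_1:\mathbb R^n\times\mathbb R^m\to\mathbb R^n$, $F_2:\mathbb R^n\times\mathbb R^m\to\mathbb R^m$, $g$ is a time-dependent $\mathbb R^m$-valued function of $(t,x,y)$ (with $t\in\mathbb R$), $\sigma$ is $\mathbb R^{m\times m}$-valued, $B_t$ is an $m$-dimensional standard Brownian motion. Put $F=(F_1,F_2)^\top$ and $\Sigma=\sigma\sigma^\top$. In inner products with vectors of $\mathbb R^{n+m}$, $g$ is identified with $(0,g)^\top$. **Assumption (A1)** (on time intervals $[a,b]$). (i) For every $R>0$, $\int_a^b\sup_{|z|\le R}|g(s,z)|\,ds<\infty$. (ii) Let $\delta_0\in(0,1)$. For every $R>0$ there are $L_R>0$ and a nonnegative integrable function $\eta_R$ on $[a,b]$ such that, whenever $|z_1|\vee|z_2|\le R$ and $|z_1-z_2|\le\delta_0$, $2\langle z_1-z_2,F(z_1)-F(z_2)\rangle+\|\sigma(z_1)-\sigma(z_2)\|^2\le L_R|z_1-z_2|^2$ and $2\langle z_1-z_2,g(s,z_1)-g(s,z_2)\rangle\le\eta_R(s)|z_1-z_2|^2$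 for $s\in[a,b]$. (iii) There exist $\mathcal U\in C^2(\mathbb R^n\times\mathbb R^m;\mathbb R_+)$, $\theta>0$, $\vartheta>0$, a constant $C>0$ and a nonnegative integrable function $\eta_{\mathcal U}$ on $[a,b]$ such that $\lim_{|z|\to\infty}\mathcal U(z)=+\infty$; $\langle F(z),\nabla\mathcal U(z)\rangle+\frac\theta2\mathrm{Trace}(\sigma(z)^\top\nabla^2_{yy}\mathcal U(z)\sigma(z))+\frac{|\sigma(z)\cdot\nabla_y\mathcal U(z)|^2}{\vartheta\,\mathcal U(z)}\le C(1+\mathcal U(z))$; $\langle g(s,z),\nabla\mathcal U(z)\rangle\le\eta_{\mathcal U}(s)(1+\mathcal U(z))$ for $s\in[a,b]$; and $\mathrm{Trace}(\sigma(z)^\top\nabla^2_{yy}\mathcal U(z)\sigma(z))\ge0$. (iv) There is $\lambda_0>0$ with $v^\top\Sigma(z)v\ge\lambda_0|v|^2$ for all $z\in\mathbb R^n\times\mathbb R^m$, $v\in\mathbb R^m$. **Assumption (A2).** (i) The parameters satisfy $0<\mu<\varepsilon\ll1$. (ii) The system $\dot z=F(z)$ has three hyperbolic equilibria: two stable equilibria $z_a,z_b$ and a saddle (unstable) equilibrium $z_u$ lying on the separatrix between the basins of attraction of $z_a$ and $z_b$. **Hamiltonian system.** For $\Phi=(\phi,\psi)^\top=(\phi_x,\phi_y,\psi_x,\psi_y)^\top\in\mathbb R^{2(n+m)}$ set $$H_0(\Phi)=\tfrac12\psi_y^\top\Sigma(\phi)\psi_y+\psi_x^\top F_1(\phi)+\psi_y^\top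 F_2(\phi),\quad H_1(t,\Phi)=\psi_y^\top g(t,\phi),\quad H_\varepsilon=H_0+\varepsilon H_1,$$ $J=\begin{pmatrix}0&I_{n+m}\\-I_{n+m}&0\end{pmatrix}$, $\mathcal F=J\nabla_\Phi H_0$, $\mathcal G=J\nabla_\Phi H_1$, i.e. $\mathcal G(t,\phi,\psi)=(0,\;g,\;-(\partial_{\phi_x}g)^\top\psi_y,\;-(\partial_{\phi_y}g)^\top\psi_y)^\top$. Let $\Gamma_a=(z_a,0,0)^\top$ and $\Gamma_u=(z_u,0,0)^\top$. **Assumption (A3).** (ii) The unperturbed system $\dot\Phi=\mathcal F(\Phi)$ admits an "uphill" heteroclinic orbit $\Phi^0_{\mathrm{up}}(t)=(\phi^*(t),\psi^*(t))^\top$, $t\in\mathbb R$, with $\Phi^0_{\mathrm{up}}(t)\to\Gamma_a$ as $t\to-\infty$ and $\Phi^0_{\mathrm{up}}(t)\to\Gamma_u$ as $t\to+\infty$. (i) There is a neighborhood $U$ of $\Phi^0_{\mathrm{up}}(\mathbb R)\cup\{\Gamma_a,\Gamma_u\}$ in phase space, with projection $U_\phi$ onto the configuration ($\phi$-)space, such that $\Sigma\in C_b^3(U_\phi)$, $\mathcal F\in C_b^2(U)$, $\mathcal G\in C_b^2(\mathbb R\times U)$ ($C_b^k$: $C^k$ with bounded derivatives up to order $k$). (iii) $\Gamma_a$ and $\Gamma_u$ are hyperbolic equilibria of $\dot\Phi=\mathcal F(\Phi)$, and, with $\mathcal E_0=\{\Phi:H_0(\Phi)=0\}$ and $W^u,W^s$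 the unstable and stable manifolds for $\mathcal F$, $$T_{\Phi^0_{\mathrm{up}}(0)}W^u(\Gamma_a;\mathcal F)+T_{\Phi^0_{\mathrm{up}}(0)}W^s(\Gamma_u;\mathcal F)=T_{\Phi^0_{\mathrm{up}}(0)}\mathcal E_0.$$ (iv) The Melnikov function $$M_{\mathrm{up}}(\alpha)=\int_{-\infty}^{+\infty}\big\langle\nabla_\Phi H_0(\Phi^0_{\mathrm{up}}(s)),\,\mathcal G(s+\alpha,\Phi^0_{\mathrm{up}}(s))\big\rangle\,ds$$ has a simple zero: there is $\alpha_0\in\mathbb R$ with $M_{\mathrm{up}}(\alpha_0)=0$ and $M_{\mathrm{up}}'(\alpha_0)\ne0$. **Conventions.** A hyperbolic trajectory of a nonautonomous ODE is a solution defined for all $t\in\mathbb R$ along which the linearized equation has an exponential dichotomy on $\mathbb R$. $O(\varepsilon)$ is as $\varepsilon\to0$. *)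

theory Defs
  imports "HOL-Analysis.Analysis" "HOL-Library.Landau_Symbols"
begin

type_synonym ('n, 'm) config = "(real ^ 'n) \<times> (real ^ 'm)"
type_synonym ('n, 'm) phase = "('n, 'm) config \<times> ('n, 'm) config"

subsection \<open>Calculus\<close>

text \<open>\<open>grad f x\<close> is meaningful only where \<open>f\<close> is differentiable; differentiability is required
  wherever the predicates below use a gradient.\<close>

definition grad :: "('a::euclidean_space \<Rightarrow> real) \<Rightarrow> 'a \<Rightarrow> 'a" where
  "grad f x = (THE D. GDERIV f x :> D)"

text \<open>\<open>C\<^sup>k\<close> and \<open>C\<^sub>b\<^sup>k\<close> on an open set, by recursion on the directional derivatives
  \<open>x \<mapsto> Df(x)v\<close>. In finite dimension boundedness of all iterated directional derivatives
  is boundedness of the derivatives as multilinear maps. The derivative of order 0, that is the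
  function itself, is among the bounded ones in \<open>Cb_on\<close>.\<close>

primrec Ck_on :: "nat \<Rightarrow> 'a::euclidean_space set \<Rightarrow> ('a \<Rightarrow> 'b::real_normed_vector) \<Rightarrow> bool" where
  "Ck_on 0 S f \<longleftrightarrow> continuous_on S f"
| "Ck_on (Suc k) S f \<longleftrightarrow>
     (\<forall>x\<in>S. f differentiable (at x)) \<and> (\<forall>v. Ck_on k S (\<lambda>x. frechet_derivative f (at x) v))"

primrec Cb_on :: "nat \<Rightarrow> 'a::euclidean_space set \<Rightarrow> ('a \<Rightarrow> 'b::real_normed_vector) \<Rightarrow> bool" where
  "Cb_on 0 S f \<longleftrightarrow> continuous_on S f \<and> bounded (f ` S)"
| "Cb_on (Suc k) S f \<longleftrightarrow>
     bounded (f ` S) \<and> (\<forall>x\<in>S. f differentiable (at x)) \<and>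
     (\<forall>v. Cb_on k S (\<lambda>x. frechet_derivative f (at x) v))"

definition grad_y :: "(('n::finite, 'm::finite) config \<Rightarrow> real) \<Rightarrow> ('n, 'm) config \<Rightarrow> real ^ 'm" where
  "grad_y V z = grad (\<lambda>y. V (fst z, y)) (snd z)"

definition hess_yy :: "(('n::finite, 'm::finite) config \<Rightarrow> real) \<Rightarrow> ('n, 'm) config \<Rightarrow> real ^ 'm ^ 'm" where
  "hess_yy V z = matrix (frechet_derivative (\<lambda>y. grad_y V (fst z, y)) (at (snd z)))"


subsection \<open>Equilibria, basins and invariant manifolds of autonomous equations\<close>

text \<open>\<open>c\<close> is an eigenvalue of the complexification of the real linear map \<open>L\<close>; an eigenvector
  \<open>u + \<i> v\<close> is given by its real and imaginary parts.\<close>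

definition complex_eigenvalue :: "('a::euclidean_space \<Rightarrow> 'a) \<Rightarrow> complex \<Rightarrow> bool" where
  "complex_eigenvalue L c \<longleftrightarrow>
     (\<exists>u v. (u \<noteq> 0 \<or> v \<noteq> 0) \<and>
        L u = Re c *\<^sub>R u - Im c *\<^sub>R v \<and> L v = Im c *\<^sub>R u + Re c *\<^sub>R v)"

definition hyperbolic_equilibrium :: "('a::euclidean_space \<Rightarrow> 'a) \<Rightarrow> 'a \<Rightarrow> bool" where
  "hyperbolic_equilibrium f p \<longleftrightarrow>
     f p = 0 \<and> f differentiable (at p) \<and>
     (\<forall>c. complex_eigenvalue (frechet_derivative f (at p)) c \<longrightarrow> Re c \<noteq> 0)"

definition stable_hyperbolic_equilibrium :: "('a::euclidean_space \<Rightarrow> 'a) \<Rightarrow> 'a \<Rightarrow> bool" where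
  "stable_hyperbolic_equilibrium f p \<longleftrightarrow>
     hyperbolic_equilibrium f p \<and>
     (\<forall>c. complex_eigenvalue (frechet_derivative f (at p)) c \<longrightarrow> Re c < 0)"

definition saddle_equilibrium :: "('a::euclidean_space \<Rightarrow> 'a) \<Rightarrow> 'a \<Rightarrow> bool" where
  "saddle_equilibrium f p \<longleftrightarrow>
     hyperbolic_equilibrium f p \<and>
     (\<exists>c. complex_eigenvalue (frechet_derivative f (at p)) c \<and> Re c < 0) \<and>
     (\<exists>c. complex_eigenvalue (frechet_derivative f (at p)) c \<and> Re c > 0)"

definition forward_orbit_to :: "('a::euclidean_space \<Rightarrow> 'a) \<Rightarrow> 'a \<Rightarrow> (real \<Rightarrow> 'a) \<Rightarrow> bool" where
  "forward_orbit_to f p w \<longleftrightarrow>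
     (\<forall>t\<ge>0. (w has_vector_derivative f (w t)) (at t within {0..})) \<and> (w \<longlongrightarrow> p) at_top"

definition backward_orbit_to :: "('a::euclidean_space \<Rightarrow> 'a) \<Rightarrow> 'a \<Rightarrow> (real \<Rightarrow> 'a) \<Rightarrow> bool" where
  "backward_orbit_to f p w \<longleftrightarrow>
     (\<forall>t\<le>0. (w has_vector_derivative f (w t)) (at t within {..0})) \<and> (w \<longlongrightarrow> p) at_bot"

definition basin :: "('a::euclidean_space \<Rightarrow> 'a) \<Rightarrow> 'a \<Rightarrow> 'a set" where
  "basin f p = {w 0 | w. forward_orbit_to f p w}"

text \<open>Tangent vectors of a set at \<open>q\<close>: velocities of \<open>C\<^sup>1\<close> curves in the set through \<open>q\<close>.\<close>

definition tangent_vectors :: "'a::euclidean_space set \<Rightarrow> 'a \<Rightarrow> 'a set" where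
  "tangent_vectors M q =
     {v. \<exists>\<delta>>0. \<exists>c. c 0 = q \<and> (\<forall>s\<in>{-\<delta><..<\<delta>}. c s \<in> M) \<and>
           c C1_differentiable_on {-\<delta><..<\<delta>} \<and> (c has_vector_derivative v) (at 0)}"

text \<open>The stable (unstable) manifold of \<open>p\<close> consists of the initial values \<open>w 0\<close> of the forward
  (backward) orbits \<open>w\<close> converging to \<open>p\<close>. In general it is only an injectively immersed
  submanifold, which may accumulate on itself, so the curves defining its tangent vectors have to be
  continuous in its manifold topology and not merely in the ambient one. That topology is the
  one of uniform convergence of the half-orbits: half-orbits uniformly close to \<open>w\<close> enter the local
  manifold together with \<open>w\<close>, hence start in the same embedded disc as \<open>w\<close>.\<close>

definition tangent_stable :: "('a::euclidean_space \<Rightarrow> 'a) \<Rightarrow> 'a \<Rightarrow> 'a \<Rightarrow> 'a set" where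
  "tangent_stable f p q =
     {v. \<exists>\<delta>>0. \<exists>w. w 0 0 = q \<and> (\<forall>s\<in>{-\<delta><..<\<delta>}. forward_orbit_to f p (w s)) \<and>
           (\<forall>s\<in>{-\<delta><..<\<delta>}. uniform_limit {0..} w (w s) (at s)) \<and>
           (\<lambda>s. w s 0) C1_differentiable_on {-\<delta><..<\<delta>} \<and>
           ((\<lambda>s. w s 0) has_vector_derivative v) (at 0)}"

definition tangent_unstable :: "('a::euclidean_space \<Rightarrow> 'a) \<Rightarrow> 'a \<Rightarrow> 'a \<Rightarrow> 'a set" where
  "tangent_unstable f p q =
     {v. \<exists>\<delta>>0. \<exists>w. w 0 0 = q \<and> (\<forall>s\<in>{-\<delta><..<\<delta>}. backward_orbit_to f p (w s)) \<and>
           (\<forall>s\<in>{-\<delta><..<\<delta>}. uniform_limit {..0} w (w s) (at s)) \<and>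
           (\<lambda>s. w s 0) C1_differentiable_on {-\<delta><..<\<delta>} \<and>
           ((\<lambda>s. w s 0) has_vector_derivative v) (at 0)}"


subsection \<open>Hyperbolic trajectories of nonautonomous equations\<close>

text \<open>Exponential dichotomy on the whole line for the linear equation \<open>u' = A(t) u\<close>: \<open>X\<close> is a
  fundamental matrix solution, \<open>Y\<close> its pointwise inverse, \<open>P\<close> the projection.\<close>

definition exponential_dichotomy :: "(real \<Rightarrow> 'a::euclidean_space \<Rightarrow> 'a) \<Rightarrow> bool" where
  "exponential_dichotomy A \<longleftrightarrow>
     (\<exists>(X :: real \<Rightarrow> 'a \<Rightarrow>\<^sub>L 'a) (Y :: real \<Rightarrow> 'a \<Rightarrow>\<^sub>L 'a) (P :: 'a \<Rightarrow>\<^sub>L 'a) (K::real) (l::real).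
        K > 0 \<and> l > 0 \<and>
        (\<forall>t v. ((\<lambda>s. blinfun_apply (X s) v) has_vector_derivative A t (blinfun_apply (X t) v)) (at t)) \<and>
        (\<forall>t. X t o\<^sub>L Y t = id_blinfun \<and> Y t o\<^sub>L X t = id_blinfun) \<and>
        P o\<^sub>L P = P \<and>
        (\<forall>t s. s \<le> t \<longrightarrow> norm (X t o\<^sub>L P o\<^sub>L Y s) \<le> K * exp (- l * (t - s))) \<and>
        (\<forall>t s. t \<le> s \<longrightarrow> norm (X t o\<^sub>L (id_blinfun - P) o\<^sub>L Y s) \<le> K * exp (- l * (s - t))))"

definition hyperbolic_trajectory ::
    "(real \<Rightarrow> 'a::euclidean_space \<Rightarrow> 'a) \<Rightarrow> (real \<Rightarrow> 'a) \<Rightarrow> bool" where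
  "hyperbolic_trajectory X w \<longleftrightarrow>
     (\<forall>t. (w has_vector_derivative X t (w t)) (at t)) \<and>
     (\<forall>t. X t differentiable (at (w t))) \<and>
     exponential_dichotomy (\<lambda>t. frechet_derivative (X t) (at (w t)))"


subsection \<open>The system and its Hamiltonian\<close>

definition drift ::
    "(('n::finite, 'm::finite) config \<Rightarrow> real ^ 'n) \<Rightarrow> (('n, 'm) config \<Rightarrow> real ^ 'm) \<Rightarrow>
     ('n, 'm) config \<Rightarrow> ('n, 'm) config" where
  "drift F1 F2 z = (F1 z, F2 z)"

definition diffusion ::
    "(('n::finite, 'm::finite) config \<Rightarrow> real ^ 'm ^ 'm) \<Rightarrow> ('n, 'm) config \<Rightarrow> real ^ 'm ^ 'm" where
  "diffusion \<sigma> z = \<sigma> z ** transpose (\<sigma> z)"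

text \<open>Phase points are \<open>((\<phi>\<^sub>x, \<phi>\<^sub>y), (\<psi>\<^sub>x, \<psi>\<^sub>y))\<close>.\<close>

definition H0 ::
    "(('n::finite, 'm::finite) config \<Rightarrow> real ^ 'n) \<Rightarrow> (('n, 'm) config \<Rightarrow> real ^ 'm) \<Rightarrow>
     (('n, 'm) config \<Rightarrow> real ^ 'm ^ 'm) \<Rightarrow> ('n, 'm) phase \<Rightarrow> real" where
  "H0 F1 F2 \<sigma> = (\<lambda>(\<phi>, (\<psi>x, \<psi>y)).
     1/2 * (\<psi>y \<bullet> (diffusion \<sigma> \<phi> *v \<psi>y)) + \<psi>x \<bullet> F1 \<phi> + \<psi>y \<bullet> F2 \<phi>)"

definition H1 ::
    "(real \<Rightarrow> ('n::finite, 'm::finite) config \<Rightarrow> real ^ 'm) \<Rightarrow> real \<Rightarrow> ('n, 'm) phase \<Rightarrow> real" where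
  "H1 g t = (\<lambda>(\<phi>, (\<psi>x, \<psi>y)). \<psi>y \<bullet> g t \<phi>)"

definition Heps ::
    "(('n::finite, 'm::finite) config \<Rightarrow> real ^ 'n) \<Rightarrow> (('n, 'm) config \<Rightarrow> real ^ 'm) \<Rightarrow>
     (real \<Rightarrow> ('n, 'm) config \<Rightarrow> real ^ 'm) \<Rightarrow> (('n, 'm) config \<Rightarrow> real ^ 'm ^ 'm) \<Rightarrow>
     real \<Rightarrow> real \<Rightarrow> ('n, 'm) phase \<Rightarrow> real" where
  "Heps F1 F2 g \<sigma> \<epsilon> t \<Phi> = H0 F1 F2 \<sigma> \<Phi> + \<epsilon> * H1 g t \<Phi>"

definition Jmap :: "('n::finite, 'm::finite) phase \<Rightarrow> ('n, 'm) phase" where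
  "Jmap \<Phi> = (snd \<Phi>, - fst \<Phi>)"

definition ham_field :: "(('n::finite, 'm::finite) phase \<Rightarrow> real) \<Rightarrow> ('n, 'm) phase \<Rightarrow> ('n, 'm) phase" where
  "ham_field H \<Phi> = Jmap (grad H \<Phi>)"

definition hamiltonian_solution ::
    "(real \<Rightarrow> ('n::finite, 'm::finite) phase \<Rightarrow> real) \<Rightarrow> (real \<Rightarrow> ('n, 'm) phase) \<Rightarrow> bool" where
  "hamiltonian_solution H w \<longleftrightarrow>
     (\<forall>t. H t differentiable (at (w t)) \<and> (w has_vector_derivative ham_field (H t) (w t)) (at t))"

definition Fham ::
    "(('n::finite, 'm::finite) config \<Rightarrow> real ^ 'n) \<Rightarrow> (('n, 'm) config \<Rightarrow> real ^ 'm) \<Rightarrow>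
     (('n, 'm) config \<Rightarrow> real ^ 'm ^ 'm) \<Rightarrow> ('n, 'm) phase \<Rightarrow> ('n, 'm) phase" where
  "Fham F1 F2 \<sigma> = ham_field (H0 F1 F2 \<sigma>)"

definition Gham ::
    "(real \<Rightarrow> ('n::finite, 'm::finite) config \<Rightarrow> real ^ 'm) \<Rightarrow> real \<Rightarrow> ('n, 'm) phase \<Rightarrow> ('n, 'm) phase" where
  "Gham g t = ham_field (H1 g t)"

lemma GDERIV_unique:
  assumes "GDERIV f x :> D" "GDERIV f x :> D'"
  shows "D = D'"
proof -
  have "(\<lambda>h. h \<bullet> D) = (\<lambda>h. h \<bullet> D')"
    using assms unfolding gderiv_def by (rule has_derivative_unique)
  then have "(D - D') \<bullet> D = (D - D') \<bullet> D'"
    by (rule fun_cong)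
  then have "(D - D') \<bullet> (D - D') = 0"
    by (simp add: inner_diff_right)
  then show ?thesis
    by simp
qed

lemma GDERIV_grad:
  assumes "f differentiable (at x)"
  shows "GDERIV f x :> grad f x"
proof -
  obtain L where L: "(f has_derivative L) (at x)"
    using assms unfolding differentiable_def by blast
  interpret L: bounded_linear L using L by (rule has_derivative_bounded_linear)
  have "(\<lambda>h. h \<bullet> adjoint L 1) = L"
    using adjoint_works[OF L.linear_axioms, of _ 1] by (simp add: fun_eq_iff)
  with L have *: "GDERIV f x :> adjoint L 1"
    by (simp add: gderiv_def)
  show ?thesis
    unfolding grad_def by (rule theI[where P = "\<lambda>D. GDERIV f x :> D", OF *]) (rule GDERIV_unique[OF _ *])
qed

lemma grad_eqI: "GDERIV f x :> D \<Longrightarrow> grad f x = D"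
  unfolding grad_def by (rule the_equality) (auto intro: GDERIV_unique)

lemma ham_field_Heps:
  assumes "H0 F1 F2 \<sigma> differentiable (at \<Phi>)" and "H1 g t differentiable (at \<Phi>)"
  shows "ham_field (Heps F1 F2 g \<sigma> \<epsilon> t) \<Phi> = Fham F1 F2 \<sigma> \<Phi> + \<epsilon> *\<^sub>R Gham g t \<Phi>"
proof -
  have "GDERIV (\<lambda>\<Phi>. \<epsilon> * H1 g t \<Phi>) \<Phi> :> \<epsilon> *\<^sub>R grad (H1 g t) \<Phi>"
    using has_derivative_mult_right[OF GDERIV_grad[OF assms(2), unfolded gderiv_def], of \<epsilon>]
    by (simp add: gderiv_def)
  from GDERIV_add[OF GDERIV_grad[OF assms(1)] this]
  have "grad (Heps F1 F2 g \<sigma> \<epsilon> t) \<Phi> = grad (H0 F1 F2 \<sigma>) \<Phi> + \<epsilon> *\<^sub>R grad (H1 g t) \<Phi>"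
    by (intro grad_eqI) (simp add: Heps_def[abs_def])
  then show ?thesis
    by (simp add: ham_field_def Fham_def Gham_def Jmap_def prod_eq_iff)
qed


subsection \<open>Standing assumptions\<close>

text \<open>Matrix norms are Frobenius norms, which is the library norm on \<open>real ^ 'm ^ 'm\<close>; \<open>g\<close> is
  identified with \<open>(0, g)\<close>. Where \<open>V z = 0\<close> the nonnegative \<open>V\<close> has zero gradient, and the quotient
  below, formally \<open>0 / 0\<close>, is \<open>0\<close>.\<close>

definition A1 ::
    "real \<Rightarrow> real \<Rightarrow> real \<Rightarrow>
     (('n::finite, 'm::finite) config \<Rightarrow> real ^ 'n) \<Rightarrow> (('n, 'm) config \<Rightarrow> real ^ 'm) \<Rightarrow>
     (real \<Rightarrow> ('n, 'm) config \<Rightarrow> real ^ 'm) \<Rightarrow> (('n, 'm) config \<Rightarrow> real ^ 'm ^ 'm) \<Rightarrow> bool" where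
  "A1 \<delta>0 a b F1 F2 g \<sigma> \<longleftrightarrow>
     (\<forall>R>0. (\<lambda>s. SUP z\<in>cball 0 R. ennreal (norm (g s z))) \<in> borel_measurable (lebesgue_on {a..b}) \<and>
        (\<integral>\<^sup>+ s. (SUP z\<in>cball 0 R. ennreal (norm (g s z))) \<partial>lebesgue_on {a..b}) < \<infinity>) \<and>
     (\<forall>R>0. \<exists>L>0. \<exists>\<eta>. integrable (lebesgue_on {a..b}) \<eta> \<and> (\<forall>s\<in>{a..b}. 0 \<le> \<eta> s) \<and>
        (\<forall>z1 z2. max (norm z1) (norm z2) \<le> R \<and> norm (z1 - z2) \<le> \<delta>0 \<longrightarrow>
           2 * ((z1 - z2) \<bullet> (drift F1 F2 z1 - drift F1 F2 z2)) + (norm (\<sigma> z1 - \<sigma> z2))\<^sup>2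
             \<le> L * (norm (z1 - z2))\<^sup>2 \<and>
           (\<forall>s\<in>{a..b}. 2 * ((z1 - z2) \<bullet> ((0, g s z1) - (0, g s z2))) \<le> \<eta> s * (norm (z1 - z2))\<^sup>2))) \<and>
     (\<exists>V \<theta> \<kappa> C \<eta>. Ck_on 2 UNIV V \<and> (\<forall>z. 0 \<le> V z) \<and> \<theta> > 0 \<and> \<kappa> > 0 \<and> C > 0 \<and>
        integrable (lebesgue_on {a..b}) \<eta> \<and> (\<forall>s\<in>{a..b}. 0 \<le> \<eta> s) \<and>
        filterlim V at_top at_infinity \<and>
        (\<forall>z. drift F1 F2 z \<bullet> grad V z
              + \<theta> / 2 * trace (transpose (\<sigma> z) ** hess_yy V z ** \<sigma> z)
              + (norm (\<sigma> z *v grad_y V z))\<^sup>2 / (\<kappa> * V z)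
              \<le> C * (1 + V z)) \<and>
        (\<forall>s\<in>{a..b}. \<forall>z. (0, g s z) \<bullet> grad V z \<le> \<eta> s * (1 + V z)) \<and>
        (\<forall>z. 0 \<le> trace (transpose (\<sigma> z) ** hess_yy V z ** \<sigma> z))) \<and>
     (\<exists>l0>0. \<forall>z v. v \<bullet> (diffusion \<sigma> z *v v) \<ge> l0 * (norm v)\<^sup>2)"

text \<open>\<open>\<mu>\<close> and \<open>\<epsilon>\<close> are the parameters of the stochastic equation. The separatrix between the two
  basins is their common boundary.\<close>

definition A2 ::
    "real \<Rightarrow> real \<Rightarrow> (('n::finite, 'm::finite) config \<Rightarrow> real ^ 'n) \<Rightarrow>
     (('n, 'm) config \<Rightarrow> real ^ 'm) \<Rightarrow>
     ('n, 'm) config \<Rightarrow> ('n, 'm) config \<Rightarrow> ('n, 'm) config \<Rightarrow> bool" where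
  "A2 \<mu> \<epsilon> F1 F2 za zb zu \<longleftrightarrow>
     0 < \<mu> \<and> \<mu> < \<epsilon> \<and> \<epsilon> < 1 \<and>
     za \<noteq> zb \<and>
     stable_hyperbolic_equilibrium (drift F1 F2) za \<and>
     stable_hyperbolic_equilibrium (drift F1 F2) zb \<and>
     saddle_equilibrium (drift F1 F2) zu \<and>
     zu \<in> frontier (basin (drift F1 F2) za) \<inter> frontier (basin (drift F1 F2) zb)"

definition melnikov ::
    "(('n::finite, 'm::finite) config \<Rightarrow> real ^ 'n) \<Rightarrow> (('n, 'm) config \<Rightarrow> real ^ 'm) \<Rightarrow>
     (real \<Rightarrow> ('n, 'm) config \<Rightarrow> real ^ 'm) \<Rightarrow> (('n, 'm) config \<Rightarrow> real ^ 'm ^ 'm) \<Rightarrow>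
     (real \<Rightarrow> ('n, 'm) phase) \<Rightarrow> real \<Rightarrow> real" where
  "melnikov F1 F2 g \<sigma> \<Phi>0 \<alpha> =
     (\<integral>s. grad (H0 F1 F2 \<sigma>) (\<Phi>0 s) \<bullet> Gham g (s + \<alpha>) (\<Phi>0 s) \<partial>lborel)"

text \<open>The neighbourhood \<open>U\<close> is taken open, and the existence of the gradients on \<open>U\<close> that is implicit
  in forming \<open>J\<nabla>H\<^sub>0\<close> and \<open>J\<nabla>H\<^sub>1\<close> is spelled out.\<close>

definition A3 ::
    "(('n::finite, 'm::finite) config \<Rightarrow> real ^ 'n) \<Rightarrow> (('n, 'm) config \<Rightarrow> real ^ 'm) \<Rightarrow>
     (real \<Rightarrow> ('n, 'm) config \<Rightarrow> real ^ 'm) \<Rightarrow> (('n, 'm) config \<Rightarrow> real ^ 'm ^ 'm) \<Rightarrow>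
     ('n, 'm) config \<Rightarrow> ('n, 'm) config \<Rightarrow> (real \<Rightarrow> ('n, 'm) phase) \<Rightarrow> real \<Rightarrow> bool" where
  "A3 F1 F2 g \<sigma> za zu \<Phi>0 \<alpha>0 \<longleftrightarrow>
     hamiltonian_solution (\<lambda>_. H0 F1 F2 \<sigma>) \<Phi>0 \<and>
     (\<Phi>0 \<longlongrightarrow> (za, 0)) at_bot \<and> (\<Phi>0 \<longlongrightarrow> (zu, 0)) at_top \<and>
     (\<exists>U. open U \<and> range \<Phi>0 \<union> {(za, 0), (zu, 0)} \<subseteq> U \<and>
        (\<forall>\<Phi>\<in>U. H0 F1 F2 \<sigma> differentiable (at \<Phi>)) \<and>
        (\<forall>t. \<forall>\<Phi>\<in>U. H1 g t differentiable (at \<Phi>)) \<and>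
        Cb_on 3 (fst ` U) (diffusion \<sigma>) \<and>
        Cb_on 2 U (Fham F1 F2 \<sigma>) \<and>
        Cb_on 2 (UNIV \<times> U) (\<lambda>(t, \<Phi>). Gham g t \<Phi>)) \<and>
     hyperbolic_equilibrium (Fham F1 F2 \<sigma>) (za, 0) \<and>
     hyperbolic_equilibrium (Fham F1 F2 \<sigma>) (zu, 0) \<and>
     {u + v | u v. u \<in> tangent_unstable (Fham F1 F2 \<sigma>) (za, 0) (\<Phi>0 0) \<and>
                   v \<in> tangent_stable (Fham F1 F2 \<sigma>) (zu, 0) (\<Phi>0 0)}
       = tangent_vectors {\<Phi>. H0 F1 F2 \<sigma> \<Phi> = 0} (\<Phi>0 0) \<and>
     melnikov F1 F2 g \<sigma> \<Phi>0 \<alpha>0 = 0 \<and>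
     (\<exists>D. (melnikov F1 F2 g \<sigma> \<Phi>0 has_real_derivative D) (at \<alpha>0) \<and> D \<noteq> 0)"

end

theory Submission
  imports Defs "HOL-Computational_Algebra.Fundamental_Theorem_Algebra"
begin

text \<open>Everything is reduced to the inversion of \<open>D - A\<close>, \<open>D = d/dt\<close>, on bounded continuous functions on the line.
  For constant hyperbolic \<open>A\<close> the inverse is explicit in terms of a polynomial annihilating \<open>A\<close>; bounded
  invertibility survives small perturbations of \<open>A\<close> and yields an exponential dichotomy. A
  contraction argument with this inverse gives the hyperbolic trajectories \<open>\<Gamma>\<^sub>a\<close> and \<open>\<Gamma>\<^sub>u\<close>.

  Along the heteroclinic orbit \<open>\<Phi>\<^sub>0\<close>, the gradient \<open>p = \<nabla>H\<^sub>0(\<Phi>\<^sub>0)\<close> solves the adjoint variational equation, and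
  transversality within the energy level makes \<open>{h. \<integral> p \<bullet> h = 0}\<close> the range of \<open>D - A\<close>. Lyapunov--Schmidt
  reduction yields \<open>w(\<epsilon>, \<alpha>) = O(\<epsilon>)\<close> such that \<open>\<Phi>\<^sub>0(t - \<alpha>) + w(t - \<alpha>)\<close> is a solution iff a scalar function of
  \<open>\<alpha>\<close> vanishes. Divided by \<open>\<epsilon>\<close>, this function is continuous in \<open>\<alpha>\<close> and \<open>O(\<epsilon>)\<close>-close to the Melnikov function,
  so the simple zero produces a zero nearby by the intermediate value theorem. Near an equilibrium,
  two solutions that stay close to it in the future (in the past) approach each other exponentially.\<close>

subsection \<open>Linear differential equations\<close>

text \<open>The field is controlled only on a neighbourhood \<open>U\<close>, so there is no global
  flow to work with. The unknowns are deviations from a known curve, taken in the Banach space of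
  bounded continuous functions and kept in a tube inside \<open>U\<close>. Along the heteroclinic
  orbit the obstacle is that D - A is not invertible: the velocity of the orbit lies in the kernel
  and, because energy is conserved, \<open>p\<close> annihilates the range. One scalar solvability
  condition is thus missing, and the phase \<alpha> is the scalar unknown that pays for it.
  Transversality is given through tangent vectors of possibly only immersed manifolds; it reaches
  the variational equation by way of the fact that such tangent vectors are initial values of
  solutions bounded on a half-line. The phase is moved into the time argument of \<open>G\<close>,
  so that the linear operator stays the same for all \<alpha>, and the Lipschitz bound of
  \<open>G\<close> in time makes the scalar function continuous. Statements about the past come from
  those about the future by time reversal.\<close>

lemma antiderivative_exists:
  fixes f :: "real \<Rightarrow> 'b::banach"
  assumes "continuous_on UNIV f"
  obtains J where "J 0 = 0" "\<And>t. (J has_vector_derivative f t) (at t)"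
proof -
  \<comment> \<open>One of the two intervals is empty or a point and contributes 0, so this is the
    integral from 0 to t with its sign.\<close>
  define J where "J t = integral {0..t::real} f - integral {t..0} f" for t
  have "(J has_vector_derivative f t) (at t)" for t
  proof -
  define n where "n = \<bar>t\<bar> + (1::real)"
  have cont: "continuous_on S f" for S
    using assms continuous_on_subset by blast
  have int: "f integrable_on {a..b}" for a b
    by (rule integrable_continuous_interval[OF cont])
  have eq: "J s = integral {-n..s} f - integral {-n..0} f" if "s \<in> {-n<..<n}" for s
  proof (cases "s \<ge> 0")
    case True
    then have "integral {-n..0} f + integral {0..s} f = integral {-n..s} f"
      by (intro Henstock_Kurzweil_Integration.integral_combine int) (auto simp: n_def)
    with True show ?thesis
      by (cases "s = 0") (auto simp: J_def algebra_simps)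
  next
    case False
    then have "integral {-n..s} f + integral {s..0} f = integral {-n..0} f"
      using that by (intro Henstock_Kurzweil_Integration.integral_combine int) auto
    with False show ?thesis
      by (auto simp: J_def algebra_simps)
  qed
  have t: "t \<in> {-n<..<n}" by (auto simp: n_def)
  have "((\<lambda>s. integral {-n..s} f) has_vector_derivative f t) (at t within {-n..n})"
    using t by (intro integral_has_vector_derivative[OF cont]) auto
  then have "((\<lambda>s. integral {-n..s} f) has_vector_derivative f t) (at t)"
    using t by (metis at_within_interior interior_atLeastAtMost_real)
  then have "((\<lambda>s. integral {-n..s} f - integral {-n..0} f) has_vector_derivative f t) (at t)"
    by (auto intro!: derivative_eq_intros)
  then show "(J has_vector_derivative f t) (at t)"
    by (rule has_vector_derivative_transform_within_open[of _ _ _ "{-n<..<n}"]) (use t eq in auto)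
  qed
  moreover have "J 0 = 0" by (simp add: J_def)
  ultimately show thesis by (rule that[rotated])
qed

lemma vector_derivative_le:
  fixes J :: "real \<Rightarrow> 'b::real_normed_vector"
  assumes "a \<le> b" "\<And>t. (J has_vector_derivative f t) (at t)"
    and "\<And>t. (\<phi> has_vector_derivative \<phi>' t) (at t)"
    and "\<And>t. a \<le> t \<Longrightarrow> t \<le> b \<Longrightarrow> norm (f t) \<le> \<phi>' t"
  shows "norm (J b - J a) \<le> \<phi> b - (\<phi> a :: real)"
proof (cases "a = b")
  case False
  then have "a < b" using assms by simp
  then show ?thesis
  proof (rule differentiable_bound_general)
    show "continuous_on {a..b} J" "continuous_on {a..b} \<phi>"
      using assms(2,3) by (auto intro!: continuous_at_imp_continuous_on intro: has_vector_derivative_continuous)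
  qed (use assms in auto)
qed auto

lemma has_vector_derivative_reflect:
  assumes "(x has_vector_derivative v) (at (- t))"
  shows "((\<lambda>s. x (- s)) has_vector_derivative - v) (at t)"
proof -
  have "(uminus has_vector_derivative (- 1 :: real)) (at t)"
    by (auto intro!: derivative_eq_intros)
  from vector_diff_chain_at[OF this assms] show ?thesis
    by (simp add: o_def)
qed

lemma has_vector_derivative_shift:
  assumes "(x has_vector_derivative v) (at (t + a :: real))"
  shows "((\<lambda>s. x (s + a)) has_vector_derivative v) (at t)"
proof -
  have "((\<lambda>s. s + a) has_vector_derivative 1) (at t)"
    by (auto intro!: derivative_eq_intros)
  from vector_diff_chain_at[OF this assms] show ?thesis
    by (simp add: o_def)
qed

text \<open>Integration against the weight exp (c |t|) gains a factor 1 / c. This gain provides the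
  contraction constant in the construction of global solutions.\<close>

lemma exp_growth_bound:
  fixes J :: "real \<Rightarrow> 'b::real_normed_vector"
  assumes c: "c > 0" and J0: "J 0 = 0" and J: "\<And>t. (J has_vector_derivative f t) (at t)"
    and f: "\<And>t. norm (f t) \<le> B * exp (c * \<bar>t\<bar>)"
  shows "norm (J t) \<le> B / c * exp (c * \<bar>t\<bar>)"
proof -
  have B: "B \<ge> 0" using f[of 0] order_trans[OF norm_ge_zero] by force
  have E: "((\<lambda>t. B / c * exp (c * t)) has_vector_derivative B * exp (c * t)) (at t)" for t
    using c by (auto intro!: derivative_eq_intros simp: has_real_derivative_iff_has_vector_derivative[symmetric])
  have p: "0 \<le> B / c" using B c by simp
  show ?thesis
  proof (cases "t \<ge> 0")
    case True
    have "norm (J t - J 0) \<le> B / c * exp (c * t) - B / c * exp (c * 0)"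
      using True J E by (rule vector_derivative_le) (metis f abs_of_nonneg)
    with True J0 p show ?thesis by simp
  next
    case False
    have J': "((\<lambda>s. J (- s)) has_vector_derivative - f (- s)) (at s)" for s
      by (rule has_vector_derivative_reflect[OF J])
    have "norm (J (- (- t)) - J (- 0)) \<le> B / c * exp (c * (- t)) - B / c * exp (c * 0)"
    proof (rule vector_derivative_le[OF _ J' E])
      show "norm (- f (- s)) \<le> B * exp (c * s)" if "0 \<le> s" for s
        using f[of "- s"] that by simp
    qed (use False in auto)
    with False J0 p show ?thesis by simp
  qed
qed

text \<open>Picard's operator in a weighted norm: for x = exp (c |t|) y with y bounded, the
  Lipschitz constant L of the field turns into L / c = 1/2, so a single application of Banach's
  theorem covers the entire line. \<open>f t 0 = 0\<close> and the Lipschitz bound keep the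
  integrand below a multiple of exp (c |t|).\<close>

lemma global_ode_solution:
  fixes f :: "real \<Rightarrow> 'b::banach \<Rightarrow> 'b"
  assumes cont: "continuous_on UNIV (\<lambda>(t, x). f t x)" and f0: "\<And>t. f t 0 = 0"
    and lip: "\<And>t x y. norm (f t x - f t y) \<le> M * norm (x - y)"
  obtains x where "x 0 = x0" "\<And>t. (x has_vector_derivative f t (x t)) (at t)"
proof -
  define L where "L = \<bar>M\<bar> + 1"
  define c where "c = 2 * L"
  have L: "L > 0" and c: "c > 0" by (auto simp: L_def c_def)
  have lip': "norm (f t x - f t y) \<le> L * norm (x - y)" for t x y
    using lip[of t x y] mult_right_mono[of M L "norm (x - y)"] unfolding L_def by (smt (verit) norm_ge_zero)
  define g where "g y t = f t (exp (c * \<bar>t\<bar>) *\<^sub>R apply_bcontfun y t)" for y :: "real \<Rightarrow>\<^sub>C 'b" and t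
  have g_cont: "continuous_on UNIV (g y)" for y
  proof -
    have "continuous_on UNIV (\<lambda>t. (\<lambda>(t, x). f t x) (t, exp (c * \<bar>t\<bar>) *\<^sub>R apply_bcontfun y t))"
      by (rule continuous_on_compose2[OF cont]) (auto intro!: continuous_intros)
    then show ?thesis by (simp add: g_def[abs_def])
  qed
  have "\<exists>J. J 0 = 0 \<and> (\<forall>t. (J has_vector_derivative g y t) (at t))" for y
    using antiderivative_exists[OF g_cont[of y]] by metis
  then obtain J where J0: "\<And>y. J y 0 = 0" and J: "\<And>y t. (J y has_vector_derivative g y t) (at t)"
    by metis
  have Jdiff: "norm (J y t - J z t) \<le> norm (y - z) / 2 * exp (c * \<bar>t\<bar>)" for y z t
  proof -
    have "norm (J y t - J z t) \<le> (L * norm (y - z)) / c * exp (c * \<bar>t\<bar>)"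
    proof (rule exp_growth_bound[OF c, where J = "\<lambda>t. J y t - J z t"])
      show "((\<lambda>t. J y t - J z t) has_vector_derivative g y t - g z t) (at t)" for t
        by (intro derivative_intros J)
      fix t
      have "norm (g y t - g z t) \<le> L * norm (exp (c * \<bar>t\<bar>) *\<^sub>R (y - z) t)"
        unfolding g_def using lip' by (smt (verit) minus_bcontfun.rep_eq scaleR_right_diff_distrib)
      also have "\<dots> \<le> L * norm (y - z) * exp (c * \<bar>t\<bar>)"
        using L norm_bounded[of "y - z" t] by (simp add: mult.commute mult_left_mono)
      finally show "norm (g y t - g z t) \<le> L * norm (y - z) * exp (c * \<bar>t\<bar>)" .
    qed (use J0 in auto)
    then show ?thesis using L by (simp add: c_def)
  qed
  have g0: "g 0 t = 0" for t by (simp add: g_def f0)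
  have J00: "J 0 t = 0" for t
    using exp_growth_bound[OF c J0 J, of 0 0 t] g0 by auto
  define T where "T y t = exp (- c * \<bar>t\<bar>) *\<^sub>R (x0 + J y t)" for y t
  have Jc: "continuous_on UNIV (J y)" for y
    using J by (auto intro!: continuous_at_imp_continuous_on intro: has_vector_derivative_continuous)
  have expm: "exp (- c * \<bar>t\<bar>) * (r * exp (c * \<bar>t\<bar>)) = r" for r t
    by (simp add: exp_minus field_simps)
  have Tb: "T y \<in> bcontfun" for y
  proof (rule bcontfun_normI)
    show "continuous_on UNIV (T y)"
      unfolding T_def[abs_def] by (intro continuous_intros Jc)
    fix t
    have "norm (T y t) \<le> exp (- c * \<bar>t\<bar>) * (norm x0 + norm (J y t))"
      by (auto simp: T_def intro!: mult_left_mono norm_triangle_ineq)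
    also have "norm (J y t) \<le> norm y / 2 * exp (c * \<bar>t\<bar>)"
      using Jdiff[of y t 0] by (simp add: J00)
    finally have "norm (T y t) \<le> exp (- c * \<bar>t\<bar>) * (norm x0 + norm y / 2 * exp (c * \<bar>t\<bar>))"
      by simp
    also have "\<dots> = exp (- c * \<bar>t\<bar>) * norm x0 + norm y / 2"
      unfolding distrib_left expm ..
    finally have "norm (T y t) \<le> exp (- c * \<bar>t\<bar>) * norm x0 + norm y / 2" .
    moreover have "exp (- c * \<bar>t\<bar>) * norm x0 \<le> norm x0"
      using c by (simp add: mult_left_le_one_le)
    ultimately show "norm (T y t) \<le> norm x0 + norm y / 2" by linarith
  qed
  define TT where "TT y = Bcontfun (T y)" for y
  have TT: "apply_bcontfun (TT y) = T y" for y
    by (simp add: TT_def Bcontfun_inverse Tb)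
  have "\<exists>!y. TT y = y"
  proof (rule banach_fix_type[where c = "1/2"])
    show "\<forall>y z. dist (TT y) (TT z) \<le> 1/2 * dist y z"
    proof (intro allI dist_bound)
      fix y z t
      have "dist (TT y t) (TT z t) = exp (- c * \<bar>t\<bar>) * norm (J y t - J z t)"
        by (simp add: TT T_def dist_norm scaleR_right_diff_distrib[symmetric])
      also have "\<dots> \<le> exp (- c * \<bar>t\<bar>) * (norm (y - z) / 2 * exp (c * \<bar>t\<bar>))"
        by (intro mult_left_mono Jdiff) auto
      also have "\<dots> = 1/2 * dist y z" unfolding expm by (simp add: dist_norm)
      finally show "dist (TT y t) (TT z t) \<le> 1/2 * dist y z" .
    qed
  qed auto
  then obtain y where y: "TT y = y" by auto
  define x where "x t = x0 + J y t" for t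
  have x_eq: "x t = exp (c * \<bar>t\<bar>) *\<^sub>R y t" for t
    using TT[of y] y by (simp add: T_def x_def exp_minus)
  show thesis
  proof
    show "x 0 = x0" by (simp add: x_def J0)
    show "(x has_vector_derivative f t (x t)) (at t)" for t
      using J[of y t] unfolding g_def x_eq[symmetric] by (auto simp: x_def[abs_def] intro!: derivative_eq_intros)
  qed
qed

text \<open>The squared norm is differentiable even where the norm is not, and its derivative lies
  between -2 M |x|^2 and 2 M |x|^2. Hence exp (-2 M t) |x|^2 does not increase and exp (2 M t) |x|^2
  does not decrease, which gives estimates in both time directions.\<close>

lemma gronwall_homogeneous:
  fixes x :: "real \<Rightarrow> 'b::real_inner"
  assumes ab: "a \<le> b" and cont: "continuous_on {a..b} x"
    and der: "\<And>t. a < t \<Longrightarrow> t < b \<Longrightarrow> (x has_vector_derivative x' t) (at t)"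
    and le: "\<And>t. a < t \<Longrightarrow> t < b \<Longrightarrow> norm (x' t) \<le> M * norm (x t)"
  shows "norm (x b) \<le> exp (M * (b - a)) * norm (x a)" "norm (x a) \<le> exp (M * (b - a)) * norm (x b)"
proof -
  have bound: "\<bar>x t \<bullet> x' t\<bar> \<le> M * (norm (x t))\<^sup>2" if "a < t" "t < b" for t
  proof -
    have "\<bar>x t \<bullet> x' t\<bar> \<le> norm (x t) * norm (x' t)" by (rule Cauchy_Schwarz_ineq2)
    also have "\<dots> \<le> norm (x t) * (M * norm (x t))" using le[OF that] by (intro mult_left_mono) auto
    finally show ?thesis by (simp add: power2_eq_square algebra_simps)
  qed
  define E where "E k t = exp (k * t) * (x t \<bullet> x t)" for k t
  have dE: "(E k has_real_derivative exp (k * t) * (k * (norm (x t))\<^sup>2 + 2 * (x t \<bullet> x' t))) (at t)"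
    if "a < t" "t < b" for k t
  proof -
    have "((\<lambda>t. x t \<bullet> x t) has_real_derivative (x t \<bullet> x' t + x' t \<bullet> x t)) (at t)"
      using bounded_bilinear.has_vector_derivative[OF bounded_bilinear_inner der[OF that] der[OF that]]
      by (simp add: has_real_derivative_iff_has_vector_derivative)
    moreover have "((\<lambda>t. exp (k * t)) has_real_derivative exp (k * t) * k) (at t)"
      by (auto intro!: derivative_eq_intros)
    ultimately have "((\<lambda>t. exp (k * t) * (x t \<bullet> x t)) has_real_derivative
        exp (k * t) * k * (x t \<bullet> x t) + (x t \<bullet> x' t + x' t \<bullet> x t) * exp (k * t)) (at t)"
      by (intro DERIV_mult)
    then show ?thesis
      unfolding E_def[abs_def]
      by (rule DERIV_cong) (simp add: power2_norm_eq_inner inner_commute algebra_simps)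
  qed
  have cE: "continuous_on {a..b} (E k)" for k
    unfolding E_def[abs_def] by (intro continuous_intros cont)
  have 1: "E (- 2 * M) b \<le> E (- 2 * M) a"
  proof (cases "a = b")
    case False
    have "\<exists>y. (E (- 2 * M) has_real_derivative y) (at t) \<and> y \<le> 0" if "a < t" "t < b" for t
    proof (rule exI, rule conjI, rule dE[OF that])
      have "- 2 * M * (norm (x t))\<^sup>2 + 2 * (x t \<bullet> x' t) \<le> 0"
        using bound[OF that] by linarith
      then show "exp (- 2 * M * t) * (- 2 * M * (norm (x t))\<^sup>2 + 2 * (x t \<bullet> x' t)) \<le> 0"
        by (simp only: mult_nonneg_nonpos exp_ge_zero)
    qed
    then show ?thesis using ab False
      by (intro DERIV_nonpos_imp_decreasing_open[of a b "E (- 2 * M)"] cE) auto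
  qed simp
  have 2: "E (2 * M) a \<le> E (2 * M) b"
  proof (cases "a = b")
    case False
    have "\<exists>y. (E (2 * M) has_real_derivative y) (at t) \<and> y \<ge> 0" if "a < t" "t < b" for t
    proof (rule exI, rule conjI, rule dE[OF that])
      have "2 * M * (norm (x t))\<^sup>2 + 2 * (x t \<bullet> x' t) \<ge> 0"
        using bound[OF that] by linarith
      then show "exp (2 * M * t) * (2 * M * (norm (x t))\<^sup>2 + 2 * (x t \<bullet> x' t)) \<ge> 0"
        by (simp only: mult_nonneg_nonneg exp_ge_zero)
    qed
    then show ?thesis using ab False
      by (intro DERIV_nonneg_imp_increasing_open[of a b "E (2 * M)"] cE) auto
  qed simp
  have sq: "(exp (M * (b - a)))\<^sup>2 = exp (2 * M * b) * exp (- 2 * M * a)"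
    by (simp flip: exp_double exp_add) (simp add: algebra_simps)
  have "exp (2 * M * b) * E (- 2 * M) b \<le> exp (2 * M * b) * E (- 2 * M) a"
    using 1 by (intro mult_left_mono) auto
  moreover have "exp (2 * M * b) * E (- 2 * M) b = (norm (x b))\<^sup>2"
    by (simp add: E_def power2_norm_eq_inner mult.assoc[symmetric] flip: exp_add)
  ultimately have "(norm (x b))\<^sup>2 \<le> exp (2 * M * b) * E (- 2 * M) a"
    by (simp only:)
  also have "\<dots> = (exp (M * (b - a)) * norm (x a))\<^sup>2"
    unfolding E_def power_mult_distrib sq power2_norm_eq_inner by simp
  finally have "(norm (x b))\<^sup>2 \<le> (exp (M * (b - a)) * norm (x a))\<^sup>2" .
  then show "norm (x b) \<le> exp (M * (b - a)) * norm (x a)"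
    by (rule power2_le_imp_le) simp
  have "exp (- 2 * M * a) * E (2 * M) a \<le> exp (- 2 * M * a) * E (2 * M) b"
    using 2 by (intro mult_left_mono) auto
  moreover have "exp (- 2 * M * a) * E (2 * M) a = (norm (x a))\<^sup>2"
    by (simp add: E_def power2_norm_eq_inner mult.assoc[symmetric] flip: exp_add)
  ultimately have "(norm (x a))\<^sup>2 \<le> exp (- 2 * M * a) * E (2 * M) b"
    by (simp only:)
  also have "\<dots> = (exp (M * (b - a)) * norm (x b))\<^sup>2"
    unfolding E_def power_mult_distrib sq power2_norm_eq_inner by simp
  finally have "(norm (x a))\<^sup>2 \<le> (exp (M * (b - a)) * norm (x b))\<^sup>2" .
  then show "norm (x a) \<le> exp (M * (b - a)) * norm (x b)"
    by (rule power2_le_imp_le) simp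
qed

text \<open>\<open>X\<close> is the fundamental solution and \<open>Y\<close> its inverse.
  \<open>Y\<close> carries a differential equation of its own, which reduces variation of constants
  to differentiating \<open>Y t (x t)\<close>.\<close>

definition propagator ::
    "(real \<Rightarrow> 'a::euclidean_space \<Rightarrow>\<^sub>L 'a) \<Rightarrow> (real \<Rightarrow> 'a \<Rightarrow>\<^sub>L 'a) \<Rightarrow> (real \<Rightarrow> 'a \<Rightarrow>\<^sub>L 'a) \<Rightarrow> bool" where
  "propagator A X Y \<longleftrightarrow> X 0 = id_blinfun \<and> Y 0 = id_blinfun \<and>
     (\<forall>t. (X has_vector_derivative (A t o\<^sub>L X t)) (at t)) \<and>
     (\<forall>t. (Y has_vector_derivative - (Y t o\<^sub>L A t)) (at t)) \<and>
     (\<forall>t. X t o\<^sub>L Y t = id_blinfun \<and> Y t o\<^sub>L X t = id_blinfun)"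

lemma blinfun_eq_iff: "F = G \<longleftrightarrow> (\<forall>x. blinfun_apply F x = blinfun_apply G x)"
  by (auto intro: blinfun_eqI)

lemma blinfun_left_inverse_right_inverse:
  fixes F G :: "'a::euclidean_space \<Rightarrow>\<^sub>L 'a"
  assumes "F o\<^sub>L G = id_blinfun"
  shows "G o\<^sub>L F = id_blinfun"
proof -
  have "blinfun_apply F (blinfun_apply G v) = v" for v
    using assms by (simp add: blinfun_eq_iff)
  then have "blinfun_apply F \<circ> blinfun_apply G = id"
    by (simp add: fun_eq_iff)
  then have "blinfun_apply G \<circ> blinfun_apply F = id"
    using linear_inverse_left[OF blinfun.bounded_linear_right[THEN bounded_linear.linear]
        blinfun.bounded_linear_right[THEN bounded_linear.linear], of F G] by simp
  then show ?thesis
    by (simp add: blinfun_eq_iff fun_eq_iff)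
qed

text \<open>\<open>X\<close> and \<open>Y\<close> come from two separate linear equations. The
  product of \<open>Y t\<close> and \<open>X t\<close> has derivative zero, so it keeps its initial
  value, the identity; in finite dimension the left inverse is also a right inverse.\<close>

lemma propagator_exists:
  fixes A :: "real \<Rightarrow> 'a::euclidean_space \<Rightarrow>\<^sub>L 'a"
  assumes cont: "continuous_on UNIV A" and M: "\<And>t. norm (A t) \<le> M"
  obtains X Y where "propagator A X Y"
proof -
  have cA: "continuous_on UNIV (\<lambda>p::real \<times> ('a \<Rightarrow>\<^sub>L 'a). A (fst p))"
    by (rule continuous_on_compose2[OF cont continuous_on_fst[OF continuous_on_id]]) simp
  have "continuous_on UNIV (\<lambda>(t, X :: 'a \<Rightarrow>\<^sub>L 'a). A t o\<^sub>L X)"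
    unfolding split_beta
    by (intro bounded_bilinear.continuous_on[OF bounded_bilinear_blinfun_compose] cA continuous_on_snd continuous_on_id)
  moreover have "norm ((A t o\<^sub>L X) - (A t o\<^sub>L Y)) \<le> M * norm (X - Y)" for t and X Y :: "'a \<Rightarrow>\<^sub>L 'a"
  proof -
    have "norm (A t o\<^sub>L (X - Y)) \<le> norm (A t) * norm (X - Y)"
      by (rule norm_blinfun_compose)
    also have "\<dots> \<le> M * norm (X - Y)" by (intro mult_right_mono M) auto
    finally show ?thesis by (simp add: bounded_bilinear.diff_right[OF bounded_bilinear_blinfun_compose])
  qed
  moreover have "A t o\<^sub>L (0 :: 'a \<Rightarrow>\<^sub>L 'a) = 0" for t
    by (rule bounded_bilinear.zero_right[OF bounded_bilinear_blinfun_compose])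
  ultimately obtain X where X: "X 0 = id_blinfun" "\<And>t. (X has_vector_derivative (A t o\<^sub>L X t)) (at t)"
    using global_ode_solution[of "\<lambda>t X. A t o\<^sub>L X" M id_blinfun] by blast
  have "continuous_on UNIV (\<lambda>(t, X :: 'a \<Rightarrow>\<^sub>L 'a). - (X o\<^sub>L A t))"
    unfolding split_beta
    by (intro continuous_on_minus bounded_bilinear.continuous_on[OF bounded_bilinear_blinfun_compose] cA
        continuous_on_snd continuous_on_id)
  moreover have "norm (- (X o\<^sub>L A t) - - (Y o\<^sub>L A t)) \<le> M * norm (X - Y)" for t and X Y :: "'a \<Rightarrow>\<^sub>L 'a"
  proof -
    have "norm ((X - Y) o\<^sub>L A t) \<le> norm (X - Y) * norm (A t)"
      by (rule norm_blinfun_compose)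
    also have "\<dots> \<le> norm (X - Y) * M" by (intro mult_left_mono M) auto
    finally show ?thesis
      by (simp add: bounded_bilinear.diff_left[OF bounded_bilinear_blinfun_compose] mult.commute norm_minus_commute)
  qed
  moreover have "- ((0 :: 'a \<Rightarrow>\<^sub>L 'a) o\<^sub>L A t) = 0" for t
    by (simp add: bounded_bilinear.zero_left[OF bounded_bilinear_blinfun_compose])
  ultimately obtain Y where Y: "Y 0 = id_blinfun" "\<And>t. (Y has_vector_derivative - (Y t o\<^sub>L A t)) (at t)"
    using global_ode_solution[of "\<lambda>t X. - (X o\<^sub>L A t)" M id_blinfun] by blast
  have "((\<lambda>t. Y t o\<^sub>L X t) has_vector_derivative 0) (at t)" for t
    using bounded_bilinear.has_vector_derivative[OF bounded_bilinear_blinfun_compose Y(2)[of t] X(2)[of t]]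
    by (rule has_vector_derivative_eq_rhs)
      (simp add: bounded_bilinear.minus_left[OF bounded_bilinear_blinfun_compose], simp add: blinfun_eq_iff)
  then obtain C where C: "\<And>t. Y t o\<^sub>L X t = C"
    using has_vector_derivative_zero_constant[of UNIV "\<lambda>t. Y t o\<^sub>L X t"] by auto
  have YX: "Y t o\<^sub>L X t = id_blinfun" for t
  proof -
    have "id_blinfun o\<^sub>L id_blinfun = (id_blinfun :: 'a \<Rightarrow>\<^sub>L 'a)" by (simp add: blinfun_eq_iff)
    then show ?thesis using C[of 0] C[of t] X(1) Y(1) by simp
  qed
  show thesis
    using X Y YX blinfun_left_inverse_right_inverse[OF YX]
    by (intro that[of X Y]) (simp add: propagator_def)
qed

lemma propagator_apply_derivative:
  assumes "propagator A X Y"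
  shows "((\<lambda>t. X t v) has_vector_derivative A t (X t v)) (at t)"
proof -
  have "(X has_vector_derivative (A t o\<^sub>L X t)) (at t)"
    using assms by (simp add: propagator_def)
  from bounded_bilinear.has_vector_derivative[OF bounded_bilinear_blinfun_apply this has_vector_derivative_const]
  show ?thesis by (simp add: blinfun.zero_right)
qed

lemma propagator_cancel:
  assumes "propagator A X Y"
  shows "X t (Y t v) = v" "Y t (X t v) = v"
proof -
  have "(X t o\<^sub>L Y t) v = v" "(Y t o\<^sub>L X t) v = v"
    using assms by (simp_all only: propagator_def) (simp_all add: id_blinfun.rep_eq)
  then show "X t (Y t v) = v" "Y t (X t v) = v" by simp_all
qed

lemma propagator_inverse_derivative:
  assumes "propagator A X Y" "(x has_vector_derivative A t (x t) + h) (at t)"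
  shows "((\<lambda>t. Y t (x t)) has_vector_derivative Y t h) (at t)"
proof -
  have "(Y has_vector_derivative - (Y t o\<^sub>L A t)) (at t)"
    using assms by (auto simp: propagator_def)
  from bounded_bilinear.has_vector_derivative[OF bounded_bilinear_blinfun_apply this assms(2)]
  show ?thesis
    by (simp add: blinfun.minus_left blinfun.add_right)
qed

lemma propagator_continuous:
  assumes "propagator A X Y"
  shows "continuous_on S X" "continuous_on S Y"
  using assms has_vector_derivative_continuous unfolding propagator_def
  by (blast intro: continuous_at_imp_continuous_on)+

lemma propagator_norm_le:
  assumes "propagator A X Y" "\<And>t. norm (A t) \<le> M"
  shows "norm (X t v) \<le> exp (M * \<bar>t - s\<bar>) * norm (X s v)"
proof -
  have d: "((\<lambda>t. X t v) has_vector_derivative A t (X t v)) (at t)" for t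
    by (rule propagator_apply_derivative[OF assms(1)])
  have le: "norm (A t (X t v)) \<le> M * norm (X t v)" for t
    using norm_blinfun[of "A t" "X t v"] mult_right_mono[OF assms(2)[of t], of "norm (X t v)"] by auto
  have c: "continuous_on S (\<lambda>t. X t v)" for S
    using d by (auto intro!: continuous_at_imp_continuous_on intro: has_vector_derivative_continuous)
  show ?thesis
    using gronwall_homogeneous[where x = "\<lambda>t. X t v" and x' = "\<lambda>t. A t (X t v)" and M = M, OF _ c d le]
    by (cases "s \<le> t") auto
qed

subsection \<open>Bounded invertibility and exponential dichotomies\<close>

text \<open>\<open>D - A\<close>, with \<open>D\<close> the time derivative, is a bijection from bounded \<open>C\<^sup>1\<close> functions onto bounded
  continuous functions on the line, and its inverse has norm at most \<open>K\<close>.\<close>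

definition solves :: "(real \<Rightarrow> 'a::euclidean_space \<Rightarrow>\<^sub>L 'a) \<Rightarrow> (real \<Rightarrow> 'a) \<Rightarrow> (real \<Rightarrow> 'a) \<Rightarrow> bool" where
  "solves A h x \<longleftrightarrow> (\<forall>t. (x has_vector_derivative A t (x t) + h t) (at t))"

definition bounded_inverse :: "(real \<Rightarrow> 'a::euclidean_space \<Rightarrow>\<^sub>L 'a) \<Rightarrow> real \<Rightarrow> bool" where
  "bounded_inverse A K \<longleftrightarrow> K > 0 \<and>
     (\<forall>h :: real \<Rightarrow>\<^sub>C 'a. \<exists>x :: real \<Rightarrow>\<^sub>C 'a. norm x \<le> K * norm h \<and> solves A (apply_bcontfun h) (apply_bcontfun x)) \<and>
     (\<forall>x :: real \<Rightarrow>\<^sub>C 'a. solves A (\<lambda>_. 0) (apply_bcontfun x) \<longrightarrow> x = 0)"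

definition resolvent :: "(real \<Rightarrow> 'a::euclidean_space \<Rightarrow>\<^sub>L 'a) \<Rightarrow> (real \<Rightarrow>\<^sub>C 'a) \<Rightarrow> (real \<Rightarrow>\<^sub>C 'a)" where
  "resolvent A h = (THE x. solves A (apply_bcontfun h) (apply_bcontfun x))"

lemma solves_add: "solves A h x \<Longrightarrow> solves A k y \<Longrightarrow> solves A (\<lambda>t. h t + k t) (\<lambda>t. x t + y t)"
  unfolding solves_def
  by (drule (1) all_conj_distrib[THEN iffD2, OF conjI], erule all_forward, erule conjE,
      drule (1) has_vector_derivative_add, simp add: blinfun.add_right algebra_simps)

lemma solves_diff: "solves A h x \<Longrightarrow> solves A k y \<Longrightarrow> solves A (\<lambda>t. h t - k t) (\<lambda>t. x t - y t)"
  unfolding solves_def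
  by (drule (1) all_conj_distrib[THEN iffD2, OF conjI], erule all_forward, erule conjE,
      drule (1) has_vector_derivative_diff, simp add: blinfun.diff_right algebra_simps)

lemma solves_scaleR: "solves A h x \<Longrightarrow> solves A (\<lambda>t. r *\<^sub>R h t) (\<lambda>t. r *\<^sub>R x t)"
  unfolding solves_def
  by (erule all_forward, drule bounded_linear.has_vector_derivative[OF bounded_linear_scaleR_right[of r]],
      simp add: blinfun.scaleR_right scaleR_add_right)

lemma solves_continuous:
  assumes "solves A h x"
  shows "continuous_on S x"
proof (rule continuous_at_imp_continuous_on, rule ballI)
  show "isCont x t" for t
    using assms has_vector_derivative_continuous unfolding solves_def by blast
qed

lemma bounded_inverse_unique:
  assumes "bounded_inverse A K" "solves A h (apply_bcontfun x)" "solves A h (apply_bcontfun y)"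
  shows "x = y"
proof -
  have "solves A (\<lambda>_. 0) (apply_bcontfun (x - y))"
    using solves_diff[OF assms(2,3)] by (simp add: minus_bcontfun.rep_eq[abs_def])
  then have "x - y = 0" using assms(1) unfolding bounded_inverse_def by blast
  then show ?thesis by simp
qed

lemma
  assumes "bounded_inverse A K"
  shows solves_resolvent: "solves A (apply_bcontfun h) (apply_bcontfun (resolvent A h))"
    and resolvent_eqI: "solves A (apply_bcontfun h) (apply_bcontfun x) \<Longrightarrow> resolvent A h = x"
    and norm_resolvent_le: "norm (resolvent A h) \<le> K * norm h"
proof -
  obtain y :: "real \<Rightarrow>\<^sub>C 'a" where y: "norm y \<le> K * norm h" "solves A (apply_bcontfun h) (apply_bcontfun y)"
    using assms unfolding bounded_inverse_def by blast
  have eq: "resolvent A h = x" if "solves A (apply_bcontfun h) (apply_bcontfun x)" for x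
    unfolding resolvent_def using that bounded_inverse_unique[OF assms _ that] by (rule the_equality)
  show "solves A (apply_bcontfun h) (apply_bcontfun (resolvent A h))" "norm (resolvent A h) \<le> K * norm h"
    using eq[OF y(2)] y by auto
  show "solves A (apply_bcontfun h) (apply_bcontfun x) \<Longrightarrow> resolvent A h = x" by (rule eq)
qed

lemma resolvent_add:
  assumes "bounded_inverse A K"
  shows "resolvent A (h + k) = resolvent A h + resolvent A k"
  using solves_add[OF solves_resolvent[OF assms, of h] solves_resolvent[OF assms, of k]]
  by (intro resolvent_eqI[OF assms]) (simp add: plus_bcontfun.rep_eq[abs_def])

lemma resolvent_scaleR:
  assumes "bounded_inverse A K"
  shows "resolvent A (r *\<^sub>R h) = r *\<^sub>R resolvent A h"
  using solves_scaleR[OF solves_resolvent[OF assms, of h], of r]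
  by (intro resolvent_eqI[OF assms]) (simp add: scaleR_bcontfun.rep_eq[abs_def])

lemma bounded_linear_resolvent:
  assumes "bounded_inverse A K"
  shows "bounded_linear (resolvent A)"
  using norm_resolvent_le[OF assms]
  by (intro bounded_linear_intro[where K = K] resolvent_add[OF assms] resolvent_scaleR[OF assms])
    (auto simp: mult.commute)

text \<open>By uniqueness a bounded solution is the resolvent of its right-hand side.
  \<open>B\<close> certifies boundedness and leaves no trace in the conclusion.\<close>

lemma bounded_inverse_estimate:
  assumes inv: "bounded_inverse A K" and x: "solves A h x" and h: "continuous_on UNIV h"
    and H: "\<And>t. norm (h t) \<le> H" and B: "\<And>t. norm (x t) \<le> B"
  shows "norm (x t) \<le> K * H"
proof -
  define x' where "x' = Bcontfun x"
  define h' where "h' = Bcontfun h"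
  have x': "apply_bcontfun x' = x"
    unfolding x'_def using solves_continuous[OF x] B by (intro Bcontfun_inverse bcontfun_normI)
  have h': "apply_bcontfun h' = h"
    unfolding h'_def using h H by (intro Bcontfun_inverse bcontfun_normI)
  have "resolvent A h' = x'" using x x' h' resolvent_eqI[OF inv, of h' x'] by simp
  then have "norm (x t) \<le> norm (resolvent A h')" using norm_bounded[of x' t] by (simp add: x')
  also have "norm (resolvent A h') \<le> K * norm h'" by (rule norm_resolvent_le[OF inv])
  also have "\<dots> \<le> K * H"
    using inv H by (intro mult_left_mono norm_bound) (auto simp: h' bounded_inverse_def)
  finally show ?thesis .
qed

text \<open>x' = (A + E) x + h is the fixed point equation x = R (E x + h) with R the resolvent of
  \<open>A\<close>. K \<eta> \<le> 1/2 makes the right-hand side a contraction, and absorbing half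
  of the norm of x doubles the constant.\<close>

lemma bounded_inverse_perturb:
  fixes A E :: "real \<Rightarrow> 'a::euclidean_space \<Rightarrow>\<^sub>L 'a"
  assumes inv: "bounded_inverse A K" and E: "continuous_on UNIV E" "\<And>t. norm (E t) \<le> \<eta>"
    and small: "K * \<eta> \<le> 1/2"
  shows "bounded_inverse (\<lambda>t. A t + E t) (2 * K)"
proof -
  have K: "K > 0" using inv by (simp add: bounded_inverse_def)
  define m where "m x = Bcontfun (\<lambda>t. E t (apply_bcontfun x t))" for x :: "real \<Rightarrow>\<^sub>C 'a"
  have b: "norm (E t (x t)) \<le> \<eta> * norm x" for t and x :: "real \<Rightarrow>\<^sub>C 'a"
  proof -
    have "norm (E t (x t)) \<le> norm (E t) * norm (x t)" by (rule norm_blinfun)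
    also have "\<dots> \<le> \<eta> * norm x"
      using E(2)[of 0] by (intro mult_mono E norm_bounded) (auto intro: order_trans[OF norm_ge_zero])
    finally show ?thesis .
  qed
  have m: "m x t = E t (x t)" for x t
    unfolding m_def
    by (subst Bcontfun_inverse) (auto intro!: bcontfun_normI[OF _ b]
        bounded_bilinear.continuous_on[OF bounded_bilinear_blinfun_apply] E)
  have m_norm: "norm (m x) \<le> \<eta> * norm x" for x
    by (rule norm_bound) (simp add: m b)
  have m_diff: "m x - m y = m (x - y)" for x y
    by (rule bcontfun_eqI) (simp add: m blinfun.diff_right)
  have sol: "solves (\<lambda>t. A t + E t) h (apply_bcontfun x) \<longleftrightarrow> solves A (\<lambda>t. m x t + h t) (apply_bcontfun x)" for h and x :: "real \<Rightarrow>\<^sub>C 'a"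
    by (simp add: solves_def m blinfun.add_left add.assoc)
  have contr: "norm (resolvent A (m x)) \<le> 1/2 * norm x" for x
  proof -
    have "norm (resolvent A (m x)) \<le> K * norm (m x)" by (rule norm_resolvent_le[OF inv])
    also have "\<dots> \<le> K * (\<eta> * norm x)" using K by (intro mult_left_mono m_norm) auto
    also have "\<dots> \<le> 1/2 * norm x" using mult_right_mono[OF small, of "norm x"] by (simp add: mult.assoc)
    finally show ?thesis .
  qed
  have res_diff: "resolvent A x - resolvent A y = resolvent A (x - y)" for x y
    using bounded_linear.linear[OF bounded_linear_resolvent[OF inv]] by (simp add: linear_diff)
  have ex: "\<exists>x. norm x \<le> 2 * K * norm h \<and> solves (\<lambda>t. A t + E t) (apply_bcontfun h) (apply_bcontfun x)" for h :: "real \<Rightarrow>\<^sub>C 'a"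
  proof -
    have "\<exists>!x. resolvent A (m x + h) = x"
      by (rule banach_fix_type[where c = "1/2"]) (use contr in \<open>auto simp: dist_norm res_diff m_diff\<close>)
    then obtain x where x: "resolvent A (m x + h) = x" by auto
    have "solves A (apply_bcontfun (m x + h)) (apply_bcontfun x)" using solves_resolvent[OF inv, of "m x + h"] x by simp
    then have "solves (\<lambda>t. A t + E t) (apply_bcontfun h) (apply_bcontfun x)" unfolding sol by (simp add: plus_bcontfun.rep_eq[abs_def])
    moreover have "norm x \<le> norm (resolvent A (m x)) + norm (resolvent A h)"
      using x resolvent_add[OF inv, of "m x" h] norm_triangle_ineq by metis
    then have "norm x \<le> 2 * K * norm h"
      using contr[of x] norm_resolvent_le[OF inv, of h] by (simp add: mult.assoc)
    ultimately show ?thesis by blast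
  qed
  have un: "x = 0" if "solves (\<lambda>t. A t + E t) (\<lambda>_. 0) (apply_bcontfun x)" for x
  proof -
    have "resolvent A (m x) = x" using that unfolding sol by (intro resolvent_eqI[OF inv]) simp
    then show ?thesis using contr[of x] by simp
  qed
  show ?thesis
    unfolding bounded_inverse_def using K ex un by auto
qed

text \<open>Time reversal turns D - A into -(D + A (- t)), so a right-hand side h is sent to - h (-
  t). Statements about the future thereby give statements about the past.\<close>

lemma bounded_inverse_reflect:
  assumes inv: "bounded_inverse A K"
  shows "bounded_inverse (\<lambda>t. - A (- t)) K"
proof -
  have c: "continuous_on UNIV (\<lambda>t. apply_bcontfun h (- t))" for h :: "real \<Rightarrow>\<^sub>C 'a"
    by (rule continuous_on_compose2[OF continuous_on_apply_bcontfun[of UNIV h] continuous_on_minus[OF continuous_on_id]]) auto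
  have rc': "apply_bcontfun (Bcontfun (\<lambda>t. h (- t))) = (\<lambda>t. h (- t))" for h :: "real \<Rightarrow>\<^sub>C 'a"
    by (rule Bcontfun_inverse[OF bcontfun_normI[OF c norm_bounded]])
  have rc: "apply_bcontfun (Bcontfun (\<lambda>t. - h (- t))) = (\<lambda>t. - h (- t))" for h :: "real \<Rightarrow>\<^sub>C 'a"
    by (rule Bcontfun_inverse[OF bcontfun_normI[OF continuous_on_minus[OF c], where b = "norm h"]]) (simp add: norm_bounded)
  have sol': "solves (\<lambda>t. - A (- t)) (\<lambda>t. - h (- t)) (\<lambda>t. x (- t))" if "solves A h x"
    for h x and A :: "real \<Rightarrow> 'a \<Rightarrow>\<^sub>L 'a"
    unfolding solves_def
  proof
    fix t
    have "(x has_vector_derivative A (- t) (x (- t)) + h (- t)) (at (- t))"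
      using that by (simp add: solves_def)
    from has_vector_derivative_reflect[OF this]
    show "((\<lambda>t. x (- t)) has_vector_derivative (- A (- t)) (x (- t)) + - h (- t)) (at t)"
      by (simp add: blinfun.minus_left)
  qed
  show ?thesis
    unfolding bounded_inverse_def
  proof (intro conjI allI impI)
    show "K > 0" using inv by (simp add: bounded_inverse_def)
    fix h :: "real \<Rightarrow>\<^sub>C 'a"
    define k where "k = Bcontfun (\<lambda>t. - h (- t))"
    define x where "x = Bcontfun (\<lambda>t. resolvent A k (- t))"
    have "solves (\<lambda>t. - A (- t)) (apply_bcontfun h) (apply_bcontfun x)"
      using sol'[OF solves_resolvent[OF inv, of k]] by (simp add: x_def rc' k_def rc)
    moreover have "norm x \<le> norm (resolvent A k)"
      by (rule norm_bound) (simp add: x_def rc' norm_bounded)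
    moreover have "norm k \<le> norm h"
      by (rule norm_bound) (simp add: k_def rc norm_bounded)
    then have "norm (resolvent A k) \<le> K * norm h"
      using norm_resolvent_le[OF inv, of k] mult_left_mono[of "norm k" "norm h" K] inv[unfolded bounded_inverse_def]
      by linarith
    ultimately show "\<exists>x. norm x \<le> K * norm h \<and> solves (\<lambda>t. - A (- t)) (apply_bcontfun h) (apply_bcontfun x)"
      by (meson order_trans)
  next
    fix x :: "real \<Rightarrow>\<^sub>C 'a"
    assume "solves (\<lambda>t. - A (- t)) (\<lambda>_. 0) (apply_bcontfun x)"
    then have "solves A (\<lambda>_. 0) (\<lambda>t. x (- t))"
      using sol'[where h = "\<lambda>_. 0" and x = "apply_bcontfun x" and A = "\<lambda>t. - A (- t)"] by simp
    then have "solves A (\<lambda>_. 0) (apply_bcontfun (Bcontfun (\<lambda>t. x (- t))))" by (simp add: rc')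
    then have "Bcontfun (\<lambda>t. x (- t)) = 0" using inv unfolding bounded_inverse_def by blast
    then have "x (- t) = 0" for t using rc'[of x] by (metis zero_bcontfun.rep_eq)
    then show "x = 0" by (intro bcontfun_eqI) (metis add.inverse_inverse zero_bcontfun.rep_eq)
  qed
qed

section \<open>Cutoff functions and exponential decay on a half-line\<close>

lemma has_real_derivative_max_0_square:
  "((\<lambda>t::real. (max 0 t)\<^sup>2) has_real_derivative 2 * max 0 t) (at t)"
proof -
  consider "t > 0" | "t < 0" | "t = 0" by linarith
  then show ?thesis
  proof cases
    case 1
    have "((\<lambda>t::real. t\<^sup>2) has_real_derivative 2 * max 0 t) (at t)"
      using 1 by (auto intro!: derivative_eq_intros)
    then show ?thesis
      by (rule has_field_derivative_transform_within_open[of _ _ _ "{0<..}"]) (use 1 in auto)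
  next
    case 2
    have "((\<lambda>t::real. 0) has_real_derivative 2 * max 0 t) (at t)"
      using 2 by (auto intro!: derivative_eq_intros)
    then show ?thesis
      by (rule has_field_derivative_transform_within_open[of _ _ _ "{..<0}"]) (use 2 in auto)
  next
    case 3
    have "((\<lambda>h::real. (max 0 h)\<^sup>2 / h) \<longlongrightarrow> 0) (at 0)"
    proof (rule Lim_null_comparison)
      show "\<forall>\<^sub>F h in at 0. norm ((max 0 h)\<^sup>2 / h) \<le> \<bar>h\<bar>"
        by (intro always_eventually allI) (auto simp: max_def power2_eq_square)
    qed (auto intro!: tendsto_eq_intros)
    then show ?thesis using 3 by (simp add: DERIV_def)
  qed
qed

lemma cutoff_function_exists:
  obtains \<kappa> \<kappa>' :: "real \<Rightarrow> real" where
    "\<And>t. (\<kappa> has_real_derivative \<kappa>' t) (at t)" "continuous_on UNIV \<kappa>'"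
    "\<And>t. t \<le> 0 \<Longrightarrow> \<kappa> t = 0" "\<And>t. t \<ge> 1 \<Longrightarrow> \<kappa> t = 1" "\<And>t. 0 \<le> \<kappa> t" "\<And>t. \<kappa> t \<le> 1"
    "\<And>t. t \<le> 0 \<Longrightarrow> \<kappa>' t = 0" "\<And>t. t \<ge> 1 \<Longrightarrow> \<kappa>' t = 0" "\<And>t. 0 \<le> \<kappa>' t" "\<And>t. \<kappa>' t \<le> 2"
proof -
  \<comment> \<open>This is the antiderivative of the tent on [0, 1] with peak 2 at 1/2 and area 1.
    Squares of positive parts are continuously differentiable, and the peak gives the slope bound
    2.\<close>
  define \<kappa> where "\<kappa> t = 2 * (max 0 t)\<^sup>2 - 4 * (max 0 (t - 1/2))\<^sup>2 + 2 * (max 0 (t - 1))\<^sup>2" for t :: real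
  define \<kappa>' where "\<kappa>' t = 4 * max 0 t - 8 * max 0 (t - 1/2) + 4 * max 0 (t - 1)" for t :: real
  have s: "((\<lambda>t::real. (max 0 (t - a))\<^sup>2) has_real_derivative 2 * max 0 (t - a)) (at t)" for a t
    using has_real_derivative_max_0_square[of "t + - a"] unfolding DERIV_shift by simp
  have d: "(\<kappa> has_real_derivative \<kappa>' t) (at t)" for t
    unfolding \<kappa>_def[abs_def] \<kappa>'_def
    using DERIV_add[OF DERIV_diff[OF DERIV_cmult[OF s[of 0 t], of 2] DERIV_cmult[OF s[of "1/2" t], of 4]]
        DERIV_cmult[OF s[of 1 t], of 2]]
    by simp
  have c: "continuous_on UNIV \<kappa>'"
    unfolding \<kappa>'_def[abs_def] by (intro continuous_intros)
  have pos: "0 \<le> \<kappa>' t" and le2: "\<kappa>' t \<le> 2" for t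
    by (auto simp: \<kappa>'_def max_def)
  have lo: "\<kappa> t = 0" "\<kappa>' t = 0" if "t \<le> 0" for t
    using that by (auto simp: \<kappa>_def \<kappa>'_def max_def)
  have hi: "\<kappa> t = 1" "\<kappa>' t = 0" if "t \<ge> 1" for t
    using that by (simp_all add: \<kappa>_def \<kappa>'_def max_def power2_eq_square algebra_simps)
  have mono: "\<kappa> a \<le> \<kappa> b" if "a \<le> b" for a b
    using that d pos by (intro DERIV_nonneg_imp_nondecreasing[of a b \<kappa>]) auto
  have "0 \<le> \<kappa> t" "\<kappa> t \<le> 1" for t
    using mono[of "min t 0" t] mono[of t "max t 1"] lo(1)[of "min t 0"] hi(1)[of "max t 1"] by auto
  then show thesis using d c pos le2 lo hi by (intro that[of \<kappa> \<kappa>']) auto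
qed

text \<open>Multiplying a half-line solution by a cutoff turns it into a solution on the whole line.\<close>

lemma cutoff_estimate:
  fixes x :: "real \<Rightarrow> 'a::euclidean_space"
  assumes inv: "bounded_inverse A K"
    and x: "\<And>t. t > T \<Longrightarrow> (x has_vector_derivative A t (x t) + r t) (at t)"
    and r: "continuous_on {T<..} r" and S: "T < S" and \<tau>: "\<tau> > 0"
    and B: "\<And>t. t > T \<Longrightarrow> norm (x t) \<le> B"
    and B1: "\<And>t. S \<le> t \<Longrightarrow> t \<le> S + \<tau> \<Longrightarrow> norm (x t) \<le> B1"
    and H: "\<And>t. t \<ge> S \<Longrightarrow> norm (r t) \<le> H"
    and t: "t \<ge> S + \<tau>"
  shows "norm (x t) \<le> K * (2 / \<tau> * B1 + H)"
proof -
  obtain \<kappa> \<kappa>' :: "real \<Rightarrow> real" where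
    d\<kappa>: "\<And>t. (\<kappa> has_real_derivative \<kappa>' t) (at t)" and c\<kappa>': "continuous_on UNIV \<kappa>'" and
    lo: "\<And>t. t \<le> 0 \<Longrightarrow> \<kappa> t = 0" "\<And>t. t \<le> 0 \<Longrightarrow> \<kappa>' t = 0" and
    hi: "\<And>t. t \<ge> 1 \<Longrightarrow> \<kappa> t = 1" "\<And>t. t \<ge> 1 \<Longrightarrow> \<kappa>' t = 0" and
    bd: "\<And>t. 0 \<le> \<kappa> t" "\<And>t. \<kappa> t \<le> 1" "\<And>t. 0 \<le> \<kappa>' t" "\<And>t. \<kappa>' t \<le> 2"
    using cutoff_function_exists by metis
  define a where "a t = \<kappa> ((t - S) / \<tau>)" for t
  define a' where "a' t = \<kappa>' ((t - S) / \<tau>) / \<tau>" for t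
  have da: "(a has_real_derivative a' t) (at t)" for t
  proof -
    have "((\<lambda>t. (t - S) / \<tau>) has_real_derivative 1 / \<tau>) (at t)"
      using \<tau> by (auto intro!: derivative_eq_intros)
    from DERIV_chain2[OF d\<kappa> this] show ?thesis
      by (simp add: a_def[abs_def] a'_def)
  qed
  have ca: "continuous_on I a" for I
    using da by (intro continuous_at_imp_continuous_on ballI) (rule DERIV_isCont)
  have ca': "continuous_on I a'" for I
    unfolding a'_def[abs_def] using \<tau>
    by (intro continuous_on_divide continuous_on_compose2[OF c\<kappa>'] continuous_on_diff continuous_on_id
        continuous_on_const) auto
  have alo: "a t = 0" "a' t = 0" if "t \<le> S" for t
    using that \<tau> by (auto simp: a_def a'_def lo divide_nonpos_pos)
  have ahi: "a t = 1" "a' t = 0" if "t \<ge> S + \<tau>" for t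
    using that \<tau> by (auto simp: a_def a'_def hi)
  have abd: "0 \<le> a t" "a t \<le> 1" "0 \<le> a' t" "a' t \<le> 2 / \<tau>" for t
    using bd \<tau> by (auto simp: a_def a'_def divide_right_mono)
  define z where "z t = a t *\<^sub>R x t" for t
  \<comment> \<open>The commutator term \<open>a' t *\<^sub>R x t\<close> is supported on
    [S, S + \<tau>], so it costs 2 / \<tau> times the local bound \<open>B1\<close>. The global
    bound \<open>B\<close> makes \<open>z\<close> a bounded function, and its size does not reach
    the result.\<close>
  define h where "h t = a' t *\<^sub>R x t + a t *\<^sub>R r t" for t
  have z0: "z t = 0" "h t = 0" if "t \<le> S" for t
    using that by (auto simp: z_def h_def alo)
  have cx: "continuous_on {T<..} x"
    using x by (intro continuous_at_imp_continuous_on ballI) (auto intro: has_vector_derivative_continuous)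
  have dz: "(z has_vector_derivative A t (z t) + h t) (at t)" for t
  proof (cases "t > T")
    case True
    have "(z has_vector_derivative (a t *\<^sub>R (A t (x t) + r t) + a' t *\<^sub>R x t)) (at t)"
      unfolding z_def[abs_def] using da x[OF True] by (rule has_vector_derivative_scaleR)
    then show ?thesis
      by (rule has_vector_derivative_eq_rhs) (simp add: z_def h_def blinfun.scaleR_right scaleR_add_right)
  next
    case False
    have "((\<lambda>_. 0) has_vector_derivative A t (z t) + h t) (at t)"
      using False S by (simp add: z0 blinfun.zero_right)
    then show ?thesis
      by (rule has_vector_derivative_transform_within_open[of _ _ _ "{..<S}"]) (use False S z0 in auto)
  qed
  have ch: "continuous_on UNIV h"
  proof -
    have "continuous_on {T<..} h"
      unfolding h_def[abs_def] by (intro continuous_on_add continuous_on_scaleR ca ca' cx r)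
    moreover have "continuous_on {..<S} h"
      by (rule continuous_on_eq[OF continuous_on_const[of _ 0]]) (simp add: z0)
    ultimately have "continuous_on ({T<..} \<union> {..<S}) h"
      by (intro continuous_on_open_Un) auto
    moreover have "{T<..} \<union> {..<S} = UNIV" using S by auto
    ultimately show ?thesis by simp
  qed
  have B0: "0 \<le> B" "0 \<le> B1" "0 \<le> H"
    using order_trans[OF norm_ge_zero B[OF S]] order_trans[OF norm_ge_zero B1[of S]]
      order_trans[OF norm_ge_zero H[of S]] \<tau> by auto
  have zB: "norm (z t) \<le> B" for t
  proof (cases "t \<le> S")
    case False
    then have "norm (x t) \<le> B" using B S by simp
    then have "a t * norm (x t) \<le> 1 * B" using abd by (intro mult_mono) auto
    then show ?thesis using abd by (simp add: z_def)
  qed (simp add: z0 B0)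
  have hH: "norm (h t) \<le> 2 / \<tau> * B1 + H" for t
  proof (cases "t \<le> S")
    case True
    then show ?thesis using z0 B0 \<tau> by simp
  next
    case False
    have 1: "norm (a' t *\<^sub>R x t) \<le> 2 / \<tau> * B1"
    proof (cases "t \<le> S + \<tau>")
      case True
      then have "a' t * norm (x t) \<le> 2 / \<tau> * B1"
        using abd False B1[of t] B0 \<tau> by (intro mult_mono) auto
      then show ?thesis using abd by simp
    qed (use ahi B0 \<tau> in auto)
    have "a t * norm (r t) \<le> 1 * H" using abd H[of t] False B0 by (intro mult_mono) auto
    then have "norm (a t *\<^sub>R r t) \<le> H" using abd by simp
    with 1 show ?thesis unfolding h_def by (intro norm_triangle_le) linarith
  qed
  have "norm (z t) \<le> K * (2 / \<tau> * B1 + H)"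
    using dz by (intro bounded_inverse_estimate[OF inv _ ch hH zB]) (simp add: solves_def)
  then show ?thesis using t by (simp add: z_def ahi)
qed

text \<open>The bound halves over each time step of length p = 8 K + 1: one unit to get past the
  start, then a cutoff of width 8 K, whose contribution K * 2 / (8 K) = 1/4 adds to K \<eta> \<le>
  1/4. The rate is ln 2 / p, and rounding the number of steps down costs the factor 2.\<close>

lemma exponential_decay:
  fixes x :: "real \<Rightarrow> 'a::euclidean_space"
  assumes inv: "bounded_inverse A K"
    and x: "\<And>t. t > T \<Longrightarrow> (x has_vector_derivative A t (x t) + r t) (at t)"
    and r: "continuous_on {T<..} r"
    and B: "\<And>t. t > T \<Longrightarrow> norm (x t) \<le> B"
    and small: "\<And>t. t > T \<Longrightarrow> norm (r t) \<le> \<eta> * norm (x t)" "K * \<eta> \<le> 1/4" "\<eta> \<ge> 0"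
    and t: "t > T"
  shows "norm (x t) \<le> 2 * B * exp (- (ln 2 / (8 * K + 1)) * (t - T))"
proof -
  have K: "K > 0" using inv by (simp add: bounded_inverse_def)
  define p where "p = 8 * K + 1"
  have p: "p > 0" using K by (simp add: p_def)
  have B0: "B \<ge> 0" using B[OF t] norm_ge_zero order_trans by blast
  have P: "norm (x t) \<le> B / 2 ^ n" if "t \<ge> T + n * p" "t > T" for n :: nat and t
    using that
  proof (induction n arbitrary: t)
    case 0
    then show ?case using B by simp
  next
    case (Suc n)
    let ?T = "T + n * p" and ?B = "B / 2 ^ n"
    have T: "?T \<ge> T" using p by simp
    have bd: "norm (x s) \<le> ?B" if "s > ?T" for s
      using Suc.IH[of s] that T by simp
    have rb: "norm (r s) \<le> \<eta> * ?B" if "s > ?T" for s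
    proof -
      have "norm (r s) \<le> \<eta> * norm (x s)" using small(1) that T by simp
      also have "\<dots> \<le> \<eta> * ?B" using small(3) bd[OF that] by (rule mult_left_mono[rotated])
      finally show ?thesis .
    qed
    have "norm (x t) \<le> K * (2 / (8 * K) * ?B + \<eta> * ?B)"
    proof (rule cutoff_estimate[OF inv, where T = ?T and S = "?T + 1" and B = ?B])
      show "(x has_vector_derivative A s (x s) + r s) (at s)" if "?T < s" for s
        using x that T by simp
      show "continuous_on {?T<..} r" using r by (rule continuous_on_subset) (use T in auto)
      show "?T + 1 + 8 * K \<le> t" using Suc.prems by (simp add: p_def algebra_simps)
    qed (use K bd rb in auto)
    also have "\<dots> = (1/4 + K * \<eta>) * ?B" using K by (simp add: field_simps)
    also have "\<dots> \<le> 1/2 * ?B" using small(2) B0 by (intro mult_right_mono) auto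
    finally show ?case by simp
  qed
  define n where "n = nat \<lfloor>(t - T) / p\<rfloor>"
  have q0: "(t - T) / p \<ge> 0" using t p by simp
  have n: "real n \<le> (t - T) / p" "(t - T) / p < real n + 1"
    using q0 unfolding n_def by (auto simp: of_nat_nat floor_le_iff)
  have "norm (x t) \<le> B / 2 ^ n"
    using n(1) p t by (intro P) (auto simp: field_simps)
  also have "B / 2 ^ n = 2 * B * (1 / 2) ^ (n + 1)" by (simp add: field_simps power_divide)
  also have "(1 / 2 :: real) ^ (n + 1) = exp (- (ln 2) * (real n + 1))"
  proof -
    have "exp (- ln 2) = (1 / 2 :: real)" by (simp add: exp_minus)
    moreover have "- ln 2 * (real n + 1) = real (n + 1) * - ln 2" by (simp add: algebra_simps)
    ultimately show ?thesis using exp_of_nat_mult[of "n + 1" "- ln 2 :: real"] by (simp only:)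
  qed
  also have "\<dots> \<le> exp (- (ln 2) * ((t - T) / p))"
    unfolding exp_le_cancel_iff using n(2) by (intro mult_left_mono_neg) auto
  also have "- (ln 2) * ((t - T) / p) = - (ln 2 / p) * (t - T)" by simp
  finally show ?thesis using B0 by (simp add: p_def mult_left_mono)
qed


section \<open>From bounded invertibility to an exponential dichotomy\<close>

lemma solves_homogeneous_propagator:
  assumes p: "propagator A X Y" and y: "solves A (\<lambda>_. 0) y"
  shows "y t = X t (y 0)"
proof -
  have "((\<lambda>t. Y t (y t)) has_vector_derivative 0) (at t)" for t
    using propagator_inverse_derivative[OF p, of y t 0] y by (simp add: solves_def blinfun.zero_right)
  then obtain c where c: "\<And>t. Y t (y t) = c"
    using has_vector_derivative_zero_constant[of UNIV "\<lambda>t. Y t (y t)"] by auto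
  have "y 0 = c" using c[of 0] p by (simp add: propagator_def)
  moreover have "y t = X t c" using c[of t] propagator_cancel(1)[OF p, of t "y t"] by simp
  ultimately show ?thesis by simp
qed

lemma propagator_bounded_imp_zero:
  assumes inv: "bounded_inverse A K" and p: "propagator A X Y" and B: "\<And>t. norm (X t v) \<le> B"
  shows "v = 0"
proof -
  have s: "solves A (\<lambda>_. 0) (\<lambda>t. X t v)"
    using propagator_apply_derivative[OF p] by (simp add: solves_def)
  have "norm (X 0 v) \<le> K * 0"
    by (rule bounded_inverse_estimate[OF inv s continuous_on_const _ B]) simp
  then show ?thesis using p by (simp add: propagator_def)
qed

text \<open>Let \<open>z = X v\<close>, let \<open>\<kappa>\<close> be a cutoff that switches on after \<open>s\<close>, and let \<open>x\<close> be the bounded solution of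
  \<open>x' = A x + \<kappa>' z\<close>. Then \<open>\<kappa> z - x\<close> solves the homogeneous equation; it equals \<open>- x\<close> before \<open>s\<close>, and
  \<open>z - (\<kappa> z - x)\<close> equals \<open>x\<close> after \<open>s + 1\<close>.\<close>

lemma bounded_solution_splitting:
  fixes A :: "real \<Rightarrow> 'a::euclidean_space \<Rightarrow>\<^sub>L 'a"
  assumes inv: "bounded_inverse A K" and p: "propagator A X Y" and M: "\<And>t. norm (A t) \<le> M"
  obtains a b where "v = a + b"
    "\<And>t. t \<ge> s \<Longrightarrow> norm (X t a) \<le> (1 + 2 * K) * exp M * norm (X s v)"
    "\<And>t. t \<le> s \<Longrightarrow> norm (X t b) \<le> (1 + 2 * K) * exp M * norm (X s v)"
proof -
  have K: "K > 0" using inv by (simp add: bounded_inverse_def)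
  have M0: "M \<ge> 0" using M[of 0] norm_ge_zero order_trans by blast
  obtain \<kappa> \<kappa>' :: "real \<Rightarrow> real" where
    d\<kappa>: "\<And>t. (\<kappa> has_real_derivative \<kappa>' t) (at t)" and c\<kappa>': "continuous_on UNIV \<kappa>'" and
    lo: "\<And>t. t \<le> 0 \<Longrightarrow> \<kappa> t = 0" "\<And>t. t \<le> 0 \<Longrightarrow> \<kappa>' t = 0" and
    hi: "\<And>t. t \<ge> 1 \<Longrightarrow> \<kappa> t = 1" "\<And>t. t \<ge> 1 \<Longrightarrow> \<kappa>' t = 0" and
    bd: "\<And>t. 0 \<le> \<kappa> t" "\<And>t. \<kappa> t \<le> 1" "\<And>t. 0 \<le> \<kappa>' t" "\<And>t. \<kappa>' t \<le> 2"
    using cutoff_function_exists by metis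
  \<comment> \<open>\<open>Z\<close> bounds \<open>X t v\<close> on [s, s + 1], outside which
    \<kappa>' (t - s) vanishes; this is the origin of the factor exp M in the conclusion.\<close>
  define Z where "Z = exp M * norm (X s v)"
  have Z: "norm (X t v) \<le> Z" if "s \<le> t" "t \<le> s + 1" for t
  proof -
    have "norm (X t v) \<le> exp (M * \<bar>t - s\<bar>) * norm (X s v)" by (rule propagator_norm_le[OF p M])
    also have "\<dots> \<le> Z"
      unfolding Z_def using that M0 mult_left_mono[of "\<bar>t - s\<bar>" 1 M] by (intro mult_right_mono) auto
    finally show ?thesis .
  qed
  have Z0: "Z \<ge> 0" by (simp add: Z_def)
  have dX: "((\<lambda>t. X t v) has_vector_derivative A t (X t v)) (at t)" for t
    by (rule propagator_apply_derivative[OF p])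
  have cX: "continuous_on UNIV (\<lambda>t. X t v)"
    using dX by (intro continuous_at_imp_continuous_on ballI) (rule has_vector_derivative_continuous)
  define h where "h t = \<kappa>' (t - s) *\<^sub>R X t v" for t
  have hb: "norm (h t) \<le> 2 * Z" for t
  proof (cases "s \<le> t \<and> t \<le> s + 1")
    case True
    then have "\<kappa>' (t - s) * norm (X t v) \<le> 2 * Z" using bd Z by (intro mult_mono) auto
    then show ?thesis using bd by (simp add: h_def)
  qed (use lo hi Z0 in \<open>auto simp: h_def\<close>)
  have hc: "continuous_on UNIV h"
    unfolding h_def[abs_def]
    by (intro continuous_on_scaleR cX continuous_on_compose2[OF c\<kappa>'] continuous_on_diff continuous_on_id
        continuous_on_const) auto
  define h' where "h' = Bcontfun h"
  have h': "apply_bcontfun h' = h"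
    unfolding h'_def by (rule Bcontfun_inverse[OF bcontfun_normI[OF hc hb]])
  define x where "x = apply_bcontfun (resolvent A h')"
  have x: "solves A h x" using solves_resolvent[OF inv, of h'] by (simp add: x_def h')
  have xb: "norm (x t) \<le> 2 * K * Z" for t
  proof -
    have "norm (x t) \<le> norm (resolvent A h')" unfolding x_def by (rule norm_bounded)
    also have "\<dots> \<le> K * norm h'" by (rule norm_resolvent_le[OF inv])
    also have "\<dots> \<le> K * (2 * Z)" using K hb by (intro mult_left_mono norm_bound) (auto simp: h')
    finally show ?thesis by simp
  qed
  have "solves A h (\<lambda>t. \<kappa> (t - s) *\<^sub>R X t v)"
    unfolding solves_def
  proof
    fix t
    have "((\<lambda>t. \<kappa> (t - s)) has_real_derivative \<kappa>' (t - s)) (at t)"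
      using d\<kappa>[of "t + - s"] unfolding DERIV_shift by simp
    from has_vector_derivative_scaleR[OF this dX[of t]]
    show "((\<lambda>t. \<kappa> (t - s) *\<^sub>R X t v) has_vector_derivative A t (\<kappa> (t - s) *\<^sub>R X t v) + h t) (at t)"
      by (simp add: h_def blinfun.scaleR_right)
  qed
  from solves_diff[OF this x] have y: "solves A (\<lambda>_. 0) (\<lambda>t. \<kappa> (t - s) *\<^sub>R X t v - x t)"
    by simp
  define b where "b = \<kappa> (0 - s) *\<^sub>R X 0 v - x 0"
  have Xb: "X t b = \<kappa> (t - s) *\<^sub>R X t v - x t" for t
    using solves_homogeneous_propagator[OF p y, of t] by (simp add: b_def)
  show thesis
  proof (rule that[of "v - b" b])
    fix t
    have eq: "(1 + 2 * K) * exp M * norm (X s v) = Z + 2 * K * Z" by (simp add: Z_def algebra_simps)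
    show "norm (X t b) \<le> (1 + 2 * K) * exp M * norm (X s v)" if "t \<le> s"
      unfolding eq Xb using that lo(1)[of "t - s"] xb[of t] Z0 by simp
    show "norm (X t (v - b)) \<le> (1 + 2 * K) * exp M * norm (X s v)" if "t \<ge> s"
    proof -
      have "X t (v - b) = (1 - \<kappa> (t - s)) *\<^sub>R X t v + x t"
        by (simp add: blinfun.diff_right Xb algebra_simps)
      moreover have "norm ((1 - \<kappa> (t - s)) *\<^sub>R X t v) \<le> Z"
      proof (cases "t \<le> s + 1")
        case True
        have "(1 - \<kappa> (t - s)) * norm (X t v) \<le> 1 * Z"
          using bd Z True that by (intro mult_mono) auto
        then show ?thesis using bd by simp
      qed (use hi(1)[of "t - s"] Z0 in auto)
      ultimately show ?thesis unfolding eq using xb[of t]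
        by (simp only:) (rule norm_triangle_le, linarith)
    qed
  qed auto
qed

text \<open>A linear right inverse of (a, b) \<mapsto> a + b on \<open>S \<times> U\<close> picks
  the summand in \<open>S\<close> linearly. \<open>S\<close> and \<open>U\<close> may overlap, and
  then \<open>P\<close> is one choice among several; the Fredholm alternative relies on this
  case.\<close>

lemma exists_linear_splitting:
  fixes S U :: "'a::euclidean_space set"
  assumes S: "subspace S" and U: "subspace U"
  shows "\<exists>P. linear P \<and> range P \<subseteq> S \<and> (\<forall>a\<in>S. \<forall>b\<in>U. a + b - P (a + b) \<in> U)"
proof -
  define f where "f = (\<lambda>(a :: 'a, b :: 'a). a + b)"
  have f: "linear f" unfolding f_def by (rule linearI) (auto simp: algebra_simps)
  have "subspace (S \<times> U)" using S U by (rule subspace_Times)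
  then obtain g where g: "range g \<subseteq> S \<times> U" "linear g" "\<forall>v\<in>f ` (S \<times> U). f (g v) = v"
    using linear_exists_right_inverse_on[OF f] by blast
  have "a + b - fst (g (a + b)) \<in> U" if "a \<in> S" "b \<in> U" for a b
  proof -
    have "(a, b) \<in> S \<times> U" using that by simp
    then have "f (a, b) \<in> f ` (S \<times> U)" by (rule imageI)
    then have "f (g (a + b)) = a + b" using g(3) that by (simp add: f_def split_beta)
    then have "a + b - fst (g (a + b)) = snd (g (a + b))"
      by (simp add: f_def split_beta algebra_simps)
    moreover have "g (a + b) \<in> S \<times> U" using g(1) by blast
    ultimately show ?thesis by (simp add: mem_Times_iff)
  qed
  moreover have "linear (\<lambda>v. fst (g v))"
    using linear_compose[OF g(2) linear_fst] by (simp add: o_def)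
  moreover have "range (\<lambda>v. fst (g v)) \<subseteq> S" using g(1) by (auto simp: image_subset_iff mem_Times_iff)
  ultimately show ?thesis by (intro exI[of _ "\<lambda>v. fst (g v)"]) simp
qed

text \<open>Perron's admissibility principle. Uniqueness of bounded solutions makes forward bounded
  and backward bounded initial values independent, and the splitting at a time s bounds both parts
  by a constant that does not depend on s. Boundedness on a half-line then improves to exponential
  decay.\<close>

theorem bounded_inverse_imp_exponential_dichotomy:
  fixes A :: "real \<Rightarrow> 'a::euclidean_space \<Rightarrow>\<^sub>L 'a"
  assumes inv: "bounded_inverse A K" and cA: "continuous_on UNIV A" and M: "\<And>t. norm (A t) \<le> M"
  shows "exponential_dichotomy (\<lambda>t. blinfun_apply (A t))"
proof -
  have K: "K > 0" using inv by (simp add: bounded_inverse_def)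
  obtain X Y where p: "propagator A X Y" using propagator_exists[OF cA M] by blast
  define S where "S = {v. \<exists>B. \<forall>t\<in>{0..}. norm (X t v) \<le> B}"
  define U where "U = {v. \<exists>B. \<forall>t\<in>{..0}. norm (X t v) \<le> B}"
  have sub: "subspace {v. \<exists>B. \<forall>t\<in>I. norm (X t v) \<le> B}" for I
  proof (rule subspaceI)
    show "0 \<in> {v. \<exists>B. \<forall>t\<in>I. norm (X t v) \<le> B}"
      by (intro CollectI exI[of _ 0]) (simp add: blinfun.zero_right)
    fix v w c
    assume "v \<in> {v. \<exists>B. \<forall>t\<in>I. norm (X t v) \<le> B}"
    then obtain B where B: "\<And>t. t \<in> I \<Longrightarrow> norm (X t v) \<le> B" by blast
    have "norm (X t (c *\<^sub>R v)) \<le> \<bar>c\<bar> * B" if "t \<in> I" for t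
      using B[OF that] by (simp add: blinfun.scaleR_right mult_left_mono)
    then show "c *\<^sub>R v \<in> {v. \<exists>B. \<forall>t\<in>I. norm (X t v) \<le> B}" by (intro CollectI exI ballI)
    assume "w \<in> {v. \<exists>B. \<forall>t\<in>I. norm (X t v) \<le> B}"
    then obtain B' where B': "\<And>t. t \<in> I \<Longrightarrow> norm (X t w) \<le> B'" by blast
    have "norm (X t (v + w)) \<le> B + B'" if "t \<in> I" for t
      using B[OF that] B'[OF that] norm_triangle_ineq[of "X t v" "X t w"] by (simp add: blinfun.add_right)
    then show "v + w \<in> {v. \<exists>B. \<forall>t\<in>I. norm (X t v) \<le> B}" by (intro CollectI exI ballI)
  qed
  have S: "subspace S" using sub[of "{0..}"] by (simp add: S_def)
  have U: "subspace U" using sub[of "{..0}"] by (simp add: U_def)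
  have SU: "v = 0" if vS: "v \<in> S" and vU: "v \<in> U" for v
  proof -
    obtain B where B: "\<And>t. t \<ge> 0 \<Longrightarrow> norm (X t v) \<le> B" using vS unfolding S_def mem_Collect_eq Ball_def atLeast_iff by metis
    obtain B' where B': "\<And>t. t \<le> 0 \<Longrightarrow> norm (X t v) \<le> B'" using vU unfolding U_def mem_Collect_eq Ball_def atMost_iff by metis
    have "norm (X t v) \<le> max B B'" for t
      using B[of t] B'[of t] by (cases "t \<ge> 0") auto
    then show ?thesis by (rule propagator_bounded_imp_zero[OF inv p])
  qed
  define C where "C = (1 + 2 * K) * exp M"
  have C: "C > 0" using K by (simp add: C_def)
  \<comment> \<open>The constant \<open>C\<close> is the same for every s. Gronwall bridges the
    interval between s and 0, so that the two parts also satisfy the definitions of \<open>S\<close>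
    and \<open>U\<close>, which refer to time 0.\<close>
  have split: "\<exists>a b. v = a + b \<and> a \<in> S \<and> b \<in> U \<and> (\<forall>t\<ge>s. norm (X t a) \<le> C * norm (X s v)) \<and>
      (\<forall>t\<le>s. norm (X t b) \<le> C * norm (X s v))" for v s
  proof -
    obtain a b where ab: "v = a + b" and a: "\<And>t. t \<ge> s \<Longrightarrow> norm (X t a) \<le> C * norm (X s v)"
      and b: "\<And>t. t \<le> s \<Longrightarrow> norm (X t b) \<le> C * norm (X s v)"
      unfolding C_def using bounded_solution_splitting[OF inv p M, of v s] by blast
    have M0: "M \<ge> 0" using M[of 0] norm_ge_zero order_trans by blast
    have loc: "norm (X t w) \<le> exp (M * \<bar>s\<bar>) * norm (X s w)" if "\<bar>t - s\<bar> \<le> \<bar>s\<bar>" for t w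
    proof -
      have "norm (X t w) \<le> exp (M * \<bar>t - s\<bar>) * norm (X s w)" by (rule propagator_norm_le[OF p M])
      also have "\<dots> \<le> exp (M * \<bar>s\<bar>) * norm (X s w)"
        using mult_left_mono[OF that M0] by (intro mult_right_mono) simp_all
      finally show ?thesis .
    qed
    have "norm (X t a) \<le> max (C * norm (X s v)) (exp (M * \<bar>s\<bar>) * norm (X s a))" if "t \<ge> 0" for t
    proof (cases "t \<ge> s")
      case True then show ?thesis using a[of t] by linarith
    next
      case False then show ?thesis using that by (intro max.coboundedI2 loc) simp
    qed
    then have "a \<in> S" unfolding S_def by (intro CollectI exI ballI) simp
    moreover have "norm (X t b) \<le> max (C * norm (X s v)) (exp (M * \<bar>s\<bar>) * norm (X s b))" if "t \<le> 0" for t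
    proof (cases "t \<le> s")
      case True then show ?thesis using b[of t] by linarith
    next
      case False then show ?thesis using that by (intro max.coboundedI2 loc) simp
    qed
    then have "b \<in> U" unfolding U_def by (intro CollectI exI ballI) simp
    ultimately show ?thesis using ab a b by (intro exI[of _ a] exI[of _ b]) simp
  qed
  obtain P where P: "linear P" "range P \<subseteq> S" "\<forall>a\<in>S. \<forall>b\<in>U. a + b - P (a + b) \<in> U"
    using exists_linear_splitting[OF S U] by blast
  have PS: "P v \<in> S" "v - P v \<in> U" for v
  proof -
    show "P v \<in> S" using P(2) by blast
    obtain a b where "v = a + b" "a \<in> S" "b \<in> U" using split[of v 0] by blast
    then show "v - P v \<in> U" using P(3) by simp
  qed
  \<comment> \<open>The decomposition is unique, so \<open>P\<close> gives the same summand whatever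
    the time s at which the splitting was made.\<close>
  have P_eq: "P v = a" if "v = a + b" "a \<in> S" "b \<in> U" for v a b
  proof -
    have "P v - a \<in> S" by (rule subspace_diff[OF S PS(1) that(2)])
    moreover have "b - (v - P v) \<in> U" by (rule subspace_diff[OF U that(3) PS(2)])
    moreover have "b - (v - P v) = P v - a" unfolding that(1) by simp
    ultimately have "P v - a \<in> S" "P v - a \<in> U" by simp_all
    then have "P v - a = 0" by (rule SU)
    then show ?thesis by simp
  qed
  define PP where "PP = Blinfun P"
  have PP: "blinfun_apply PP = P"
    unfolding PP_def using P(1) by (intro bounded_linear_Blinfun_apply) (simp add: linear_conv_bounded_linear)
  define l where "l = ln 2 / (8 * K + 1)"
  have l: "l > 0" using K by (simp add: l_def)
  have decS: "norm (X t (P (Y s v))) \<le> 2 * C * exp (- l * (t - s)) * norm v" if "s \<le> t" for s t v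
  proof -
    obtain a b where ab: "Y s v = a + b" "a \<in> S" "b \<in> U"
      and a: "\<And>t. t \<ge> s \<Longrightarrow> norm (X t a) \<le> C * norm (X s (Y s v))"
      using split[of "Y s v" s] by blast
    have Pa: "P (Y s v) = a" using P_eq[OF ab] .
    have a': "norm (X t a) \<le> C * norm v" if "t \<ge> s" for t
      using a[OF that] by (simp add: propagator_cancel[OF p])
    show ?thesis
    \<comment> \<open>The decay lemma speaks of times strictly after T = s; at t = s the plain bound
      by \<open>C\<close> suffices.\<close>
    proof (cases "s = t")
      case True
      then have "norm (X t a) \<le> C * norm v" "0 \<le> C * norm v" using a'[of t] C by auto
      then show ?thesis using True unfolding Pa by simp
    next
      case False
      have "norm (X t a) \<le> 2 * (C * norm v) * exp (- (ln 2 / (8 * K + 1)) * (t - s))"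
        by (rule exponential_decay[OF inv, where r = "\<lambda>_. 0" and \<eta> = 0 and T = s])
          (use propagator_apply_derivative[OF p, of a] a' False that in \<open>simp_all add: continuous_on_const\<close>)
      then show ?thesis unfolding Pa l_def by (simp only: ac_simps)
    qed
  qed
  have decU: "norm (X t (Y s v - P (Y s v))) \<le> 2 * C * exp (- l * (s - t)) * norm v" if "t \<le> s" for s t v
  proof -
    obtain a b where ab: "Y s v = a + b" "a \<in> S" "b \<in> U"
      and b: "\<And>t. t \<le> s \<Longrightarrow> norm (X t b) \<le> C * norm (X s (Y s v))"
      using split[of "Y s v" s] by blast
    have Pb: "Y s v - P (Y s v) = b" using P_eq[OF ab] ab(1) by simp
    have b': "norm (X t b) \<le> C * norm v" if "t \<le> s" for t
      using b[OF that] by (simp add: propagator_cancel[OF p])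
    show ?thesis
    proof (cases "s = t")
      case True
      then have "norm (X t b) \<le> C * norm v" "0 \<le> C * norm v" using b'[of t] C by auto
      then show ?thesis using True unfolding Pb by simp
    next
      case False
      have "norm (X (- (- t)) b) \<le> 2 * (C * norm v) * exp (- (ln 2 / (8 * K + 1)) * (- t - - s))"
      proof (rule exponential_decay[OF bounded_inverse_reflect[OF inv], where r = "\<lambda>_. 0" and \<eta> = 0 and T = "- s"])
        show "((\<lambda>t. X (- t) b) has_vector_derivative (- A (- u)) (X (- u) b) + 0) (at u)" for u
          using has_vector_derivative_reflect[OF propagator_apply_derivative[OF p, of b "- u"]]
          by (simp add: blinfun.minus_left)
      qed (use b' False that in \<open>simp_all add: continuous_on_const\<close>)
      moreover have "- t - - s = s - t" by simp
      ultimately show ?thesis unfolding Pb l_def by (simp only: ac_simps minus_minus)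
    qed
  qed
  have "PP o\<^sub>L PP = PP"
  proof -
    have "P (P v) = P v" for v
      using P_eq[of "P v" "P v" 0] PS(1)[of v] subspace_0[OF U] by simp
    then show ?thesis by (simp add: blinfun_eq_iff PP)
  qed
  moreover have "norm (X t o\<^sub>L PP o\<^sub>L Y s) \<le> 2 * C * exp (- l * (t - s))" if "s \<le> t" for t s
    using C decS[OF that] by (intro norm_blinfun_bound) (simp_all add: PP)
  moreover have "norm (X t o\<^sub>L (id_blinfun - PP) o\<^sub>L Y s) \<le> 2 * C * exp (- l * (s - t))" if "t \<le> s" for t s
    using C decU[OF that] by (intro norm_blinfun_bound) (simp_all add: PP blinfun.diff_left blinfun.diff_right)
  moreover have "\<forall>t. X t o\<^sub>L Y t = id_blinfun \<and> Y t o\<^sub>L X t = id_blinfun"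
    using p by (simp add: propagator_def)
  moreover have "\<forall>t v. ((\<lambda>s. X s v) has_vector_derivative A t (X t v)) (at t)"
    using propagator_apply_derivative[OF p] by simp
  moreover have "2 * C > 0" using C by simp
  ultimately show ?thesis
    unfolding exponential_dichotomy_def using l
    by (intro exI[of _ X] exI[of _ Y] exI[of _ PP] exI[of _ "2 * C"] exI[of _ l] conjI) simp_all
qed

subsection \<open>Constant hyperbolic coefficients\<close>

text \<open>The complexification of \<open>'a\<close> is modelled by \<open>'a \<times> 'a\<close>, with real and imaginary parts as components.\<close>

definition cscale :: "complex \<Rightarrow> 'a::euclidean_space \<times> 'a \<Rightarrow> 'a \<times> 'a" where
  "cscale c w = (Re c *\<^sub>R fst w - Im c *\<^sub>R snd w, Im c *\<^sub>R fst w + Re c *\<^sub>R snd w)"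

definition cext :: "('a::euclidean_space \<Rightarrow>\<^sub>L 'a) \<Rightarrow> 'a \<times> 'a \<Rightarrow> 'a \<times> 'a" where
  "cext L w = (L (fst w), L (snd w))"

lemma cscale_simps [simp]:
  "cscale 1 w = w" "cscale 0 w = 0" "cscale c 0 = 0" "cscale a (cscale b w) = cscale (a * b) w"
  by (simp_all add: cscale_def prod_eq_iff algebra_simps)

lemma cscale_add_right: "cscale c (v + w) = cscale c v + cscale c w"
  by (simp add: cscale_def prod_eq_iff algebra_simps)

lemma cscale_add_left: "cscale (a + b) w = cscale a w + cscale b w"
  by (simp add: cscale_def prod_eq_iff algebra_simps)

lemma cscale_of_real: "cscale (of_real r) w = r *\<^sub>R w"
  by (simp add: cscale_def prod_eq_iff)

lemma cscale_minus_left: "cscale (- a) w = - cscale a w"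
  by (simp add: cscale_def prod_eq_iff)

lemma norm_cscale: "norm (cscale c w) = cmod c * norm w"
proof -
  have "(norm (cscale c w))\<^sup>2 = (cmod c)\<^sup>2 * (norm w)\<^sup>2"
    unfolding power2_norm_eq_inner[of w] power2_norm_eq_inner[of "cscale c w"] cmod_power2
    by (simp add: cscale_def inner_prod_def inner_diff_left inner_diff_right inner_add_left inner_add_right
        inner_commute power2_eq_square algebra_simps)
  then have "(norm (cscale c w))\<^sup>2 = (cmod c * norm w)\<^sup>2" by (simp add: power_mult_distrib)
  then show ?thesis by (rule power2_eq_imp_eq) auto
qed

lemma bounded_bilinear_cscale: "bounded_bilinear cscale"
proof
  show "\<exists>K. \<forall>a b. norm (cscale a b) \<le> norm a * norm b * K"
    by (rule exI[of _ 1]) (simp add: norm_cscale)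
qed (simp_all add: cscale_add_left cscale_add_right cscale_def prod_eq_iff algebra_simps)

lemma bounded_linear_cext: "bounded_linear (cext L)"
  unfolding cext_def
  by (intro bounded_linear_Pair bounded_linear_compose[OF blinfun.bounded_linear_right]
      bounded_linear_fst bounded_linear_snd)

lemma cext_cscale: "cext L (cscale c w) = cscale c (cext L w)"
  by (simp add: cscale_def cext_def blinfun.add_right blinfun.diff_right blinfun.scaleR_right)

text \<open>The polynomial functional calculus: \<open>pop L p\<close> is p (L) on the
  complexification, evaluated by Horner's scheme.\<close>

definition pop :: "('a::euclidean_space \<Rightarrow>\<^sub>L 'a) \<Rightarrow> complex poly \<Rightarrow> 'a \<times> 'a \<Rightarrow> 'a \<times> 'a" where
  "pop L p = fold_coeffs (\<lambda>a f w. cscale a w + cext L (f w)) p (\<lambda>w. 0)"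

lemma cext_0 [simp]: "cext L 0 = 0"
  using linear_0[OF bounded_linear.linear[OF bounded_linear_cext]] .

lemma cext_add: "cext L (v + w) = cext L v + cext L w"
  using linear_add[OF bounded_linear.linear[OF bounded_linear_cext]] .

lemma pop_0 [simp]: "pop L 0 w = 0"
  by (simp add: pop_def)

lemma pop_pCons [simp]: "pop L (pCons a p) w = cscale a w + cext L (pop L p w)"
proof (cases "p = 0 \<and> a = 0")
  case True
  then show ?thesis by (simp add: pop_def)
next
  case False
  then show ?thesis unfolding pop_def by (cases "p = 0") (simp_all add: fold_coeffs_pCons_coeff_not_0_eq fold_coeffs_pCons_not_0_0_eq)
qed

lemma pop_1 [simp]: "pop L 1 w = w"
  by (simp add: one_pCons)

lemma pop_add: "pop L (p + q) w = pop L p w + pop L q w"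
  by (induction p q rule: poly_induct2) (simp_all add: cscale_add_left cext_add)

lemma pop_smult: "pop L (smult c p) w = cscale c (pop L p w)"
  by (induction p) (simp_all add: cscale_add_right cext_cscale)

lemma pop_mult: "pop L (p * q) w = pop L p (pop L q w)"
  by (induction p) (simp_all add: pop_add pop_smult)

lemma pop_sum: "pop L (sum f I) w = (\<Sum>i\<in>I. pop L (f i) w)"
  by (induction I rule: infinite_finite_induct) (simp_all add: pop_add)

lemma pop_monom: "pop L (monom c i) w = cscale c ((cext L ^^ i) w)"
  by (induction i) (simp_all add: monom_0 monom_Suc cext_cscale)

lemma bounded_linear_pop: "bounded_linear (pop L p)"
proof (induction p)
  case 0
  have "pop L 0 = (\<lambda>w. 0)" by (simp add: fun_eq_iff)
  then show ?case by (simp add: bounded_linear_zero)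
next
  case (pCons a p)
  have "bounded_linear (\<lambda>w. cscale a w + cext L (pop L p w))"
    by (intro bounded_linear_add bounded_bilinear.bounded_linear_right[OF bounded_bilinear_cscale]
        bounded_linear_compose[OF bounded_linear_cext pCons.IH])
  moreover have "pop L (pCons a p) = (\<lambda>w. cscale a w + cext L (pop L p w))" by (simp add: fun_eq_iff)
  ultimately show ?case by simp
qed

lemma pop_cext: "pop L p (cext L w) = cext L (pop L p w)"
  using pop_mult[of L p "[:0, 1:]" w] pop_mult[of L "[:0, 1:]" p w] by (simp add: mult.commute)

text \<open>In dimension D the D + 1 vectors w, L w, ..., L^D w satisfy a linear relation, and its
  coefficients form the polynomial. Coinciding iterates are treated apart, since the set of these
  vectors does not register a repetition.\<close>

lemma pop_annihilates_vector: "\<exists>p. p \<noteq> 0 \<and> pop L p w = 0"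
proof -
  define D where "D = DIM('a \<times> 'a)"
  define v where "v i = (cext L ^^ i) w" for i
  show ?thesis
  proof (cases "inj_on v {..D}")
    case False
    then obtain i j where ij: "v i = v j" "i \<noteq> j" unfolding inj_on_def by blast
    have "coeff (monom 1 i + monom (- 1) j :: complex poly) i = 1" using ij by (simp add: coeff_monom)
    then have "monom 1 i + monom (- 1) j \<noteq> (0 :: complex poly)" by (metis coeff_0 zero_neq_one)
    moreover have "pop L (monom 1 i + monom (- 1) j) w = 0"
      using ij by (simp add: pop_add pop_monom v_def[symmetric] cscale_minus_left)
    ultimately show ?thesis by blast
  next
    case True
    have "card (v ` {..D}) = D + 1" using True by (simp add: card_image)
    then have "dependent (v ` {..D})" by (intro dependent_biggerset) (simp_all add: D_def)
    then obtain u k where u: "(\<Sum>x\<in>v ` {..D}. u x *\<^sub>R x) = 0" "k \<le> D" "u (v k) \<noteq> 0"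
      by (auto simp: dependent_finite)
    define p where "p = (\<Sum>i\<le>D. monom (complex_of_real (u (v i))) i)"
    have "coeff p k = u (v k)" using u(2) by (simp add: p_def coeff_sum coeff_monom)
    then have "p \<noteq> 0" using u(3) by (metis coeff_0 of_real_eq_0_iff)
    moreover have "pop L p w = (\<Sum>i\<le>D. u (v i) *\<^sub>R v i)"
      by (simp add: p_def pop_sum pop_monom cscale_of_real v_def[symmetric])
    then have "pop L p w = 0" using u(1) True by (simp add: sum.reindex)
    ultimately show ?thesis by blast
  qed
qed

text \<open>Polynomials in L commute, so the product of annihilating polynomials of all basis
  vectors annihilates each of them.\<close>

lemma pop_annihilator_exists: "\<exists>p. p \<noteq> 0 \<and> (\<forall>w. pop L p w = 0)"
proof -
  obtain P where P: "\<And>w. P w \<noteq> 0" "\<And>w. pop L (P w) w = 0"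
    using pop_annihilates_vector by metis
  define p where "p = (\<Prod>b\<in>Basis. P b)"
  have "p \<noteq> 0" using P(1) by (simp add: p_def)
  moreover have "pop L p b = 0" if "b \<in> Basis" for b
  proof -
    have "p = (\<Prod>b\<in>Basis - {b}. P b) * P b" using that by (simp add: p_def prod.remove mult.commute)
    then show ?thesis
      using P(2) linear_0[OF bounded_linear.linear[OF bounded_linear_pop]] by (simp add: pop_mult)
  qed
  then have "pop L p = (\<lambda>w. 0)"
    by (intro linear_eq_stdbasis bounded_linear.linear[OF bounded_linear_pop] linear_zero) simp
  then have "\<forall>w. pop L p w = 0" by (simp add: fun_eq_iff)
  ultimately show ?thesis by blast
qed

definition root_poly :: "complex list \<Rightarrow> complex poly" where
  "root_poly cs = prod_list (map (\<lambda>c. [:- c, 1:]) cs)"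

lemma pop_root_poly_Cons:
  "pop L (root_poly (c # cs)) w = pop L (root_poly cs) (cext L w - cscale c w)"
proof -
  have "root_poly (c # cs) = root_poly cs * [:- c, 1:]" by (simp add: root_poly_def mult.commute)
  then have "pop L (root_poly (c # cs)) w = pop L (root_poly cs) (pop L [:- c, 1:] w)"
    by (simp only: pop_mult)
  then show ?thesis by (simp add: cscale_minus_left)
qed

text \<open>A linear factor X - c with c not an eigenvalue acts injectively and can be cancelled.
  What remains of an annihilating polynomial has only eigenvalues as roots, hence no root on the
  imaginary axis in the hyperbolic case.\<close>

lemma eigenvalue_factors:
  "p \<noteq> 0 \<Longrightarrow> \<exists>cs. (\<forall>c\<in>set cs. complex_eigenvalue (blinfun_apply L) c) \<and>
     (\<forall>w. pop L p w = 0 \<longrightarrow> pop L (root_poly cs) w = 0)"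
proof (induction "degree p" arbitrary: p)
  case 0
  then obtain a where a: "p = [:a:]" "a \<noteq> 0" by (metis degree_eq_zeroE pCons_0_0)
  have "w = 0" if "pop L p w = 0" for w
  proof -
    have "cscale (inverse a) (cscale a w) = 0" using that a by simp
    then show ?thesis using a by simp
  qed
  then show ?case by (intro exI[of _ "[]"]) (simp add: root_poly_def)
next
  case (Suc n)
  then have "\<not> constant (poly p)" by (simp add: constant_degree)
  then obtain c where "poly p c = 0" using fundamental_theorem_of_algebra by blast
  then obtain q where q: "p = [:- c, 1:] * q" by (metis dvdE poly_eq_0_iff_dvd)
  have "q \<noteq> 0" using Suc.prems q by force
  moreover have "degree p = 1 + degree q" using \<open>q \<noteq> 0\<close> unfolding q by (subst degree_mult_eq) auto
  ultimately obtain cs where cs: "\<forall>c\<in>set cs. complex_eigenvalue (blinfun_apply L) c"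
    "\<forall>w. pop L q w = 0 \<longrightarrow> pop L (root_poly cs) w = 0"
    using Suc.hyps(1)[of q] Suc.hyps(2) by auto
  show ?case
  proof (cases "complex_eigenvalue (blinfun_apply L) c")
    case True
    have "pop L (root_poly (c # cs)) w = 0" if "pop L p w = 0" for w
    proof -
      have "pop L q (cext L w - cscale c w) = 0"
        using that unfolding q by (simp only: mult.commute[of _ q] pop_mult) (simp add: cscale_minus_left)
      then show ?thesis using cs(2)[rule_format] unfolding pop_root_poly_Cons by blast
    qed
    then show ?thesis using cs(1) True by (intro exI[of _ "c # cs"]) simp
  next
    case False
    have "pop L q w = 0" if "pop L p w = 0" for w
    proof (rule ccontr)
      assume nz: "pop L q w \<noteq> 0"
      define z where "z = pop L q w"
      have "cext L z = cscale c z"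
        using that unfolding q pop_mult z_def[symmetric] by (simp add: cscale_minus_left algebra_simps)
      then have "complex_eigenvalue (blinfun_apply L) c"
        using nz unfolding complex_eigenvalue_def z_def[symmetric]
        by (intro exI[of _ "fst z"] exI[of _ "snd z"]) (simp add: cext_def cscale_def prod_eq_iff)
      with False show False by simp
    qed
    then show ?thesis using cs by (intro exI[of _ cs]) simp
  qed
qed

lemma has_vector_derivative_exp_complex:
  "((\<lambda>t. exp (c * complex_of_real t)) has_vector_derivative c * exp (c * complex_of_real t)) (at t)"
proof -
  have "((\<lambda>z. exp (c * z)) has_field_derivative c * exp (c * complex_of_real t)) (at (complex_of_real t))"
    by (auto intro!: derivative_eq_intros)
  from has_vector_derivative_real_field[OF this] show ?thesis by simp
qed

text \<open>Variation of constants from minus infinity: z (t) is exp (c t) times the integral of exp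
  (- c s) k (s) over s \<le> t. The improper integral is obtained as \<open>J t - j\<close>, where j
  is the limit of \<open>J\<close> along the negative integers.\<close>

lemma scalar_equation_stable:
  fixes k :: "real \<Rightarrow> 'a::euclidean_space \<times> 'a"
  assumes c: "Re c < 0" and k: "continuous_on UNIV k" and H: "\<And>t. norm (k t) \<le> H"
  shows "\<exists>z. (\<forall>t. (z has_vector_derivative cscale c (z t) + k t) (at t)) \<and> (\<forall>t. norm (z t) \<le> H / - Re c)"
proof -
  define a where "a = Re c"
  have a: "a < 0" using c by (simp add: a_def)
  have H0: "H \<ge> 0" using order_trans[OF norm_ge_zero H] .
  define f where "f s = cscale (exp (- c * complex_of_real s)) (k s)" for s
  have cf: "continuous_on UNIV f"
    unfolding f_def[abs_def]
    by (intro bounded_bilinear.continuous_on[OF bounded_bilinear_cscale] k continuous_intros)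
  obtain J where J0: "J 0 = 0" and J: "\<And>t. (J has_vector_derivative f t) (at t)"
    using antiderivative_exists[OF cf] by blast
  define \<phi> where "\<phi> t = H / - a * exp (- a * t)" for t
  have d\<phi>: "(\<phi> has_vector_derivative H * exp (- a * t)) (at t)" for t
    unfolding has_real_derivative_iff_has_vector_derivative[symmetric] \<phi>_def[abs_def]
    using a by (auto intro!: derivative_eq_intros simp: field_simps)
  have fb: "norm (f s) \<le> H * exp (- a * s)" for s
  proof -
    have "norm (f s) = exp (- a * s) * norm (k s)"
      by (simp add: f_def norm_cscale a_def)
    also have "\<dots> \<le> exp (- a * s) * H" by (intro mult_left_mono H) simp
    finally show ?thesis by (simp add: mult.commute)
  qed
  have \<phi>0: "\<phi> t \<ge> 0" for t using a H0 by (simp add: \<phi>_def divide_nonneg_neg)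
  have Jd: "norm (J t - J s) \<le> \<phi> t" if "s \<le> t" for s t
    using vector_derivative_le[OF that J d\<phi> fb] \<phi>0[of s] by linarith
  have \<phi>lim: "(\<lambda>n. \<phi> (- real n)) \<longlonglongrightarrow> 0"
  proof -
    have "(\<lambda>n. H / - a * exp a ^ n) \<longlonglongrightarrow> H / - a * 0"
      using a by (intro tendsto_mult_left LIMSEQ_power_zero) simp
    then show ?thesis by (simp add: \<phi>_def exp_of_nat_mult[symmetric] mult.commute)
  qed
  have mono\<phi>: "\<phi> s \<le> \<phi> t" if "s \<le> t" for s t
    unfolding \<phi>_def using a H0 that by (intro mult_left_mono) (simp_all add: divide_nonneg_neg)
  have "Cauchy (\<lambda>n. J (- real n))"
  proof (rule CauchyI)
    fix e :: real assume "e > 0"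
    with \<phi>lim have "\<forall>\<^sub>F n in sequentially. \<phi> (- real n) < e" by (rule order_tendstoD)
    then obtain N where N: "\<phi> (- real N) < e" unfolding eventually_sequentially by blast
    have "norm (J (- real m) - J (- real n)) < e" if "m \<ge> N" "n \<ge> N" for m n
    proof -
      have "norm (J (- real m) - J (- real n)) \<le> max (\<phi> (- real m)) (\<phi> (- real n))"
        using Jd[of "- real m" "- real n"] Jd[of "- real n" "- real m"] norm_minus_commute[of "J (- real m)"]
        by (cases "m \<le> n") auto
      also have "\<dots> \<le> \<phi> (- real N)" using that by (auto intro!: mono\<phi>)
      finally show ?thesis using N by simp
    qed
    then show "\<exists>M. \<forall>m\<ge>M. \<forall>n\<ge>M. norm (J (- real m) - J (- real n)) < e" by blast
  qed
  then obtain j where j: "(\<lambda>n. J (- real n)) \<longlonglongrightarrow> j"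
    using Cauchy_convergent_iff convergent_def by blast
  have Jj: "norm (J t - j) \<le> \<phi> t" for t
  proof (rule tendsto_upperbound)
    show "(\<lambda>n. norm (J t - J (- real n))) \<longlonglongrightarrow> norm (J t - j)" by (intro tendsto_intros j)
    obtain N where "- t \<le> real N" using real_arch_simple by blast
    then show "\<forall>\<^sub>F n in sequentially. norm (J t - J (- real n)) \<le> \<phi> t"
      unfolding eventually_sequentially by (intro exI[of _ N]) (auto intro!: Jd)
  qed simp
  define z where "z t = cscale (exp (c * complex_of_real t)) (J t - j)" for t
  have "(z has_vector_derivative cscale c (z t) + k t) (at t)" for t
  proof -
    have "((\<lambda>t. J t - j) has_vector_derivative f t) (at t)"
      using has_vector_derivative_diff[OF J has_vector_derivative_const] by simp
    from bounded_bilinear.has_vector_derivative[OF bounded_bilinear_cscale has_vector_derivative_exp_complex this]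
    have "(z has_vector_derivative cscale (exp (c * of_real t)) (f t) + cscale (c * exp (c * of_real t)) (J t - j)) (at t)"
      unfolding z_def[abs_def] .
    moreover have "cscale (exp (c * of_real t)) (f t) = k t"
      by (simp add: f_def exp_minus_inverse flip: exp_minus)
    ultimately show ?thesis by (simp add: z_def add.commute)
  qed
  moreover have "norm (z t) \<le> H / - Re c" for t
  proof -
    have "norm (z t) = exp (a * t) * norm (J t - j)" by (simp add: z_def norm_cscale a_def)
    also have "\<dots> \<le> exp (a * t) * \<phi> t" by (intro mult_left_mono Jj) simp
    also have "\<dots> = H / - a" by (simp add: \<phi>_def exp_minus)
    finally show ?thesis by (simp add: a_def)
  qed
  ultimately show ?thesis by blast
qed

lemma scalar_equation_hyperbolic:
  fixes k :: "real \<Rightarrow> 'a::euclidean_space \<times> 'a"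
  assumes c: "Re c \<noteq> 0" and k: "continuous_on UNIV k" and H: "\<And>t. norm (k t) \<le> H"
  shows "\<exists>z. (\<forall>t. (z has_vector_derivative cscale c (z t) + k t) (at t)) \<and> (\<forall>t. norm (z t) \<le> H / \<bar>Re c\<bar>)"
proof (cases "Re c < 0")
  case True
  then show ?thesis using scalar_equation_stable[OF True k H] by simp
next
  case False
  then have c': "Re (- c) < 0" using c by simp
  have k': "continuous_on UNIV (\<lambda>t. - k (- t))"
    by (intro continuous_on_minus continuous_on_compose2[OF k] continuous_on_id) auto
  obtain y where y: "\<And>t. (y has_vector_derivative cscale (- c) (y t) + - k (- t)) (at t)"
    "\<And>t. norm (y t) \<le> H / - Re (- c)"
    using scalar_equation_stable[OF c' k', of H] H by auto
  have "((\<lambda>t. y (- t)) has_vector_derivative cscale c (y (- t)) + k t) (at t)" for t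
    using has_vector_derivative_reflect[OF y(1)[of "- t"]] by (simp add: cscale_minus_left add.commute)
  moreover have "norm (y (- t)) \<le> H / \<bar>Re c\<bar>" for t using y(2)[of "- t"] c' by simp
  ultimately show ?thesis by (intro exI[of _ "\<lambda>t. y (- t)"]) simp
qed

lemma scalar_equation_unique:
  fixes z :: "real \<Rightarrow> 'a::euclidean_space \<times> 'a"
  assumes c: "Re c \<noteq> 0" and z: "\<And>t. (z has_vector_derivative cscale c (z t)) (at t)"
    and B: "\<And>t. norm (z t) \<le> B"
  shows "z t = 0"
proof -
  have "((\<lambda>t. cscale (exp (- c * complex_of_real t)) (z t)) has_vector_derivative 0) (at t)" for t
    using bounded_bilinear.has_vector_derivative[OF bounded_bilinear_cscale
        has_vector_derivative_exp_complex[of "- c" t] z[of t]]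
    by (simp add: cscale_minus_left mult.commute)
  then obtain y where y: "\<And>t. cscale (exp (- c * complex_of_real t)) (z t) = y"
    using has_vector_derivative_zero_constant[of UNIV "\<lambda>t. cscale (exp (- c * complex_of_real t)) (z t)"]
    by auto
  have z_eq: "z t = cscale (exp (c * complex_of_real t)) y" for t
  proof -
    have "exp (c * complex_of_real t) * exp (- (c * complex_of_real t)) = 1"
      by (simp add: exp_minus)
    then show ?thesis using y[of t] by (simp flip: y[of t])
  qed
  have "y = 0"
  proof (rule ccontr)
    assume "y \<noteq> 0"
    then have n: "norm y > 0" by simp
    \<comment> \<open>Then Re c * t = B / norm y whatever the sign of Re c, and exp u \<ge> 1 + u
      lifts the norm of \<open>z t\<close> above \<open>B\<close>.\<close>
    define t where "t = B / norm y / Re c"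
    have "norm (z t) = exp (B / norm y) * norm y"
      unfolding z_eq[of t] norm_cscale using c by (simp add: t_def)
    also have "\<dots> \<ge> (1 + B / norm y) * norm y" using n by (intro mult_right_mono exp_ge_add_one_self) simp
    also have "(1 + B / norm y) * norm y = norm y + B" using n by (simp add: field_simps)
    finally show False using B[of t] n by linarith
  qed
  then show ?thesis by (simp add: z_eq)
qed

text \<open>With \<open>z\<^sub>0 = k\<close>, \<open>z\<^sub>j = (D - c\<^sub>j)\<^sup>-\<^sup>1 z\<^sub>j\<^sub>-\<^sub>1\<close> and \<open>p\<^sub>j = (L - c\<^sub>1) \<cdots> (L - c\<^sub>j)\<close>, the sum \<open>x = \<Sum>\<^sub>j p\<^sub>j\<^sub>-\<^sub>1 z\<^sub>j\<close>
  telescopes to \<open>(D - L) x = k - p\<^sub>n z\<^sub>n\<close>. The list is built up from the other end.\<close>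

lemma root_poly_resolvent:
  assumes "\<forall>c\<in>set cs. Re c \<noteq> 0"
  shows "\<exists>K\<ge>0. \<forall>k H. continuous_on UNIV k \<and> (\<forall>t. norm (k t) \<le> H) \<longrightarrow>
    (\<exists>x y. (\<forall>t. (x has_vector_derivative cext L (x t) + k t - pop L (root_poly cs) (y t)) (at t)) \<and>
       continuous_on UNIV y \<and> (\<forall>t. norm (x t) \<le> K * H) \<and> (\<forall>t. norm (y t) \<le> K * H))"
  using assms
proof (induction cs)
  case Nil
  have "\<exists>x y. (\<forall>t. (x has_vector_derivative cext L (x t) + k t - pop L (root_poly []) (y t)) (at t)) \<and>
       continuous_on UNIV y \<and> (\<forall>t. norm (x t) \<le> 1 * H) \<and> (\<forall>t. norm (y t) \<le> 1 * H)"
    if "continuous_on UNIV k" "\<forall>t. norm (k t) \<le> H" for k H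
    using that order_trans[OF norm_ge_zero that(2)[rule_format, of 0]]
    by (intro exI[of _ "\<lambda>_. 0"] exI[of _ k]) (simp add: root_poly_def)
  then show ?case by (intro exI[of _ 1]) simp
next
  case (Cons c cs)
  then obtain K where K: "K \<ge> 0" and IH: "\<And>k H. continuous_on UNIV k \<Longrightarrow> (\<And>t. norm (k t) \<le> H) \<Longrightarrow>
    (\<exists>x y. (\<forall>t. (x has_vector_derivative cext L (x t) + k t - pop L (root_poly cs) (y t)) (at t)) \<and>
       continuous_on UNIV y \<and> (\<forall>t. norm (x t) \<le> K * H) \<and> (\<forall>t. norm (y t) \<le> K * H))"
    by auto
  have c: "Re c \<noteq> 0" using Cons.prems by simp
  obtain N where N: "N > 0" "\<And>w. norm (pop L (root_poly cs) w) \<le> norm w * N"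
    using bounded_linear.pos_bounded[OF bounded_linear_pop] by blast
  note lin = bounded_linear.linear[OF bounded_linear_pop]
  define K' where "K' = K + K / \<bar>Re c\<bar> + K / \<bar>Re c\<bar> * N"
  have K': "K / \<bar>Re c\<bar> \<le> K'" "K + K / \<bar>Re c\<bar> * N \<le> K'" "K' \<ge> 0" using K N(1) by (simp_all add: K'_def)
  have "\<exists>x y. (\<forall>t. (x has_vector_derivative cext L (x t) + k t - pop L (root_poly (c # cs)) (y t)) (at t)) \<and>
       continuous_on UNIV y \<and> (\<forall>t. norm (x t) \<le> K' * H) \<and> (\<forall>t. norm (y t) \<le> K' * H)"
    if k: "continuous_on UNIV k" and H: "\<forall>t. norm (k t) \<le> H" for k H
  proof -
    have H0: "H \<ge> 0" using order_trans[OF norm_ge_zero H[rule_format]] .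
    obtain x y where x: "\<And>t. (x has_vector_derivative cext L (x t) + k t - pop L (root_poly cs) (y t)) (at t)"
      and y: "continuous_on UNIV y" and xb: "\<And>t. norm (x t) \<le> K * H" and yb: "\<And>t. norm (y t) \<le> K * H"
      using IH[OF k] H by blast
    obtain z where z: "\<And>t. (z has_vector_derivative cscale c (z t) + y t) (at t)"
      and zb: "\<And>t. norm (z t) \<le> K * H / \<bar>Re c\<bar>"
      using scalar_equation_hyperbolic[OF c y yb] by blast
    have zc: "continuous_on UNIV z"
      using z by (intro continuous_at_imp_continuous_on ballI) (rule has_vector_derivative_continuous)
    \<comment> \<open>With p the polynomial of the shorter list, (D - L) p (L) z = p (L) y - p (L)
      (L - c) z. The first term cancels the old remainder, and the second is the new remainder with
      one more factor.\<close>
    define x' where "x' t = x t + pop L (root_poly cs) (z t)" for t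
    have "(x' has_vector_derivative cext L (x' t) + k t - pop L (root_poly (c # cs)) (z t)) (at t)" for t
    proof -
      have "(x' has_vector_derivative (cext L (x t) + k t - pop L (root_poly cs) (y t)) +
          pop L (root_poly cs) (cscale c (z t) + y t)) (at t)"
        unfolding x'_def[abs_def]
        by (intro has_vector_derivative_add x bounded_linear.has_vector_derivative[OF bounded_linear_pop] z)
      then show ?thesis
        by (rule has_vector_derivative_eq_rhs)
          (simp add: x'_def pop_root_poly_Cons linear_add[OF lin] linear_diff[OF lin] cext_add pop_cext)
    qed
    moreover have "norm (x' t) \<le> K' * H" for t
    proof -
      have "norm (x' t) \<le> norm (x t) + norm (pop L (root_poly cs) (z t))"
        unfolding x'_def by (rule norm_triangle_ineq)
      also have "\<dots> \<le> K * H + (K * H / \<bar>Re c\<bar>) * N"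
        using xb[of t] N(2)[of "z t"] mult_right_mono[OF zb[of t], of N] N(1) by linarith
      also have "\<dots> = (K + K / \<bar>Re c\<bar> * N) * H" by (simp add: algebra_simps)
      also have "\<dots> \<le> K' * H" by (intro mult_right_mono K' H0)
      finally show ?thesis .
    qed
    moreover have "norm (z t) \<le> K' * H" for t
    proof -
      have "norm (z t) \<le> K / \<bar>Re c\<bar> * H" using zb[of t] by simp
      also have "\<dots> \<le> K' * H" by (intro mult_right_mono K' H0)
      finally show ?thesis .
    qed
    ultimately show ?thesis using zc by (intro exI[of _ x'] exI[of _ z]) simp
  qed
  then show ?case using K'(3) by (intro exI[of _ K']) simp
qed

text \<open>The factors are stripped one at a time: applying the remaining factors to w gives a y
  with L y = c y, which is a bounded solution of y' = c y and vanishes because Re c is not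
  zero.\<close>

lemma root_poly_bounded_unique:
  assumes "\<forall>c\<in>set cs. Re c \<noteq> 0" "\<And>t. pop L (root_poly cs) (w t) = 0"
    and w: "\<And>t. (w has_vector_derivative cext L (w t)) (at t)" "\<And>t. norm (w t) \<le> B"
  shows "w t = 0"
  using assms(1,2)
proof (induction cs arbitrary: t)
  case Nil
  then show ?case by (simp add: root_poly_def)
next
  case (Cons c cs)
  define y where "y t = pop L (root_poly cs) (w t)" for t
  obtain N where N: "N > 0" "\<And>w. norm (pop L (root_poly cs) w) \<le> norm w * N"
    using bounded_linear.pos_bounded[OF bounded_linear_pop] by blast
  note lin = bounded_linear.linear[OF bounded_linear_pop]
  have "cext L (y t) = cscale c (y t)" for t
  proof -
    have "pop L (root_poly (c # cs)) (w t) = cext L (y t) - cscale c (y t)"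
    proof -
      have "root_poly (c # cs) = [:- c, 1:] * root_poly cs" by (simp add: root_poly_def)
      then show ?thesis by (simp only: pop_mult y_def) (simp add: cscale_minus_left)
    qed
    then show ?thesis using Cons.prems(2)[of t] by simp
  qed
  moreover have "(y has_vector_derivative cext L (y t)) (at t)" for t
    unfolding y_def[abs_def]
    using bounded_linear.has_vector_derivative[OF bounded_linear_pop[of L "root_poly cs"] w(1)[of t]]
    by (simp add: pop_cext)
  ultimately have "(y has_vector_derivative cscale c (y t)) (at t)" for t by simp
  moreover have "norm (y t) \<le> B * N" for t
    using N(2)[of "w t"] mult_right_mono[OF w(2)[of t], of N] N(1) unfolding y_def by linarith
  ultimately have "y t = 0" for t
    using Cons.prems(1) by (intro scalar_equation_unique[of c y "B * N"]) simp_all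
  then show ?case using Cons.prems(1) by (intro Cons.IH) (simp_all add: y_def)
qed

text \<open>The real right-hand side h is fed in as (h, 0), and the first component of the solution
  is kept. As the polynomial annihilates L, the remainder of the telescoping sum disappears.\<close>

theorem hyperbolic_bounded_inverse:
  fixes L :: "'a::euclidean_space \<Rightarrow>\<^sub>L 'a"
  assumes "\<And>c. complex_eigenvalue (blinfun_apply L) c \<Longrightarrow> Re c \<noteq> 0"
  shows "\<exists>K. bounded_inverse (\<lambda>_. L) K"
proof -
  obtain p where p: "p \<noteq> 0" "\<And>w. pop L p w = 0" using pop_annihilator_exists by blast
  then obtain cs where cs: "\<And>c. c \<in> set cs \<Longrightarrow> complex_eigenvalue (blinfun_apply L) c"
    and ann: "\<And>w. pop L (root_poly cs) w = 0"
    using eigenvalue_factors[OF p(1), of L] by blast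
  have cs': "\<forall>c\<in>set cs. Re c \<noteq> 0" using cs assms by blast
  obtain K where K: "K \<ge> 0" and sol: "\<And>k H. continuous_on UNIV k \<Longrightarrow> (\<And>t. norm (k t) \<le> H) \<Longrightarrow>
    (\<exists>x y. (\<forall>t. (x has_vector_derivative cext L (x t) + k t - pop L (root_poly cs) (y t)) (at t)) \<and>
       continuous_on UNIV y \<and> (\<forall>t. norm (x t) \<le> K * H) \<and> (\<forall>t. norm (y t) \<le> K * H))"
    using root_poly_resolvent[OF cs', of L] by blast
  have "\<exists>x. norm x \<le> (K + 1) * norm h \<and> solves (\<lambda>_. L) (apply_bcontfun h) (apply_bcontfun x)"
    for h :: "real \<Rightarrow>\<^sub>C 'a"
  proof -
    have "continuous_on UNIV (\<lambda>t. (apply_bcontfun h t, 0 :: 'a))"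
      by (intro continuous_on_Pair continuous_on_apply_bcontfun continuous_on_const)
    moreover have "norm (apply_bcontfun h t, 0 :: 'a) \<le> norm h" for t
      using norm_bounded[of h t] by (simp add: norm_Pair)
    ultimately obtain x y where "\<And>t. (x has_vector_derivative cext L (x t) + (apply_bcontfun h t, 0)
        - pop L (root_poly cs) (y t)) (at t)" and xb: "\<And>t. norm (x t) \<le> K * norm h"
      using sol[of "\<lambda>t. (apply_bcontfun h t, 0)" "norm h"] by blast
    then have x: "(x has_vector_derivative cext L (x t) + (apply_bcontfun h t, 0)) (at t)" for t
      by (simp add: ann)
    have s: "solves (\<lambda>_. L) (apply_bcontfun h) (\<lambda>t. fst (x t))"
      unfolding solves_def using bounded_linear.has_vector_derivative[OF bounded_linear_fst x]
      by (simp add: cext_def)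
    have b: "norm (fst (x t)) \<le> (K + 1) * norm h" for t
    proof -
      have "norm (fst (x t)) \<le> norm (x t)" using norm_fst_le[of "fst (x t)" "snd (x t)"] by simp
      also have "\<dots> \<le> K * norm h + norm h" using xb[of t] by (rule add_increasing2[OF norm_ge_zero])
      finally show ?thesis by (simp add: distrib_right)
    qed
    define x' where "x' = Bcontfun (\<lambda>t. fst (x t))"
    have x': "apply_bcontfun x' = (\<lambda>t. fst (x t))"
      unfolding x'_def by (rule Bcontfun_inverse[OF bcontfun_normI[OF solves_continuous[OF s] b]])
    have "norm x' \<le> (K + 1) * norm h" by (rule norm_bound) (simp add: x' b)
    then show ?thesis using s x' by (intro exI[of _ x']) simp
  qed
  moreover have "x = 0" if x: "solves (\<lambda>_. L) (\<lambda>_. 0) (apply_bcontfun x)" for x :: "real \<Rightarrow>\<^sub>C 'a"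
  proof (rule bcontfun_eqI)
    fix t
    have "((\<lambda>t. (x t, 0 :: 'a)) has_vector_derivative cext L (x t, 0)) (at t)" for t
    proof -
      have "((\<lambda>t. (x t, 0 :: 'a)) has_vector_derivative (L (x t), 0)) (at t)"
        using x unfolding solves_def by (intro has_vector_derivative_Pair) simp_all
      then show ?thesis by (simp add: cext_def)
    qed
    moreover have "norm (x t, 0 :: 'a) \<le> norm x" for t using norm_bounded[of x t] by (simp add: norm_Pair)
    ultimately have "(x t, 0 :: 'a) = 0"
      by (rule root_poly_bounded_unique[OF cs' ann])
    then show "x t = apply_bcontfun 0 t" by (simp add: zero_prod_def)
  qed
  ultimately show ?thesis
    unfolding bounded_inverse_def using K by (intro exI[of _ "K + 1"]) simp
qed

subsection \<open>Asymptotically hyperbolic coefficients\<close>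

locale bounded_coefficients =
  fixes A :: "real \<Rightarrow> 'a::euclidean_space \<Rightarrow>\<^sub>L 'a" and M :: real
  assumes cont: "continuous_on UNIV A" and bound: "\<And>t. norm (A t) \<le> M"
begin

lemma M_nonneg: "M \<ge> 0"
  using order_trans[OF norm_ge_zero bound] .

lemma apply_bound: "norm (A t v) \<le> M * norm v"
  using norm_blinfun[of "A t" v] mult_right_mono[OF bound[of t] norm_ge_zero[of v]] by linarith

text \<open>The inhomogeneous estimate is the homogeneous one for the pair \<open>(x, H)\<close> with \<open>H\<close> constant.\<close>

lemma gronwall_inhomogeneous:
  assumes ab: "a \<le> b" and c: "continuous_on {a..b} x"
    and d: "\<And>t. a < t \<Longrightarrow> t < b \<Longrightarrow> (x has_vector_derivative A t (x t) + r t) (at t)"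
    and H: "\<And>t. a < t \<Longrightarrow> t < b \<Longrightarrow> norm (r t) \<le> H" "H \<ge> 0"
  shows "norm (x b) \<le> exp ((M + 1) * (b - a)) * (norm (x a) + H)"
    "norm (x a) \<le> exp ((M + 1) * (b - a)) * (norm (x b) + H)"
proof -
  define y where "y t = (x t, H)" for t
  have cy: "continuous_on {a..b} y"
    unfolding y_def[abs_def] by (intro continuous_on_Pair c continuous_on_const)
  have dy: "(y has_vector_derivative (A t (x t) + r t, 0)) (at t)" if "a < t" "t < b" for t
    unfolding y_def[abs_def] by (intro has_vector_derivative_Pair d that has_vector_derivative_const)
  have nx: "norm (x t) \<le> norm (y t)" and nH: "H \<le> norm (y t)" for t
    using norm_fst_le[of "x t" H] norm_snd_le[of H "x t"] by (simp_all add: y_def)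
  have le: "norm (A t (x t) + r t, 0 :: real) \<le> (M + 1) * norm (y t)" if "a < t" "t < b" for t
  proof -
    have "norm (A t (x t) + r t, 0 :: real) = norm (A t (x t) + r t)" by (simp add: norm_Pair)
    also have "\<dots> \<le> norm (A t (x t)) + norm (r t)" by (rule norm_triangle_ineq)
    also have "\<dots> \<le> M * norm (y t) + norm (y t)"
      using apply_bound[of t "x t"] H(1)[OF that] nH[of t] mult_left_mono[OF nx[of t] M_nonneg] by linarith
    finally show ?thesis by (simp add: distrib_right)
  qed
  have ny: "norm (y t) \<le> norm (x t) + H" for t
    using norm_Pair_le[of "x t" H] H(2) by (simp add: y_def)
  have e: "exp ((M + 1) * (b - a)) * norm (y t) \<le> exp ((M + 1) * (b - a)) * (norm (x t) + H)" for t
    by (intro mult_left_mono ny) simp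
  show "norm (x b) \<le> exp ((M + 1) * (b - a)) * (norm (x a) + H)"
    using gronwall_homogeneous(1)[OF ab cy dy le] nx[of b] e[of a] by linarith
  show "norm (x a) \<le> exp ((M + 1) * (b - a)) * (norm (x b) + H)"
    using gronwall_homogeneous(2)[OF ab cy dy le] nx[of a] e[of b] by linarith
qed

lemma solves_growth:
  assumes x: "solves A h x" and H: "\<And>t. norm (h t) \<le> H"
  shows "norm (x t) \<le> exp ((M + 1) * \<bar>t - s\<bar>) * (norm (x s) + H)"
proof -
  have d: "(x has_vector_derivative A t (x t) + h t) (at t)" for t
    using x by (simp add: solves_def)
  have H0: "H \<ge> 0" using order_trans[OF norm_ge_zero H] .
  show ?thesis
  proof (cases "s \<le> t")
    case True
    then show ?thesis
      using gronwall_inhomogeneous(1)[OF True solves_continuous[OF x] d H H0] by simp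
  next
    case False
    then have "t \<le> s" by simp
    from gronwall_inhomogeneous(2)[OF this solves_continuous[OF x] d H H0] show ?thesis
      using False by simp
  qed
qed

lemma solves_unique:
  assumes "solves A h x" "solves A h y" "x s = y s"
  shows "x = y"
proof
  fix t
  have "solves A (\<lambda>_. 0) (\<lambda>t. x t - y t)" using solves_diff[OF assms(1,2)] by simp
  from solves_growth[OF this, of 0 t s] assms(3) show "x t = y t" by simp
qed

lemma solution_exists:
  assumes "continuous_on UNIV h"
  shows "\<exists>x. x 0 = v \<and> solves A h x"
proof -
  obtain X Y where p: "propagator A X Y" using propagator_exists[OF cont bound] by blast
  have "continuous_on UNIV (\<lambda>t. Y t (h t))"
    by (intro bounded_bilinear.continuous_on[OF bounded_bilinear_blinfun_apply] propagator_continuous[OF p] assms)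
  then obtain J where J: "J 0 = 0" "\<And>t. (J has_vector_derivative Y t (h t)) (at t)"
    using antiderivative_exists by blast
  define x where "x t = X t (v + J t)" for t
  have "(x has_vector_derivative A t (x t) + h t) (at t)" for t
  proof -
    have X: "(X has_vector_derivative (A t o\<^sub>L X t)) (at t)" using p by (simp add: propagator_def)
    have "((\<lambda>t. v + J t) has_vector_derivative Y t (h t)) (at t)"
      using has_vector_derivative_add[OF has_vector_derivative_const J(2)] by simp
    from bounded_bilinear.has_vector_derivative[OF bounded_bilinear_blinfun_apply X this]
    show ?thesis by (simp add: x_def[abs_def] propagator_cancel[OF p] add.commute)
  qed
  moreover have "x 0 = v" using p J(1) by (simp add: x_def propagator_def)
  ultimately show ?thesis unfolding solves_def by blast
qed

definition flow :: "(real \<Rightarrow>\<^sub>C 'a) \<Rightarrow> 'a \<Rightarrow> real \<Rightarrow> 'a" where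
  "flow h v = (THE x. x 0 = v \<and> solves A (apply_bcontfun h) x)"

lemma flow: "flow h v 0 = v" "solves A (apply_bcontfun h) (flow h v)"
proof -
  obtain x where x: "x 0 = v \<and> solves A (apply_bcontfun h) x"
    using solution_exists[OF continuous_on_apply_bcontfun] by blast
  have "flow h v = x"
    unfolding flow_def
  proof (rule the_equality[where P = "\<lambda>x. x 0 = v \<and> solves A (apply_bcontfun h) x", OF x])
    fix y assume "y 0 = v \<and> solves A (apply_bcontfun h) y"
    then show "y = x" using x by (intro solves_unique[of "apply_bcontfun h" y x 0]) simp_all
  qed
  then show "flow h v 0 = v" "solves A (apply_bcontfun h) (flow h v)" using x by simp_all
qed

lemma flow_eqI: "x 0 = v \<Longrightarrow> solves A (apply_bcontfun h) x \<Longrightarrow> flow h v = x"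
  by (rule solves_unique[OF flow(2), where s = 0]) (simp_all add: flow(1))

lemma flow_add: "flow (h + k) (v + w) t = flow h v t + flow k w t"
proof -
  have "flow (h + k) (v + w) = (\<lambda>t. flow h v t + flow k w t)"
    using solves_add[OF flow(2)[of h v] flow(2)[of k w]]
    by (intro flow_eqI) (simp_all add: flow(1) plus_bcontfun.rep_eq[abs_def])
  then show ?thesis by simp
qed

lemma flow_scaleR: "flow (r *\<^sub>R h) (r *\<^sub>R v) t = r *\<^sub>R flow h v t"
proof -
  have "flow (r *\<^sub>R h) (r *\<^sub>R v) = (\<lambda>t. r *\<^sub>R flow h v t)"
    using solves_scaleR[OF flow(2)[of h v], of r]
    by (intro flow_eqI) (simp_all add: flow(1) scaleR_bcontfun.rep_eq[abs_def])
  then show ?thesis by simp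
qed

lemma flow_diff: "flow (h - k) (v - w) t = flow h v t - flow k w t"
  using flow_add[of h "- 1 *\<^sub>R k" v "- 1 *\<^sub>R w" t] flow_scaleR[of "- 1" k w t] by simp

lemma bounded_linear_flow_0: "bounded_linear (\<lambda>h. flow h 0 t)"
proof (rule bounded_linear_intro)
  fix h k :: "real \<Rightarrow>\<^sub>C 'a" and r :: real
  show "flow (h + k) 0 t = flow h 0 t + flow k 0 t" using flow_add[of h k 0 0 t] by simp
  show "flow (r *\<^sub>R h) 0 t = r *\<^sub>R flow h 0 t" using flow_scaleR[of r h 0 t] by simp
  show "norm (flow h 0 t) \<le> norm h * exp ((M + 1) * \<bar>t - 0\<bar>)"
    using solves_growth[OF flow(2)[of h 0] norm_bounded[of h], of t 0] by (simp add: flow(1) mult.commute)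
qed

text \<open>Beyond some time \<open>A\<close> is \<eta>-close to L, so (A - L) x counts as part of
  the forcing and contributes at most K \<eta> S = S / 4 to the supremum S of |x|, where it is
  absorbed. Gronwall covers the compact initial interval. \<open>B\<close> makes S finite and does
  not enter the constant.\<close>

lemma half_line_estimate:
  assumes lim: "(A \<longlongrightarrow> L) at_top" and inv: "bounded_inverse (\<lambda>_. L) K"
  shows "\<exists>C>0. \<forall>x r H B. continuous_on {0..} x \<and>
     (\<forall>t>0. (x has_vector_derivative A t (x t) + r t) (at t)) \<and> continuous_on {0<..} r \<and>
     (\<forall>t>0. norm (r t) \<le> H) \<and> (\<forall>t\<ge>0. norm (x t) \<le> B) \<longrightarrow>
     (\<forall>t\<ge>0. norm (x t) \<le> C * (norm (x 0) + H))"
proof -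
  have K: "K > 0" using inv by (simp add: bounded_inverse_def)
  define \<eta> where "\<eta> = 1 / (4 * K)"
  have \<eta>: "\<eta> > 0" "K * \<eta> = 1/4" using K by (simp_all add: \<eta>_def)
  have "\<forall>\<^sub>F t in at_top. dist (A t) L < \<eta>" using lim \<eta>(1) by (rule tendstoD)
  then obtain T' where T': "\<And>t. t \<ge> T' \<Longrightarrow> dist (A t) L < \<eta>" unfolding eventually_at_top_linorder by blast
  define T where "T = max T' 0"
  have T: "T \<ge> 0" "\<And>t. t \<ge> T \<Longrightarrow> norm (A t - L) \<le> \<eta>"
    using T' by (simp_all add: T_def dist_norm less_imp_le)
  define E where "E = exp ((M + 1) * (T + 2))"
  have E1: "E \<ge> 1" using T(1) M_nonneg by (simp add: E_def)
  define C where "C = 2 * (1 + 3 * K) * E"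
  have "norm (x t) \<le> C * (norm (x 0) + H)"
    if c: "continuous_on {0..} x" and d: "\<forall>t>0. (x has_vector_derivative A t (x t) + r t) (at t)"
      and cr: "continuous_on {0<..} r" and H: "\<forall>t>0. norm (r t) \<le> H" and B: "\<forall>t\<ge>0. norm (x t) \<le> B"
      and t: "t \<ge> 0" for x r H B t
  proof -
    have H0: "H \<ge> 0" using order_trans[OF norm_ge_zero, of "r 1" H] H by simp
    define D where "D = E * (norm (x 0) + H)"
    have D0: "D \<ge> 0" using E1 H0 by (simp add: D_def)
    have HD: "H \<le> D"
    proof -
      have "H \<le> norm (x 0) + H" by simp
      also have "\<dots> \<le> E * (norm (x 0) + H)" using mult_right_mono[OF E1, of "norm (x 0) + H"] H0 by simp
      finally show ?thesis unfolding D_def .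
    qed
    have start: "norm (x s) \<le> D" if "0 \<le> s" "s \<le> T + 2" for s
    proof -
      have "norm (x s) \<le> exp ((M + 1) * (s - 0)) * (norm (x 0) + H)"
        using d H H0 by (intro gronwall_inhomogeneous(1)[OF that(1) continuous_on_subset[OF c]]) auto
      also have "\<dots> \<le> D"
        unfolding D_def E_def using that M_nonneg H0 by (intro mult_right_mono) (simp_all add: mult_left_mono)
      finally show ?thesis .
    qed
    define S where "S = (SUP s\<in>{0..}. norm (x s))"
    have bdd: "bdd_above ((\<lambda>s. norm (x s)) ` {0..})"
      using B by (intro bdd_aboveI2[where M = B]) simp
    have S: "norm (x s) \<le> S" if "s \<ge> 0" for s
      unfolding S_def using that bdd by (intro cSUP_upper) simp_all
    have cx: "continuous_on {T<..} x" by (rule continuous_on_subset[OF c]) (use T in auto)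
    have tail: "norm (x s) \<le> K * (2 / 1 * D + (\<eta> * S + H))" if "s \<ge> T + 2" for s
    proof (rule cutoff_estimate[OF inv, where T = T and S = "T + 1" and r = "\<lambda>t. (A t - L) (x t) + r t" and B = B])
      show "(x has_vector_derivative L (x u) + ((A u - L) (x u) + r u)) (at u)" if "T < u" for u
        using d[rule_format, of u] that T by (simp add: blinfun.diff_left)
      show "continuous_on {T<..} (\<lambda>t. (A t - L) (x t) + r t)"
        using T by (intro continuous_on_add bounded_bilinear.continuous_on[OF bounded_bilinear_blinfun_apply]
            continuous_on_diff continuous_on_const continuous_on_subset[OF cont] cx continuous_on_subset[OF cr]) auto
      fix u assume "T + 1 \<le> u"
      then have u: "u \<ge> T" "u > 0" using T by simp_all
      have "norm ((A u - L) (x u)) \<le> norm (A u - L) * norm (x u)" by (rule norm_blinfun)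
      also have "\<dots> \<le> \<eta> * S" using u \<eta> T S[of u] by (intro mult_mono) simp_all
      finally have "norm ((A u - L) (x u)) \<le> \<eta> * S" .
      moreover have "norm (r u) \<le> H" using H u by simp
      ultimately show "norm ((A u - L) (x u) + r u) \<le> \<eta> * S + H" by (intro norm_triangle_le) linarith
    qed (use B T start that in simp_all)
    have "norm (x s) \<le> (1 + 3 * K) * D + S / 4" if "s \<ge> 0" for s
    proof (cases "s \<le> T + 2")
      case True
      have "S \<ge> 0" using order_trans[OF norm_ge_zero S[of 0]] by simp
      moreover have "D \<le> (1 + 3 * K) * D" using K mult_right_mono[of 1 "1 + 3 * K" D] D0 by simp
      ultimately show ?thesis using start[OF that True] by linarith
    next
      case False
      have "K * (2 / 1 * D + (\<eta> * S + H)) = 2 * K * D + (K * \<eta>) * S + K * H" by (simp add: algebra_simps)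
      also have "(K * \<eta>) * S = S / 4" unfolding \<eta>(2) by simp
      also have "2 * K * D + S / 4 + K * H \<le> 2 * K * D + S / 4 + K * D" using HD K by simp
      also have "\<dots> \<le> (1 + 3 * K) * D + S / 4" using D0 by (simp add: algebra_simps)
      finally show ?thesis using tail[of s] False by simp
    qed
    then have "S \<le> (1 + 3 * K) * D + S / 4" unfolding S_def by (intro cSUP_least) simp_all
    then have "S \<le> 2 * ((1 + 3 * K) * D)" using D0 K mult_nonneg_nonneg[of "1 + 3 * K" D] by linarith
    also have "\<dots> = C * (norm (x 0) + H)" by (simp add: C_def D_def)
    finally show ?thesis using S[OF t] by simp
  qed
  moreover have "C > 0" using K E1 by (simp add: C_def)
  ultimately show ?thesis by (intro exI[of _ C]) blast
qed

text \<open>Freezing \<open>A\<close> before a late time T leaves a small perturbation of L on the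
  entire line, which has a resolvent. The value of the resolvent at T, carried back to time 0 by the
  true equation, is the initial value \<open>c h\<close>; it is linear in h because each of these
  steps is.\<close>

lemma half_line_solution:
  assumes lim: "(A \<longlongrightarrow> L) at_top" and inv: "bounded_inverse (\<lambda>_. L) K"
  shows "\<exists>c. bounded_linear c \<and> (\<forall>h. bounded (flow h (c h) ` {0..}))"
proof -
  have K: "K > 0" using inv by (simp add: bounded_inverse_def)
  define \<eta> where "\<eta> = 1 / (4 * K)"
  have \<eta>: "\<eta> > 0" "K * \<eta> \<le> 1/2" using K by (simp_all add: \<eta>_def)
  have "\<forall>\<^sub>F t in at_top. dist (A t) L < \<eta>" using lim \<eta>(1) by (rule tendstoD)
  then obtain T' where T': "\<And>t. t \<ge> T' \<Longrightarrow> dist (A t) L < \<eta>" unfolding eventually_at_top_linorder by blast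
  define T where "T = max T' 0"
  have T: "T \<ge> 0" "\<And>t. t \<ge> T \<Longrightarrow> norm (A t - L) \<le> \<eta>"
    using T' by (simp_all add: T_def dist_norm less_imp_le)
  define At where "At t = L + (A (max t T) - L)" for t
  have "continuous_on UNIV (\<lambda>t. A (max t T) - L)"
    by (intro continuous_on_diff continuous_on_compose2[OF cont] continuous_on_const continuous_on_max continuous_on_id) simp
  then have invt: "bounded_inverse At (2 * K)"
    unfolding At_def[abs_def] by (rule bounded_inverse_perturb[OF inv _ _ \<eta>(2)]) (simp_all add: T(2))
  obtain X Y where p: "propagator A X Y" using propagator_exists[OF cont bound] by blast
  define c where "c h = Y T (resolvent At h T - flow h 0 T)" for h
  have lin: "bounded_linear c"
  proof -
    have "bounded_linear (\<lambda>f :: real \<Rightarrow>\<^sub>C 'a. apply_bcontfun f T)"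
      by (rule bounded_linear_intro[where K = 1]) (simp_all add: norm_bounded)
    then have "bounded_linear (\<lambda>h. apply_bcontfun (resolvent At h) T)"
      by (rule bounded_linear_compose[OF _ bounded_linear_resolvent[OF invt]])
    from bounded_linear_compose[OF blinfun.bounded_linear_right[of "Y T"] bounded_linear_sub[OF this bounded_linear_flow_0]]
    show ?thesis unfolding c_def[abs_def] .
  qed
  have "bounded (flow h (c h) ` {0..})" for h
  proof -
    let ?x = "flow h (c h)"
    have hom: "flow 0 v t = X t v" for v t
    proof -
      have "solves A (apply_bcontfun 0) (\<lambda>t. X t v)"
        using propagator_apply_derivative[OF p] by (simp add: solves_def)
      moreover have "X 0 v = v" using p by (simp add: propagator_def)
      ultimately have "flow 0 v = (\<lambda>t. X t v)" by (intro flow_eqI) simp_all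
      then show ?thesis by simp
    qed
    have xT: "?x T = resolvent At h T"
      using flow_add[of h 0 0 "c h" T] by (simp add: hom c_def propagator_cancel[OF p])
    define z where "z t = ?x t - resolvent At h t" for t
    have dz: "(z has_vector_derivative A t (z t)) (at t)" if "t > T" for t
    proof -
      have "At t = A t" using that by (simp add: At_def max_def)
      then have "(apply_bcontfun (resolvent At h) has_vector_derivative A t (resolvent At h t) + h t) (at t)"
        using solves_resolvent[OF invt, of h] unfolding solves_def by (metis (no_types))
      moreover have "(?x has_vector_derivative A t (?x t) + h t) (at t)"
        using flow(2)[of h "c h"] by (simp add: solves_def)
      ultimately have "(z has_vector_derivative (A t (?x t) + h t) - (A t (resolvent At h t) + h t)) (at t)"
        unfolding z_def[abs_def] by (intro has_vector_derivative_diff)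
      then show ?thesis
        by (rule has_vector_derivative_eq_rhs) (simp add: z_def blinfun.diff_right)
    qed
    have cz: "continuous_on I z" for I
      unfolding z_def[abs_def]
      by (intro continuous_on_diff solves_continuous[OF flow(2)] continuous_on_apply_bcontfun)
    have z0: "z t = 0" if "t \<ge> T" for t
    proof -
      have "norm (z t) \<le> exp (M * (t - T)) * norm (z T)"
        by (rule gronwall_homogeneous(1)[OF that cz dz apply_bound]) simp_all
      then show ?thesis using xT by (simp add: z_def)
    qed
    have "{0..} = {0..T} \<union> {T..}" using T(1) by auto
    then have "?x ` {0..} = ?x ` {0..T} \<union> ?x ` {T..}" by (simp only: image_Un)
    moreover have "bounded (?x ` {0..T})"
      by (intro compact_imp_bounded compact_continuous_image solves_continuous[OF flow(2)] compact_Icc)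
    moreover have "?x ` {T..} \<subseteq> range (apply_bcontfun (resolvent At h))"
    proof
      fix y assume "y \<in> ?x ` {T..}"
      then obtain t where t: "t \<ge> T" "y = ?x t" by (auto simp only: image_iff atLeast_iff)
      have "y = resolvent At h t" using z0[OF t(1)] by (simp add: z_def t(2))
      then show "y \<in> range (apply_bcontfun (resolvent At h))" by simp
    qed
    then have "bounded (?x ` {T..})" by (rule bounded_subset[OF bounded_apply_bcontfun])
    ultimately show ?thesis by (simp only: bounded_Un)
  qed
  with lin show ?thesis by (intro exI[of _ c] conjI allI)
qed

end

section \<open>Solutions bounded in the future or in the past\<close>

definition stable_space :: "(real \<Rightarrow> 'a::euclidean_space \<Rightarrow>\<^sub>L 'a) \<Rightarrow> 'a set" where
  "stable_space A = {v. \<exists>x. solves A (\<lambda>_. 0) x \<and> x 0 = v \<and> bounded (x ` {0..})}"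

definition unstable_space :: "(real \<Rightarrow> 'a::euclidean_space \<Rightarrow>\<^sub>L 'a) \<Rightarrow> 'a set" where
  "unstable_space A = {v. \<exists>x. solves A (\<lambda>_. 0) x \<and> x 0 = v \<and> bounded (x ` {..0})}"

lemma solves_reflect:
  assumes "solves A h x"
  shows "solves (\<lambda>t. - A (- t)) (\<lambda>t. - h (- t)) (\<lambda>t. x (- t))"
  unfolding solves_def
proof
  fix t
  have "(x has_vector_derivative A (- t) (x (- t)) + h (- t)) (at (- t))"
    using assms by (simp add: solves_def)
  from has_vector_derivative_reflect[OF this]
  show "((\<lambda>t. x (- t)) has_vector_derivative (- A (- t)) (x (- t)) + - h (- t)) (at t)"
    by (simp add: blinfun.minus_left)
qed

lemma image_reflect_nonneg: "(\<lambda>t. x (- t)) ` {0..} = x ` {..(0::real)}"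
proof -
  have "uminus ` {0..} = {..0::real}" by simp
  then have "x ` {..0} = x ` (uminus ` {0..})" by (simp only:)
  then show ?thesis by (simp only: image_image)
qed

lemma unstable_space_reflect: "unstable_space A = stable_space (\<lambda>t. - A (- t))"
proof (intro set_eqI iffI)
  fix v assume "v \<in> unstable_space A"
  then obtain x where x: "solves A (\<lambda>_. 0) x" "x 0 = v" "bounded (x ` {..0})"
    unfolding unstable_space_def by blast
  show "v \<in> stable_space (\<lambda>t. - A (- t))"
    unfolding stable_space_def using solves_reflect[OF x(1)] x(2,3)
    by (intro CollectI exI[of _ "\<lambda>t. x (- t)"]) (simp add: image_reflect_nonneg)
next
  fix v assume "v \<in> stable_space (\<lambda>t. - A (- t))"
  then obtain x where x: "solves (\<lambda>t. - A (- t)) (\<lambda>_. 0) x" "x 0 = v" "bounded (x ` {0..})"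
    unfolding stable_space_def by blast
  have "(\<lambda>t. x (- t)) ` {..0} = x ` {0..}" using image_reflect_nonneg[of "\<lambda>t. x (- t)"] by simp
  then show "v \<in> unstable_space A"
    unfolding unstable_space_def using solves_reflect[OF x(1)] x(2,3)
    by (intro CollectI exI[of _ "\<lambda>t. x (- t)"]) simp
qed

lemma subspace_stable_space: "subspace (stable_space A)"
proof (rule subspaceI)
  show "0 \<in> stable_space A"
    unfolding stable_space_def
    by (intro CollectI exI[of _ "\<lambda>_. 0"]) (simp add: solves_def blinfun.zero_right image_constant_conv)
  fix v w c
  assume "v \<in> stable_space A"
  then obtain x where x: "solves A (\<lambda>_. 0) x" "x 0 = v" "bounded (x ` {0..})"
    unfolding stable_space_def by blast
  show "c *\<^sub>R v \<in> stable_space A"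
    unfolding stable_space_def using solves_scaleR[OF x(1), of c] x(2) bounded_scaleR_comp[OF x(3), of c]
    by (intro CollectI exI[of _ "\<lambda>t. c *\<^sub>R x t"]) simp
  assume "w \<in> stable_space A"
  then obtain y where y: "solves A (\<lambda>_. 0) y" "y 0 = w" "bounded (y ` {0..})"
    unfolding stable_space_def by blast
  show "v + w \<in> stable_space A"
    unfolding stable_space_def using solves_add[OF x(1) y(1)] x(2) y(2) bounded_plus_comp[OF x(3) y(3)]
    by (intro CollectI exI[of _ "\<lambda>t. x t + y t"]) simp
qed

context bounded_coefficients
begin

lemma reflect: "bounded_coefficients (\<lambda>t. - A (- t)) M"
proof
  show "continuous_on UNIV (\<lambda>t. - A (- t))"
    by (intro continuous_on_minus continuous_on_compose2[OF cont] continuous_on_id) simp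
qed (simp add: bound)

lemma half_line_solution_at_bot:
  assumes lim: "(A \<longlongrightarrow> L) at_bot" and inv: "bounded_inverse (\<lambda>_. L) K"
  shows "\<exists>c. bounded_linear c \<and> (\<forall>h. bounded (flow h (c h) ` {..0}))"
proof -
  interpret R: bounded_coefficients "\<lambda>t. - A (- t)" M by (rule reflect)
  have lim': "((\<lambda>t. - A (- t)) \<longlongrightarrow> - L) at_top"
    using lim by (intro tendsto_minus) (simp add: filterlim_at_bot_mirror)
  have inv': "bounded_inverse (\<lambda>_. - L) K" using bounded_inverse_reflect[OF inv] by simp
  obtain c where c: "bounded_linear c" "\<And>h. bounded (R.flow h (c h) ` {0..})"
    using R.half_line_solution[OF lim' inv'] by blast
  define r where "r h = Bcontfun (\<lambda>t. - h (- t))" for h :: "real \<Rightarrow>\<^sub>C 'a"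
  have r: "apply_bcontfun (r h) = (\<lambda>t. - h (- t))" for h
    unfolding r_def
    by (intro Bcontfun_inverse bcontfun_normI[where b = "norm h"] continuous_on_minus
        continuous_on_compose2[OF continuous_on_apply_bcontfun[of UNIV h]] continuous_on_id)
      (simp_all add: norm_bounded)
  have lr: "bounded_linear r"
    by (rule bounded_linear_intro[where K = 1]) (auto intro!: bcontfun_eqI norm_bound simp: r norm_bounded)
  have "bounded (flow h (c (r h)) ` {..0})" for h
  proof -
    have "flow h (c (r h)) = (\<lambda>t. R.flow (r h) (c (r h)) (- t))"
      using solves_reflect[OF R.flow(2)[of "r h" "c (r h)"]]
      by (intro flow_eqI) (simp_all add: R.flow(1) r)
    then have "(\<lambda>t. flow h (c (r h)) (- t)) = R.flow (r h) (c (r h))" by simp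
    then have "bounded ((\<lambda>t. flow h (c (r h)) (- t)) ` {0..})" using c(2)[of "r h"] by (simp only:)
    then show ?thesis by (simp only: image_reflect_nonneg)
  qed
  then show ?thesis using bounded_linear_compose[OF c(1) lr] by (intro exI[of _ "\<lambda>h. c (r h)"] conjI allI)
qed

lemma stable_space_flow: "v \<in> stable_space A \<Longrightarrow> bounded (flow 0 v ` {0..})"
  unfolding stable_space_def
proof safe
  fix x assume "solves A (\<lambda>_. 0) x" "bounded (x ` {0..})"
  moreover from this(1) have "flow 0 (x 0) = x" by (intro flow_eqI) simp_all
  ultimately show "bounded (flow 0 (x 0) ` {0..})" by simp
qed

lemma unstable_space_flow: "v \<in> unstable_space A \<Longrightarrow> bounded (flow 0 v ` {..0})"
  unfolding unstable_space_def
proof safe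
  fix x assume "solves A (\<lambda>_. 0) x" "bounded (x ` {..0})"
  moreover from this(1) have "flow 0 (x 0) = x" by (intro flow_eqI) simp_all
  ultimately show "bounded (flow 0 (x 0) ` {..0})" by simp
qed

text \<open>The two half-line estimates control a bounded solution by its value at time 0 and the
  forcing. This is what makes the solution operator of the Fredholm alternative bounded.\<close>

lemma bounded_solution_estimate:
  assumes limu: "(A \<longlongrightarrow> Lu) at_top" and invu: "bounded_inverse (\<lambda>_. Lu) Ku"
    and lima: "(A \<longlongrightarrow> La) at_bot" and inva: "bounded_inverse (\<lambda>_. La) Ka"
  shows "\<exists>C>0. \<forall>h x. solves A (apply_bcontfun h) x \<and> bounded (range x) \<longrightarrow> (\<forall>t. norm (x t) \<le> C * (norm (x 0) + norm h))"
proof -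
  interpret R: bounded_coefficients "\<lambda>t. - A (- t)" M by (rule reflect)
  have lim': "((\<lambda>t. - A (- t)) \<longlongrightarrow> - La) at_top"
    using lima by (intro tendsto_minus) (simp add: filterlim_at_bot_mirror)
  have inv': "bounded_inverse (\<lambda>_. - La) Ka" using bounded_inverse_reflect[OF inva] by simp
  obtain C1 where C1: "C1 > 0" and e1: "\<forall>x r H B. continuous_on {0..} x \<and>
     (\<forall>t>0. (x has_vector_derivative A t (x t) + r t) (at t)) \<and> continuous_on {0<..} r \<and>
     (\<forall>t>0. norm (r t) \<le> H) \<and> (\<forall>t\<ge>0. norm (x t) \<le> B) \<longrightarrow>
     (\<forall>t\<ge>0. norm (x t) \<le> C1 * (norm (x 0) + H))"
    using half_line_estimate[OF limu invu] by (elim exE conjE) (rule that)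
  obtain C2 where C2: "C2 > 0" and e2: "\<forall>x r H B. continuous_on {0..} x \<and>
     (\<forall>t>0. (x has_vector_derivative (- A (- t)) (x t) + r t) (at t)) \<and> continuous_on {0<..} r \<and>
     (\<forall>t>0. norm (r t) \<le> H) \<and> (\<forall>t\<ge>0. norm (x t) \<le> B) \<longrightarrow>
     (\<forall>t\<ge>0. norm (x t) \<le> C2 * (norm (x 0) + H))"
    using R.half_line_estimate[OF lim' inv'] by (elim exE conjE) (rule that)
  have "norm (x t) \<le> max C1 C2 * (norm (x 0) + norm h)"
    if x: "solves A (apply_bcontfun h) x" and b: "bounded (range x)" for h x t
  proof -
    obtain B where B: "\<And>t. norm (x t) \<le> B" using b by (auto simp: bounded_iff)
    have m: "C1 * (norm (x 0) + norm h) \<le> max C1 C2 * (norm (x 0) + norm h)"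
      "C2 * (norm (x 0) + norm h) \<le> max C1 C2 * (norm (x 0) + norm h)"
      by (intro mult_right_mono; simp)+
    show ?thesis
    proof (cases "t \<ge> 0")
      case True
      have "norm (x t) \<le> C1 * (norm (x 0) + norm h)"
        using x B True by (intro e1[rule_format, of x "apply_bcontfun h" "norm h" B] conjI solves_continuous[OF x])
          (simp_all add: solves_def norm_bounded)
      then show ?thesis using m(1) by linarith
    next
      case False
      have "norm (x (- t)) \<le> C2 * (norm (x (- 0)) + norm h)" if "t \<ge> 0" for t
      proof (intro e2[rule_format, of "\<lambda>t. x (- t)" "\<lambda>t. - h (- t)" "norm h" B] conjI allI impI)
        show "((\<lambda>t. x (- t)) has_vector_derivative (- A (- t)) (x (- t)) + - h (- t)) (at t)" for t
          using solves_reflect[OF x] by (simp add: solves_def)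
        show "continuous_on {0..} (\<lambda>t. x (- t))"
          by (intro continuous_on_compose2[OF solves_continuous[OF x, of UNIV]] continuous_on_minus continuous_on_id) simp
        show "continuous_on {0<..} (\<lambda>t. - h (- t))"
          by (intro continuous_on_minus continuous_on_compose2[OF continuous_on_apply_bcontfun[of UNIV h]] continuous_on_id) simp
      qed (use that in \<open>simp_all add: B norm_bounded\<close>)
      from this[of "- t"] have "norm (x (- (- t))) \<le> C2 * (norm (x (- 0)) + norm h)" using False by simp
      then show ?thesis using m(2) by simp
    qed
  qed
  then show ?thesis using C1 by (intro exI[of _ "max C1 C2"]) (simp add: less_max_iff_disj)
qed

end

text \<open>Comparison with 1 / (1 + t^2), whose antiderivative arctan has finite limits. The
  constant comes from exp u \<ge> 1 and exp u \<ge> u^2 / 2 at u = l |t|.\<close>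

lemma integrable_exp_abs:
  assumes "l > 0"
  shows "integrable lborel (\<lambda>t::real. exp (- l * \<bar>t\<bar>))"
proof (rule Bochner_Integration.integrable_bound)
  have "set_integrable lborel (einterval (-\<infinity>) \<infinity>) (\<lambda>t. inverse (1 + t\<^sup>2))"
  proof (rule interval_integral_FTC_nonneg)
    show "((arctan \<circ> real_of_ereal) \<longlongrightarrow> - (pi / 2)) (at_right (-\<infinity>))"
      "((arctan \<circ> real_of_ereal) \<longlongrightarrow> pi / 2) (at_left \<infinity>)"
      by (simp_all add: ereal_tendsto_simps tendsto_arctan_at_top tendsto_arctan_at_bot)
    show "isCont (\<lambda>t. inverse (1 + t\<^sup>2)) t" for t :: real
      by (intro continuous_intros) (simp add: sum_power2_eq_zero_iff add_nonneg_eq_0_iff)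
  qed (simp_all add: DERIV_arctan)
  then have "integrable lborel (\<lambda>t::real. inverse (1 + t\<^sup>2))" by (simp add: set_integrable_def)
  then show "integrable lborel (\<lambda>t::real. (1 + 2 / l\<^sup>2) * inverse (1 + t\<^sup>2))" by (rule integrable_mult_right)
  have "exp (- l * \<bar>t\<bar>) \<le> (1 + 2 / l\<^sup>2) * inverse (1 + t\<^sup>2)" for t :: real
  proof -
    have "1 + l * \<bar>t\<bar> + (l * \<bar>t\<bar>)\<^sup>2 / 2 \<le> exp (l * \<bar>t\<bar>)"
      using assms by (intro exp_lower_Taylor_quadratic) simp
    moreover have "0 \<le> l * \<bar>t\<bar>" using assms by simp
    ultimately have q: "(l * t)\<^sup>2 / 2 \<le> exp (l * \<bar>t\<bar>)" "1 \<le> exp (l * \<bar>t\<bar>)"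
      by (simp_all add: power_mult_distrib)
    have "t\<^sup>2 = 2 / l\<^sup>2 * ((l * t)\<^sup>2 / 2)" using assms by (simp add: power_mult_distrib)
    also have "\<dots> \<le> 2 / l\<^sup>2 * exp (l * \<bar>t\<bar>)" using q(1) by (rule mult_left_mono) simp
    finally have "1 + t\<^sup>2 \<le> (1 + 2 / l\<^sup>2) * exp (l * \<bar>t\<bar>)" using q(2) unfolding distrib_right by linarith
    then have "(1 + t\<^sup>2) * inverse (exp (l * \<bar>t\<bar>)) \<le> 1 + 2 / l\<^sup>2"
      by (simp add: field_simps)
    moreover have "1 + t\<^sup>2 > 0" by (simp add: add_pos_nonneg)
    ultimately show ?thesis by (simp add: exp_minus field_simps)
  qed
  then show "AE t in lborel. norm (exp (- l * \<bar>t\<bar>)) \<le> norm ((1 + 2 / l\<^sup>2) * inverse (1 + t\<^sup>2))"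
    by (intro always_eventually allI) (simp add: abs_mult add_nonneg_nonneg)
qed simp

lemma integral_real_line_FTC:
  fixes y f :: "real \<Rightarrow> real"
  assumes y: "\<And>t. (y has_real_derivative f t) (at t)" and f: "continuous_on UNIV f" "integrable lborel f"
    and lim: "(y \<longlongrightarrow> a) at_bot" "(y \<longlongrightarrow> b) at_top"
  shows "(\<integral>t. f t \<partial>lborel) = b - a"
proof -
  have "(LBINT t=-\<infinity>..\<infinity>. f t) = b - a"
  proof (rule interval_integral_FTC_integrable)
    show "(y has_vector_derivative f t) (at t)" for t
      using y by (simp add: has_real_derivative_iff_has_vector_derivative)
    show "isCont f t" for t using f(1) by (simp add: continuous_on_eq_continuous_at)
    show "set_integrable lborel (einterval (-\<infinity>) \<infinity>) f"
      using f(2) by (simp add: set_integrable_def)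
    show "((y \<circ> real_of_ereal) \<longlongrightarrow> a) (at_right (-\<infinity>))" "((y \<circ> real_of_ereal) \<longlongrightarrow> b) (at_left \<infinity>)"
      using lim by (simp_all add: ereal_tendsto_simps)
  qed simp
  then show ?thesis by (simp add: interval_lebesgue_integral_def set_lebesgue_integral_def)
qed

context bounded_coefficients
begin

text \<open>\<open>p\<close> is a solution of the adjoint equation. A solution bounded in the future and one bounded in the
  past exist for every \<open>h\<close>; integrating \<open>(p \<bullet> x)' = p \<bullet> h\<close> shows that the gap between them at time 0 is
  orthogonal to \<open>p 0\<close>, and so can be closed by homogeneous solutions, iff \<open>\<integral> p \<bullet> h = 0\<close>.\<close>

theorem fredholm_alternative:
  assumes limu: "(A \<longlongrightarrow> Lu) at_top" and invu: "bounded_inverse (\<lambda>_. Lu) Ku"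
    and lima: "(A \<longlongrightarrow> La) at_bot" and inva: "bounded_inverse (\<lambda>_. La) Ka"
    and p_cont: "continuous_on UNIV p" and p_decay: "\<And>t. norm (p t) \<le> D * exp (- l * \<bar>t\<bar>)" and l: "l > 0"
    and p_adj: "\<And>h x t. solves A h x \<Longrightarrow> ((\<lambda>t. p t \<bullet> x t) has_real_derivative p t \<bullet> h t) (at t)"
    and p0: "p 0 \<noteq> 0"
    and trans: "\<And>v. p 0 \<bullet> v = 0 \<Longrightarrow> \<exists>a b. a \<in> stable_space A \<and> b \<in> unstable_space A \<and> v = a + b"
  shows "\<exists>(\<beta> :: (real \<Rightarrow>\<^sub>C 'a) \<Rightarrow> real) (R :: (real \<Rightarrow>\<^sub>C 'a) \<Rightarrow> (real \<Rightarrow>\<^sub>C 'a)) (e :: real \<Rightarrow>\<^sub>C 'a).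
    bounded_linear \<beta> \<and> bounded_linear R \<and> (\<forall>h. \<beta> h = (\<integral>t. p t \<bullet> apply_bcontfun h t \<partial>lborel)) \<and>
    (\<forall>h. solves A (apply_bcontfun (h - \<beta> h *\<^sub>R e)) (apply_bcontfun (R h)))"
proof -
  have D0: "D \<ge> 0" using order_trans[OF norm_ge_zero p_decay[of 0]] by simp
  have expb: "exp (- l * \<bar>t\<bar>) \<le> 1" for t using l by simp
  have pb: "norm (p t) \<le> D" for t
    using p_decay[of t] mult_left_mono[OF expb[of t] D0] by linarith
  have exp_lim: "((\<lambda>t. D * exp (- l * \<bar>t\<bar>)) \<longlongrightarrow> 0) F" if "F = at_top \<or> F = at_bot" for F
  proof -
    have "LIM t at_bot. \<bar>t :: real\<bar> :> at_top"
      using filterlim_compose[OF filterlim_abs_real filterlim_uminus_at_top_at_bot] by simp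
    then have "LIM t F. \<bar>t\<bar> :> at_top" using that filterlim_abs_real by (elim disjE) simp_all
    from filterlim_tendsto_pos_mult_at_top[OF tendsto_const l this]
    have "LIM t F. l * \<bar>t\<bar> :> at_top" .
    then have "((\<lambda>t. exp (- (l * \<bar>t\<bar>))) \<longlongrightarrow> 0) F"
      by (intro filterlim_compose[OF exp_at_bot] filterlim_uminus_at_bot[THEN iffD2]) simp
    from tendsto_mult_right_zero[OF this, of D] show ?thesis by simp
  qed
  have plim: "((\<lambda>t. p t \<bullet> x t) \<longlongrightarrow> 0) F" if "F = at_top \<or> F = at_bot" "\<forall>\<^sub>F t in F. norm (x t) \<le> B" for x :: "real \<Rightarrow> 'a" and F B
  proof (rule Lim_null_comparison[of _ "\<lambda>t. (D * exp (- l * \<bar>t\<bar>)) * B"])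
    show "\<forall>\<^sub>F t in F. norm (p t \<bullet> x t) \<le> D * exp (- l * \<bar>t\<bar>) * B"
      using that(2)
    proof eventually_elim
      case (elim t)
      have "norm (p t \<bullet> x t) \<le> norm (p t) * norm (x t)" by (simp add: Cauchy_Schwarz_ineq2)
      also have "\<dots> \<le> D * exp (- l * \<bar>t\<bar>) * B" using D0 by (intro mult_mono p_decay elim) simp_all
      finally show ?case .
    qed
    show "((\<lambda>t. D * exp (- l * \<bar>t\<bar>) * B) \<longlongrightarrow> 0) F"
      by (rule tendsto_mult_left_zero[OF exp_lim[OF that(1)]])
  qed
  have plim_top: "((\<lambda>t. p t \<bullet> x t) \<longlongrightarrow> 0) at_top" if b: "bounded (x ` {0..})" for x :: "real \<Rightarrow> 'a"
  proof -
    obtain B where "\<And>t. t \<ge> 0 \<Longrightarrow> norm (x t) \<le> B" using b by (auto simp: bounded_iff)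
    then show ?thesis by (intro plim[of _ x B] eventually_at_top_linorderI[of 0]) simp_all
  qed
  have plim_bot: "((\<lambda>t. p t \<bullet> x t) \<longlongrightarrow> 0) at_bot" if b: "bounded (x ` {..0})" for x :: "real \<Rightarrow> 'a"
  proof -
    obtain B where B: "\<And>t. t \<le> 0 \<Longrightarrow> norm (x t) \<le> B" using b by (auto simp: bounded_iff)
    have "\<forall>\<^sub>F t in at_bot. norm (x t) \<le> B" unfolding eventually_at_bot_linorder using B by blast
    then show ?thesis by (intro plim[of _ x B]) simp_all
  qed
  obtain c1 where c1: "bounded_linear c1" "\<And>h. bounded (flow h (c1 h) ` {0..})"
    using half_line_solution[OF limu invu] by blast
  obtain c2 where c2: "bounded_linear c2" "\<And>h. bounded (flow h (c2 h) ` {..0})"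
    using half_line_solution_at_bot[OF lima inva] by blast
  define \<gamma> where "\<gamma> h = c1 h - c2 h" for h
  have \<gamma>: "bounded_linear \<gamma>" unfolding \<gamma>_def[abs_def] by (rule bounded_linear_sub[OF c1(1) c2(1)])
  \<comment> \<open>Along the solution that is bounded in the future, p \<bullet> x runs from
    \<open>p 0 \<bullet> \<gamma> h\<close> at minus infinity to 0 at plus infinity, whence the
    sign.\<close>
  define \<beta> where "\<beta> h = - (p 0 \<bullet> \<gamma> h)" for h
  have \<beta>: "bounded_linear \<beta>"
    unfolding \<beta>_def[abs_def]
    by (intro bounded_linear_minus bounded_linear_compose[OF bounded_linear_inner_right \<gamma>])
  have \<beta>_int: "\<beta> h = (\<integral>t. p t \<bullet> apply_bcontfun h t \<partial>lborel)" for h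
  proof -
    define y where "y t = p t \<bullet> flow h (c1 h) t" for t
    define y2 where "y2 t = p t \<bullet> flow h (c2 h) t" for t
    have d: "(y has_real_derivative p t \<bullet> apply_bcontfun h t) (at t)" "(y2 has_real_derivative p t \<bullet> apply_bcontfun h t) (at t)" for t
      unfolding y_def[abs_def] y2_def[abs_def] by (intro p_adj flow(2))+
    have "((\<lambda>t. y t - y2 t) has_real_derivative 0) (at t)" for t
      using DERIV_diff[OF d[of t]] by simp
    then have "y t - y2 t = y 0 - y2 0" for t
      using DERIV_isconst_all[of "\<lambda>t. y t - y2 t" t 0] by blast
    moreover have "y 0 - y2 0 = p 0 \<bullet> \<gamma> h" by (simp add: y_def y2_def flow(1) \<gamma>_def inner_diff_right)
    ultimately have y_eq: "y = (\<lambda>t. y2 t + p 0 \<bullet> \<gamma> h)" by (simp add: fun_eq_iff algebra_simps)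
    have "(y2 \<longlongrightarrow> 0) at_bot" unfolding y2_def[abs_def] by (rule plim_bot[OF c2(2)])
    from tendsto_add[OF this tendsto_const[of "p 0 \<bullet> \<gamma> h"]] have "(y \<longlongrightarrow> p 0 \<bullet> \<gamma> h) at_bot"
      unfolding y_eq by simp
    moreover have "(y \<longlongrightarrow> 0) at_top" unfolding y_def[abs_def] by (rule plim_top[OF c1(2)])
    moreover have cph: "continuous_on UNIV (\<lambda>t. p t \<bullet> h t)"
      by (intro continuous_on_inner p_cont continuous_on_apply_bcontfun)
    moreover have "integrable lborel (\<lambda>t. p t \<bullet> h t)"
    proof (rule Bochner_Integration.integrable_bound)
      show "integrable lborel (\<lambda>t. D * norm h * exp (- l * \<bar>t\<bar>))"
        by (intro integrable_mult_right integrable_exp_abs l)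
      show "(\<lambda>t. p t \<bullet> h t) \<in> borel_measurable lborel"
        using borel_measurable_continuous_onI[OF cph] by simp
      have "norm (p t \<bullet> h t) \<le> norm (D * norm h * exp (- l * \<bar>t\<bar>))" for t
      proof -
        have "norm (p t \<bullet> h t) \<le> norm (p t) * norm (h t)" by (simp add: Cauchy_Schwarz_ineq2)
        also have "\<dots> \<le> D * exp (- l * \<bar>t\<bar>) * norm h" using D0 by (intro mult_mono p_decay norm_bounded) simp_all
        finally show ?thesis using D0 by (simp add: abs_mult mult.commute mult.left_commute)
      qed
      then show "AE t in lborel. norm (p t \<bullet> h t) \<le> norm (D * norm h * exp (- l * \<bar>t\<bar>))" by simp
    qed
    ultimately have "(\<integral>t. p t \<bullet> apply_bcontfun h t \<partial>lborel) = 0 - p 0 \<bullet> \<gamma> h"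
      by (intro integral_real_line_FTC[OF d(1)])
    then show ?thesis by (simp add: \<beta>_def)
  qed
  obtain P where P: "linear P" "range P \<subseteq> stable_space A"
    "\<forall>a\<in>stable_space A. \<forall>b\<in>unstable_space A. a + b - P (a + b) \<in> unstable_space A"
    using exists_linear_splitting[OF subspace_stable_space[of A] subspace_stable_space[of "\<lambda>t. - A (- t)"]]
    unfolding unstable_space_reflect[symmetric] by blast
  \<comment> \<open>Bounded solutions need not be unique, as the stable and the unstable space may
    meet. The fixed linear choice \<open>P\<close> of the stable part of the gap keeps the initial
    value linear in h.\<close>
  define c where "c h = c1 h - P (\<gamma> h)" for h
  have c: "bounded_linear c"
    unfolding c_def[abs_def]
    using P(1) by (intro bounded_linear_sub c1(1) bounded_linear_compose[OF _ \<gamma>]) (simp add: linear_conv_bounded_linear)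
  have bdd: "bounded (range (flow h (c h)))" if h0: "\<beta> h = 0" for h
  proof -
    obtain a b where ab: "a \<in> stable_space A" "b \<in> unstable_space A" "\<gamma> h = a + b"
      using trans[of "\<gamma> h"] h0 by (auto simp: \<beta>_def)
    have s: "P (\<gamma> h) \<in> stable_space A" using P(2) by blast
    have u: "\<gamma> h - P (\<gamma> h) \<in> unstable_space A" using P(3) ab by simp
    have f1: "flow h (c h) = (\<lambda>t. flow h (c1 h) t - flow 0 (P (\<gamma> h)) t)"
      using flow_diff[of h 0 "c1 h" "P (\<gamma> h)"] by (simp add: c_def fun_eq_iff)
    have "c h = c2 h + (\<gamma> h - P (\<gamma> h))" by (simp add: c_def \<gamma>_def)
    then have f2: "flow h (c h) = (\<lambda>t. flow h (c2 h) t + flow 0 (\<gamma> h - P (\<gamma> h)) t)"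
      using flow_add[of h 0 "c2 h" "\<gamma> h - P (\<gamma> h)"] by (simp add: fun_eq_iff)
    have "bounded (flow h (c h) ` {0..})"
      unfolding f1 by (intro bounded_minus_comp c1(2) stable_space_flow s)
    moreover have "bounded (flow h (c h) ` {..0})"
      unfolding f2 by (intro bounded_plus_comp c2(2) unstable_space_flow u)
    moreover have "{0..} \<union> {..(0::real)} = UNIV" by auto
    then have "range (flow h (c h)) = flow h (c h) ` {0..} \<union> flow h (c h) ` {..0}"
      by (simp only: image_Un[symmetric])
    ultimately show ?thesis by (simp only: bounded_Un)
  qed
  obtain C where C: "C > 0" and est: "\<forall>h x. solves A (apply_bcontfun h) x \<and> bounded (range x) \<longrightarrow>
      (\<forall>t. norm (x t) \<le> C * (norm (x 0) + norm h))"
    using bounded_solution_estimate[OF limu invu lima inva] by blast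
  \<comment> \<open>If \<open>\<beta>\<close> vanished on p itself, the bounded solution x with
    forcing p would have p \<bullet> x with derivative |p|^2 and limit 0 at both ends. Monotonicity
    makes p \<bullet> x zero, which contradicts \<open>p0\<close>.\<close>
  have "\<exists>e. \<beta> e = 1"
  proof (rule ccontr)
    assume no: "\<nexists>e. \<beta> e = 1"
    define q where "q = Bcontfun p"
    have q: "apply_bcontfun q = p" unfolding q_def by (rule Bcontfun_inverse[OF bcontfun_normI[OF p_cont pb]])
    have "\<beta> q = 0"
    proof (rule ccontr)
      assume nz: "\<beta> q \<noteq> 0"
      have "\<beta> ((1 / \<beta> q) *\<^sub>R q) = 1" using nz bounded_linear.linear[OF \<beta>] by (simp add: linear_scale)
      with no show False by blast
    qed
    then have b: "bounded (range (flow q (c q)))" by (rule bdd)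
    define y where "y t = p t \<bullet> flow q (c q) t" for t
    have dy: "(y has_real_derivative p t \<bullet> p t) (at t)" for t
      unfolding y_def[abs_def] using p_adj[OF flow(2)[of q "c q"]] by (simp add: q)
    have mono: "y s \<le> y t" if "s \<le> t" for s t
      by (rule DERIV_nonneg_imp_nondecreasing[OF that]) (intro exI conjI, rule dy, simp)
    have yt: "(y \<longlongrightarrow> 0) at_top" "(y \<longlongrightarrow> 0) at_bot"
      unfolding y_def[abs_def] by (intro plim_top plim_bot bounded_subset[OF b] image_mono subset_UNIV)+
    have "y t \<le> 0" for t
      by (rule tendsto_lowerbound[OF yt(1) eventually_at_top_linorderI[of t]]) (simp_all add: mono)
    moreover have "y t \<ge> 0" for t
    proof (rule tendsto_upperbound[OF yt(2)])
      show "\<forall>\<^sub>F s in at_bot. y s \<le> y t"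
        unfolding eventually_at_bot_linorder by (intro exI[of _ t] allI impI mono)
    qed simp
    ultimately have "y = (\<lambda>_. 0)" by (simp add: fun_eq_iff order_antisym)
    then have "(y has_real_derivative 0) (at 0)" by simp
    then have "p 0 \<bullet> p 0 = 0" using DERIV_unique[OF dy] by blast
    then show False using p0 by simp
  qed
  then obtain e where e: "\<beta> e = 1" by blast
  define \<pi> where "\<pi> h = h - \<beta> h *\<^sub>R e" for h
  have \<pi>: "bounded_linear \<pi>"
    unfolding \<pi>_def[abs_def] by (intro bounded_linear_sub bounded_linear_ident bounded_linear_scaleR_const \<beta>)
  have \<beta>\<pi>: "\<beta> (\<pi> h) = 0" for h
    using bounded_linear.linear[OF \<beta>] by (simp add: \<pi>_def linear_diff linear_scale e)
  define R where "R h = Bcontfun (flow (\<pi> h) (c (\<pi> h)))" for h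
  have R: "apply_bcontfun (R h) = flow (\<pi> h) (c (\<pi> h))" for h
    unfolding R_def using bdd[OF \<beta>\<pi>] solves_continuous[OF flow(2)]
    by (intro Bcontfun_inverse) (simp add: bcontfun_def)
  obtain N1 where N1: "N1 \<ge> 0" "\<And>h. norm (c h) \<le> norm h * N1" using bounded_linear.nonneg_bounded[OF c] by blast
  obtain N2 where N2: "N2 \<ge> 0" "\<And>h. norm (\<pi> h) \<le> norm h * N2" using bounded_linear.nonneg_bounded[OF \<pi>] by blast
  note lin\<pi> = bounded_linear.linear[OF \<pi>] and linc = bounded_linear.linear[OF c]
  have "bounded_linear R"
  proof (rule bounded_linear_intro)
    fix h k :: "real \<Rightarrow>\<^sub>C 'a" and r :: real
    show "R (h + k) = R h + R k"
      by (rule bcontfun_eqI) (simp add: R linear_add[OF lin\<pi>] linear_add[OF linc] flow_add)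
    show "R (r *\<^sub>R h) = r *\<^sub>R R h"
      by (rule bcontfun_eqI) (simp add: R linear_scale[OF lin\<pi>] linear_scale[OF linc] flow_scaleR)
    show "norm (R h) \<le> norm h * (C * (N1 + 1) * N2)"
    proof (rule norm_bound)
      fix t
      have "norm (R h t) \<le> C * (norm (c (\<pi> h)) + norm (\<pi> h))"
        using est flow(2)[of "\<pi> h" "c (\<pi> h)"] bdd[OF \<beta>\<pi>, of h]
        flow(1)[of "\<pi> h" "c (\<pi> h)"] unfolding R by force
      also have "\<dots> \<le> C * ((N1 + 1) * norm (\<pi> h))"
        using C N1(2)[of "\<pi> h"] by (intro mult_left_mono) (simp_all add: algebra_simps)
      also have "\<dots> \<le> C * ((N1 + 1) * (norm h * N2))"
        using C N1(1) N2(2) by (intro mult_left_mono) simp_all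
      finally show "norm (R h t) \<le> norm h * (C * (N1 + 1) * N2)" by (simp add: ac_simps)
    qed
  qed
  moreover have "solves A (apply_bcontfun (h - \<beta> h *\<^sub>R e)) (apply_bcontfun (R h))" for h
    unfolding R \<pi>_def[symmetric] by (rule flow(2))
  ultimately show ?thesis using \<beta> \<beta>_int
    by (intro exI[of _ \<beta>] exI[of _ R] exI[of _ e] conjI allI) simp_all
qed

end

subsection \<open>Persistence of hyperbolic equilibria and of heteroclinic orbits\<close>

text \<open>The Lipschitz bound on \<open>DF\<close> is tied to segments inside \<open>U\<close>,
  because a neighbourhood of an orbit may fail to be convex. The Lipschitz bound of \<open>G\<close>
  in time controls the dependence on the phase.\<close>

locale perturbed_system =
  fixes F :: "'a::euclidean_space \<Rightarrow> 'a" and G :: "real \<Rightarrow> 'a \<Rightarrow> 'a"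
    and DF :: "'a \<Rightarrow> 'a \<Rightarrow>\<^sub>L 'a" and DG :: "real \<Rightarrow> 'a \<Rightarrow> 'a \<Rightarrow>\<^sub>L 'a"
    and U :: "'a set" and M :: real
  assumes U: "open U" and M: "M > 0"
    and F_deriv: "\<And>x. x \<in> U \<Longrightarrow> (F has_derivative blinfun_apply (DF x)) (at x)"
    and G_deriv: "\<And>t x. x \<in> U \<Longrightarrow> (G t has_derivative blinfun_apply (DG t x)) (at x)"
    and DF_bound: "\<And>x. x \<in> U \<Longrightarrow> norm (DF x) \<le> M"
    and DF_lip: "\<And>x y. closed_segment x y \<subseteq> U \<Longrightarrow> norm (DF x - DF y) \<le> M * norm (x - y)"
    and G_bound: "\<And>t x. x \<in> U \<Longrightarrow> norm (G t x) \<le> M"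
    and DG_bound: "\<And>t x. x \<in> U \<Longrightarrow> norm (DG t x) \<le> M"
    and G_time: "\<And>s t x. x \<in> U \<Longrightarrow> norm (G s x - G t x) \<le> M * \<bar>s - t\<bar>"
    and G_cont: "continuous_on (UNIV \<times> U) (\<lambda>(t, x). G t x)"
    and DG_cont: "continuous_on (UNIV \<times> U) (\<lambda>(t, x). DG t x)"
begin

lemma F_cont: "continuous_on U F"
  by (intro continuous_at_imp_continuous_on ballI) (rule has_derivative_continuous[OF F_deriv])

lemma DF_cont: "continuous_on U DF"
  unfolding continuous_on_iff
proof (intro ballI allI impI)
  fix x e assume x: "x \<in> U" and e: "(0::real) < e"
  obtain r where r: "r > 0" "ball x r \<subseteq> U" using U x openE by blast
  show "\<exists>d>0. \<forall>x'\<in>U. dist x' x < d \<longrightarrow> dist (DF x') (DF x) < e"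
  proof (intro exI[of _ "min r (e / M)"] conjI ballI impI)
    show "min r (e / M) > 0" using r e M by simp
    fix y assume y: "y \<in> U" "dist y x < min r (e / M)"
    have "closed_segment y x \<subseteq> ball x r"
      using r y by (intro closed_segment_subset convex_ball) (simp_all add: dist_commute)
    then have "norm (DF y - DF x) \<le> M * norm (y - x)" using r by (intro DF_lip) blast
    also have "\<dots> < M * (e / M)" using y(2) M unfolding dist_norm by (intro mult_strict_left_mono) simp_all
    also have "\<dots> = e" using M by simp
    finally show "dist (DF y) (DF x) < e" by (simp add: dist_norm)
  qed
qed

text \<open>The derivative of F - DF z is at most M r on the ball, so the mean value inequality
  gives a Lipschitz constant that shrinks with the radius. Contraction and merging both draw their
  smallness from this factor.\<close>

lemma linearization_error:
  assumes r: "cball z r \<subseteq> U" and a: "norm (x - z) \<le> r" "norm (y - z) \<le> r"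
  shows "norm (F x - F y - DF z (x - y)) \<le> M * r * norm (x - y)"
proof -
  have r0: "r \<ge> 0" using order_trans[OF norm_ge_zero a(1)] .
  have "norm ((\<lambda>x. F x - DF z x) x - (\<lambda>x. F x - DF z x) y) \<le> M * r * norm (x - y)"
  proof (rule differentiable_bound[where f' = "\<lambda>x v. (DF x - DF z) v" and S = "cball z r"])
    fix u assume u: "u \<in> cball z r"
    have "((\<lambda>x. F x - DF z x) has_derivative (\<lambda>v. DF u v - DF z v)) (at u)"
      using u r by (intro has_derivative_diff F_deriv bounded_linear_imp_has_derivative blinfun.bounded_linear_right) blast
    then show "((\<lambda>x. F x - DF z x) has_derivative (\<lambda>v. (DF u - DF z) v)) (at u within cball z r)"
      by (simp add: blinfun.diff_left has_derivative_at_withinI)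
    have "closed_segment u z \<subseteq> cball z r"
      using u r0 by (intro closed_segment_subset convex_cball) simp_all
    then have "norm (DF u - DF z) \<le> M * norm (u - z)" using r by (intro DF_lip) blast
    also have "\<dots> \<le> M * r" using u M by (intro mult_left_mono) (simp_all add: dist_norm norm_minus_commute)
    finally show "onorm (blinfun_apply (DF u - DF z)) \<le> M * r" by (simp add: norm_blinfun.rep_eq)
  qed (use a in \<open>simp_all add: dist_norm norm_minus_commute\<close>)
  then show ?thesis by (simp add: blinfun.diff_right algebra_simps)
qed

lemma G_lip:
  assumes r: "cball z r \<subseteq> U" and a: "norm (x - z) \<le> r" "norm (y - z) \<le> r"
  shows "norm (G t x - G t y) \<le> M * norm (x - y)"
proof (rule differentiable_bound[where f' = "\<lambda>x. blinfun_apply (DG t x)" and S = "cball z r"])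
  fix u assume "u \<in> cball z r"
  then have u: "u \<in> U" using r by blast
  show "(G t has_derivative blinfun_apply (DG t u)) (at u within cball z r)"
    by (rule has_derivative_at_withinI[OF G_deriv[OF u]])
  show "onorm (blinfun_apply (DG t u)) \<le> M"
    using DG_bound[OF u, of t] by (simp add: norm_blinfun.rep_eq)
qed (use a in \<open>simp_all add: dist_norm norm_minus_commute\<close>)

end

text \<open>One setting for two kinds of curve: a constant one at an equilibrium, and the
  heteroclinic orbit. A radius uniform in time lets bounded functions of small norm serve as
  deviations.\<close>

locale perturbed_curve = perturbed_system F G DF DG U M
  for F :: "'a::euclidean_space \<Rightarrow> 'a" and G DF DG U M +
  fixes z :: "real \<Rightarrow> 'a" and \<rho> :: real
  assumes z_cont: "continuous_on UNIV z" and \<rho>: "\<rho> > 0" and tube: "\<And>t. cball (z t) \<rho> \<subseteq> U"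
begin

text \<open>If z' = F (z), then z + w solves the equation with \<open>G\<close> advanced by \<alpha>
  exactly when w' = DF (z) w + \<open>forcing\<close>, as long as w stays in the tube. The phase
  sits in the time of \<open>G\<close>, so the linear operator is independent of \<alpha>.\<close>

definition forcing :: "real \<Rightarrow> real \<Rightarrow> (real \<Rightarrow>\<^sub>C 'a) \<Rightarrow> (real \<Rightarrow>\<^sub>C 'a)" where
  "forcing \<epsilon> \<alpha> w = Bcontfun (\<lambda>t. F (z t + w t) - F (z t) - DF (z t) (w t) + \<epsilon> *\<^sub>R G (t + \<alpha>) (z t + w t))"

lemma in_tube: "norm (apply_bcontfun w t) \<le> \<rho> \<Longrightarrow> z t + apply_bcontfun w t \<in> U"
  using tube[of t] by (force simp: dist_norm)

lemma curve_in: "z t \<in> U"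
  using tube[of t] \<rho> by force

lemma taylor_bound:
  assumes "norm w1 \<le> r" "norm w2 \<le> r" "r \<le> \<rho>"
  shows "norm (F (z t + apply_bcontfun w1 t) - F (z t + apply_bcontfun w2 t) - DF (z t) (w1 t - w2 t))
    \<le> M * r * norm (w1 - w2)"
proof -
  have r0: "r \<ge> 0" using order_trans[OF norm_ge_zero assms(1)] .
  have "cball (z t) r \<subseteq> U" using tube[of t] assms(3) by (meson cball_subset_cball_iff order_trans subset_cball)
  moreover have "norm (w1 t) \<le> r" "norm (w2 t) \<le> r"
    using norm_bounded[of w1 t] norm_bounded[of w2 t] assms by linarith+
  ultimately have "norm (F (z t + w1 t) - F (z t + w2 t) - DF (z t) (z t + w1 t - (z t + w2 t)))
      \<le> M * r * norm (z t + w1 t - (z t + w2 t))"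
    by (intro linearization_error) simp_all
  also have "\<dots> \<le> M * r * norm (w1 - w2)"
    using M r0 norm_bounded[of "w1 - w2" t] by (intro mult_left_mono) simp_all
  finally show ?thesis by simp
qed

lemma forcing:
  assumes w: "norm w \<le> \<rho>"
  shows "apply_bcontfun (forcing \<epsilon> \<alpha> w) t =
    F (z t + w t) - F (z t) - DF (z t) (w t) + \<epsilon> *\<^sub>R G (t + \<alpha>) (z t + w t)"
proof -
  have wt: "z t + w t \<in> U" for t using norm_bounded[of w t] w by (intro in_tube) linarith
  have c1: "continuous_on UNIV (\<lambda>t. z t + w t)" by (intro continuous_on_add z_cont continuous_on_apply_bcontfun)
  have c2: "continuous_on UNIV (\<lambda>t. G (t + \<alpha>) (z t + w t))"
  proof -
    have "continuous_on UNIV (\<lambda>t. (t + \<alpha>, z t + w t))"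
      by (intro continuous_on_Pair c1 continuous_on_add continuous_on_id continuous_on_const)
    from continuous_on_compose2[OF G_cont this] show ?thesis using wt by (simp add: image_subset_iff)
  qed
  have "(\<lambda>t. F (z t + w t) - F (z t) - DF (z t) (w t) + \<epsilon> *\<^sub>R G (t + \<alpha>) (z t + w t)) \<in> bcontfun"
  proof (rule bcontfun_normI)
    show "continuous_on UNIV (\<lambda>t. F (z t + w t) - F (z t) - DF (z t) (w t) + \<epsilon> *\<^sub>R G (t + \<alpha>) (z t + w t))"
      by (intro continuous_on_add continuous_on_diff continuous_on_scaleR continuous_on_const c2
          continuous_on_compose2[OF F_cont c1] continuous_on_compose2[OF F_cont z_cont]
          bounded_bilinear.continuous_on[OF bounded_bilinear_blinfun_apply]
          continuous_on_compose2[OF DF_cont z_cont] continuous_on_apply_bcontfun)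
        (use wt curve_in in \<open>simp_all add: image_subset_iff\<close>)
    fix t
    have "norm (F (z t + w t) - F (z t) - DF (z t) (w t)) \<le> M * \<rho> * norm w"
      using taylor_bound[OF w _ order_refl, of 0 t] \<rho> by simp
    moreover have "norm (\<epsilon> *\<^sub>R G (t + \<alpha>) (z t + w t)) \<le> \<bar>\<epsilon>\<bar> * M"
      using G_bound[OF wt, of "t + \<alpha>" t] by (simp add: mult_left_mono)
    ultimately show "norm (F (z t + w t) - F (z t) - DF (z t) (w t) + \<epsilon> *\<^sub>R G (t + \<alpha>) (z t + w t)) \<le> M * \<rho> * norm w + \<bar>\<epsilon>\<bar> * M"
      by (intro norm_triangle_le) linarith
  qed
  then show ?thesis unfolding forcing_def by (simp add: Bcontfun_inverse)
qed

lemma forcing_diff: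
  assumes w: "norm w1 \<le> r" "norm w2 \<le> r" "r \<le> \<rho>"
  shows "norm (forcing \<epsilon> \<alpha> w1 - forcing \<epsilon> \<alpha>' w2) \<le>
    (M * r + \<bar>\<epsilon>\<bar> * M) * norm (w1 - w2) + \<bar>\<epsilon>\<bar> * M * \<bar>\<alpha> - \<alpha>'\<bar>"
proof (rule norm_bound)
  fix t
  have w': "norm w1 \<le> \<rho>" "norm w2 \<le> \<rho>" using w by linarith+
  have wt: "norm (w1 t) \<le> \<rho>" "norm (w2 t) \<le> \<rho>" "norm (w1 t - w2 t) \<le> norm (w1 - w2)"
    using norm_bounded[of w1 t] norm_bounded[of w2 t] norm_bounded[of "w1 - w2" t] w' by simp_all
  define T1 where "T1 = F (z t + w1 t) - F (z t + w2 t) - DF (z t) (w1 t - w2 t)"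
  define T2 where "T2 = G (t + \<alpha>) (z t + w1 t) - G (t + \<alpha>) (z t + w2 t)"
  define T3 where "T3 = G (t + \<alpha>) (z t + w2 t) - G (t + \<alpha>') (z t + w2 t)"
  have eq: "(forcing \<epsilon> \<alpha> w1 - forcing \<epsilon> \<alpha>' w2) t = T1 + \<epsilon> *\<^sub>R (T2 + T3)"
    by (simp add: forcing w' T1_def T2_def T3_def blinfun.diff_right algebra_simps)
  have "norm T1 \<le> M * r * norm (w1 - w2)" unfolding T1_def by (rule taylor_bound[OF w])
  moreover have "norm (\<epsilon> *\<^sub>R (T2 + T3)) \<le> \<bar>\<epsilon>\<bar> * (M * norm (w1 - w2) + M * \<bar>\<alpha> - \<alpha>'\<bar>)"
  proof -
    have "norm T2 \<le> M * norm (z t + w1 t - (z t + w2 t))"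
      unfolding T2_def using wt by (intro G_lip[OF tube[of t]]) simp_all
    also have "\<dots> \<le> M * norm (w1 - w2)" using wt M by simp
    finally have "norm T2 \<le> M * norm (w1 - w2)" .
    moreover have "norm T3 \<le> M * \<bar>t + \<alpha> - (t + \<alpha>')\<bar>"
      unfolding T3_def using wt by (intro G_time in_tube)
    ultimately have "norm (T2 + T3) \<le> M * norm (w1 - w2) + M * \<bar>\<alpha> - \<alpha>'\<bar>"
      by (intro norm_triangle_le) simp
    then show ?thesis by (simp add: mult_left_mono)
  qed
  ultimately have "norm (T1 + \<epsilon> *\<^sub>R (T2 + T3)) \<le> M * r * norm (w1 - w2) + \<bar>\<epsilon>\<bar> * (M * norm (w1 - w2) + M * \<bar>\<alpha> - \<alpha>'\<bar>)"
    by (intro norm_triangle_le) linarith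
  then show "norm (apply_bcontfun (forcing \<epsilon> \<alpha> w1 - forcing \<epsilon> \<alpha>' w2) t) \<le>
      (M * r + \<bar>\<epsilon>\<bar> * M) * norm (w1 - w2) + \<bar>\<epsilon>\<bar> * M * \<bar>\<alpha> - \<alpha>'\<bar>"
    unfolding eq by (simp add: algebra_simps)
qed

lemma forcing_0_norm: "norm (forcing \<epsilon> \<alpha> 0) \<le> \<bar>\<epsilon>\<bar> * M"
proof (rule norm_bound)
  fix t
  have "norm (G (t + \<alpha>) (z t)) \<le> M" by (rule G_bound[OF curve_in])
  then show "norm (apply_bcontfun (forcing \<epsilon> \<alpha> 0) t) \<le> \<bar>\<epsilon>\<bar> * M"
    using \<rho> by (simp add: forcing mult_left_mono)
qed

text \<open>The fixed point is Lipschitz in \<open>\<alpha>\<close> because \<open>G\<close> is Lipschitz in time.\<close>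

lemma fixed_point_family:
  assumes R: "bounded_linear R"
  shows "\<exists>\<epsilon>1>0. \<exists>C\<ge>0. \<exists>W. \<forall>\<epsilon> \<alpha>. \<bar>\<epsilon>\<bar> \<le> \<epsilon>1 \<longrightarrow>
     norm (W \<epsilon> \<alpha>) \<le> \<rho> \<and> norm (W \<epsilon> \<alpha>) \<le> C * \<bar>\<epsilon>\<bar> \<and> W \<epsilon> \<alpha> = R (forcing \<epsilon> \<alpha> (W \<epsilon> \<alpha>)) \<and>
     (\<forall>\<alpha>'. norm (W \<epsilon> \<alpha> - W \<epsilon> \<alpha>') \<le> C * \<bar>\<epsilon>\<bar> * \<bar>\<alpha> - \<alpha>'\<bar>)"
proof -
  obtain K where K: "K > 0" "\<And>h. norm (R h) \<le> norm h * K" using bounded_linear.pos_bounded[OF R] by blast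
  note lin = bounded_linear.linear[OF R]
  \<comment> \<open>The radius gives K M r \<le> 1/4, and \<open>\<epsilon>1\<close> adds at most
    another 1/4 to the contraction constant. The second entry of \<open>\<epsilon>1\<close> keeps
    the image of 0 within r / 2, so that the ball is mapped into itself.\<close>
  define r where "r = min \<rho> (1 / (4 * K * M))"
  have r: "r > 0" "r \<le> \<rho>" "K * (M * r) \<le> 1/4"
  proof -
    show "r > 0" "r \<le> \<rho>" using \<rho> K M by (simp_all add: r_def)
    have "K * M * r \<le> K * M * (1 / (4 * K * M))" using K M by (intro mult_left_mono) (simp_all add: r_def)
    then show "K * (M * r) \<le> 1/4" using K M by (simp add: mult.assoc)
  qed
  define \<epsilon>1 where "\<epsilon>1 = min (1 / (4 * K * M)) (r / (2 * K * M))"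
  have \<epsilon>1: "\<epsilon>1 > 0" using r K M by (simp add: \<epsilon>1_def)
  have small: "K * (\<bar>\<epsilon>\<bar> * M) \<le> 1/4" "K * (\<bar>\<epsilon>\<bar> * M) \<le> r/2" if "\<bar>\<epsilon>\<bar> \<le> \<epsilon>1" for \<epsilon>
  proof -
    have "K * M * \<bar>\<epsilon>\<bar> \<le> K * M * (1 / (4 * K * M))" "K * M * \<bar>\<epsilon>\<bar> \<le> K * M * (r / (2 * K * M))"
      using K M that by (intro mult_left_mono; simp add: \<epsilon>1_def)+
    then show "K * (\<bar>\<epsilon>\<bar> * M) \<le> 1/4" "K * (\<bar>\<epsilon>\<bar> * M) \<le> r/2" using K M by (simp_all add: ac_simps)
  qed
  define T where "T \<epsilon> \<alpha> w = R (forcing \<epsilon> \<alpha> w)" for \<epsilon> \<alpha> w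
  have Td: "norm (T \<epsilon> \<alpha> w1 - T \<epsilon> \<alpha>' w2) \<le> 1/2 * norm (w1 - w2) + K * (\<bar>\<epsilon>\<bar> * M) * \<bar>\<alpha> - \<alpha>'\<bar>"
    if "\<bar>\<epsilon>\<bar> \<le> \<epsilon>1" "norm w1 \<le> r" "norm w2 \<le> r" for \<epsilon> \<alpha> \<alpha>' w1 w2
  proof -
    have "T \<epsilon> \<alpha> w1 - T \<epsilon> \<alpha>' w2 = R (forcing \<epsilon> \<alpha> w1 - forcing \<epsilon> \<alpha>' w2)" by (simp add: T_def linear_diff[OF lin])
    then have "norm (T \<epsilon> \<alpha> w1 - T \<epsilon> \<alpha>' w2) \<le> norm (forcing \<epsilon> \<alpha> w1 - forcing \<epsilon> \<alpha>' w2) * K" using K(2) by simp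
    also have "\<dots> \<le> ((M * r + \<bar>\<epsilon>\<bar> * M) * norm (w1 - w2) + \<bar>\<epsilon>\<bar> * M * \<bar>\<alpha> - \<alpha>'\<bar>) * K"
      using K that r by (intro mult_right_mono forcing_diff) simp_all
    also have "\<dots> = (K * (M * r) + K * (\<bar>\<epsilon>\<bar> * M)) * norm (w1 - w2) + K * (\<bar>\<epsilon>\<bar> * M) * \<bar>\<alpha> - \<alpha>'\<bar>"
      by (simp add: algebra_simps)
    also have "\<dots> \<le> 1/2 * norm (w1 - w2) + K * (\<bar>\<epsilon>\<bar> * M) * \<bar>\<alpha> - \<alpha>'\<bar>"
      using r(3) small(1)[OF that(1)] by (intro add_right_mono mult_right_mono) simp_all
    finally show ?thesis .
  qed
  have T0: "norm (T \<epsilon> \<alpha> 0) \<le> K * (\<bar>\<epsilon>\<bar> * M)" for \<epsilon> \<alpha>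
  proof -
    have "norm (T \<epsilon> \<alpha> 0) \<le> norm (forcing \<epsilon> \<alpha> 0) * K" unfolding T_def by (rule K(2))
    also have "\<dots> \<le> \<bar>\<epsilon>\<bar> * M * K" using K by (intro mult_right_mono forcing_0_norm) simp
    finally show ?thesis by (simp add: ac_simps)
  qed
  have Tb: "norm (T \<epsilon> \<alpha> w) \<le> 1/2 * norm w + K * (\<bar>\<epsilon>\<bar> * M)" if "\<bar>\<epsilon>\<bar> \<le> \<epsilon>1" "norm w \<le> r" for \<epsilon> \<alpha> w
  proof -
    have "norm (T \<epsilon> \<alpha> w) \<le> norm (T \<epsilon> \<alpha> w - T \<epsilon> \<alpha> 0) + norm (T \<epsilon> \<alpha> 0)"
      using norm_triangle_ineq[of "T \<epsilon> \<alpha> w - T \<epsilon> \<alpha> 0" "T \<epsilon> \<alpha> 0"] by simp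
    then show ?thesis using Td[of \<epsilon> w 0 \<alpha> \<alpha>] T0[of \<epsilon> \<alpha>] that r by simp
  qed
  have "\<exists>w. norm w \<le> r \<and> T \<epsilon> \<alpha> w = w" if "\<bar>\<epsilon>\<bar> \<le> \<epsilon>1" for \<epsilon> \<alpha>
  proof -
    have "\<exists>!w. w \<in> cball 0 r \<and> T \<epsilon> \<alpha> w = w"
    proof (rule Banach_fix[where c = "1/2"])
      show "complete (cball (0 :: real \<Rightarrow>\<^sub>C 'a) r)" by (simp add: complete_eq_closed)
      show "cball (0 :: real \<Rightarrow>\<^sub>C 'a) r \<noteq> {}" using r by simp
      show "T \<epsilon> \<alpha> ` cball 0 r \<subseteq> cball 0 r"
      proof
        fix v assume "v \<in> T \<epsilon> \<alpha> ` cball 0 r"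
        then obtain w where w: "norm w \<le> r" "v = T \<epsilon> \<alpha> w" by auto
        then show "v \<in> cball 0 r" using Tb[OF that w(1), of \<alpha>] small(2)[OF that] by simp
      qed
      show "dist (T \<epsilon> \<alpha> v) (T \<epsilon> \<alpha> w) \<le> 1/2 * dist v w" if "v \<in> cball 0 r" "w \<in> cball 0 r" for v w
        using Td[OF \<open>\<bar>\<epsilon>\<bar> \<le> \<epsilon>1\<close>, of v w \<alpha> \<alpha>] that by (simp add: dist_norm)
    qed simp_all
    then show ?thesis by auto
  qed
  then obtain W where W: "\<And>\<epsilon> \<alpha>. \<bar>\<epsilon>\<bar> \<le> \<epsilon>1 \<Longrightarrow> norm (W \<epsilon> \<alpha>) \<le> r" "\<And>\<epsilon> \<alpha>. \<bar>\<epsilon>\<bar> \<le> \<epsilon>1 \<Longrightarrow> T \<epsilon> \<alpha> (W \<epsilon> \<alpha>) = W \<epsilon> \<alpha>"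
    by metis
  show ?thesis
  proof (rule exI[of _ \<epsilon>1], rule conjI[OF \<epsilon>1], rule exI[of _ "2 * K * M"], rule conjI)
    show "0 \<le> 2 * K * M" using K M by simp
    have "norm (W \<epsilon> \<alpha>) \<le> \<rho> \<and> norm (W \<epsilon> \<alpha>) \<le> 2 * K * M * \<bar>\<epsilon>\<bar> \<and> W \<epsilon> \<alpha> = R (forcing \<epsilon> \<alpha> (W \<epsilon> \<alpha>)) \<and>
      (\<forall>\<alpha>'. norm (W \<epsilon> \<alpha> - W \<epsilon> \<alpha>') \<le> 2 * K * M * \<bar>\<epsilon>\<bar> * \<bar>\<alpha> - \<alpha>'\<bar>)" if e: "\<bar>\<epsilon>\<bar> \<le> \<epsilon>1" for \<epsilon> \<alpha>
    proof (intro conjI allI)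
    show "norm (W \<epsilon> \<alpha>) \<le> \<rho>" using W(1)[OF e, of \<alpha>] r by linarith
    show "W \<epsilon> \<alpha> = R (forcing \<epsilon> \<alpha> (W \<epsilon> \<alpha>))" using W(2)[OF e, of \<alpha>] by (simp add: T_def)
    show "norm (W \<epsilon> \<alpha>) \<le> 2 * K * M * \<bar>\<epsilon>\<bar>"
      using Tb[OF e W(1)[OF e], of \<alpha> \<alpha>] W(2)[OF e, of \<alpha>] by (simp add: ac_simps)
    show "norm (W \<epsilon> \<alpha> - W \<epsilon> \<alpha>') \<le> 2 * K * M * \<bar>\<epsilon>\<bar> * \<bar>\<alpha> - \<alpha>'\<bar>" for \<alpha>'
      using Td[OF e W(1)[OF e, of \<alpha>] W(1)[OF e, of \<alpha>'], of \<alpha> \<alpha>'] W(2)[OF e, of \<alpha>] W(2)[OF e, of \<alpha>']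
      by (simp add: ac_simps)
    qed
    then show "\<exists>W. \<forall>\<epsilon> \<alpha>. \<bar>\<epsilon>\<bar> \<le> \<epsilon>1 \<longrightarrow>
     norm (W \<epsilon> \<alpha>) \<le> \<rho> \<and> norm (W \<epsilon> \<alpha>) \<le> 2 * K * M * \<bar>\<epsilon>\<bar> \<and> W \<epsilon> \<alpha> = R (forcing \<epsilon> \<alpha> (W \<epsilon> \<alpha>)) \<and>
     (\<forall>\<alpha>'. norm (W \<epsilon> \<alpha> - W \<epsilon> \<alpha>') \<le> 2 * K * M * \<bar>\<epsilon>\<bar> * \<bar>\<alpha> - \<alpha>'\<bar>)"
      by (intro exI[of _ W] allI impI)
  qed
qed

end

section \<open>Merging of solutions near a hyperbolic equilibrium\<close>

lemma decay_at_top: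
  fixes d :: "real \<Rightarrow> 'a::euclidean_space"
  assumes inv: "bounded_inverse A K"
    and d: "\<And>t. t > T \<Longrightarrow> (d has_vector_derivative A t (d t) + r t) (at t)"
    and r: "continuous_on {T<..} r" and B: "\<And>t. t > T \<Longrightarrow> norm (d t) \<le> B"
    and small: "\<And>t. t > T \<Longrightarrow> norm (r t) \<le> \<eta> * norm (d t)" "K * \<eta> \<le> 1/4" "\<eta> \<ge> 0"
  shows "((\<lambda>t. norm (d t)) \<longlongrightarrow> 0) at_top"
proof (rule Lim_null_comparison)
  define l where "l = ln 2 / (8 * K + 1)"
  have l: "l > 0" using inv by (simp add: l_def bounded_inverse_def)
  show "\<forall>\<^sub>F t in at_top. norm (norm (d t)) \<le> 2 * B * exp (- (l * (t - T)))"
    using eventually_gt_at_top[of T]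
  proof eventually_elim
    case (elim t)
    show ?case using exponential_decay[OF inv d r B small elim] by (simp add: l_def)
  qed
  have "LIM t at_top. l * (t - T) :> at_top"
    using filterlim_tendsto_add_at_top[OF tendsto_const[of "- T"] filterlim_ident]
    by (intro filterlim_tendsto_pos_mult_at_top[OF tendsto_const l]) simp
  then have "((\<lambda>t. exp (- (l * (t - T)))) \<longlongrightarrow> 0) at_top"
    by (intro filterlim_compose[OF exp_at_bot] filterlim_uminus_at_bot[THEN iffD2]) simp
  from tendsto_mult_right_zero[OF this, of "2 * B"]
  show "((\<lambda>t. 2 * B * exp (- (l * (t - T)))) \<longlongrightarrow> 0) at_top" by simp
qed

context perturbed_system
begin

lemma difference_equation:
  assumes \<Phi>: "(\<Phi> has_vector_derivative F (\<Phi> t) + \<epsilon> *\<^sub>R G t (\<Phi> t)) (at t)"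
    and \<Gamma>: "(\<Gamma> has_vector_derivative F (\<Gamma> t) + \<epsilon> *\<^sub>R G t (\<Gamma> t)) (at t)"
  shows "((\<lambda>t. \<Phi> t - \<Gamma> t) has_vector_derivative DF p (\<Phi> t - \<Gamma> t) +
    (F (\<Phi> t) - F (\<Gamma> t) - DF p (\<Phi> t - \<Gamma> t) + \<epsilon> *\<^sub>R (G t (\<Phi> t) - G t (\<Gamma> t)))) (at t)"
  using has_vector_derivative_diff[OF \<Phi> \<Gamma>]
  by (rule has_vector_derivative_eq_rhs) (simp add: algebra_simps)

lemma difference_remainder_continuous:
  assumes "continuous_on I \<Phi>" "continuous_on I \<Gamma>" "\<And>t. t \<in> I \<Longrightarrow> \<Phi> t \<in> U" "\<And>t. t \<in> I \<Longrightarrow> \<Gamma> t \<in> U"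
  shows "continuous_on I (\<lambda>t. F (\<Phi> t) - F (\<Gamma> t) - DF p (\<Phi> t - \<Gamma> t) + \<epsilon> *\<^sub>R (G t (\<Phi> t) - G t (\<Gamma> t)))"
proof -
  have g: "continuous_on I (\<lambda>t. G t (x t))" if "continuous_on I x" "\<And>t. t \<in> I \<Longrightarrow> x t \<in> U" for x
    using continuous_on_compose2[OF G_cont continuous_on_Pair[OF continuous_on_id that(1)]] that(2)
    by (simp add: image_subset_iff)
  show ?thesis
    by (intro continuous_on_add continuous_on_diff continuous_on_scaleR continuous_on_const g assms
        continuous_on_compose2[OF F_cont] bounded_bilinear.continuous_on[OF bounded_bilinear_blinfun_apply])
      (use assms in \<open>simp_all add: image_subset_iff\<close>)
qed

lemma difference_remainder_bound:
  assumes r: "cball p r \<subseteq> U" and a: "norm (x - p) \<le> r" "norm (y - p) \<le> r"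
  shows "norm (F x - F y - DF p (x - y) + \<epsilon> *\<^sub>R (G t x - G t y)) \<le> (M * r + \<bar>\<epsilon>\<bar> * M) * norm (x - y)"
proof -
  have "norm (\<epsilon> *\<^sub>R (G t x - G t y)) \<le> \<bar>\<epsilon>\<bar> * (M * norm (x - y))"
    using G_lip[OF r a, of t] by (simp add: mult_left_mono)
  then show ?thesis using linearization_error[OF r a]
    by (intro norm_triangle_le) (simp add: algebra_simps)
qed

text \<open>The difference of the two solutions satisfies a linear equation with constant
  coefficient \<open>DF p\<close>, up to a remainder of at most M r + |\<epsilon>| M times the
  difference. This is small enough for exponential decay.\<close>

lemma solutions_merge_at_top:
  assumes inv: "bounded_inverse (\<lambda>_. DF p) K" and r: "cball p r \<subseteq> U" "K * (M * r + \<bar>\<epsilon>\<bar> * M) \<le> 1/4"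
    and \<Phi>: "\<And>t. t > T \<Longrightarrow> (\<Phi> has_vector_derivative F (\<Phi> t) + \<epsilon> *\<^sub>R G t (\<Phi> t)) (at t)" "\<And>t. t > T \<Longrightarrow> norm (\<Phi> t - p) \<le> r"
    and \<Gamma>: "\<And>t. t > T \<Longrightarrow> (\<Gamma> has_vector_derivative F (\<Gamma> t) + \<epsilon> *\<^sub>R G t (\<Gamma> t)) (at t)" "\<And>t. t > T \<Longrightarrow> norm (\<Gamma> t - p) \<le> r"
  shows "((\<lambda>t. norm (\<Phi> t - \<Gamma> t)) \<longlongrightarrow> 0) at_top"
proof (rule decay_at_top[OF inv difference_equation])
  have r0: "r \<ge> 0" using order_trans[OF norm_ge_zero \<Phi>(2)[of "T + 1"]] by simp
  have c: "continuous_on {T<..} x" if "\<And>t. t > T \<Longrightarrow> (x has_vector_derivative x' t) (at t)" for x :: "real \<Rightarrow> 'a" and x'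
    using that by (intro continuous_at_imp_continuous_on ballI) (auto intro: has_vector_derivative_continuous)
  have U': "x \<in> U" if "norm (x - p) \<le> r" for x
    using r(1) that by (force simp: dist_norm norm_minus_commute)
  show "continuous_on {T<..} (\<lambda>t. F (\<Phi> t) - F (\<Gamma> t) - DF p (\<Phi> t - \<Gamma> t) + \<epsilon> *\<^sub>R (G t (\<Phi> t) - G t (\<Gamma> t)))"
    by (intro difference_remainder_continuous c[OF \<Phi>(1)] c[OF \<Gamma>(1)] U' \<Phi>(2) \<Gamma>(2)) simp_all
  show "K * (M * r + \<bar>\<epsilon>\<bar> * M) \<le> 1/4" by (rule r(2))
  show "0 \<le> M * r + \<bar>\<epsilon>\<bar> * M" using M r0 by simp
  fix t assume t: "T < t"
  show "norm (F (\<Phi> t) - F (\<Gamma> t) - DF p (\<Phi> t - \<Gamma> t) + \<epsilon> *\<^sub>R (G t (\<Phi> t) - G t (\<Gamma> t))) \<le> (M * r + \<bar>\<epsilon>\<bar> * M) * norm (\<Phi> t - \<Gamma> t)"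
    by (rule difference_remainder_bound[OF r(1) \<Phi>(2)[OF t] \<Gamma>(2)[OF t]])
  have "\<Phi> t - \<Gamma> t = (\<Phi> t - p) - (\<Gamma> t - p)" by simp
  then show "norm (\<Phi> t - \<Gamma> t) \<le> r + r" using \<Phi>(2)[OF t] \<Gamma>(2)[OF t] by (metis add_mono norm_triangle_le_diff)
  show "(\<Phi> has_vector_derivative F (\<Phi> t) + \<epsilon> *\<^sub>R G t (\<Phi> t)) (at t)" by (rule \<Phi>(1)[OF t])
  show "(\<Gamma> has_vector_derivative F (\<Gamma> t) + \<epsilon> *\<^sub>R G t (\<Gamma> t)) (at t)" by (rule \<Gamma>(1)[OF t])
qed

lemma reverse_time: "perturbed_system (\<lambda>x. - F x) (\<lambda>t x. - G (- t) x) (\<lambda>x. - DF x) (\<lambda>t x. - DG (- t) x) U M"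
proof
  show "((\<lambda>x. - F x) has_derivative blinfun_apply (- DF x)) (at x)" if "x \<in> U" for x
    using has_derivative_minus[OF F_deriv[OF that]] by (simp add: uminus_blinfun.rep_eq)
  show "((\<lambda>x. - G (- t) x) has_derivative blinfun_apply (- DG (- t) x)) (at x)" if "x \<in> U" for x t
    using has_derivative_minus[OF G_deriv[OF that]] by (simp add: uminus_blinfun.rep_eq)
  show "norm (- DF x - - DF y) \<le> M * norm (x - y)" if "closed_segment x y \<subseteq> U" for x y
    using DF_lip[OF that] by (simp add: norm_minus_commute)
  show "norm (- G (- s) x - - G (- t) x) \<le> M * \<bar>s - t\<bar>" if "x \<in> U" for s t x
    using G_time[OF that, of "- s" "- t"] by (simp add: norm_minus_commute abs_minus_commute)
  have c: "continuous_on (UNIV \<times> U) (\<lambda>p. (- fst p :: real, snd p))"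
    by (intro continuous_on_Pair continuous_on_minus continuous_on_fst continuous_on_snd continuous_on_id)
  have i: "(\<lambda>p. (- fst p :: real, snd p)) ` (UNIV \<times> U) \<subseteq> UNIV \<times> U" by auto
  show "continuous_on (UNIV \<times> U) (\<lambda>(t, x). - G (- t) x)"
    using continuous_on_minus[OF continuous_on_compose2[OF G_cont c i]] by (simp add: split_beta)
  show "continuous_on (UNIV \<times> U) (\<lambda>(t, x). - DG (- t) x)"
    using continuous_on_minus[OF continuous_on_compose2[OF DG_cont c i]] by (simp add: split_beta)
qed (simp_all add: U M DF_bound G_bound DG_bound)

lemma solutions_merge_at_bot:
  assumes inv: "bounded_inverse (\<lambda>_. DF p) K" and r: "cball p r \<subseteq> U" "K * (M * r + \<bar>\<epsilon>\<bar> * M) \<le> 1/4"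
    and \<Phi>: "\<And>t. t < T \<Longrightarrow> (\<Phi> has_vector_derivative F (\<Phi> t) + \<epsilon> *\<^sub>R G t (\<Phi> t)) (at t)" "\<And>t. t < T \<Longrightarrow> norm (\<Phi> t - p) \<le> r"
    and \<Gamma>: "\<And>t. t < T \<Longrightarrow> (\<Gamma> has_vector_derivative F (\<Gamma> t) + \<epsilon> *\<^sub>R G t (\<Gamma> t)) (at t)" "\<And>t. t < T \<Longrightarrow> norm (\<Gamma> t - p) \<le> r"
  shows "((\<lambda>t. norm (\<Phi> t - \<Gamma> t)) \<longlongrightarrow> 0) at_bot"
proof -
  interpret R: perturbed_system "\<lambda>x. - F x" "\<lambda>t x. - G (- t) x" "\<lambda>x. - DF x" "\<lambda>t x. - DG (- t) x" U M
    by (rule reverse_time)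
  have "((\<lambda>t. norm (\<Phi> (- t) - \<Gamma> (- t))) \<longlongrightarrow> 0) at_top"
  proof (rule R.solutions_merge_at_top[OF bounded_inverse_reflect[OF inv] r, where T = "- T"])
    fix t assume t: "- T < t"
    then have t': "- t < T" by simp
    show "((\<lambda>t. \<Phi> (- t)) has_vector_derivative - F (\<Phi> (- t)) + \<epsilon> *\<^sub>R - G (- t) (\<Phi> (- t))) (at t)"
      using has_vector_derivative_reflect[OF \<Phi>(1)[OF t']] by (simp add: algebra_simps)
    show "((\<lambda>t. \<Gamma> (- t)) has_vector_derivative - F (\<Gamma> (- t)) + \<epsilon> *\<^sub>R - G (- t) (\<Gamma> (- t))) (at t)"
      using has_vector_derivative_reflect[OF \<Gamma>(1)[OF t']] by (simp add: algebra_simps)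
    show "norm (\<Phi> (- t) - p) \<le> r" "norm (\<Gamma> (- t) - p) \<le> r" using \<Phi>(2)[OF t'] \<Gamma>(2)[OF t'] .
  qed
  then show ?thesis by (simp add: filterlim_at_bot_mirror)
qed

text \<open>The fixed point stays within O(\<epsilon>) of p, so the linearization along it differs
  from \<open>DF p\<close> by at most M (C + 1) |\<epsilon>|. The threshold
  \<open>\<epsilon>2\<close> makes K times this at most 1/2, which preserves bounded
  invertibility.\<close>

theorem hyperbolic_trajectory_persists:
  assumes p: "F p = 0" "cball p \<rho> \<subseteq> U" "\<rho> > 0" and inv: "bounded_inverse (\<lambda>_. DF p) K"
  shows "\<exists>\<epsilon>1>0. \<exists>C\<ge>0. \<forall>\<epsilon>. \<bar>\<epsilon>\<bar> \<le> \<epsilon>1 \<longrightarrow> (\<exists>\<Gamma>. (\<forall>t. \<Gamma> t \<in> U) \<and> (\<forall>t. norm (\<Gamma> t - p) \<le> C * \<bar>\<epsilon>\<bar>) \<and>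
     (\<forall>t. (\<Gamma> has_vector_derivative F (\<Gamma> t) + \<epsilon> *\<^sub>R G t (\<Gamma> t)) (at t)) \<and>
     exponential_dichotomy (\<lambda>t. blinfun_apply (DF (\<Gamma> t) + \<epsilon> *\<^sub>R DG t (\<Gamma> t))))"
proof -
  interpret C: perturbed_curve F G DF DG U M "\<lambda>_. p" \<rho>
    by unfold_locales (simp_all add: p)
  have K: "K > 0" using inv by (simp add: bounded_inverse_def)
  obtain \<epsilon>1 C W where \<epsilon>1: "\<epsilon>1 > 0" and C: "C \<ge> 0" and W: "\<And>\<epsilon> \<alpha>. \<bar>\<epsilon>\<bar> \<le> \<epsilon>1 \<Longrightarrow>
     norm (W \<epsilon> \<alpha>) \<le> \<rho> \<and> norm (W \<epsilon> \<alpha>) \<le> C * \<bar>\<epsilon>\<bar> \<and> W \<epsilon> \<alpha> = resolvent (\<lambda>_. DF p) (C.forcing \<epsilon> \<alpha> (W \<epsilon> \<alpha>))"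
    using C.fixed_point_family[OF bounded_linear_resolvent[OF inv]] by blast
  define Z where "Z = K * M * (C + 1)"
  have Z: "Z > 0" using K M C by (simp add: Z_def)
  define \<epsilon>2 where "\<epsilon>2 = min \<epsilon>1 (1 / (2 * Z))"
  have \<epsilon>2: "\<epsilon>2 > 0" using \<epsilon>1 Z by (simp add: \<epsilon>2_def)
  have "\<exists>\<Gamma>. (\<forall>t. \<Gamma> t \<in> U) \<and> (\<forall>t. norm (\<Gamma> t - p) \<le> C * \<bar>\<epsilon>\<bar>) \<and>
     (\<forall>t. (\<Gamma> has_vector_derivative F (\<Gamma> t) + \<epsilon> *\<^sub>R G t (\<Gamma> t)) (at t)) \<and>
     exponential_dichotomy (\<lambda>t. blinfun_apply (DF (\<Gamma> t) + \<epsilon> *\<^sub>R DG t (\<Gamma> t)))" if e: "\<bar>\<epsilon>\<bar> \<le> \<epsilon>2" for \<epsilon>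
  proof -
    define w where "w = W \<epsilon> 0"
    have w: "norm w \<le> \<rho>" "norm w \<le> C * \<bar>\<epsilon>\<bar>" "resolvent (\<lambda>_. DF p) (C.forcing \<epsilon> 0 w) = w"
      using W[of \<epsilon> 0] e unfolding w_def \<epsilon>2_def by simp_all
    define \<Gamma> where "\<Gamma> t = p + w t" for t
    have \<Gamma>U: "\<Gamma> t \<in> U" for t
      unfolding \<Gamma>_def using norm_bounded[of w t] w(1) by (intro C.in_tube) linarith
    have \<Gamma>b: "norm (\<Gamma> t - p) \<le> C * \<bar>\<epsilon>\<bar>" "norm (\<Gamma> t - p) \<le> \<rho>" for t
      using norm_bounded[of w t] w by (simp_all add: \<Gamma>_def)
    have "solves (\<lambda>_. DF p) (apply_bcontfun (C.forcing \<epsilon> 0 w)) (apply_bcontfun w)"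
      using solves_resolvent[OF inv, of "C.forcing \<epsilon> 0 w"] w(3) by simp
    then have dw: "(w has_vector_derivative F (\<Gamma> t) + \<epsilon> *\<^sub>R G t (\<Gamma> t)) (at t)" for t
      using w(1) by (simp add: solves_def C.forcing p(1) \<Gamma>_def)
    have d\<Gamma>: "(\<Gamma> has_vector_derivative F (\<Gamma> t) + \<epsilon> *\<^sub>R G t (\<Gamma> t)) (at t)" for t
      unfolding \<Gamma>_def[abs_def] using has_vector_derivative_add[OF has_vector_derivative_const dw[of t]]
      by (simp add: \<Gamma>_def)
    have c\<Gamma>: "continuous_on UNIV \<Gamma>"
      unfolding \<Gamma>_def[abs_def] by (intro continuous_on_add continuous_on_const continuous_on_apply_bcontfun)
    define E where "E t = DF (\<Gamma> t) - DF p + \<epsilon> *\<^sub>R DG t (\<Gamma> t)" for t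
    have cE: "continuous_on UNIV E"
    proof -
      have "continuous_on UNIV (\<lambda>t. DG t (\<Gamma> t))"
        using continuous_on_compose2[OF DG_cont continuous_on_Pair[OF continuous_on_id c\<Gamma>]] \<Gamma>U
        by (simp add: image_subset_iff)
      then show ?thesis unfolding E_def[abs_def]
        by (intro continuous_on_add continuous_on_diff continuous_on_scaleR continuous_on_const
            continuous_on_compose2[OF DF_cont c\<Gamma>]) (simp_all add: image_subset_iff \<Gamma>U)
    qed
    have Eb: "norm (E t) \<le> M * (C + 1) * \<bar>\<epsilon>\<bar>" for t
    proof -
      have "closed_segment (\<Gamma> t) p \<subseteq> cball p \<rho>"
        using \<Gamma>b(2)[of t] p(3) by (intro closed_segment_subset convex_cball) (simp_all add: dist_norm norm_minus_commute)
      then have "norm (DF (\<Gamma> t) - DF p) \<le> M * norm (\<Gamma> t - p)" using p(2) by (intro DF_lip) blast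
      also have "\<dots> \<le> M * (C * \<bar>\<epsilon>\<bar>)" using M \<Gamma>b(1) by (intro mult_left_mono) simp_all
      finally have "norm (DF (\<Gamma> t) - DF p) \<le> M * (C * \<bar>\<epsilon>\<bar>)" .
      moreover have "norm (\<epsilon> *\<^sub>R DG t (\<Gamma> t)) \<le> \<bar>\<epsilon>\<bar> * M" using DG_bound[OF \<Gamma>U, of t t] by (simp add: mult_left_mono)
      ultimately have "norm (E t) \<le> M * (C * \<bar>\<epsilon>\<bar>) + \<bar>\<epsilon>\<bar> * M" unfolding E_def by (intro norm_triangle_le) linarith
      then show ?thesis by (simp add: algebra_simps)
    qed
    have "K * (M * (C + 1) * \<bar>\<epsilon>\<bar>) = Z * \<bar>\<epsilon>\<bar>" by (simp add: Z_def)
    also have "\<dots> \<le> Z * (1 / (2 * Z))" using e Z by (intro mult_left_mono) (simp_all add: \<epsilon>2_def)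
    also have "\<dots> = 1/2" using Z by simp
    finally have inv2: "bounded_inverse (\<lambda>t. DF p + E t) (2 * K)"
      by (rule bounded_inverse_perturb[OF inv cE Eb])
    have "exponential_dichotomy (\<lambda>t. blinfun_apply (DF p + E t))"
    proof (rule bounded_inverse_imp_exponential_dichotomy[OF inv2])
      show "continuous_on UNIV (\<lambda>t. DF p + E t)" by (intro continuous_on_add continuous_on_const cE)
      show "norm (DF p + E t) \<le> norm (DF p) + M * (C + 1) * \<bar>\<epsilon>\<bar>" for t
        using Eb[of t] by (intro norm_triangle_le) simp
    qed
    then have "exponential_dichotomy (\<lambda>t. blinfun_apply (DF (\<Gamma> t) + \<epsilon> *\<^sub>R DG t (\<Gamma> t)))"
      by (simp add: E_def)
    then show ?thesis using \<Gamma>U \<Gamma>b(1) d\<Gamma> by (intro exI[of _ \<Gamma>] conjI allI)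
  qed
  note main = this
  show ?thesis
    by (rule exI[of _ \<epsilon>2], rule conjI[OF \<epsilon>2], rule exI[of _ C], rule conjI[OF C], intro allI impI, rule main)
qed

end

text \<open>At distance c \<epsilon> from the zero, the linear part of m has size |D| c \<epsilon> =
  2 (C + 1) \<epsilon>. The nonlinear error takes less than half of it, and what remains exceeds C
  \<epsilon>, so b changes sign between the two ends. \<open>\<epsilon>1\<close> and c serve all
  admissible b at once.\<close>

lemma simple_zero_persists:
  fixes m :: "real \<Rightarrow> real"
  assumes m0: "m \<alpha>0 = 0" and dm: "(m has_real_derivative D) (at \<alpha>0)" and D: "D \<noteq> 0" and C: "C \<ge> 0"
  shows "\<exists>\<epsilon>1>0. \<exists>c\<ge>0. \<forall>\<epsilon> b. 0 < \<epsilon> \<and> \<epsilon> \<le> \<epsilon>1 \<and> continuous_on UNIV b \<and> (\<forall>\<alpha>. \<bar>b \<alpha> - m \<alpha>\<bar> \<le> C * \<epsilon>) \<longrightarrow>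
    (\<exists>\<alpha>. \<bar>\<alpha> - \<alpha>0\<bar> \<le> c * \<epsilon> \<and> b \<alpha> = (0 :: real))"
proof -
  have "((\<lambda>h. m (\<alpha>0 + h) / h) \<longlongrightarrow> D) (at 0)" using dm m0 by (simp add: DERIV_def)
  then have "\<forall>\<^sub>F h in at 0. dist (m (\<alpha>0 + h) / h) D < \<bar>D\<bar> / 2" using D by (intro tendstoD) simp_all
  then obtain d where d: "d > 0" "\<And>h. h \<noteq> 0 \<Longrightarrow> \<bar>h\<bar> < d \<Longrightarrow> \<bar>m (\<alpha>0 + h) / h - D\<bar> < \<bar>D\<bar> / 2"
    unfolding eventually_at by (auto simp: dist_real_def)
  define c where "c = 2 * (C + 1) / \<bar>D\<bar>"
  have c: "c > 0" "c * \<bar>D\<bar> = 2 * (C + 1)" using C D by (simp_all add: c_def)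
  define \<epsilon>1 where "\<epsilon>1 = d / (2 * c)"
  have "\<exists>\<alpha>. \<bar>\<alpha> - \<alpha>0\<bar> \<le> c * \<epsilon> \<and> b \<alpha> = 0"
    if e: "0 < \<epsilon>" "\<epsilon> \<le> \<epsilon>1" and b: "continuous_on UNIV b" "\<And>\<alpha>. \<bar>b \<alpha> - m \<alpha>\<bar> \<le> C * \<epsilon>" for \<epsilon> b
  proof -
    define h where "h = c * \<epsilon>"
    have h: "h > 0" using c e by (simp add: h_def)
    have "h \<le> c * (d / (2 * c))" unfolding h_def using c e by (intro mult_left_mono) (simp_all add: \<epsilon>1_def)
    also have "\<dots> < d" using c d by simp
    finally have hd: "h < d" .
    have big: "h * (\<bar>D\<bar> / 2) = (C + 1) * \<epsilon>" using c(2) by (simp add: h_def mult.commute mult.left_commute)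
    have s1: "\<bar>m (\<alpha>0 + h) - D * h\<bar> < (C + 1) * \<epsilon>" "\<bar>m (\<alpha>0 - h) + D * h\<bar> < (C + 1) * \<epsilon>"
    proof -
      have "\<bar>m (\<alpha>0 + k) - D * k\<bar> < (C + 1) * \<epsilon>" if k: "\<bar>k\<bar> = h" for k
      proof -
        have k0: "k \<noteq> 0" using k h by auto
        have "\<bar>m (\<alpha>0 + k) - D * k\<bar> = \<bar>k\<bar> * \<bar>m (\<alpha>0 + k) / k - D\<bar>"
          using k0 by (simp add: abs_mult[symmetric] right_diff_distrib mult.commute)
        also have "\<dots> < \<bar>k\<bar> * (\<bar>D\<bar> / 2)" using d(2)[OF k0] k hd k0 by (intro mult_strict_left_mono) simp_all
        finally show ?thesis using big k by simp
      qed
      from this[of h] this[of "- h"] show "\<bar>m (\<alpha>0 + h) - D * h\<bar> < (C + 1) * \<epsilon>" "\<bar>m (\<alpha>0 - h) + D * h\<bar> < (C + 1) * \<epsilon>"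
        using h by simp_all
    qed
    have Dh: "\<bar>D * h\<bar> = 2 * ((C + 1) * \<epsilon>)" using c e by (simp add: h_def abs_mult mult.left_commute[of "\<bar>D\<bar>"] mult.assoc[symmetric] mult.commute[of "\<bar>D\<bar>"])
    have Ce: "C * \<epsilon> \<le> (C + 1) * \<epsilon>" "(C + 1) * \<epsilon> = C * \<epsilon> + \<epsilon>" using e by (simp_all add: distrib_right)
    have cont: "continuous_on {\<alpha>0 - h..\<alpha>0 + h} b" using b(1) continuous_on_subset by blast
    have "\<exists>\<alpha>\<ge>\<alpha>0 - h. \<alpha> \<le> \<alpha>0 + h \<and> b \<alpha> = 0"
    proof (cases "D > 0")
      case True
      then have "D * h > 0" using h by simp
      then have "b (\<alpha>0 - h) \<le> 0" "0 \<le> b (\<alpha>0 + h)"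
        using s1 Dh Ce b(2)[of "\<alpha>0 + h"] b(2)[of "\<alpha>0 - h"] by linarith+
      then show ?thesis using h cont by (intro IVT') simp_all
    next
      case False
      then have "D * h < 0" using h D by (simp add: mult_less_0_iff)
      then have "b (\<alpha>0 + h) \<le> 0" "0 \<le> b (\<alpha>0 - h)"
        using s1 Dh Ce b(2)[of "\<alpha>0 + h"] b(2)[of "\<alpha>0 - h"] by linarith+
      then show ?thesis using h cont by (intro IVT2') simp_all
    qed
    then obtain \<alpha> where "\<alpha> \<ge> \<alpha>0 - h" "\<alpha> \<le> \<alpha>0 + h" "b \<alpha> = 0" by blast
    then show ?thesis by (intro exI[of _ \<alpha>]) (simp add: h_def abs_le_iff)
  qed
  then have "\<forall>\<epsilon> b. 0 < \<epsilon> \<and> \<epsilon> \<le> \<epsilon>1 \<and> continuous_on UNIV b \<and> (\<forall>\<alpha>. \<bar>b \<alpha> - m \<alpha>\<bar> \<le> C * \<epsilon>) \<longrightarrow>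
    (\<exists>\<alpha>. \<bar>\<alpha> - \<alpha>0\<bar> \<le> c * \<epsilon> \<and> b \<alpha> = (0 :: real))" by blast
  moreover have "\<epsilon>1 > 0" using c d by (simp add: \<epsilon>1_def)
  moreover have "c \<ge> 0" using c(1) by simp
  ultimately show ?thesis by blast
qed

context perturbed_curve
begin

text \<open>For every phase the fixed point solves the equation up to the multiple \<beta> (f
  \<epsilon> \<alpha>) of e. To first order in \<epsilon> the deviation drops out of f, so this
  multiple is \<epsilon> m (\<alpha>) + O(\<epsilon>^2), uniformly in \<alpha>.\<close>

theorem melnikov_persistence:
  assumes z: "\<And>t. (z has_vector_derivative F (z t)) (at t)"
    and \<beta>: "bounded_linear \<beta>" and R: "bounded_linear R"
    and sol: "\<And>h. solves (\<lambda>t. DF (z t)) (apply_bcontfun (h - \<beta> h *\<^sub>R e)) (apply_bcontfun (R h))"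
    and m: "\<And>\<alpha>. m \<alpha> = \<beta> (forcing 1 \<alpha> 0)"
    and m0: "m \<alpha>0 = 0" and dm: "(m has_real_derivative D) (at \<alpha>0)" and D: "D \<noteq> 0"
  shows "\<exists>\<epsilon>1>0. \<exists>C\<ge>0. \<forall>\<epsilon>. \<bar>\<epsilon>\<bar> \<le> \<epsilon>1 \<longrightarrow> (\<exists>\<alpha> \<Phi>. \<bar>\<alpha> - \<alpha>0\<bar> \<le> C * \<bar>\<epsilon>\<bar> \<and> (\<forall>t. \<Phi> t \<in> U) \<and>
     (\<forall>t. norm (\<Phi> t - z (t - \<alpha>)) \<le> C * \<bar>\<epsilon>\<bar>) \<and> (\<forall>t. (\<Phi> has_vector_derivative F (\<Phi> t) + \<epsilon> *\<^sub>R G t (\<Phi> t)) (at t)))"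
proof -
  obtain \<epsilon>1 C W where \<epsilon>1: "\<epsilon>1 > 0" and C: "C \<ge> 0" and W0: "\<forall>\<epsilon> \<alpha>. \<bar>\<epsilon>\<bar> \<le> \<epsilon>1 \<longrightarrow>
     norm (W \<epsilon> \<alpha>) \<le> \<rho> \<and> norm (W \<epsilon> \<alpha>) \<le> C * \<bar>\<epsilon>\<bar> \<and> W \<epsilon> \<alpha> = R (forcing \<epsilon> \<alpha> (W \<epsilon> \<alpha>)) \<and>
     (\<forall>\<alpha>'. norm (W \<epsilon> \<alpha> - W \<epsilon> \<alpha>') \<le> C * \<bar>\<epsilon>\<bar> * \<bar>\<alpha> - \<alpha>'\<bar>)"
    using fixed_point_family[OF R] by (elim exE conjE) (rule that)
  note W = W0[THEN spec, THEN spec, THEN mp]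
  obtain N where N: "N > 0" "\<And>h. norm (\<beta> h) \<le> norm h * N" using bounded_linear.pos_bounded[OF \<beta>] by blast
  note lin = bounded_linear.linear[OF \<beta>]
  define f where "f \<epsilon> \<alpha> = forcing \<epsilon> \<alpha> (W \<epsilon> \<alpha>)" for \<epsilon> \<alpha>
  have cont_\<beta>: "continuous_on UNIV (\<lambda>\<alpha>. \<beta> (f \<epsilon> \<alpha>))" if e: "\<bar>\<epsilon>\<bar> \<le> \<epsilon>1" for \<epsilon>
  proof -
    define Q where "Q = (M * \<rho> + \<bar>\<epsilon>\<bar> * M) * (C * \<bar>\<epsilon>\<bar>) + \<bar>\<epsilon>\<bar> * M"
    have Q0: "Q \<ge> 0" using M \<rho> C by (simp add: Q_def)
    have "norm (f \<epsilon> \<alpha> - f \<epsilon> \<alpha>') \<le> Q * \<bar>\<alpha> - \<alpha>'\<bar>" for \<alpha> \<alpha>'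
    proof -
      have "norm (f \<epsilon> \<alpha> - f \<epsilon> \<alpha>') \<le> (M * \<rho> + \<bar>\<epsilon>\<bar> * M) * norm (W \<epsilon> \<alpha> - W \<epsilon> \<alpha>') + \<bar>\<epsilon>\<bar> * M * \<bar>\<alpha> - \<alpha>'\<bar>"
        unfolding f_def using W[OF e] by (intro forcing_diff) simp_all
      also have "\<dots> \<le> (M * \<rho> + \<bar>\<epsilon>\<bar> * M) * (C * \<bar>\<epsilon>\<bar> * \<bar>\<alpha> - \<alpha>'\<bar>) + \<bar>\<epsilon>\<bar> * M * \<bar>\<alpha> - \<alpha>'\<bar>"
        using W[OF e] M \<rho> by (intro add_right_mono mult_left_mono) simp_all
      also have "\<dots> = Q * \<bar>\<alpha> - \<alpha>'\<bar>"
        unfolding Q_def by (simp only: distrib_right[of "(M * \<rho> + \<bar>\<epsilon>\<bar> * M) * (C * \<bar>\<epsilon>\<bar>)"] mult.assoc)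
      finally show ?thesis .
    qed
    then have "Q-lipschitz_on UNIV (f \<epsilon>)" using Q0 by (intro lipschitz_onI) (simp_all add: dist_norm)
    then have "continuous_on UNIV (f \<epsilon>)" by (rule lipschitz_on_continuous_on)
    then show ?thesis by (rule bounded_linear.continuous_on[OF \<beta>])
  qed
  have est: "\<bar>\<beta> (f \<epsilon> \<alpha>) - \<epsilon> * m \<alpha>\<bar> \<le> (M * C * C + M * C) * N * \<bar>\<epsilon>\<bar> * \<bar>\<epsilon>\<bar>" if e: "\<bar>\<epsilon>\<bar> \<le> \<epsilon>1" for \<epsilon> \<alpha>
  proof -
    define w where "w = W \<epsilon> \<alpha>"
    have w: "norm w \<le> \<rho>" "norm w \<le> C * \<bar>\<epsilon>\<bar>" using W[OF e, of \<alpha>] by (simp_all add: w_def)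
    have s: "forcing \<epsilon> \<alpha> 0 = \<epsilon> *\<^sub>R forcing 1 \<alpha> 0"
      by (rule bcontfun_eqI) (simp add: forcing \<rho> less_imp_le)
    have "norm (f \<epsilon> \<alpha> - \<epsilon> *\<^sub>R forcing 1 \<alpha> 0) \<le> (M * norm w + \<bar>\<epsilon>\<bar> * M) * norm (w - 0) + \<bar>\<epsilon>\<bar> * M * \<bar>\<alpha> - \<alpha>\<bar>"
      unfolding f_def w_def[symmetric] s[symmetric] using w by (intro forcing_diff) simp_all
    also have "\<dots> = (M * norm w + \<bar>\<epsilon>\<bar> * M) * norm w" by simp
    also have "\<dots> \<le> (M * (C * \<bar>\<epsilon>\<bar>) + \<bar>\<epsilon>\<bar> * M) * (C * \<bar>\<epsilon>\<bar>)"
      using w(2) M C by (intro mult_mono add_right_mono mult_left_mono) simp_all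
    finally have n: "norm (f \<epsilon> \<alpha> - \<epsilon> *\<^sub>R forcing 1 \<alpha> 0) \<le> (M * C * C + M * C) * \<bar>\<epsilon>\<bar> * \<bar>\<epsilon>\<bar>"
      by (simp add: algebra_simps)
    have "\<beta> (f \<epsilon> \<alpha>) - \<epsilon> * m \<alpha> = \<beta> (f \<epsilon> \<alpha> - \<epsilon> *\<^sub>R forcing 1 \<alpha> 0)"
      by (simp add: m linear_diff[OF lin] linear_scale[OF lin])
    then have "\<bar>\<beta> (f \<epsilon> \<alpha>) - \<epsilon> * m \<alpha>\<bar> \<le> norm (f \<epsilon> \<alpha> - \<epsilon> *\<^sub>R forcing 1 \<alpha> 0) * N"
      using N(2)[of "f \<epsilon> \<alpha> - \<epsilon> *\<^sub>R forcing 1 \<alpha> 0"] by simp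
    also have "\<dots> \<le> (M * C * C + M * C) * \<bar>\<epsilon>\<bar> * \<bar>\<epsilon>\<bar> * N" using n N by (intro mult_right_mono) simp_all
    finally show ?thesis by (simp add: ac_simps)
  qed
  define C' where "C' = (M * C * C + M * C) * N"
  have C': "C' \<ge> 0" using M C N by (simp add: C'_def)
  obtain \<epsilon>2 c where \<epsilon>2: "\<epsilon>2 > 0" and c: "c \<ge> 0" and zero0: "\<forall>\<epsilon> b. 0 < \<epsilon> \<and> \<epsilon> \<le> \<epsilon>2 \<and> continuous_on UNIV b \<and>
      (\<forall>\<alpha>. \<bar>b \<alpha> - m \<alpha>\<bar> \<le> C' * \<epsilon>) \<longrightarrow> (\<exists>\<alpha>. \<bar>\<alpha> - \<alpha>0\<bar> \<le> c * \<epsilon> \<and> b \<alpha> = (0 :: real))"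
    using simple_zero_persists[OF m0 dm D C'] by (elim exE conjE) (rule that)
  note zero = zero0[THEN spec, THEN spec, THEN mp]
  have "\<exists>\<alpha>. \<bar>\<alpha> - \<alpha>0\<bar> \<le> c * \<bar>\<epsilon>\<bar> \<and> \<beta> (f \<epsilon> \<alpha>) = 0" if e: "\<bar>\<epsilon>\<bar> \<le> min \<epsilon>1 \<epsilon>2" for \<epsilon>
  \<comment> \<open>At \<epsilon> = 0 division by \<epsilon> says nothing; the estimate itself gives
    \<beta> (f 0 \<alpha>0) = 0.\<close>
  proof (cases "\<epsilon> = 0")
    case True
    have "\<bar>\<beta> (f 0 \<alpha>0)\<bar> \<le> 0" using est[of 0 \<alpha>0] \<epsilon>1 by simp
    then show ?thesis using True by (intro exI[of _ \<alpha>0]) simp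
  next
    case False
    have "\<exists>\<alpha>. \<bar>\<alpha> - \<alpha>0\<bar> \<le> c * \<bar>\<epsilon>\<bar> \<and> \<beta> (f \<epsilon> \<alpha>) / \<epsilon> = 0"
    proof (rule zero, intro conjI allI)
      show "continuous_on UNIV (\<lambda>\<alpha>. \<beta> (f \<epsilon> \<alpha>) / \<epsilon>)"
        using e by (intro continuous_on_divide cont_\<beta> continuous_on_const) (simp_all add: False)
      fix \<alpha>
      have "\<beta> (f \<epsilon> \<alpha>) / \<epsilon> - m \<alpha> = (\<beta> (f \<epsilon> \<alpha>) - \<epsilon> * m \<alpha>) / \<epsilon>" using False by (simp add: field_simps)
      then have "\<bar>\<beta> (f \<epsilon> \<alpha>) / \<epsilon> - m \<alpha>\<bar> = \<bar>\<beta> (f \<epsilon> \<alpha>) - \<epsilon> * m \<alpha>\<bar> / \<bar>\<epsilon>\<bar>" by (simp add: abs_divide)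
      also have "\<dots> \<le> (C' * \<bar>\<epsilon>\<bar> * \<bar>\<epsilon>\<bar>) / \<bar>\<epsilon>\<bar>"
        using est[of \<epsilon> \<alpha>] e unfolding C'_def by (intro divide_right_mono) simp_all
      also have "\<dots> = C' * \<bar>\<epsilon>\<bar>" using False by simp
      finally show "\<bar>\<beta> (f \<epsilon> \<alpha>) / \<epsilon> - m \<alpha>\<bar> \<le> C' * \<bar>\<epsilon>\<bar>" .
    qed (use e False in simp_all)
    then show ?thesis using False by simp
  qed
  then obtain \<alpha> where \<alpha>: "\<And>\<epsilon>. \<bar>\<epsilon>\<bar> \<le> min \<epsilon>1 \<epsilon>2 \<Longrightarrow> \<bar>\<alpha> \<epsilon> - \<alpha>0\<bar> \<le> c * \<bar>\<epsilon>\<bar> \<and> \<beta> (f \<epsilon> (\<alpha> \<epsilon>)) = 0" by metis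
  have "\<exists>\<alpha> \<Phi>. \<bar>\<alpha> - \<alpha>0\<bar> \<le> max c C * \<bar>\<epsilon>\<bar> \<and> (\<forall>t. \<Phi> t \<in> U) \<and>
     (\<forall>t. norm (\<Phi> t - z (t - \<alpha>)) \<le> max c C * \<bar>\<epsilon>\<bar>) \<and> (\<forall>t. (\<Phi> has_vector_derivative F (\<Phi> t) + \<epsilon> *\<^sub>R G t (\<Phi> t)) (at t))"
    if e: "\<bar>\<epsilon>\<bar> \<le> min \<epsilon>1 \<epsilon>2" for \<epsilon>
  proof -
    define a where "a = \<alpha> \<epsilon>"
    define w where "w = W \<epsilon> a"
    have a: "\<bar>a - \<alpha>0\<bar> \<le> c * \<bar>\<epsilon>\<bar>" "\<beta> (forcing \<epsilon> a w) = 0" using \<alpha>[OF e] by (simp_all add: a_def f_def w_def)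
    have e1: "\<bar>\<epsilon>\<bar> \<le> \<epsilon>1" using e by simp
    have w: "norm w \<le> \<rho>" "norm w \<le> C * \<bar>\<epsilon>\<bar>" "R (forcing \<epsilon> a w) = w" using W[OF e1, of a] by (simp_all add: w_def)
    have "solves (\<lambda>t. DF (z t)) (apply_bcontfun (forcing \<epsilon> a w)) (apply_bcontfun w)"
      using sol[of "forcing \<epsilon> a w"] unfolding a(2) w(3) by simp
    note s = this
    have dw: "(w has_vector_derivative F (z t + w t) - F (z t) + \<epsilon> *\<^sub>R G (t + a) (z t + w t)) (at t)" for t
    proof -
      from s have "(w has_vector_derivative DF (z t) (w t) + forcing \<epsilon> a w t) (at t)" by (simp add: solves_def)
      then show ?thesis by (rule has_vector_derivative_eq_rhs) (simp add: forcing w(1))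
    qed
    \<comment> \<open>This undoes the shift: at s = t - a the time s + a of \<open>G\<close> is t
      again.\<close>
    define \<Phi> where "\<Phi> t = z (t + - a) + w (t + - a)" for t
    have "(\<Phi> has_vector_derivative F (\<Phi> t) + \<epsilon> *\<^sub>R G t (\<Phi> t)) (at t)" for t
    proof -
      have "((\<lambda>t. z t + w t) has_vector_derivative F (z s + w s) + \<epsilon> *\<^sub>R G (s + a) (z s + w s)) (at s)" for s
        using has_vector_derivative_add[OF z dw, of s] by simp
      from has_vector_derivative_shift[OF this[of "t + - a"]] show ?thesis by (simp add: \<Phi>_def[abs_def])
    qed
    moreover have "\<Phi> t \<in> U" for t
      unfolding \<Phi>_def using norm_bounded[of w "t + - a"] w(1) by (intro in_tube) linarith
    moreover have "norm (\<Phi> t - z (t - a)) \<le> max c C * \<bar>\<epsilon>\<bar>" for t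
    proof -
      have "norm (\<Phi> t - z (t - a)) \<le> C * \<bar>\<epsilon>\<bar>" using norm_bounded[of w "t - a"] w(2) by (simp add: \<Phi>_def)
      also have "\<dots> \<le> max c C * \<bar>\<epsilon>\<bar>" by (intro mult_right_mono) simp_all
      finally show ?thesis .
    qed
    moreover have "\<bar>a - \<alpha>0\<bar> \<le> max c C * \<bar>\<epsilon>\<bar>"
      using a(1) mult_right_mono[of c "max c C" "\<bar>\<epsilon>\<bar>"] by simp
    ultimately show ?thesis by (intro exI[of _ a] exI[of _ \<Phi>] conjI allI)
  qed
  note main = this
  have e0: "min \<epsilon>1 \<epsilon>2 > 0" and c0: "max c C \<ge> 0" using \<epsilon>1 \<epsilon>2 c by simp_all
  show ?thesis
    by (rule exI[of _ "min \<epsilon>1 \<epsilon>2"], rule conjI[OF e0], rule exI[of _ "max c C"], rule conjI[OF c0],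
        intro allI impI, rule main)
qed

end

subsection \<open>Smoothness, level sets and tangent spaces\<close>

lemma linear_norm_le_Basis_sum:
  fixes f :: "'a::euclidean_space \<Rightarrow> 'b::real_normed_vector"
  assumes "linear f"
  shows "norm (f v) \<le> (\<Sum>b\<in>Basis. norm (f b)) * norm v"
proof -
  have "f v = f (\<Sum>b\<in>Basis. (v \<bullet> b) *\<^sub>R b)" by (simp add: euclidean_representation)
  also have "\<dots> = (\<Sum>b\<in>Basis. (v \<bullet> b) *\<^sub>R f b)" by (simp add: linear_sum[OF assms] linear_scale[OF assms])
  also have "norm \<dots> \<le> (\<Sum>b\<in>Basis. norm (f b) * norm v)"
  proof (rule sum_norm_le)
    fix b :: 'a assume "b \<in> Basis"
    then have "norm (f b) * \<bar>v \<bullet> b\<bar> \<le> norm (f b) * norm v" by (intro mult_left_mono Basis_le_norm) simp_all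
    then show "norm ((v \<bullet> b) *\<^sub>R f b) \<le> norm (f b) * norm v" by (simp add: mult.commute)
  qed
  finally show ?thesis by (simp add: sum_distrib_right)
qed

lemma Cb_on_differentiable: "Cb_on (Suc k) S f \<Longrightarrow> x \<in> S \<Longrightarrow> (f has_derivative frechet_derivative f (at x)) (at x)"
  using frechet_derivative_works by auto

lemma Cb_on_continuous: "Cb_on k S f \<Longrightarrow> continuous_on S f"
proof (cases k)
  case (Suc j)
  assume "Cb_on k S f"
  then have f: "Cb_on (Suc j) S f" using Suc by simp
  show ?thesis
    by (intro continuous_at_imp_continuous_on ballI) (rule has_derivative_continuous[OF Cb_on_differentiable[OF f]])
qed simp

lemma Cb_on_bounded: "Cb_on k S f \<Longrightarrow> \<exists>B\<ge>0. \<forall>x\<in>S. norm (f x) \<le> B"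
proof -
  assume "Cb_on k S f"
  then have "bounded (f ` S)" by (cases k) simp_all
  then obtain B where "\<forall>x\<in>S. norm (f x) \<le> B" by (auto simp: bounded_iff)
  then have "\<forall>x\<in>S. norm (f x) \<le> max B 0" by (auto intro: max.coboundedI1)
  then show ?thesis by (intro exI[of _ "max B 0"]) simp
qed

text \<open>\<open>Cb_on\<close> bounds one directional derivative at a time. Linearity in the
  direction and a finite basis combine these bounds into one for the operator norm.\<close>

lemma Cb_on_derivative_bound:
  fixes f :: "'a::euclidean_space \<Rightarrow> 'b::real_normed_vector"
  assumes "Cb_on (Suc k) S f"
  shows "\<exists>B\<ge>0. \<forall>x\<in>S. \<forall>v. norm (frechet_derivative f (at x) v) \<le> B * norm v"
proof -
  have "\<exists>B\<ge>0. \<forall>x\<in>S. norm (frechet_derivative f (at x) b) \<le> B" for b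
    using assms by (intro Cb_on_bounded[of k]) simp
  then obtain B where B: "\<And>b. B b \<ge> 0" "\<And>b x. x \<in> S \<Longrightarrow> norm (frechet_derivative f (at x) b) \<le> B b" by metis
  have "norm (frechet_derivative f (at x) v) \<le> (\<Sum>b\<in>Basis. B b) * norm v" if x: "x \<in> S" for x v
  proof -
    have "linear (frechet_derivative f (at x))"
      using Cb_on_differentiable[OF assms x] by (rule has_derivative_linear)
    then have "norm (frechet_derivative f (at x) v) \<le> (\<Sum>b\<in>Basis. norm (frechet_derivative f (at x) b)) * norm v"
      by (rule linear_norm_le_Basis_sum)
    also have "\<dots> \<le> (\<Sum>b\<in>Basis. B b) * norm v" by (intro mult_right_mono sum_mono B(2)[OF x]) simp
    finally show ?thesis .
  qed
  moreover have "(\<Sum>b\<in>Basis. B b) \<ge> 0" by (intro sum_nonneg B(1))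
  ultimately show ?thesis by (intro exI[of _ "\<Sum>b\<in>Basis. B b"] conjI ballI allI)
qed

lemma Cb_on_lipschitz:
  fixes f :: "'a::euclidean_space \<Rightarrow> 'b::real_normed_vector"
  assumes "Cb_on (Suc k) S f"
  shows "\<exists>B\<ge>0. \<forall>x y. closed_segment x y \<subseteq> S \<longrightarrow> norm (f x - f y) \<le> B * norm (x - y)"
proof -
  obtain B where B: "B \<ge> 0" "\<forall>x\<in>S. \<forall>v. norm (frechet_derivative f (at x) v) \<le> B * norm v"
    using Cb_on_derivative_bound[OF assms] by blast
  have "norm (f x - f y) \<le> B * norm (x - y)" if s: "closed_segment x y \<subseteq> S" for x y
  proof (rule differentiable_bound[where S = "closed_segment x y" and f' = "\<lambda>x. frechet_derivative f (at x)"])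
    fix u assume "u \<in> closed_segment x y"
    then have u: "u \<in> S" using s by blast
    show "(f has_derivative frechet_derivative f (at u)) (at u within closed_segment x y)"
      by (rule has_derivative_at_withinI[OF Cb_on_differentiable[OF assms u]])
    show "onorm (frechet_derivative f (at u)) \<le> B" using B u by (intro onorm_le) simp
  qed simp_all
  then show ?thesis using B(1) by (intro exI[of _ B] conjI allI impI)
qed

text \<open>The spatial derivative of \<open>G\<close> is the joint derivative in directions (0, v),
  so it inherits bound and continuity from the joint smoothness. The Lipschitz bound on
  \<open>DF\<close> is summed from those on its values at basis vectors.\<close>

lemma Cb_on_2_imp_perturbed_system:
  fixes F :: "'a::euclidean_space \<Rightarrow> 'a" and G :: "real \<Rightarrow> 'a \<Rightarrow> 'a"
  assumes U: "open U" and F: "Cb_on 2 U F" and G: "Cb_on 2 (UNIV \<times> U) (\<lambda>(t, x). G t x)"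
  shows "\<exists>M. perturbed_system F G (\<lambda>x. Blinfun (frechet_derivative F (at x)))
    (\<lambda>t x. Blinfun (frechet_derivative (G t) (at x))) U M"
proof -
  define g where "g = (\<lambda>(t, x). G t x)"
  have two: "2 = Suc (Suc 0)" by simp
  have F2: "Cb_on (Suc (Suc 0)) U F" and g2: "Cb_on (Suc (Suc 0)) (UNIV \<times> U) g"
    using F G unfolding two g_def .
  have F1: "Cb_on (Suc 0) U (\<lambda>x. frechet_derivative F (at x) b)" for b using F2 unfolding Cb_on.simps(2)[of "Suc 0"] by blast
  have g1: "Cb_on (Suc 0) (UNIV \<times> U) (\<lambda>x. frechet_derivative g (at x) b)" for b using g2 unfolding Cb_on.simps(2)[of "Suc 0"] by blast
  define DF where "DF x = Blinfun (frechet_derivative F (at x))" for x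
  define DG where "DG t x = Blinfun (frechet_derivative (G t) (at x))" for t x
  have F': "(F has_derivative frechet_derivative F (at x)) (at x)" if "x \<in> U" for x
    by (rule Cb_on_differentiable[OF F2 that])
  have DF: "blinfun_apply (DF x) = frechet_derivative F (at x)" if "x \<in> U" for x
    unfolding DF_def using F'[OF that] by (intro bounded_linear_Blinfun_apply has_derivative_bounded_linear)
  have G': "(G t has_derivative (\<lambda>v. frechet_derivative g (at (t, x)) (0, v))) (at x)" if "x \<in> U" for t x
  proof -
    have "(g has_derivative frechet_derivative g (at (t, x))) (at (t, x))"
      using that by (intro Cb_on_differentiable[OF g2]) simp
    moreover have "((\<lambda>x. (t, x)) has_derivative (\<lambda>v. (0, v))) (at x)"
      by (intro has_derivative_Pair has_derivative_const has_derivative_ident)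
    ultimately have "((\<lambda>x. g (t, x)) has_derivative (\<lambda>v. frechet_derivative g (at (t, x)) (0, v))) (at x)"
      by (rule has_derivative_compose[rotated])
    then show ?thesis by (simp add: g_def)
  qed
  have DG: "blinfun_apply (DG t x) = (\<lambda>v. frechet_derivative g (at (t, x)) (0, v))" if "x \<in> U" for t x
  proof -
    have "frechet_derivative (G t) (at x) = (\<lambda>v. frechet_derivative g (at (t, x)) (0, v))"
      using frechet_derivative_at[OF G'[OF that]] by simp
    then show ?thesis
      unfolding DG_def using has_derivative_bounded_linear[OF G'[OF that]] by (simp add: bounded_linear_Blinfun_apply)
  qed
  obtain B1 where B1: "B1 \<ge> 0" "\<forall>x\<in>U. \<forall>v. norm (frechet_derivative F (at x) v) \<le> B1 * norm v"
    using Cb_on_derivative_bound[OF F2] by blast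
  have "\<exists>B\<ge>0. \<forall>x y. closed_segment x y \<subseteq> U \<longrightarrow> norm (frechet_derivative F (at x) b - frechet_derivative F (at y) b) \<le> B * norm (x - y)" for b
    by (rule Cb_on_lipschitz[OF F1])
  then obtain L where L: "\<And>b. L b \<ge> 0" "\<And>b x y. closed_segment x y \<subseteq> U \<Longrightarrow>
      norm (frechet_derivative F (at x) b - frechet_derivative F (at y) b) \<le> L b * norm (x - y)" by metis
  define B2 where "B2 = (\<Sum>b\<in>Basis. L b)"
  obtain B3 where B3: "B3 \<ge> 0" "\<forall>x\<in>UNIV \<times> U. norm (g x) \<le> B3" using Cb_on_bounded[OF g2] by blast
  obtain B4 where B4: "B4 \<ge> 0" "\<forall>x\<in>UNIV \<times> U. \<forall>v. norm (frechet_derivative g (at x) v) \<le> B4 * norm v"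
    using Cb_on_derivative_bound[OF g2] by blast
  obtain B5 where B5: "B5 \<ge> 0" "\<forall>x y. closed_segment x y \<subseteq> UNIV \<times> U \<longrightarrow> norm (g x - g y) \<le> B5 * norm (x - y)"
    using Cb_on_lipschitz[OF g2] by blast
  have B2: "B2 \<ge> 0" unfolding B2_def by (intro sum_nonneg L(1))
  define M where "M = B1 + B2 + B3 + B4 + B5 + 1"
  have M: "M > 0" "B1 \<le> M" "B2 \<le> M" "B3 \<le> M" "B4 \<le> M" "B5 \<le> M"
    using B1(1) B2 B3(1) B4(1) B5(1) by (simp_all add: M_def)
  have "perturbed_system F G DF DG U M"
  proof
    show "open U" "M > 0" by (rule U, rule M)
    show "(F has_derivative blinfun_apply (DF x)) (at x)" if "x \<in> U" for x
      using F'[OF that] by (simp add: DF[OF that])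
    show "(G t has_derivative blinfun_apply (DG t x)) (at x)" if "x \<in> U" for t x
      using G'[OF that] by (simp add: DG[OF that])
    show "norm (DF x) \<le> M" if "x \<in> U" for x
    proof (rule norm_blinfun_bound)
      fix v
      have "norm (DF x v) \<le> B1 * norm v" using B1(2) that by (simp add: DF[OF that])
      also have "\<dots> \<le> M * norm v" using M by (intro mult_right_mono) simp_all
      finally show "norm (DF x v) \<le> M * norm v" .
    qed (use M in simp)
    show "norm (DF x - DF y) \<le> M * norm (x - y)" if s: "closed_segment x y \<subseteq> U" for x y
    proof -
      have xy: "x \<in> U" "y \<in> U" using s by auto
      have "norm (DF x - DF y) \<le> (\<Sum>b\<in>Basis. norm ((DF x - DF y) b))" by (rule norm_blinfun_euclidean_le)
      also have "\<dots> \<le> (\<Sum>b\<in>Basis. L b * norm (x - y))"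
        using L(2)[OF s] by (intro sum_mono) (simp add: blinfun.diff_left DF xy)
      also have "\<dots> = B2 * norm (x - y)" by (simp add: B2_def sum_distrib_right)
      also have "\<dots> \<le> M * norm (x - y)" using M by (intro mult_right_mono) simp_all
      finally show ?thesis .
    qed
    show "norm (G t x) \<le> M" if "x \<in> U" for t x
      using B3(2)[rule_format, of "(t, x)"] that M by (simp add: g_def)
    show "norm (DG t x) \<le> M" if "x \<in> U" for t x
    proof (rule norm_blinfun_bound)
      fix v
      have "norm (DG t x v) \<le> B4 * norm (0 :: real, v)"
        using B4(2)[rule_format, of "(t, x)" "(0, v)"] that by (simp add: DG[OF that])
      also have "\<dots> = B4 * norm v" by (simp add: norm_Pair)
      also have "\<dots> \<le> M * norm v" using M by (intro mult_right_mono) simp_all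
      finally show "norm (DG t x v) \<le> M * norm v" .
    qed (use M in simp)
    show "norm (G s x - G t x) \<le> M * \<bar>s - t\<bar>" if "x \<in> U" for s t x
    proof -
      \<comment> \<open>A segment in the time direction keeps x fixed, so it lies in
        \<open>UNIV \<times> U\<close> even where \<open>U\<close> is not convex.\<close>
      have "closed_segment (s, x) (t, x) \<subseteq> UNIV \<times> {x}"
        by (intro closed_segment_subset convex_Times convex_UNIV convex_singleton) simp_all
      then have "closed_segment (s, x) (t, x) \<subseteq> UNIV \<times> U" using that by blast
      then have "norm (g (s, x) - g (t, x)) \<le> B5 * norm ((s, x) - (t, x))" using B5(2) by blast
      also have "\<dots> = B5 * \<bar>s - t\<bar>" by (simp add: norm_Pair)
      also have "\<dots> \<le> M * \<bar>s - t\<bar>" using M by (intro mult_right_mono) simp_all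
      finally show ?thesis by (simp add: g_def)
    qed
    show "continuous_on (UNIV \<times> U) (\<lambda>(t, x). G t x)" using Cb_on_continuous[OF g2] by (simp add: g_def)
    show "continuous_on (UNIV \<times> U) (\<lambda>(t, x). DG t x)"
    proof (rule continuous_on_blinfun_componentwise)
      fix b :: 'a
      have "continuous_on (UNIV \<times> U) (\<lambda>y. frechet_derivative g (at y) (0, b))" by (rule Cb_on_continuous[OF g1])
      then show "continuous_on (UNIV \<times> U) (\<lambda>y. blinfun_apply (case y of (t, x) \<Rightarrow> DG t x) b)"
        by (rule continuous_on_eq) (auto simp: DG)
    qed
  qed
  then show ?thesis unfolding DF_def[abs_def] DG_def[abs_def] by blast
qed

text \<open>With \<open>n = \<nabla>H(q)\<close>, the map \<open>x \<mapsto> x + (H x - H q - n \<bullet> (x - q)) n / |n|\<^sup>2\<close> is a local diffeomorphism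
  whose inverse straightens the level set of \<open>H\<close> through \<open>q\<close>.\<close>

lemma level_set_tangent_vectors:
  fixes H :: "'a::euclidean_space \<Rightarrow> real"
  assumes U: "open U" "q \<in> U" and H: "\<And>x. x \<in> U \<Longrightarrow> GDERIV H x :> N x" and cN: "continuous_on U N"
    and Hq: "H q = 0" and nz: "N q \<noteq> 0" and v: "N q \<bullet> v = 0"
  shows "v \<in> tangent_vectors {x. H x = 0} q"
proof -
  define n where "n = N q"
  \<comment> \<open>Normalized by n \<bullet> m = 1, so that n \<bullet> (f x - q) = H x - H q: in
    the coordinate f the level set lies in a hyperplane.\<close>
  define m where "m = (1 / (n \<bullet> n)) *\<^sub>R n"
  have n: "n \<bullet> n > 0" using nz by (simp add: n_def)
  have mn: "n \<bullet> m = 1" using n by (simp add: m_def)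
  define f where "f x = x + (H x - H q - n \<bullet> (x - q)) *\<^sub>R m" for x
  define f' where "f' x = id_blinfun + (blinfun_scaleR_left m o\<^sub>L blinfun_inner_right (N x - n))" for x
  have f'_apply: "f' x a = a + ((N x - n) \<bullet> a) *\<^sub>R m" for x a
    by (simp add: f'_def blinfun.add_left)
  have df: "(f has_derivative blinfun_apply (f' x)) (at x)" if "x \<in> U" for x
  proof -
    have "(H has_derivative (\<lambda>a. N x \<bullet> a)) (at x)"
      using H[OF that] by (simp add: gderiv_def inner_commute)
    then have "(f has_derivative (\<lambda>a. a + (N x \<bullet> a - 0 - n \<bullet> (a - 0)) *\<^sub>R m)) (at x)"
      unfolding f_def[abs_def] by (intro derivative_intros)
    then show ?thesis by (simp add: f'_apply[abs_def] inner_diff_left)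
  qed
  have cf': "continuous_on U f'"
    unfolding f'_def[abs_def]
    by (intro continuous_on_blinfun_componentwise) (simp add: blinfun.add_left, intro continuous_intros cN)
  have "f' q = id_blinfun" by (rule blinfun_eqI) (simp add: f'_apply n_def)
  then have inv: "id_blinfun o\<^sub>L f' q = id_blinfun" by (simp add: blinfun_eq_iff)
  obtain U' V g g' where V: "open U'" "U' \<subseteq> U" "q \<in> U'" "open V" "f q \<in> V" "homeomorphism U' V f g"
    and dg: "\<And>y. y \<in> V \<Longrightarrow> (g has_derivative g' y) (at y)"
    and g': "\<And>y. y \<in> V \<Longrightarrow> g' y = inv (blinfun_apply (f' (g y)))"
    and bij: "\<And>y. y \<in> V \<Longrightarrow> bij (blinfun_apply (f' (g y)))"
    using inverse_function_theorem[OF U(1) df cf' U(2) inv] by metis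
  have fq: "f q = q" by (simp add: f_def)
  have gU: "g y \<in> U" "f (g y) = y" if "y \<in> V" for y
    using V that by (auto simp: homeomorphism_def)
  have gq: "g q = q" using V fq by (auto simp: homeomorphism_def)
  have cg: "continuous_on V g" using V(6) by (simp add: homeomorphism_def)
  have Hg: "H (g y) = n \<bullet> (y - q)" if "y \<in> V" for y
  proof -
    have "n \<bullet> (f (g y) - q) = H (g y) - H q"
      by (simp add: f_def inner_add_right inner_diff_right mn)
    then show ?thesis using gU(2)[OF that] Hq by simp
  qed
  \<comment> \<open>The part of the chart where N has a positive component along n; there the
    denominator of the velocity \<open>D\<close> is positive.\<close>
  define S where "S = V \<inter> g -` (U \<inter> {x. 0 < N x \<bullet> n})"
  have "open S"
  proof -
    have "open (U \<inter> (\<lambda>x. N x \<bullet> n) -` {0<..})"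
      by (intro continuous_open_preimage continuous_on_inner cN continuous_on_const U(1)) simp
    then have "open (V \<inter> g -` (U \<inter> (\<lambda>x. N x \<bullet> n) -` {0<..}))"
      by (rule continuous_open_preimage[OF cg V(4)])
    moreover have "U \<inter> (\<lambda>x. N x \<bullet> n) -` {0<..} = U \<inter> {x. 0 < N x \<bullet> n}" by auto
    ultimately show ?thesis by (simp add: S_def)
  qed
  moreover have "q \<in> S" using V(5) n U(2) by (simp add: S_def fq gq n_def)
  moreover have "continuous_on UNIV (\<lambda>s::real. q + s *\<^sub>R v)" by (intro continuous_intros)
  ultimately have "open ((\<lambda>s::real. q + s *\<^sub>R v) -` S)" "0 \<in> (\<lambda>s::real. q + s *\<^sub>R v) -` S"
    by (auto intro: open_vimage)
  then obtain \<delta> where \<delta>: "\<delta> > 0" "ball 0 \<delta> \<subseteq> (\<lambda>s::real. q + s *\<^sub>R v) -` S" by (rule openE)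
  have inS: "q + s *\<^sub>R v \<in> S" if "s \<in> {-\<delta><..<\<delta>}" for s
  proof -
    have "s \<in> ball 0 \<delta>" using that by (simp add: dist_real_def abs_less_iff)
    then show ?thesis using \<delta>(2) by blast
  qed
  define c where "c s = g (q + s *\<^sub>R v)" for s
  \<comment> \<open>The velocity of g along v is v minus a multiple of n, and its orthogonality to N
    fixes the multiple. Continuity of the velocity is read off from this formula.\<close>
  define D where "D s = v - ((N (c s) \<bullet> v) / (N (c s) \<bullet> n)) *\<^sub>R n" for s
  have dc: "(c has_vector_derivative D s) (at s)" if s: "s \<in> {-\<delta><..<\<delta>}" for s
  proof -
    define y where "y = q + s *\<^sub>R v"
    have y: "y \<in> V" "0 < N (c s) \<bullet> n" using inS[OF s] by (simp_all add: S_def y_def c_def)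
    have "((\<lambda>s. q + s *\<^sub>R v) has_vector_derivative v) (at s)"
      by (auto intro!: derivative_eq_intros)
    moreover have "(g has_derivative g' y) (at (q + s *\<^sub>R v))" using dg[OF y(1)] by (simp add: y_def)
    ultimately have 1: "(c has_vector_derivative g' y v) (at s)"
      using vector_derivative_diff_chain_within[of "\<lambda>s. q + s *\<^sub>R v" v s UNIV g "g' y"]
      by (simp add: c_def[abs_def] o_def has_derivative_at_withinI)
    define a where "a = g' y v"
    have "f' (c s) a = v"
      unfolding a_def g'[OF y(1)] c_def y_def[symmetric] using bij[OF y(1)] by (simp add: bij_is_surj surj_f_inv_f)
    then have eq: "a + ((N (c s) - n) \<bullet> a) *\<^sub>R m = v" by (simp add: f'_apply)
    define k where "k = ((N (c s) - n) \<bullet> a) / (n \<bullet> n)"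
    have a: "a = v - k *\<^sub>R n"
    proof -
      have "((N (c s) - n) \<bullet> a) *\<^sub>R m = k *\<^sub>R n" by (simp add: m_def k_def)
      then show ?thesis using eq by (simp add: eq_diff_eq)
    qed
    have "n \<bullet> v = n \<bullet> a + (N (c s) - n) \<bullet> a" by (subst eq[symmetric]) (simp add: inner_add_right mn)
    then have "N (c s) \<bullet> a = 0" using v by (simp add: n_def inner_diff_left)
    then have "N (c s) \<bullet> v = k * (N (c s) \<bullet> n)" by (simp add: a inner_diff_right)
    then have "k = (N (c s) \<bullet> v) / (N (c s) \<bullet> n)" using y(2) by simp
    then have "D s = g' y v" using a by (simp add: D_def a_def)
    then show ?thesis using 1 by simp
  qed
  have cc: "continuous_on {-\<delta><..<\<delta>} c"
    using dc by (intro continuous_at_imp_continuous_on ballI) (rule has_vector_derivative_continuous)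
  have cNc: "continuous_on {-\<delta><..<\<delta>} (\<lambda>s. N (c s))"
    by (rule continuous_on_compose2[OF cN cc]) (use inS gU in \<open>auto simp: S_def c_def\<close>)
  have "continuous_on {-\<delta><..<\<delta>} D"
    unfolding D_def[abs_def]
  proof (intro continuous_on_diff continuous_on_scaleR continuous_on_divide continuous_on_inner cNc continuous_on_const ballI)
    show "N (c s) \<bullet> n \<noteq> 0" if "s \<in> {-\<delta><..<\<delta>}" for s
      using inS[OF that] by (simp add: S_def c_def)
  qed
  then have "c C1_differentiable_on {-\<delta><..<\<delta>}"
    unfolding C1_differentiable_on_def using dc by blast
  moreover have "c 0 = q" by (simp add: c_def gq)
  moreover have "\<forall>s\<in>{-\<delta><..<\<delta>}. c s \<in> {x. H x = 0}"
  proof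
    fix s assume "s \<in> {-\<delta><..<\<delta>}"
    from inS[OF this] show "c s \<in> {x. H x = 0}"
      using Hg[of "q + s *\<^sub>R v"] v by (simp add: S_def c_def n_def)
  qed
  moreover have "(c has_vector_derivative v) (at 0)"
  proof -
    have "D 0 = v" using v by (simp add: D_def \<open>c 0 = q\<close>)
    then show ?thesis using dc[of 0] \<delta>(1) by simp
  qed
  ultimately show ?thesis
    unfolding tangent_vectors_def using \<delta>(1)
    by (intro CollectI exI[of _ \<delta>] conjI exI[of _ c])
qed

text \<open>Second differences of \<open>h\<close> are symmetric in the two increments.\<close>

lemma symmetric_hessian:
  fixes h :: "'a::euclidean_space \<Rightarrow> real" and g :: "'a \<Rightarrow> 'a" and B :: "'a \<Rightarrow>\<^sub>L 'a"
  assumes r: "r > 0" and h: "\<And>y. y \<in> cball x r \<Longrightarrow> GDERIV h y :> g y"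
    and g: "\<And>y z r'. r' \<le> r \<Longrightarrow> norm (y - x) \<le> r' \<Longrightarrow> norm (z - x) \<le> r' \<Longrightarrow> norm (g y - g z - B (y - z)) \<le> M * r' * norm (y - z)"
  shows "B a \<bullet> b = B b \<bullet> a"
proof -
  define n where "n = norm a + norm b + 1"
  have n: "n > 0" by (simp add: n_def add_nonneg_pos)
  \<comment> \<open>By the mean value theorem in the direction a, the second difference equals t^2
    (B b \<bullet> a) up to O(t^3). The variables a and b are bound afresh because the estimate is
    applied in both orders.\<close>
  have half: "\<bar>(h (x + t *\<^sub>R a + t *\<^sub>R b) - h (x + t *\<^sub>R a)) - (h (x + t *\<^sub>R b) - h x) - t * (t * (B b \<bullet> a))\<bar>
      \<le> t * (t * (t * (\<bar>M\<bar> * n * n * n)))"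
    if t: "0 < t" "t * n \<le> r" and ab: "norm a + norm b \<le> n" for t a b
  proof -
    have na: "norm a \<le> n" and nb: "norm b \<le> n"
      using ab norm_ge_zero[of a] norm_ge_zero[of b] by linarith+
    define u where "u s = h (x + s *\<^sub>R a + t *\<^sub>R b) - h (x + s *\<^sub>R a)" for s
    have near: "norm (s *\<^sub>R a) \<le> t * n" "norm (s *\<^sub>R a + t *\<^sub>R b) \<le> t * n" if "0 \<le> s" "s \<le> t" for s
    proof -
      have "s * norm a \<le> t * norm a" using that by (intro mult_right_mono) simp_all
      moreover have "t * (norm a + norm b) \<le> t * n" using t ab by (intro mult_left_mono) simp_all
      moreover have "0 \<le> t * norm b" using t by simp
      ultimately have le: "s * norm a \<le> t * n" "s * norm a + t * norm b \<le> t * n" by (simp_all add: distrib_left)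
      show "norm (s *\<^sub>R a) \<le> t * n" using le(1) that by simp
      show "norm (s *\<^sub>R a + t *\<^sub>R b) \<le> t * n" using le(2) that t by (intro norm_triangle_le) simp
    qed
    have du: "(u has_real_derivative (g (x + s *\<^sub>R a + t *\<^sub>R b) - g (x + s *\<^sub>R a)) \<bullet> a) (at s)" if s: "0 \<le> s" "s \<le> t" for s
    proof -
      have 1: "((\<lambda>s. h (x + s *\<^sub>R a + w)) has_real_derivative g (x + s *\<^sub>R a + w) \<bullet> a) (at s)"
        if "norm (s *\<^sub>R a + w) \<le> t * n" for w
      proof -
        have "x + s *\<^sub>R a + w \<in> cball x r"
        proof -
          have "dist x (x + s *\<^sub>R a + w) = norm (- (s *\<^sub>R a + w))"
            unfolding dist_norm by (rule arg_cong[where f = norm]) simp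
          then show ?thesis using that t(2) by (simp only: mem_cball norm_minus_cancel)
        qed
        then have "(h has_derivative (\<lambda>v. v \<bullet> g (x + s *\<^sub>R a + w))) (at (x + s *\<^sub>R a + w))"
          using h by (simp add: gderiv_def)
        moreover have "((\<lambda>s. x + s *\<^sub>R a + w) has_derivative (\<lambda>k. k *\<^sub>R a)) (at s)"
          by (auto intro!: derivative_eq_intros)
        ultimately have "((\<lambda>s. h (x + s *\<^sub>R a + w)) has_derivative (\<lambda>k. (k *\<^sub>R a) \<bullet> g (x + s *\<^sub>R a + w))) (at s)"
          by (rule has_derivative_compose[rotated])
        then show ?thesis
          unfolding has_field_derivative_def
          by (rule has_derivative_eq_rhs) (simp add: fun_eq_iff inner_commute mult.commute)
      qed
      show ?thesis
        unfolding u_def[abs_def] using DERIV_diff[OF 1[of "t *\<^sub>R b"] 1[of 0]] near[OF s] by (simp add: inner_diff_left)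
    qed
    obtain \<xi> where \<xi>: "0 < \<xi>" "\<xi> < t" "u t - u 0 = (t - 0) * ((g (x + \<xi> *\<^sub>R a + t *\<^sub>R b) - g (x + \<xi> *\<^sub>R a)) \<bullet> a)"
      using MVT2[OF t(1), of u "\<lambda>s. (g (x + s *\<^sub>R a + t *\<^sub>R b) - g (x + s *\<^sub>R a)) \<bullet> a"] du by blast
    define e where "e = g (x + \<xi> *\<^sub>R a + t *\<^sub>R b) - g (x + \<xi> *\<^sub>R a) - B (t *\<^sub>R b)"
    have "norm e \<le> M * (t * n) * norm (x + \<xi> *\<^sub>R a + t *\<^sub>R b - (x + \<xi> *\<^sub>R a))"
      using g[OF t(2), of "x + \<xi> *\<^sub>R a + t *\<^sub>R b" "x + \<xi> *\<^sub>R a"] near[of \<xi>] \<xi> by (simp add: e_def add.assoc)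
    also have "\<dots> = M * (t * n) * (t * norm b)" using t by simp
    also have "\<dots> \<le> \<bar>M\<bar> * (t * n) * (t * n)"
      using t n nb by (intro mult_mono mult_nonneg_nonneg) simp_all
    finally have e: "norm e \<le> \<bar>M\<bar> * (t * n) * (t * n)" .
    have "(h (x + t *\<^sub>R a + t *\<^sub>R b) - h (x + t *\<^sub>R a)) - (h (x + t *\<^sub>R b) - h x) = u t - u 0" by (simp add: u_def)
    also have "u t - u 0 = t * (e \<bullet> a + t * (B b \<bullet> a))"
      unfolding \<xi>(3) e_def by (simp add: inner_diff_left blinfun.scaleR_right)
    finally have "(h (x + t *\<^sub>R a + t *\<^sub>R b) - h (x + t *\<^sub>R a)) - (h (x + t *\<^sub>R b) - h x) - t * (t * (B b \<bullet> a)) = t * (e \<bullet> a)"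
      by (simp add: algebra_simps)
    moreover have "\<bar>e \<bullet> a\<bar> \<le> \<bar>M\<bar> * (t * n) * (t * n) * n"
    proof -
      have "\<bar>e \<bullet> a\<bar> \<le> norm e * norm a" by (rule Cauchy_Schwarz_ineq2)
      also have "\<dots> \<le> \<bar>M\<bar> * (t * n) * (t * n) * n"
        using e t n na by (intro mult_mono) simp_all
      finally show ?thesis .
    qed
    ultimately show ?thesis using t(1) by (simp add: abs_mult ac_simps)
  qed
  show ?thesis
  proof (rule ccontr)
    define k where "k = \<bar>M\<bar> * n * n * n"
    define d where "d = \<bar>B b \<bullet> a - B a \<bullet> b\<bar>"
    assume "B a \<bullet> b \<noteq> B b \<bullet> a"
    then have d: "d > 0" by (simp add: d_def)
    have k: "k \<ge> 0" using n by (simp add: k_def)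
    define j where "j = 2 * k + 1"
    have j: "j > 0" using k by (simp add: j_def)
    \<comment> \<open>The two values to be compared differ by t^2 d, while the errors add up to 2 k
      t^3; for this t the latter is at most half of the former.\<close>
    define t where "t = min (r / n) (d / (2 * j))"
    have t: "t > 0" "t * n \<le> r" "t * j \<le> d / 2"
    proof -
      show "t > 0" using r n d j by (simp add: t_def)
      have "t * n \<le> r / n * n" using n by (intro mult_right_mono) (simp_all add: t_def)
      then show "t * n \<le> r" using n by simp
      have "t * j \<le> d / (2 * j) * j" using j by (intro mult_right_mono) (simp_all add: t_def)
      also have "\<dots> = d / 2" using j by simp
      finally show "t * j \<le> d / 2" .
    qed
    define q where "q = h (x + t *\<^sub>R a + t *\<^sub>R b) - h (x + t *\<^sub>R a) - (h (x + t *\<^sub>R b) - h x)"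
    have sw: "x + t *\<^sub>R b + t *\<^sub>R a = x + t *\<^sub>R a + t *\<^sub>R b" by (simp only: ac_simps)
    have q': "h (x + t *\<^sub>R b + t *\<^sub>R a) - h (x + t *\<^sub>R b) - (h (x + t *\<^sub>R a) - h x) = q"
      unfolding sw q_def by linarith
    have nn: "norm a + norm b \<le> n" "norm b + norm a \<le> n" by (simp_all add: n_def)
    have 1: "\<bar>q - t * (t * (B b \<bullet> a))\<bar> \<le> t * (t * (t * k))"
      using half[OF t(1,2) nn(1)] unfolding q_def k_def .
    have 2: "\<bar>q - t * (t * (B a \<bullet> b))\<bar> \<le> t * (t * (t * k))"
      using half[OF t(1,2) nn(2)] unfolding q' k_def .
    have "\<bar>t * (t * (B b \<bullet> a)) - t * (t * (B a \<bullet> b))\<bar> \<le> 2 * (t * (t * (t * k)))" using 1 2 by linarith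
    moreover have "t * (t * (B b \<bullet> a)) - t * (t * (B a \<bullet> b)) = t * (t * (B b \<bullet> a - B a \<bullet> b))"
      by (simp only: right_diff_distrib)
    moreover have "\<bar>t * (t * (B b \<bullet> a - B a \<bullet> b))\<bar> = t * (t * d)" using t(1) by (simp only: abs_mult d_def abs_of_pos)
    moreover have "2 * (t * (t * (t * k))) = t * (t * (t * (2 * k)))" by (simp only: ac_simps)
    ultimately have "t * (t * d) \<le> t * (t * (t * (2 * k)))" by (simp only:)
    then have "d \<le> t * (2 * k)" using t(1) by (simp only: mult_le_cancel_left_pos)
    also have "\<dots> \<le> t * j" using t(1) by (intro mult_left_mono) (simp_all add: j_def)
    finally show False using t(3) d by linarith
  qed
qed

section \<open>Tangent vectors of the invariant manifolds as initial values of bounded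
  solutions\<close>

lemma forward_orbit_toD:
  assumes "forward_orbit_to f p w"
  shows "continuous_on {0..} w" "t > 0 \<Longrightarrow> (w has_vector_derivative f (w t)) (at t)" "(w \<longlongrightarrow> p) at_top"
proof -
  have d: "(w has_vector_derivative f (w t)) (at t within {0..})" if "t \<ge> 0" for t
    using assms that by (simp add: forward_orbit_to_def)
  show "continuous_on {0..} w"
    unfolding continuous_on_eq_continuous_within
    by (intro ballI has_vector_derivative_continuous[OF d]) simp
  show "(w has_vector_derivative f (w t)) (at t)" if "t > 0"
  proof -
    have "at t within {0..} = at t" using that by (intro at_within_interior) simp
    then show ?thesis using d[of t] that by simp
  qed
  show "(w \<longlongrightarrow> p) at_top" using assms by (simp add: forward_orbit_to_def)
qed

lemma tangent_unstable_reflect: "tangent_unstable f p q \<subseteq> tangent_stable (\<lambda>x. - f x) p q"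
proof
  fix v assume "v \<in> tangent_unstable f p q"
  then obtain \<delta> w where \<delta>: "\<delta> > 0" and w0: "w 0 0 = q" and w: "\<And>s. s \<in> {-\<delta><..<\<delta>} \<Longrightarrow> backward_orbit_to f p (w s)"
    and u: "\<And>s. s \<in> {-\<delta><..<\<delta>} \<Longrightarrow> uniform_limit {..0} w (w s) (at s)"
    and c: "(\<lambda>s. w s 0) C1_differentiable_on {-\<delta><..<\<delta>}" "((\<lambda>s. w s 0) has_vector_derivative v) (at 0)"
    unfolding tangent_unstable_def by blast
  have "forward_orbit_to (\<lambda>x. - f x) p (\<lambda>t. w s (- t))" if s: "s \<in> {-\<delta><..<\<delta>}" for s
    unfolding forward_orbit_to_def
  proof (intro conjI allI impI)
    have b: "(w s has_vector_derivative f (w s t)) (at t within {..0})" if "t \<le> 0" for t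
      using w[OF s] that by (simp add: backward_orbit_to_def)
    have "(w s \<longlongrightarrow> p) at_bot" using w[OF s] by (simp add: backward_orbit_to_def)
    then show "((\<lambda>t. w s (- t)) \<longlongrightarrow> p) at_top" by (simp add: filterlim_at_bot_mirror)
    fix t :: real assume t: "t \<ge> 0"
    have "(uminus has_vector_derivative (- 1 :: real)) (at t within {0..})"
      by (auto intro!: derivative_eq_intros)
    moreover have "(w s has_vector_derivative f (w s (- t))) (at (- t) within uminus ` {0..})"
      using b[of "- t"] t by simp
    ultimately show "((\<lambda>t. w s (- t)) has_vector_derivative - f (w s (- t))) (at t within {0..})"
      using vector_diff_chain_within[of uminus "- 1" t "{0..}" "w s" "f (w s (- t))"] by (simp add: o_def)
  qed
  moreover have "uniform_limit {0..} (\<lambda>s t. w s (- t)) (\<lambda>t. w s (- t)) (at s)" if s: "s \<in> {-\<delta><..<\<delta>}" for s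
  proof (rule uniform_limitI)
    fix e :: real assume "e > 0"
    from uniform_limitD[OF u[OF s] this]
    have "\<forall>\<^sub>F x in at s. \<forall>t\<in>{..0}. dist (w x t) (w s t) < e" .
    then show "\<forall>\<^sub>F x in at s. \<forall>t\<in>{0..}. dist (w x (- t)) (w s (- t)) < e"
      by eventually_elim simp
  qed
  ultimately show "v \<in> tangent_stable (\<lambda>x. - f x) p q"
    unfolding tangent_stable_def using \<delta> w0 c
    by (intro CollectI exI[of _ \<delta>] conjI exI[of _ "\<lambda>s t. w s (- t)"] ballI) simp_all
qed

context perturbed_system
begin

lemma F_lip:
  assumes r: "cball z r \<subseteq> U" and a: "norm (x - z) \<le> r" "norm (y - z) \<le> r"
  shows "norm (F x - F y) \<le> M * norm (x - y)"
proof (rule differentiable_bound[where f' = "\<lambda>x. blinfun_apply (DF x)" and S = "cball z r"])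
  fix u assume "u \<in> cball z r"
  then have u: "u \<in> U" using r by blast
  show "(F has_derivative blinfun_apply (DF u)) (at u within cball z r)"
    by (rule has_derivative_at_withinI[OF F_deriv[OF u]])
  show "onorm (blinfun_apply (DF u)) \<le> M" using DF_bound[OF u] by (simp add: norm_blinfun.rep_eq)
qed (use a in \<open>simp_all add: dist_norm norm_minus_commute\<close>)

end

context perturbed_curve
begin

lemma bounded_coefficients_linearization: "bounded_coefficients (\<lambda>t. DF (z t)) M"
proof
  show "continuous_on UNIV (\<lambda>t. DF (z t))"
    by (rule continuous_on_compose2[OF DF_cont z_cont]) (use curve_in in blast)
qed (rule DF_bound[OF curve_in])

text \<open>The Lipschitz bound of F holds on balls inside \<open>U\<close>, and w is not known to
  stay near z. Agreement is therefore continued: beyond the last time t0 of agreement on [0, t] the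
  two stay within \<open>\<rho>\<close> for a while, and Gronwall extends the agreement past
  t0.\<close>

lemma forward_orbit_unique:
  assumes z: "\<And>t. (z has_vector_derivative F (z t)) (at t)"
    and w: "continuous_on {0..} w" "\<And>t. t > 0 \<Longrightarrow> (w has_vector_derivative F (w t)) (at t)" "w 0 = z 0"
    and t: "t \<ge> 0"
  shows "w t = z t"
proof (rule ccontr)
  assume ne: "w t \<noteq> z t"
  define d where "d s = w s - z s" for s
  have cd: "continuous_on {0..} d"
    unfolding d_def[abs_def] by (intro continuous_on_diff w continuous_on_subset[OF z_cont]) simp
  have cdt: "continuous_on {0..t} (\<lambda>s. norm (d s))"
    by (intro continuous_on_norm continuous_on_subset[OF cd]) simp
  define S where "S = {0..t} \<inter> (\<lambda>s. norm (d s)) -` {0}"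
  have "closed S" unfolding S_def by (intro continuous_closed_preimage cdt) simp_all
  then have "compact ({0..t} \<inter> S)" by (intro compact_Int_closed) simp_all
  moreover have "{0..t} \<inter> S = S" by (simp add: S_def inf.absorb2 inf.left_idem)
  moreover have "0 \<in> S" using t w(3) by (simp add: S_def d_def)
  ultimately obtain t0 where t0: "t0 \<in> S" "\<And>s. s \<in> S \<Longrightarrow> s \<le> t0"
    using compact_attains_sup[of S] by force
  have t0': "0 \<le> t0" "t0 \<le> t" "d t0 = 0" using t0(1) by (simp_all add: S_def)
  have "t0 \<noteq> t" using ne t0'(3) by (auto simp: d_def)
  then have lt: "t0 < t" using t0' by simp
  \<comment> \<open>\<open>max s 0\<close> extends d continuously to negative times, so that the
    two-sided limit exists also when t0 = 0.\<close>
  have "isCont (\<lambda>s. norm (d (max s 0))) t0"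
  proof -
    have "continuous_on UNIV (\<lambda>s. norm (d (max s 0)))"
      by (intro continuous_on_norm continuous_on_compose2[OF cd] continuous_on_max continuous_on_id continuous_on_const) auto
    then show ?thesis by (simp add: continuous_on_eq_continuous_at)
  qed
  then have "((\<lambda>s. norm (d (max s 0))) \<longlongrightarrow> norm (d (max t0 0))) (at t0)" by (simp add: isCont_def)
  then have "((\<lambda>s. norm (d (max s 0))) \<longlongrightarrow> 0) (at t0)" using t0' by (simp add: max_def)
  then have "\<forall>\<^sub>F s in at t0. norm (d (max s 0)) < \<rho>" using \<rho> by (rule order_tendstoD)
  then obtain e where e: "e > 0" "\<And>s. s \<noteq> t0 \<Longrightarrow> dist s t0 < e \<Longrightarrow> norm (d (max s 0)) < \<rho>"
    unfolding eventually_at by auto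
  define t1 where "t1 = min t (t0 + e / 2)"
  have t1: "t0 < t1" "t1 \<le> t" "t1 < t0 + e" using lt e by (simp_all add: t1_def min_less_iff_disj)
  have "norm (d t1) \<le> exp (M * (t1 - t0)) * norm (d t0)"
  proof (rule gronwall_homogeneous(1)[where x' = "\<lambda>s. F (w s) - F (z s)"])
    show "continuous_on {t0..t1} d" by (rule continuous_on_subset[OF cd]) (use t0' in auto)
    fix s assume s: "t0 < s" "s < t1"
    then have s0: "s > 0" using t0' by simp
    show "(d has_vector_derivative F (w s) - F (z s)) (at s)"
      unfolding d_def[abs_def] by (intro has_vector_derivative_diff w(2)[OF s0] z)
    have "norm (d (max s 0)) < \<rho>" using s t1 by (intro e(2)) (simp_all add: dist_real_def)
    then have "norm (w s - z s) \<le> \<rho>" using s0 by (simp add: d_def max_def)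
    then show "norm (F (w s) - F (z s)) \<le> M * norm (d s)"
      unfolding d_def using \<rho> by (intro F_lip[OF tube[of s]]) simp_all
  qed (use t1 in simp)
  then have "t1 \<in> S" using t0' t1 by (simp add: S_def)
  then show False using t0(2) t1(1) by force
qed

text \<open>A tangent vector is the limit of the quotients (w s 0 - z 0) / s. Uniform closeness of
  the orbits makes their difference a solution of the variational equation up to a remainder that is
  small relative to the initial distance. Each quotient is thus almost in the stable space, and a
  subspace is closed.\<close>

lemma tangent_stable_subset:
  assumes z: "\<And>t. (z has_vector_derivative F (z t)) (at t)"
    and lim: "(z \<longlongrightarrow> p) at_top" and p: "p \<in> U" and inv: "bounded_inverse (\<lambda>_. DF p) K"
  shows "tangent_stable F p (z 0) \<subseteq> stable_space (\<lambda>t. DF (z t))"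
proof
  let ?A = "\<lambda>t. DF (z t)"
  interpret A: bounded_coefficients ?A M by (rule bounded_coefficients_linearization)
  have limA: "(?A \<longlongrightarrow> DF p) at_top"
    by (rule continuous_on_tendsto_compose[OF DF_cont lim p]) (simp add: curve_in)
  fix v assume "v \<in> tangent_stable F p (z 0)"
  then obtain \<delta> w where \<delta>: "\<delta> > 0" and w0: "w 0 0 = z 0" and w: "\<And>s. s \<in> {-\<delta><..<\<delta>} \<Longrightarrow> forward_orbit_to F p (w s)"
    and u: "\<And>s. s \<in> {-\<delta><..<\<delta>} \<Longrightarrow> uniform_limit {0..} w (w s) (at s)"
    and dv: "((\<lambda>s. w s 0) has_vector_derivative v) (at 0)"
    unfolding tangent_stable_def by blast
  have o: "forward_orbit_to F p (w 0)" using w[of 0] \<delta> by simp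
  have w00: "w 0 t = z t" if "t \<ge> 0" for t
    by (rule forward_orbit_unique[OF z forward_orbit_toD(1)[OF o] forward_orbit_toD(2)[OF o] w0 that])
  obtain C where C: "C > 0" and est: "\<forall>x r H B. continuous_on {0..} x \<and>
     (\<forall>t>0. (x has_vector_derivative ?A t (x t) + r t) (at t)) \<and> continuous_on {0<..} r \<and>
     (\<forall>t>0. norm (r t) \<le> H) \<and> (\<forall>t\<ge>0. norm (x t) \<le> B) \<longrightarrow>
     (\<forall>t\<ge>0. norm (x t) \<le> C * (norm (x 0) + H))"
    using A.half_line_estimate[OF limA inv] by (elim exE conjE) (rule that)
  obtain c where c: "bounded_linear c" "\<And>h. bounded (A.flow h (c h) ` {0..})"
    using A.half_line_solution[OF limA inv] by blast
  obtain N where N: "N > 0" "\<And>h. norm (c h) \<le> norm h * N" using bounded_linear.pos_bounded[OF c(1)] by blast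
  \<comment> \<open>b is the initial value of a bounded solution driven by the remainder;
    subtracting that solution from w s - z leaves a bounded homogeneous one. The bound on b is
    linear in the initial distance and has the extra factor \<eta>, which survives division by
    s.\<close>
  have key: "\<exists>b. norm b \<le> N * (M * \<eta> * (2 * C * norm (w s 0 - z 0))) \<and> w s 0 - z 0 - b \<in> stable_space ?A"
    if s: "s \<in> {-\<delta><..<\<delta>}" and \<eta>: "0 \<le> \<eta>" "\<eta> \<le> \<rho>" "C * (M * \<eta>) \<le> 1/2"
      and near: "\<And>t. t \<ge> 0 \<Longrightarrow> norm (w s t - z t) \<le> \<eta>" for s \<eta>
  proof -
    note ws = forward_orbit_toD[OF w[OF s]]
    define d where "d t = w s t - z t" for t
    define r where "r t = F (w s t) - F (z t) - DF (z t) (d t)" for t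
    have cd: "continuous_on {0..} d"
      unfolding d_def[abs_def] by (intro continuous_on_diff ws(1) continuous_on_subset[OF z_cont]) simp
    have wU: "w s t \<in> U" if "t \<ge> 0" for t
    proof -
      have "w s t \<in> cball (z t) \<rho>" using near[OF that] \<eta>(2) by (simp add: dist_norm norm_minus_commute)
      then show ?thesis using tube[of t] by blast
    qed
    have cr: "continuous_on {0..} r"
      unfolding r_def[abs_def]
      by (intro continuous_on_diff continuous_on_compose2[OF F_cont ws(1)] continuous_on_compose2[OF F_cont continuous_on_subset[OF z_cont]]
          bounded_bilinear.continuous_on[OF bounded_bilinear_blinfun_apply] continuous_on_subset[OF A.cont] cd)
        (use wU curve_in in \<open>simp_all add: image_subset_iff\<close>)
    have cr': "continuous_on {0<..} r" by (rule continuous_on_subset[OF cr]) auto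
    have rb: "norm (r t) \<le> M * \<eta> * norm (d t)" if "t \<ge> 0" for t
    proof -
      have "cball (z t) \<eta> \<subseteq> U" using tube[of t] \<eta>(2) by (meson cball_subset_cball_iff order_trans subset_cball)
      then show ?thesis using linearization_error[of "z t" \<eta> "w s t" "z t"] near[OF that] \<eta>(1)
        by (simp add: r_def d_def)
    qed
    have dd: "(d has_vector_derivative ?A t (d t) + r t) (at t)" if "t > 0" for t
      unfolding d_def[abs_def] using has_vector_derivative_diff[OF ws(2)[OF that] z]
      by (rule has_vector_derivative_eq_rhs) (simp add: r_def d_def)
    \<comment> \<open>The remainder is at most M \<eta> B, and C M \<eta> \<le> 1/2 lets the
      half-line estimate absorb it: B is at most 2 C times the initial distance.\<close>
    define B where "B = (SUP t\<in>{0..}. norm (d t))"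
    have bdd: "bdd_above ((\<lambda>t. norm (d t)) ` {0..})"
      using near by (intro bdd_aboveI2[where M = \<eta>]) (simp add: d_def)
    have B: "norm (d t) \<le> B" if "t \<ge> 0" for t
      unfolding B_def using that bdd by (intro cSUP_upper) simp_all
    have Mn: "0 \<le> M * \<eta>" using M \<eta> by simp
    have B0: "0 \<le> B" using order_trans[OF norm_ge_zero B[of 0]] by simp
    have rB: "norm (r t) \<le> M * \<eta> * B" if "t \<ge> 0" for t
      using rb[OF that] mult_left_mono[OF B[OF that] Mn] by linarith
    have "norm (d t) \<le> C * (norm (d 0) + M * \<eta> * B)" if "t \<ge> 0" for t
      using that cd dd cr' rB B
      by (intro est[rule_format, of d r "M * \<eta> * B" B t] conjI allI impI) simp_all
    then have "B \<le> C * (norm (d 0) + M * \<eta> * B)" unfolding B_def[symmetric]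
      by (subst B_def) (intro cSUP_least, simp_all)
    also have "\<dots> = C * norm (d 0) + (C * (M * \<eta>)) * B" by (simp add: algebra_simps)
    also have "\<dots> \<le> C * norm (d 0) + 1/2 * B" using \<eta>(3) B0 by (intro add_left_mono mult_right_mono)
    finally have B2: "B \<le> 2 * C * norm (d 0)" by simp
    \<comment> \<open>The remainder is continued to negative times by its value at 0, which gives an
      element of the space of bounded continuous functions.\<close>
    define h where "h = Bcontfun (\<lambda>t. r (max t 0))"
    have h: "apply_bcontfun h = (\<lambda>t. r (max t 0))"
      unfolding h_def
      by (intro Bcontfun_inverse bcontfun_normI[where b = "M * \<eta> * B"] continuous_on_compose2[OF cr]
          continuous_on_max continuous_on_id continuous_on_const rB) auto
    have hn: "norm h \<le> M * \<eta> * (2 * C * norm (d 0))"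
    proof (rule norm_bound)
      fix t
      have "norm (h t) \<le> M * \<eta> * B" unfolding h by (rule rB) simp
      also have "\<dots> \<le> M * \<eta> * (2 * C * norm (d 0))" using B2 Mn by (rule mult_left_mono)
      finally show "norm (h t) \<le> M * \<eta> * (2 * C * norm (d 0))" .
    qed
    define x where "x = A.flow h (c h)"
    have x: "x 0 = c h" "(x has_vector_derivative ?A t (x t) + h t) (at t)" for t
      using A.flow[of h "c h"] by (simp_all add: x_def solves_def)
    have cx: "continuous_on I x" for I unfolding x_def by (rule solves_continuous[OF A.flow(2)])
    obtain Bx where Bx: "\<And>t. t \<ge> 0 \<Longrightarrow> norm (x t) \<le> Bx" using c(2)[of h] by (auto simp: bounded_iff x_def)
    define y0 where "y0 = d 0 - c h"
    have y: "A.flow 0 y0 t = d t - x t" if t: "t \<ge> 0" for t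
    proof -
      define e where "e t = A.flow 0 y0 t - (d t - x t)" for t
      have cf: "continuous_on I (A.flow 0 y0)" for I by (rule solves_continuous[OF A.flow(2)])
      have "norm (e t) \<le> exp (M * (t - 0)) * norm (e 0)"
      proof (rule gronwall_homogeneous(1)[where x' = "\<lambda>t. ?A t (e t)"])
        show "continuous_on {0..t} e"
          unfolding e_def[abs_def] by (intro continuous_on_diff cf cx continuous_on_subset[OF cd]) auto
        fix u assume u: "0 < u" "u < t"
        have "(A.flow 0 y0 has_vector_derivative ?A u (A.flow 0 y0 u)) (at u)"
          using A.flow(2)[of 0 y0] by (simp add: solves_def)
        from has_vector_derivative_diff[OF this has_vector_derivative_diff[OF dd[OF u(1)] x(2)]]
        show "(e has_vector_derivative ?A u (e u)) (at u)"
          unfolding e_def[abs_def] by (rule has_vector_derivative_eq_rhs)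
            (use u in \<open>simp add: h max_def blinfun.diff_right\<close>)
        show "norm (?A u (e u)) \<le> M * norm (e u)" by (rule A.apply_bound)
      qed (rule t)
      moreover have "e 0 = 0" by (simp add: e_def A.flow(1) y0_def x(1))
      ultimately show ?thesis by (simp add: e_def)
    qed
    have "bounded (A.flow 0 y0 ` {0..})"
      unfolding bounded_iff
    proof (intro exI[of _ "B + Bx"] ballI)
      fix f assume "f \<in> A.flow 0 y0 ` {0..}"
      then obtain t where t: "t \<ge> 0" "f = d t - x t" using y by auto
      then show "norm f \<le> B + Bx" using B[of t] Bx[of t] norm_triangle_ineq4[of "d t" "x t"] by simp
    qed
    moreover have "solves ?A (\<lambda>_. 0) (A.flow 0 y0)" using A.flow(2)[of 0 y0] by (simp add: zero_bcontfun.rep_eq[abs_def])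
    ultimately have "y0 \<in> stable_space ?A"
      unfolding stable_space_def using A.flow(1)[of 0 y0] by blast
    moreover have "norm (c h) \<le> N * (M * \<eta> * (2 * C * norm (d 0)))"
    proof -
      have "norm (c h) \<le> norm h * N" by (rule N(2))
      also have "\<dots> \<le> (M * \<eta> * (2 * C * norm (d 0))) * N" by (rule mult_right_mono[OF hn]) (use N(1) in simp)
      finally show ?thesis by (simp only: mult.commute[of N])
    qed
    ultimately show ?thesis by (intro exI[of _ "c h"]) (simp add: y0_def d_def)
  qed
  have "v \<in> closure (stable_space ?A)"
    unfolding closure_approachable
  proof (intro allI impI)
    fix e :: real assume e: "e > 0"
    \<comment> \<open>For the chosen s the difference quotient has norm at most |v| + 1, and then Q
      \<eta> bounds the norm of b / s.\<close>
    define Q where "Q = N * (M * (2 * C * (norm v + 1)))"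
    have Q: "Q > 0" using N M C by (simp add: Q_def add_nonneg_pos)
    define \<eta> where "\<eta> = min \<rho> (min (1 / (2 * (C * M))) (e / (2 * Q)))"
    have CM: "C * M > 0" using C M by simp
    have \<eta>: "\<eta> > 0" "\<eta> \<le> \<rho>" "C * (M * \<eta>) \<le> 1/2" "Q * \<eta> \<le> e / 2"
    proof -
      show "\<eta> > 0" "\<eta> \<le> \<rho>" using \<rho> CM e Q by (simp_all add: \<eta>_def)
      have "C * M * \<eta> \<le> C * M * (1 / (2 * (C * M)))" using CM by (intro mult_left_mono) (simp_all add: \<eta>_def)
      also have "\<dots> = 1/2" using C M by simp
      finally show "C * (M * \<eta>) \<le> 1/2" by (simp add: mult.assoc)
      have "Q * \<eta> \<le> Q * (e / (2 * Q))" using Q by (intro mult_left_mono) (simp_all add: \<eta>_def)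
      also have "\<dots> = e / 2" using Q by simp
      finally show "Q * \<eta> \<le> e / 2" .
    qed
    have "uniform_limit {0..} w (w 0) (at 0)" using u[of 0] \<delta> by simp
    from uniform_limitD[OF this \<eta>(1)] have ev1: "\<forall>\<^sub>F s in at 0. \<forall>t\<in>{0..}. dist (w s t) (w 0 t) < \<eta>" .
    have "((\<lambda>s. (w s 0 - w 0 0) /\<^sub>R s) \<longlongrightarrow> v) (at 0)"
    proof -
      have "((\<lambda>s. norm (w s 0 - w 0 0 - (s - 0) *\<^sub>R v) / norm (s - 0)) \<longlongrightarrow> 0) (at 0)"
        using dv unfolding has_vector_derivative_def has_derivative_iff_norm by blast
      moreover have "norm ((w s 0 - w 0 0) /\<^sub>R s - v) = norm (w s 0 - w 0 0 - (s - 0) *\<^sub>R v) / norm (s - 0)" if "s \<noteq> 0" for s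
      proof -
        have "(w s 0 - w 0 0) /\<^sub>R s - v = (1 / s) *\<^sub>R (w s 0 - w 0 0 - (s - 0) *\<^sub>R v)"
          using that by (simp add: scaleR_diff_right inverse_eq_divide)
        then show ?thesis by (simp add: divide_inverse mult.commute)
      qed
      then have "\<forall>\<^sub>F s in at 0. norm (w s 0 - w 0 0 - (s - 0) *\<^sub>R v) / norm (s - 0) = norm ((w s 0 - w 0 0) /\<^sub>R s - v)"
        unfolding eventually_at by (intro exI[of _ 1]) simp
      ultimately have "((\<lambda>s. norm ((w s 0 - w 0 0) /\<^sub>R s - v)) \<longlongrightarrow> 0) (at 0)"
        by (rule Lim_transform_eventually)
      then show ?thesis by (simp only: tendsto_norm_zero_iff LIM_zero_iff)
    qed
    moreover have "min 1 (e / 2) > 0" using e by simp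
    ultimately have ev2: "\<forall>\<^sub>F s in at 0. dist ((w s 0 - w 0 0) /\<^sub>R s) v < min 1 (e / 2)" by (rule tendstoD)
    have ev3: "\<forall>\<^sub>F s in at 0. s \<in> {-\<delta><..<\<delta>} \<and> s \<noteq> 0"
      using \<delta> unfolding eventually_at by (intro exI[of _ \<delta>]) (auto simp: dist_real_def)
    have "\<exists>s. (\<forall>t\<in>{0..}. dist (w s t) (w 0 t) < \<eta>) \<and> dist ((w s 0 - w 0 0) /\<^sub>R s) v < min 1 (e / 2)
       \<and> s \<in> {-\<delta><..<\<delta>} \<and> s \<noteq> 0"
      using eventually_happens[OF eventually_conj[OF ev1 eventually_conj[OF ev2 ev3]]] by simp
    then obtain s where s: "\<forall>t\<in>{0..}. dist (w s t) (w 0 t) < \<eta>" "dist ((w s 0 - w 0 0) /\<^sub>R s) v < min 1 (e / 2)"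
       "s \<in> {-\<delta><..<\<delta>}" "s \<noteq> 0" by blast
    have near: "norm (w s t - z t) \<le> \<eta>" if "t \<ge> 0" for t
    proof -
      have "dist (w s t) (w 0 t) < \<eta>" using s(1) that by simp
      then show ?thesis unfolding w00[OF that] dist_norm by simp
    qed
    obtain b where b: "norm b \<le> N * (M * \<eta> * (2 * C * norm (w s 0 - z 0)))" "w s 0 - z 0 - b \<in> stable_space ?A"
      using key[OF s(3) less_imp_le[OF \<eta>(1)] \<eta>(2,3) near] by blast
    define k where "k = (w s 0 - w 0 0) /\<^sub>R s"
    have kv: "norm (k - v) < 1" "norm (k - v) < e / 2" using s(2) by (simp_all add: k_def dist_norm)
    have ks: "w s 0 - z 0 = s *\<^sub>R k" using s(4) w0 by (simp add: k_def)
    have "norm k \<le> norm v + 1" using kv(1) norm_triangle_ineq2[of k v] by linarith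
    have "norm (b /\<^sub>R s) = norm b / \<bar>s\<bar>" by (simp add: divide_inverse mult.commute)
    also have "\<dots> \<le> N * (M * \<eta> * (2 * C * (\<bar>s\<bar> * norm k))) / \<bar>s\<bar>"
      using b(1) unfolding ks by (intro divide_right_mono) simp_all
    also have "\<dots> = (N * M * \<eta> * 2 * C) * norm k" using s(4) by simp
    also have "\<dots> \<le> (N * M * \<eta> * 2 * C) * (norm v + 1)"
      using N M \<eta>(1) C \<open>norm k \<le> norm v + 1\<close> by (intro mult_left_mono) simp_all
    also have "\<dots> = Q * \<eta>" by (simp add: Q_def)
    finally have bs: "norm (b /\<^sub>R s) \<le> e / 2" using \<eta>(4) by linarith
    have "(w s 0 - z 0 - b) /\<^sub>R s \<in> stable_space ?A" by (rule subspace_scale[OF subspace_stable_space b(2)])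
    moreover have "(w s 0 - z 0 - b) /\<^sub>R s = k - b /\<^sub>R s" unfolding ks using s(4) by (simp add: scaleR_diff_right)
    ultimately have "k - b /\<^sub>R s \<in> stable_space ?A" by simp
    moreover have "dist (k - b /\<^sub>R s) v < e"
      using norm_triangle_ineq4[of "k - v" "b /\<^sub>R s"] kv(2) bs by (simp add: dist_norm algebra_simps)
    ultimately show "\<exists>y\<in>stable_space ?A. dist y v < e" by blast
  qed
  then show "v \<in> stable_space ?A" using closed_subspace[OF subspace_stable_space, of ?A] by simp
qed

end

context bounded_coefficients
begin

lemma bounded_solution_decay:
  assumes lim: "(A \<longlongrightarrow> L) at_top" and inv: "bounded_inverse (\<lambda>_. L) K"
    and y: "solves A (\<lambda>_. 0) y" and B: "\<And>t. norm (y t) \<le> B"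
  shows "\<exists>T D l. l > 0 \<and> (\<forall>t>T. norm (y t) \<le> D * exp (- l * t))"
proof -
  have K: "K > 0" using inv by (simp add: bounded_inverse_def)
  define \<eta> where "\<eta> = 1 / (4 * K)"
  have \<eta>: "\<eta> > 0" "K * \<eta> \<le> 1/4" using K by (simp_all add: \<eta>_def)
  have "\<forall>\<^sub>F t in at_top. dist (A t) L < \<eta>" using lim \<eta>(1) by (rule tendstoD)
  then obtain T where T: "\<And>t. t \<ge> T \<Longrightarrow> dist (A t) L < \<eta>" unfolding eventually_at_top_linorder by blast
  define l where "l = ln 2 / (8 * K + 1)"
  have l: "l > 0" using K by (simp add: l_def)
  have "norm (y t) \<le> 2 * B * exp (- l * (t - T))" if t: "t > T" for t
    unfolding l_def
  proof (rule exponential_decay[OF inv _ _ B _ \<eta>(2) less_imp_le[OF \<eta>(1)] t, where r = "\<lambda>t. (A t - L) (y t)"])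
    show "(y has_vector_derivative L (y s) + (A s - L) (y s)) (at s)" for s
      using y by (simp add: solves_def blinfun.diff_left)
    show "continuous_on {T<..} (\<lambda>t. (A t - L) (y t))"
      by (intro bounded_bilinear.continuous_on[OF bounded_bilinear_blinfun_apply] continuous_on_diff
          continuous_on_const continuous_on_subset[OF cont] solves_continuous[OF y]) simp
    fix s assume s: "T < s"
    have "norm ((A s - L) (y s)) \<le> norm (A s - L) * norm (y s)" by (rule norm_blinfun)
    also have "\<dots> \<le> \<eta> * norm (y s)" using T[of s] s by (intro mult_right_mono) (simp_all add: dist_norm)
    finally show "norm ((A s - L) (y s)) \<le> \<eta> * norm (y s)" .
  qed
  note dec = this
  have "norm (y t) \<le> 2 * B * exp (l * T) * exp (- l * t)" if "t > T" for t
  proof -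
    have "- l * (t - T) = l * T + - l * t" by (simp add: algebra_simps)
    then have "exp (- l * (t - T)) = exp (l * T) * exp (- l * t)" by (simp only: exp_add)
    moreover from dec[OF that] have "norm (y t) \<le> 2 * B * exp (- l * (t - T))" .
    ultimately show ?thesis by (simp only: mult.assoc)
  qed
  then show ?thesis using l by blast
qed

text \<open>Applied to the velocity of the heteroclinic orbit, this gives the exponential decay of
  the gradient of the Hamiltonian along it, and with it the convergence of the Melnikov
  integral.\<close>

lemma bounded_solution_decay_both:
  assumes limu: "(A \<longlongrightarrow> Lu) at_top" and invu: "bounded_inverse (\<lambda>_. Lu) Ku"
    and lima: "(A \<longlongrightarrow> La) at_bot" and inva: "bounded_inverse (\<lambda>_. La) Ka"
    and y: "solves A (\<lambda>_. 0) y" and B: "\<And>t. norm (y t) \<le> B"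
  shows "\<exists>D l. l > 0 \<and> (\<forall>t. norm (y t) \<le> D * exp (- l * \<bar>t\<bar>))"
proof -
  interpret R: bounded_coefficients "\<lambda>t. - A (- t)" M by (rule reflect)
  have lim': "((\<lambda>t. - A (- t)) \<longlongrightarrow> - La) at_top"
    using lima by (intro tendsto_minus) (simp add: filterlim_at_bot_mirror)
  have inv': "bounded_inverse (\<lambda>_. - La) Ka" using bounded_inverse_reflect[OF inva] by simp
  have y': "solves (\<lambda>t. - A (- t)) (\<lambda>_. 0) (\<lambda>t. y (- t))" using solves_reflect[OF y] by simp
  obtain T1 D1 l1 where 1: "l1 > 0" "\<forall>t>T1. norm (y t) \<le> D1 * exp (- l1 * t)"
    using bounded_solution_decay[OF limu invu y B] by blast
  obtain T2 D2 l2 where 2: "l2 > 0" "\<forall>t>T2. norm (y (- t)) \<le> D2 * exp (- l2 * t)"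
    using R.bounded_solution_decay[OF lim' inv' y' B] by blast
  define l where "l = min l1 l2"
  define T where "T = max 0 (max T1 T2)"
  define D where "D = max (B * exp (l * T)) (max \<bar>D1\<bar> \<bar>D2\<bar>)"
  have l: "l > 0" using 1 2 by (simp add: l_def)
  have B0: "B \<ge> 0" using order_trans[OF norm_ge_zero B] .
  have step: "D' * exp (- l' * \<bar>t\<bar>) \<le> D * exp (- l * \<bar>t\<bar>)" if "\<bar>D'\<bar> \<le> D" "l \<le> l'" for D' l' t
  proof -
    have "D' * exp (- l' * \<bar>t\<bar>) \<le> D * exp (- l' * \<bar>t\<bar>)" using that(1) by (intro mult_right_mono) simp_all
    also have "\<dots> \<le> D * exp (- l * \<bar>t\<bar>)"
      using that order_trans[OF abs_ge_zero that(1)] by (intro mult_left_mono) (simp_all add: mult_right_mono)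
    finally show ?thesis .
  qed
  have "norm (y t) \<le> D * exp (- l * \<bar>t\<bar>)" for t
  proof -
    consider "t > T" | "t < - T" | "\<bar>t\<bar> \<le> T" by linarith
    then show ?thesis
    proof cases
      case a: 1
      then have "norm (y t) \<le> D1 * exp (- l1 * \<bar>t\<bar>)" using 1(2) by (simp add: T_def)
      also have "\<dots> \<le> D * exp (- l * \<bar>t\<bar>)" by (rule step) (simp_all add: D_def l_def)
      finally show ?thesis .
    next
      case a: 2
      then have "norm (y (- (- t))) \<le> D2 * exp (- l2 * (- t))" using 2(2)[rule_format, of "- t"] by (simp add: T_def)
      then have "norm (y t) \<le> D2 * exp (- l2 * \<bar>t\<bar>)" using a by (simp add: T_def)
      also have "\<dots> \<le> D * exp (- l * \<bar>t\<bar>)" by (rule step) (simp_all add: D_def l_def)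
      finally show ?thesis .
    next
      case a: 3
      have "exp (l * T) * exp (- l * T) = 1" by (simp flip: exp_add)
      then have "norm (y t) \<le> B * exp (l * T) * exp (- l * T)" using B[of t] by (simp only: mult.assoc mult_1_right)
      also have "\<dots> \<le> D * exp (- l * \<bar>t\<bar>)"
        using a l B0 by (intro mult_mono) (simp_all add: D_def)
      finally show ?thesis .
    qed
  qed
  then show ?thesis using l by blast
qed

end

text \<open>The tails of the orbit lie well inside balls around the limits, and the piece between
  them is compact; together they leave one positive radius.\<close>

lemma orbit_tube:
  fixes z :: "real \<Rightarrow> 'a::euclidean_space"
  assumes c: "continuous_on UNIV z" and lim: "(z \<longlongrightarrow> a) at_bot" "(z \<longlongrightarrow> b) at_top"
    and U: "open U" "range z \<union> {a, b} \<subseteq> U"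
  shows "\<exists>\<rho>>0. (\<forall>t. cball (z t) \<rho> \<subseteq> U) \<and> cball a \<rho> \<subseteq> U \<and> cball b \<rho> \<subseteq> U"
proof -
  obtain ra where ra: "ra > 0" "cball a ra \<subseteq> U" using U by (meson Un_upper2 insert_subset open_contains_cball order_trans)
  obtain rb where rb: "rb > 0" "cball b rb \<subseteq> U" using U by (meson Un_upper2 insert_subset open_contains_cball order_trans)
  have "\<forall>\<^sub>F t in at_bot. dist (z t) a < ra / 2" using lim(1) ra by (intro tendstoD) simp_all
  then obtain T1 where T1: "\<And>t. t \<le> T1 \<Longrightarrow> dist (z t) a < ra / 2" unfolding eventually_at_bot_linorder by blast
  have "\<forall>\<^sub>F t in at_top. dist (z t) b < rb / 2" using lim(2) rb by (intro tendstoD) simp_all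
  then obtain T2 where T2: "\<And>t. t \<ge> T2 \<Longrightarrow> dist (z t) b < rb / 2" unfolding eventually_at_top_linorder by blast
  have "compact (z ` {T1..T2})" by (intro compact_continuous_image continuous_on_subset[OF c]) simp_all
  moreover have "z ` {T1..T2} \<subseteq> U" using U(2) by blast
  ultimately obtain r where r: "r > 0" "(\<Union>x\<in>z ` {T1..T2}. cball x r) \<subseteq> U"
    using compact_subset_open_imp_cball_epsilon_subset[OF _ U(1)] by blast
  define \<rho> where "\<rho> = min r (min (ra / 2) (rb / 2))"
  have near: "cball x (e / 2) \<subseteq> cball p e" if "dist x p < e / 2" for x p :: 'a and e
    using that by (intro subsetI) (smt (verit) dist_commute dist_triangle field_sum_of_halves mem_cball)
  have "cball (z t) \<rho> \<subseteq> U" for t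
  proof -
    consider "t \<le> T1" | "t \<ge> T2" | "t \<in> {T1..T2}" by force
    then show ?thesis
    proof cases
      case 1
      have "cball (z t) \<rho> \<subseteq> cball (z t) (ra / 2)" by (intro subset_cball) (simp add: \<rho>_def)
      then show ?thesis using near[OF T1[OF 1]] ra(2) by blast
    next
      case 2
      have "cball (z t) \<rho> \<subseteq> cball (z t) (rb / 2)" by (intro subset_cball) (simp add: \<rho>_def)
      then show ?thesis using near[OF T2[OF 2]] rb(2) by blast
    next
      case 3
      have "cball (z t) \<rho> \<subseteq> cball (z t) r" by (intro subset_cball) (simp add: \<rho>_def)
      then show ?thesis using r(2) 3 by blast
    qed
  qed
  moreover have "cball a \<rho> \<subseteq> cball a ra" "cball b \<rho> \<subseteq> cball b rb"
    using ra(1) rb(1) by (intro subset_cball; simp add: \<rho>_def min_le_iff_disj)+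
  moreover have "\<rho> > 0" using r ra rb by (simp add: \<rho>_def)
  ultimately show ?thesis using ra(2) rb(2) by blast
qed

section \<open>Asymptotics of the perturbed connection\<close>

context perturbed_system
begin

text \<open>The radius r is small enough for merging, and C |\<epsilon>| \<le> r / 2 leaves the
  other half of r for the distance of the unperturbed orbit from its limit.\<close>

lemma merging_thresholds:
  assumes inv: "bounded_inverse (\<lambda>_. DF p) K" and \<rho>: "cball p \<rho> \<subseteq> U" "\<rho> > 0" and C: "C \<ge> 0"
  shows "\<exists>\<epsilon>1>0. \<exists>r>0. cball p r \<subseteq> U \<and> (\<forall>\<epsilon>. \<bar>\<epsilon>\<bar> \<le> \<epsilon>1 \<longrightarrow> K * (M * r + \<bar>\<epsilon>\<bar> * M) \<le> 1/4 \<and> C * \<bar>\<epsilon>\<bar> \<le> r / 2)"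
proof -
  have K: "K > 0" using inv by (simp add: bounded_inverse_def)
  define k where "k = K * M"
  have k: "k > 0" using K M by (simp add: k_def)
  define r where "r = min \<rho> (1 / (8 * k))"
  have r: "r > 0" "r \<le> \<rho>" "k * r \<le> 1/8"
  proof -
    show "r > 0" "r \<le> \<rho>" using \<rho> k by (simp_all add: r_def)
    have "k * r \<le> k * (1 / (8 * k))" using k by (intro mult_left_mono) (simp_all add: r_def)
    then show "k * r \<le> 1/8" using k by simp
  qed
  define \<epsilon>1 where "\<epsilon>1 = min (1 / (8 * k)) (r / (2 * (C + 1)))"
  have \<epsilon>1: "\<epsilon>1 > 0" using k r C by (simp add: \<epsilon>1_def)
  have "K * (M * r + \<bar>\<epsilon>\<bar> * M) \<le> 1/4 \<and> C * \<bar>\<epsilon>\<bar> \<le> r / 2" if e: "\<bar>\<epsilon>\<bar> \<le> \<epsilon>1" for \<epsilon>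
  proof
    have "k * \<bar>\<epsilon>\<bar> \<le> k * (1 / (8 * k))" using k e by (intro mult_left_mono) (simp_all add: \<epsilon>1_def)
    then have "k * \<bar>\<epsilon>\<bar> \<le> 1/8" using k by simp
    moreover have "K * (M * r + \<bar>\<epsilon>\<bar> * M) = k * r + k * \<bar>\<epsilon>\<bar>" by (simp add: k_def algebra_simps)
    ultimately show "K * (M * r + \<bar>\<epsilon>\<bar> * M) \<le> 1/4" using r(3) by linarith
    define j where "j = C + 1"
    have j: "j > 0" using C by (simp add: j_def)
    have "C * \<bar>\<epsilon>\<bar> \<le> j * \<bar>\<epsilon>\<bar>" by (simp add: distrib_right j_def)
    also have "\<dots> \<le> j * (r / (2 * j))" using j e by (intro mult_left_mono) (simp_all add: \<epsilon>1_def j_def)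
    also have "\<dots> = r / 2" using j by simp
    finally show "C * \<bar>\<epsilon>\<bar> \<le> r / 2" .
  qed
  moreover have "cball p r \<subseteq> U" using \<rho>(1) subset_cball[OF r(2)] by blast
  ultimately show ?thesis using \<epsilon>1 r(1) by blast
qed

lemma near_shifted_limit:
  fixes z \<Phi> :: "real \<Rightarrow> 'a"
  assumes z: "\<And>t. t > T \<Longrightarrow> norm (z t - p) \<le> r / 2" and \<Phi>: "norm (\<Phi> t - z (t - \<alpha>)) \<le> r / (2::real)" and t: "t > T + \<alpha>"
  shows "norm (\<Phi> t - p) \<le> r"
proof -
  have "\<Phi> t - p = (\<Phi> t - z (t - \<alpha>)) + (z (t - \<alpha>) - p)" by simp
  moreover have "norm (z (t - \<alpha>) - p) \<le> r / 2" using t by (intro z) simp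
  ultimately show ?thesis using \<Phi> norm_triangle_ineq[of "\<Phi> t - z (t - \<alpha>)" "z (t - \<alpha>) - p"] by simp
qed

text \<open>The threshold is chosen before \<alpha>, \<Phi> and \<Gamma>. The phase only shifts the
  time T + \<alpha> after which both solutions are within r of p.\<close>

lemma approach_at_top:
  assumes inv: "bounded_inverse (\<lambda>_. DF p) K" and \<rho>: "cball p \<rho> \<subseteq> U" "\<rho> > 0" and C: "C \<ge> 0" and z: "(z \<longlongrightarrow> p) at_top"
  shows "\<exists>\<epsilon>1>0. \<forall>\<epsilon> \<alpha> \<Phi> \<Gamma>. \<bar>\<epsilon>\<bar> \<le> \<epsilon>1 \<and> (\<forall>t. (\<Phi> has_vector_derivative F (\<Phi> t) + \<epsilon> *\<^sub>R G t (\<Phi> t)) (at t)) \<and>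
     (\<forall>t. (\<Gamma> has_vector_derivative F (\<Gamma> t) + \<epsilon> *\<^sub>R G t (\<Gamma> t)) (at t)) \<and>
     (\<forall>t. norm (\<Phi> t - z (t - \<alpha>)) \<le> C * \<bar>\<epsilon>\<bar>) \<and> (\<forall>t. norm (\<Gamma> t - p) \<le> C * \<bar>\<epsilon>\<bar>) \<longrightarrow>
     ((\<lambda>t. norm (\<Phi> t - \<Gamma> t)) \<longlongrightarrow> 0) at_top"
proof -
  obtain \<epsilon>1 r where \<epsilon>1: "\<epsilon>1 > 0" and r: "r > 0" "cball p r \<subseteq> U"
    and th: "\<And>\<epsilon>. \<bar>\<epsilon>\<bar> \<le> \<epsilon>1 \<Longrightarrow> K * (M * r + \<bar>\<epsilon>\<bar> * M) \<le> 1/4 \<and> C * \<bar>\<epsilon>\<bar> \<le> r / 2"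
    using merging_thresholds[OF inv \<rho> C] by blast
  have "\<forall>\<^sub>F t in at_top. dist (z t) p < r / 2" using z r by (intro tendstoD) simp_all
  then obtain T where T: "\<And>t. t \<ge> T \<Longrightarrow> dist (z t) p < r / 2" unfolding eventually_at_top_linorder by blast
  have T': "norm (z t - p) \<le> r / 2" if "t > T" for t using T[of t] that by (simp add: dist_norm)
  have "((\<lambda>t. norm (\<Phi> t - \<Gamma> t)) \<longlongrightarrow> 0) at_top"
    if e: "\<bar>\<epsilon>\<bar> \<le> \<epsilon>1" and \<Phi>: "\<forall>t. (\<Phi> has_vector_derivative F (\<Phi> t) + \<epsilon> *\<^sub>R G t (\<Phi> t)) (at t)"
      and \<Gamma>: "\<forall>t. (\<Gamma> has_vector_derivative F (\<Gamma> t) + \<epsilon> *\<^sub>R G t (\<Gamma> t)) (at t)"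
      and n: "\<forall>t. norm (\<Phi> t - z (t - \<alpha>)) \<le> C * \<bar>\<epsilon>\<bar>" "\<forall>t. norm (\<Gamma> t - p) \<le> C * \<bar>\<epsilon>\<bar>" for \<epsilon> \<alpha> \<Phi> \<Gamma>
  proof (rule solutions_merge_at_top[OF inv r(2), where T = "T + \<alpha>"])
    show "K * (M * r + \<bar>\<epsilon>\<bar> * M) \<le> 1/4" using th[OF e] by simp
    have C2: "C * \<bar>\<epsilon>\<bar> \<le> r / 2" using th[OF e] by simp
    show "norm (\<Gamma> t - p) \<le> r" for t using n(2)[rule_format, of t] C2 r(1) by linarith
    have "norm (\<Phi> t - z (t - \<alpha>)) \<le> r / 2" for t using n(1)[rule_format, of t] C2 by linarith
    then show "norm (\<Phi> t - p) \<le> r" if "T + \<alpha> < t" for t by (intro near_shifted_limit[OF T' _ that])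
  qed (use \<Phi> \<Gamma> in blast)+
  then show ?thesis using \<epsilon>1 by blast
qed

lemma approach_at_bot:
  assumes inv: "bounded_inverse (\<lambda>_. DF p) K" and \<rho>: "cball p \<rho> \<subseteq> U" "\<rho> > 0" and C: "C \<ge> 0" and z: "(z \<longlongrightarrow> p) at_bot"
  shows "\<exists>\<epsilon>1>0. \<forall>\<epsilon> \<alpha> \<Phi> \<Gamma>. \<bar>\<epsilon>\<bar> \<le> \<epsilon>1 \<and> (\<forall>t. (\<Phi> has_vector_derivative F (\<Phi> t) + \<epsilon> *\<^sub>R G t (\<Phi> t)) (at t)) \<and>
     (\<forall>t. (\<Gamma> has_vector_derivative F (\<Gamma> t) + \<epsilon> *\<^sub>R G t (\<Gamma> t)) (at t)) \<and>
     (\<forall>t. norm (\<Phi> t - z (t - \<alpha>)) \<le> C * \<bar>\<epsilon>\<bar>) \<and> (\<forall>t. norm (\<Gamma> t - p) \<le> C * \<bar>\<epsilon>\<bar>) \<longrightarrow>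
     ((\<lambda>t. norm (\<Phi> t - \<Gamma> t)) \<longlongrightarrow> 0) at_bot"
proof -
  obtain \<epsilon>1 r where \<epsilon>1: "\<epsilon>1 > 0" and r: "r > 0" "cball p r \<subseteq> U"
    and th: "\<And>\<epsilon>. \<bar>\<epsilon>\<bar> \<le> \<epsilon>1 \<Longrightarrow> K * (M * r + \<bar>\<epsilon>\<bar> * M) \<le> 1/4 \<and> C * \<bar>\<epsilon>\<bar> \<le> r / 2"
    using merging_thresholds[OF inv \<rho> C] by blast
  have "\<forall>\<^sub>F t in at_bot. dist (z t) p < r / 2" using z r by (intro tendstoD) simp_all
  then obtain T where T: "\<And>t. t \<le> T \<Longrightarrow> dist (z t) p < r / 2" unfolding eventually_at_bot_linorder by blast
  have T': "norm (z (- t) - p) \<le> r / 2" if "t > - T" for t using T[of "- t"] that by (simp add: dist_norm)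
  have "((\<lambda>t. norm (\<Phi> t - \<Gamma> t)) \<longlongrightarrow> 0) at_bot"
    if e: "\<bar>\<epsilon>\<bar> \<le> \<epsilon>1" and \<Phi>: "\<forall>t. (\<Phi> has_vector_derivative F (\<Phi> t) + \<epsilon> *\<^sub>R G t (\<Phi> t)) (at t)"
      and \<Gamma>: "\<forall>t. (\<Gamma> has_vector_derivative F (\<Gamma> t) + \<epsilon> *\<^sub>R G t (\<Gamma> t)) (at t)"
      and n: "\<forall>t. norm (\<Phi> t - z (t - \<alpha>)) \<le> C * \<bar>\<epsilon>\<bar>" "\<forall>t. norm (\<Gamma> t - p) \<le> C * \<bar>\<epsilon>\<bar>" for \<epsilon> \<alpha> \<Phi> \<Gamma>
  proof (rule solutions_merge_at_bot[OF inv r(2), where T = "T + \<alpha>"])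
    show "K * (M * r + \<bar>\<epsilon>\<bar> * M) \<le> 1/4" using th[OF e] by simp
    have C2: "C * \<bar>\<epsilon>\<bar> \<le> r / 2" using th[OF e] by simp
    show "norm (\<Gamma> t - p) \<le> r" for t using n(2)[rule_format, of t] C2 r(1) by linarith
    have c: "norm (\<Phi> t - z (t - \<alpha>)) \<le> r / 2" for t using n(1)[rule_format, of t] C2 by linarith
    show "norm (\<Phi> t - p) \<le> r" if "t < T + \<alpha>" for t
      using near_shifted_limit[of "- T" "\<lambda>t. z (- t)" p r "\<lambda>t. \<Phi> (- t)" "- t" "- \<alpha>"] T' c[of t] that by simp
  qed (use \<Phi> \<Gamma> in blast)+
  then show ?thesis using \<epsilon>1 by blast
qed

end

lemma SUP_in_bigo:
  fixes f :: "real \<Rightarrow> real \<Rightarrow> real"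
  assumes "\<epsilon>0 > 0" and f0: "\<And>\<epsilon> t. 0 \<le> f \<epsilon> t" and f: "\<And>\<epsilon> t. \<bar>\<epsilon>\<bar> < \<epsilon>0 \<Longrightarrow> f \<epsilon> t \<le> C * \<bar>\<epsilon>\<bar>"
  shows "(\<lambda>\<epsilon>. SUP t. f \<epsilon> t) \<in> O[nhds 0](\<lambda>\<epsilon>. \<epsilon>)"
proof (rule bigoI[where c = C])
  have "\<forall>\<^sub>F \<epsilon> in nhds 0. dist \<epsilon> 0 < \<epsilon>0" using assms(1) by (intro eventually_nhds_metric[THEN iffD2]) blast
  then show "\<forall>\<^sub>F \<epsilon> in nhds 0. norm (SUP t. f \<epsilon> t) \<le> C * norm \<epsilon>"
  proof eventually_elim
    case (elim \<epsilon>)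
    then have e: "\<bar>\<epsilon>\<bar> < \<epsilon>0" by (simp add: dist_real_def)
    have bdd: "bdd_above (range (f \<epsilon>))" using f[OF e] by (intro bdd_aboveI2[where M = "C * \<bar>\<epsilon>\<bar>"])
    have "0 \<le> f \<epsilon> 0" by (rule f0)
    also have "\<dots> \<le> (SUP t. f \<epsilon> t)" using bdd by (intro cSUP_upper) simp_all
    finally have "0 \<le> (SUP t. f \<epsilon> t)" .
    moreover have "(SUP t. f \<epsilon> t) \<le> C * \<bar>\<epsilon>\<bar>" by (intro cSUP_least f e) simp
    ultimately show ?case by simp
  qed
qed

lemma hyperbolic_equilibrium_bounded_inverse:
  assumes "hyperbolic_equilibrium F p"
  shows "\<exists>K. bounded_inverse (\<lambda>_. Blinfun (frechet_derivative F (at p))) K"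
proof -
  have "(F has_derivative frechet_derivative F (at p)) (at p)"
    using assms frechet_derivative_works by (auto simp: hyperbolic_equilibrium_def)
  then have "blinfun_apply (Blinfun (frechet_derivative F (at p))) = frechet_derivative F (at p)"
    by (intro bounded_linear_Blinfun_apply has_derivative_bounded_linear)
  then show ?thesis
    using assms by (intro hyperbolic_bounded_inverse) (simp add: hyperbolic_equilibrium_def)
qed

subsection \<open>The Hamiltonian system\<close>

lemma bounded_linear_Jmap: "bounded_linear Jmap"
  unfolding Jmap_def
  by (intro bounded_linear_Pair bounded_linear_snd bounded_linear_minus bounded_linear_fst)

lemma norm_Jmap: "norm (Jmap x) = norm x"
  by (cases x) (simp add: Jmap_def norm_Pair add.commute)

lemma Jmap_Jmap: "Jmap (Jmap x) = - x"
  by (cases x) (simp add: Jmap_def)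

lemma inner_Jmap: "x \<bullet> Jmap y = - (Jmap x \<bullet> y)"
  by (cases x; cases y) (simp add: Jmap_def)

lemma grad_eq_Jmap_ham_field: "grad H x = - Jmap (ham_field H x)"
  by (simp add: ham_field_def Jmap_Jmap)

text \<open>The gradient of H is -J times its Hamiltonian field, so -J \<open>DF\<close> is the
  Hessian of H, and symmetry is that of second derivatives. The Taylor bound behind it is the
  linearization error of the field.\<close>

lemma ham_field_linearization_symmetric:
  fixes H :: "('n::finite, 'm::finite) phase \<Rightarrow> real"
  assumes S: "perturbed_system (ham_field H) G DF DG U M"
    and H: "\<And>x. x \<in> U \<Longrightarrow> H differentiable (at x)" and x: "x \<in> U"
  shows "Jmap (DF x a) \<bullet> b = Jmap (DF x b) \<bullet> a"
proof -
  interpret S: perturbed_system "ham_field H" G DF DG U M by (rule S)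
  note linJ = bounded_linear.linear[OF bounded_linear_Jmap]
  obtain r where r: "r > 0" "cball x r \<subseteq> U" using S.U x open_contains_cball by blast
  define B where "B = - (Blinfun Jmap o\<^sub>L DF x)"
  have B: "B v = - Jmap (DF x v)" for v
    by (simp add: B_def uminus_blinfun.rep_eq bounded_linear_Blinfun_apply[OF bounded_linear_Jmap])
  have "B a \<bullet> b = B b \<bullet> a"
  proof (rule symmetric_hessian[OF r(1), where h = H and g = "grad H" and M = M])
    show "GDERIV H y :> grad H y" if "y \<in> cball x r" for y
      using that r(2) by (intro GDERIV_grad H) blast
    fix y z r' assume a: "r' \<le> r" "norm (y - x) \<le> r'" "norm (z - x) \<le> r'"
    have "grad H y - grad H z - B (y - z) = - Jmap (ham_field H y - ham_field H z - DF x (y - z))"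
      by (simp add: grad_eq_Jmap_ham_field B linear_diff[OF linJ])
    then have "norm (grad H y - grad H z - B (y - z)) = norm (ham_field H y - ham_field H z - DF x (y - z))"
      by (simp add: norm_Jmap)
    moreover have "cball x r' \<subseteq> U" using subset_cball[OF a(1)] r(2) by blast
    ultimately show "norm (grad H y - grad H z - B (y - z)) \<le> M * r' * norm (y - z)"
      using S.linearization_error[OF _ a(2,3)] by simp
  qed
  then show ?thesis by (simp add: B)
qed

text \<open>The gradient of the Hamiltonian along an orbit solves the adjoint of the variational equation.\<close>

lemma grad_adjoint_solution:
  fixes H :: "('n::finite, 'm::finite) phase \<Rightarrow> real"
  assumes C: "perturbed_curve (ham_field H) G DF DG U M z \<rho>"
    and H: "\<And>x. x \<in> U \<Longrightarrow> H differentiable (at x)"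
    and z: "\<And>t. (z has_vector_derivative ham_field H (z t)) (at t)"
    and x: "solves (\<lambda>t. DF (z t)) h x"
  shows "((\<lambda>t. grad H (z t) \<bullet> x t) has_real_derivative grad H (z t) \<bullet> h t) (at t)"
proof -
  interpret C: perturbed_curve "ham_field H" G DF DG U M z \<rho> by (rule C)
  \<comment> \<open>y is the velocity of the orbit; it solves the variational equation, and the
    gradient is -J y. Symmetry of J \<open>DF\<close> cancels the two terms that contain
    \<open>x t\<close>, and the one with \<open>h t\<close> is left.\<close>
  define y where "y t = ham_field H (z t)" for t
  have "(y has_vector_derivative DF (z t) (y t)) (at t)"
    using vector_derivative_diff_chain_within[of z "ham_field H (z t)" t UNIV "ham_field H" "DF (z t)"]
      z[of t] C.F_deriv[OF C.curve_in[of t]]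
    by (simp add: y_def[abs_def] o_def has_derivative_at_withinI)
  from bounded_linear.has_vector_derivative[OF bounded_linear_Jmap this]
  have J: "((\<lambda>t. Jmap (y t)) has_vector_derivative Jmap (DF (z t) (y t))) (at t)" .
  have xd: "(x has_vector_derivative DF (z t) (x t) + h t) (at t)" using x by (simp add: solves_def)
  have "((\<lambda>t. Jmap (y t) \<bullet> x t) has_real_derivative
      Jmap (y t) \<bullet> (DF (z t) (x t) + h t) + Jmap (DF (z t) (y t)) \<bullet> x t) (at t)"
    using bounded_bilinear.has_vector_derivative[OF bounded_bilinear_inner J xd]
    by (simp add: has_real_derivative_iff_has_vector_derivative)
  moreover have "Jmap (DF (z t) (y t)) \<bullet> x t = Jmap (DF (z t) (x t)) \<bullet> y t"
    by (rule ham_field_linearization_symmetric[OF C.perturbed_system_axioms H C.curve_in])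
  moreover have "Jmap (y t) \<bullet> DF (z t) (x t) = - (Jmap (DF (z t) (x t)) \<bullet> y t)"
    using inner_Jmap[of "DF (z t) (x t)" "y t"] by (simp add: inner_commute)
  ultimately have "((\<lambda>t. Jmap (y t) \<bullet> x t) has_real_derivative Jmap (y t) \<bullet> h t) (at t)"
    by (simp add: inner_add_right)
  from DERIV_minus[OF this] show ?thesis
    by (simp add: grad_eq_Jmap_ham_field y_def)
qed

lemma hamiltonian_constant_along_orbit:
  fixes H :: "('n::finite, 'm::finite) phase \<Rightarrow> real"
  assumes H: "\<And>t. H differentiable (at (z t))"
    and z: "\<And>t. (z has_vector_derivative ham_field H (z t)) (at t)"
  shows "H (z t) = H (z s)"
proof -
  have "((\<lambda>t. H (z t)) has_real_derivative 0) (at t)" for t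
  proof -
    have "(H has_derivative (\<lambda>v. v \<bullet> grad H (z t))) (at (z t))"
      using GDERIV_grad[OF H] by (simp add: gderiv_def)
    then have "((\<lambda>t. H (z t)) has_vector_derivative ham_field H (z t) \<bullet> grad H (z t)) (at t)"
      using vector_derivative_diff_chain_within[of z "ham_field H (z t)" t UNIV H "\<lambda>v. v \<bullet> grad H (z t)"] z[of t]
      by (simp add: o_def has_derivative_at_withinI)
    moreover have "ham_field H (z t) \<bullet> grad H (z t) = 0"
      using inner_Jmap[of "grad H (z t)" "grad H (z t)"] by (simp add: ham_field_def inner_commute)
    ultimately show ?thesis by (simp add: has_real_derivative_iff_has_vector_derivative)
  qed
  then show ?thesis using DERIV_isconst_all[of "\<lambda>t. H (z t)" t s] by blast
qed

context
  fixes F1 :: "('n::finite, 'm::finite) config \<Rightarrow> real ^ 'n"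
    and F2 :: "('n, 'm) config \<Rightarrow> real ^ 'm"
    and g :: "real \<Rightarrow> ('n, 'm) config \<Rightarrow> real ^ 'm"
    and \<sigma> :: "('n, 'm) config \<Rightarrow> real ^ 'm ^ 'm"
    and U :: "('n, 'm) phase set"
  assumes U: "open U"
    and H0_diff: "\<And>\<Phi>. \<Phi> \<in> U \<Longrightarrow> H0 F1 F2 \<sigma> differentiable (at \<Phi>)"
    and H1_diff: "\<And>t \<Phi>. \<Phi> \<in> U \<Longrightarrow> H1 g t differentiable (at \<Phi>)"
begin

lemma hamiltonian_solution_HepsI:
  assumes "\<forall>t. w t \<in> U" "\<forall>t. (w has_vector_derivative Fham F1 F2 \<sigma> (w t) + \<epsilon> *\<^sub>R Gham g t (w t)) (at t)"
  shows "hamiltonian_solution (Heps F1 F2 g \<sigma> \<epsilon>) w"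
  unfolding hamiltonian_solution_def
proof (intro allI conjI)
  fix t
  have w: "w t \<in> U" using assms(1) by simp
  show "Heps F1 F2 g \<sigma> \<epsilon> t differentiable (at (w t))"
    unfolding Heps_def[abs_def]
    by (intro differentiable_add H0_diff[OF w] differentiable_mult differentiable_const H1_diff[OF w])
  show "(w has_vector_derivative ham_field (Heps F1 F2 g \<sigma> \<epsilon> t) (w t)) (at t)"
    using assms(2) by (simp add: ham_field_Heps[OF H0_diff[OF w] H1_diff[OF w]])
qed

text \<open>On the open set \<open>U\<close> the field of \<open>Heps\<close> coincides with F +
  \<epsilon> G, so the derivatives agree there too, and the dichotomy carries over.\<close>

lemma hyperbolic_trajectory_HepsI:
  assumes S: "perturbed_system (Fham F1 F2 \<sigma>) (Gham g) DF DG U M"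
    and w: "\<forall>t. w t \<in> U" "\<forall>t. (w has_vector_derivative Fham F1 F2 \<sigma> (w t) + \<epsilon> *\<^sub>R Gham g t (w t)) (at t)"
    and dich: "exponential_dichotomy (\<lambda>t. blinfun_apply (DF (w t) + \<epsilon> *\<^sub>R DG t (w t)))"
  shows "hyperbolic_trajectory (\<lambda>t. ham_field (Heps F1 F2 g \<sigma> \<epsilon> t)) w"
proof -
  interpret S: perturbed_system "Fham F1 F2 \<sigma>" "Gham g" DF DG U M by (rule S)
  have d: "(ham_field (Heps F1 F2 g \<sigma> \<epsilon> t) has_derivative blinfun_apply (DF (w t) + \<epsilon> *\<^sub>R DG t (w t))) (at (w t))" for t
  proof -
    have wU: "w t \<in> U" using w(1) by simp
    have "((\<lambda>\<Phi>. Fham F1 F2 \<sigma> \<Phi> + \<epsilon> *\<^sub>R Gham g t \<Phi>) has_derivative (\<lambda>v. DF (w t) v + \<epsilon> *\<^sub>R DG t (w t) v)) (at (w t))"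
      by (intro has_derivative_add has_derivative_scaleR_right S.F_deriv S.G_deriv wU)
    then have "((\<lambda>\<Phi>. Fham F1 F2 \<sigma> \<Phi> + \<epsilon> *\<^sub>R Gham g t \<Phi>) has_derivative blinfun_apply (DF (w t) + \<epsilon> *\<^sub>R DG t (w t))) (at (w t))"
      by (rule has_derivative_eq_rhs) (simp add: fun_eq_iff blinfun.add_left blinfun.scaleR_left)
    then show ?thesis
      by (rule has_derivative_transform_within_open[OF _ U wU]) (simp add: ham_field_Heps[OF H0_diff H1_diff])
  qed
  have "frechet_derivative (ham_field (Heps F1 F2 g \<sigma> \<epsilon> t)) (at (w t)) = blinfun_apply (DF (w t) + \<epsilon> *\<^sub>R DG t (w t))" for t
    using frechet_derivative_at[OF d[of t]] by simp
  then have "exponential_dichotomy (\<lambda>t. frechet_derivative (ham_field (Heps F1 F2 g \<sigma> \<epsilon> t)) (at (w t)))"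
    using dich by simp
  moreover have "ham_field (Heps F1 F2 g \<sigma> \<epsilon> t) differentiable (at (w t))" for t
    using d differentiable_def by blast
  moreover have "(w has_vector_derivative ham_field (Heps F1 F2 g \<sigma> \<epsilon> t) (w t)) (at t)" for t
    using hamiltonian_solution_HepsI[OF w] by (simp add: hamiltonian_solution_def)
  ultimately show ?thesis by (simp add: hyperbolic_trajectory_def)
qed

end

text \<open>The heteroclinic orbit is transversal within the energy level, so the variational equation along it
  has a Fredholm alternative whose functional is the Melnikov integral.\<close>

lemma heteroclinic_fredholm:
  fixes H :: "('n::finite, 'm::finite) phase \<Rightarrow> real"
  assumes C: "perturbed_curve (ham_field H) G DF DG U M z \<rho>"
    and H: "\<And>x. x \<in> U \<Longrightarrow> H differentiable (at x)"
    and z: "\<And>t. (z has_vector_derivative ham_field H (z t)) (at t)"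
    and lim: "(z \<longlongrightarrow> pa) at_bot" "(z \<longlongrightarrow> pu) at_top" and pU: "pa \<in> U" "pu \<in> U" and ne: "pa \<noteq> pu"
    and inva: "bounded_inverse (\<lambda>_. DF pa) Ka" and invu: "bounded_inverse (\<lambda>_. DF pu) Ku"
    and Hpa: "H pa = 0"
    and trans: "tangent_vectors {x. H x = 0} (z 0) \<subseteq>
      {u + v | u v. u \<in> tangent_unstable (ham_field H) pa (z 0) \<and> v \<in> tangent_stable (ham_field H) pu (z 0)}"
  shows "\<exists>(\<beta> :: (real \<Rightarrow>\<^sub>C ('n, 'm) phase) \<Rightarrow> real) R e. bounded_linear \<beta> \<and> bounded_linear R \<and>
    (\<forall>h. \<beta> h = (\<integral>t. grad H (z t) \<bullet> apply_bcontfun h t \<partial>lborel)) \<and>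
    (\<forall>h. solves (\<lambda>t. DF (z t)) (apply_bcontfun (h - \<beta> h *\<^sub>R e)) (apply_bcontfun (R h)))"
proof -
  interpret C: perturbed_curve "ham_field H" G DF DG U M z \<rho> by (rule C)
  let ?A = "\<lambda>t. DF (z t)"
  interpret A: bounded_coefficients ?A M by (rule C.bounded_coefficients_linearization)
  have limu: "(?A \<longlongrightarrow> DF pu) at_top"
    by (rule continuous_on_tendsto_compose[OF C.DF_cont lim(2) pU(2)]) (simp add: C.curve_in)
  have lima: "(?A \<longlongrightarrow> DF pa) at_bot"
    by (rule continuous_on_tendsto_compose[OF C.DF_cont lim(1) pU(1)]) (simp add: C.curve_in)
  have np: "norm (grad H x) = norm (ham_field H x)" for x
    by (simp add: grad_eq_Jmap_ham_field norm_Jmap)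
  have y: "solves ?A (\<lambda>_. 0) (\<lambda>t. ham_field H (z t))"
    unfolding solves_def
  proof
    fix t
    show "((\<lambda>t. ham_field H (z t)) has_vector_derivative DF (z t) (ham_field H (z t)) + 0) (at t)"
      using vector_derivative_diff_chain_within[of z "ham_field H (z t)" t UNIV "ham_field H" "DF (z t)"]
        z[of t] C.F_deriv[OF C.curve_in[of t]]
      by (simp add: o_def has_derivative_at_withinI)
  qed
  \<comment> \<open>The velocity solves the variational equation. If it vanished at time 0 it would
    vanish always, and the orbit would be constant with equal limits.\<close>
  have p0: "ham_field H (z 0) \<noteq> 0"
  proof
    assume "ham_field H (z 0) = 0"
    moreover have "solves ?A (\<lambda>_. 0) (\<lambda>_. 0)" by (simp add: solves_def blinfun.zero_right)
    ultimately have "(\<lambda>t. ham_field H (z t)) = (\<lambda>_. 0)"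
      by (intro A.solves_unique[OF y, where s = 0]) simp_all
    then have z0: "(z has_vector_derivative 0) (at t)" for t using z[of t] by (metis (no_types))
    have "\<exists>c. \<forall>t. z t = c"
    proof (rule has_vector_derivative_zero_constant[OF convex_UNIV z0])
      fix c assume "\<And>t. t \<in> UNIV \<Longrightarrow> z t = c"
      then show "\<exists>c. \<forall>t. z t = c" by (intro exI[of _ c] allI) simp
    qed
    then obtain c where "\<forall>t. z t = c" by (rule exE)
    then have "z = (\<lambda>_. c)" by (simp add: fun_eq_iff)
    then have "pa = c" "pu = c" using lim by (simp_all add: tendsto_const_iff)
    then show False using ne by simp
  qed
  \<comment> \<open>The energy is constant along the orbit and continuous at the limit
    \<open>pa\<close>, where it is 0.\<close>
  have Hz: "H (z t) = 0" for t
  proof -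
    have "H (z s) = H (z t)" for s
      by (rule hamiltonian_constant_along_orbit[OF H[OF C.curve_in] z])
    then have "((\<lambda>s. H (z s)) \<longlongrightarrow> H (z t)) at_bot" by (intro tendsto_eventually always_eventually allI)
    moreover have "((\<lambda>s. H (z s)) \<longlongrightarrow> H pa) at_bot"
      using differentiable_imp_continuous_within[OF H[OF pU(1)]] lim(1) by (rule isCont_tendsto_compose)
    ultimately have "H (z t) = H pa" by (rule tendsto_unique[OF trivial_limit_at_bot_linorder])
    then show ?thesis using Hpa by simp
  qed
  have stab: "tangent_stable (ham_field H) pu (z 0) \<subseteq> stable_space ?A"
    by (rule C.tangent_stable_subset[OF z lim(2) pU(2) invu])
  have unst: "tangent_unstable (ham_field H) pa (z 0) \<subseteq> unstable_space ?A"
  proof -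
    \<comment> \<open>The unstable manifold is the stable one of the time-reversed system, taken
      along the reversed orbit.\<close>
    interpret R: perturbed_curve "\<lambda>x. - ham_field H x" "\<lambda>t x. - G (- t) x" "\<lambda>x. - DF x" "\<lambda>t x. - DG (- t) x" U M "\<lambda>t. z (- t)" \<rho>
    proof (intro perturbed_curve.intro C.reverse_time perturbed_curve_axioms.intro)
      show "continuous_on UNIV (\<lambda>t. z (- t))"
        by (intro continuous_on_compose2[OF C.z_cont] continuous_on_minus continuous_on_id) simp
    qed (rule C.\<rho> C.tube)+
    have "tangent_stable (\<lambda>x. - ham_field H x) pa (z (- 0)) \<subseteq> stable_space (\<lambda>t. - DF (z (- t)))"
    proof (rule R.tangent_stable_subset[where K = Ka])
      show "((\<lambda>t. z (- t)) has_vector_derivative - ham_field H (z (- t))) (at t)" for t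
        by (rule has_vector_derivative_reflect[OF z])
      show "((\<lambda>t. z (- t)) \<longlongrightarrow> pa) at_top" using lim(1) by (simp add: filterlim_at_bot_mirror)
      show "bounded_inverse (\<lambda>_. - DF pa) Ka" using bounded_inverse_reflect[OF inva] .
    qed (rule pU)
    then show ?thesis using tangent_unstable_reflect[of "ham_field H" pa "z 0"]
      unfolding unstable_space_reflect by simp
  qed
  have tr: "\<exists>a b. a \<in> stable_space ?A \<and> b \<in> unstable_space ?A \<and> v = a + b" if v: "grad H (z 0) \<bullet> v = 0" for v
  proof -
    have "v \<in> tangent_vectors {x. H x = 0} (z 0)"
    proof (rule level_set_tangent_vectors[OF C.U C.curve_in])
      show "GDERIV H x :> grad H x" if "x \<in> U" for x by (rule GDERIV_grad[OF H[OF that]])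
      show "continuous_on U (grad H)"
        unfolding grad_eq_Jmap_ham_field[abs_def]
        by (intro continuous_on_minus bounded_linear.continuous_on[OF bounded_linear_Jmap] C.F_cont)
      show "grad H (z 0) \<noteq> 0" using p0 np[of "z 0"] by force
    qed (simp_all add: Hz v)
    then obtain u w where "v = u + w" "u \<in> tangent_unstable (ham_field H) pa (z 0)" "w \<in> tangent_stable (ham_field H) pu (z 0)"
      using trans by blast
    then show ?thesis using stab unst by (intro exI[of _ w] exI[of _ u]) (auto simp: add.commute)
  qed
  \<comment> \<open>The velocity is continuous with limits at both ends, hence bounded; this is the
    input for its exponential decay.\<close>
  obtain B where B: "\<And>t. norm (ham_field H (z t)) \<le> B"
  proof -
    have "bounded (ham_field H ` z ` UNIV)"
    proof -
      have limF: "((\<lambda>t. ham_field H (z t)) \<longlongrightarrow> ham_field H pu) at_top" "((\<lambda>t. ham_field H (z t)) \<longlongrightarrow> ham_field H pa) at_bot"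
        by (rule continuous_on_tendsto_compose[OF C.F_cont lim(2) pU(2)], simp add: C.curve_in)
          (rule continuous_on_tendsto_compose[OF C.F_cont lim(1) pU(1)], simp add: C.curve_in)
      have "\<forall>\<^sub>F t in at_top. dist (ham_field H (z t)) (ham_field H pu) < 1" using limF(1) by (intro tendstoD) simp_all
      then obtain T2 where T2: "\<And>t. t \<ge> T2 \<Longrightarrow> dist (ham_field H (z t)) (ham_field H pu) < 1"
        unfolding eventually_at_top_linorder by blast
      have "\<forall>\<^sub>F t in at_bot. dist (ham_field H (z t)) (ham_field H pa) < 1" using limF(2) by (intro tendstoD) simp_all
      then obtain T1 where T1: "\<And>t. t \<le> T1 \<Longrightarrow> dist (ham_field H (z t)) (ham_field H pa) < 1"
        unfolding eventually_at_bot_linorder by blast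
      have "bounded ((\<lambda>t. ham_field H (z t)) ` {T1..T2})"
        by (intro compact_imp_bounded compact_continuous_image solves_continuous[OF y] compact_Icc)
      moreover have "bounded (ball (ham_field H pa) 1)" "bounded (ball (ham_field H pu) 1)" by simp_all
      ultimately have b: "bounded ((\<lambda>t. ham_field H (z t)) ` {T1..T2} \<union> (ball (ham_field H pa) 1 \<union> ball (ham_field H pu) 1))"
        by (simp only: bounded_Un)
      have "ham_field H (z t) \<in> (\<lambda>t. ham_field H (z t)) ` {T1..T2} \<union> (ball (ham_field H pa) 1 \<union> ball (ham_field H pu) 1)" for t
      proof -
        consider "t \<le> T1" | "t \<ge> T2" | "t \<in> {T1..T2}" by force
        then show ?thesis
        proof cases
          case 1 then show ?thesis using T1[of t] by (simp add: dist_commute)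
        next
          case 2 then show ?thesis using T2[of t] by (simp add: dist_commute)
        qed blast
      qed
      then have "ham_field H ` z ` UNIV \<subseteq> (\<lambda>t. ham_field H (z t)) ` {T1..T2} \<union> (ball (ham_field H pa) 1 \<union> ball (ham_field H pu) 1)"
        by (simp only: image_image image_subset_iff ball_UNIV simp_thms)
      then show ?thesis by (rule bounded_subset[OF b])
    qed
    then show thesis using that by (auto simp: bounded_iff)
  qed
  obtain D l where l: "l > 0" and dec: "\<forall>t. norm (ham_field H (z t)) \<le> D * exp (- l * \<bar>t\<bar>)"
    using A.bounded_solution_decay_both[OF limu invu lima inva y B] by blast
  show ?thesis
  proof (rule A.fredholm_alternative[OF limu invu lima inva _ _ l _ _ tr])
    show "continuous_on UNIV (\<lambda>t. grad H (z t))"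
      unfolding grad_eq_Jmap_ham_field
      by (intro continuous_on_minus bounded_linear.continuous_on[OF bounded_linear_Jmap] solves_continuous[OF y])
    show "norm (grad H (z t)) \<le> D * exp (- l * \<bar>t\<bar>)" for t using dec by (simp add: np)
    show "((\<lambda>t. grad H (z t) \<bullet> x t) has_real_derivative grad H (z t) \<bullet> h t) (at t)" if "solves ?A h x" for h x t
      by (rule grad_adjoint_solution[OF C H z that])
    show "grad H (z 0) \<noteq> 0" using p0 np[of "z 0"] by force
  qed
qed

theorem theorem4p1:
  fixes F1 :: "('n::finite, 'm::finite) config \<Rightarrow> real ^ 'n"
    and F2 :: "('n, 'm) config \<Rightarrow> real ^ 'm"
    and g :: "real \<Rightarrow> ('n, 'm) config \<Rightarrow> real ^ 'm"
    and \<sigma> :: "('n, 'm) config \<Rightarrow> real ^ 'm ^ 'm"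
    and za zb zu :: "('n, 'm) config"
    and \<Phi>0 :: "real \<Rightarrow> ('n, 'm) phase"
    and \<alpha>0 \<delta>0 \<mu> \<epsilon>' :: real
  assumes delta0: "0 < \<delta>0" "\<delta>0 < 1"
    and A1: "\<And>a b. a < b \<Longrightarrow> A1 \<delta>0 a b F1 F2 g \<sigma>"
    and A2: "A2 \<mu> \<epsilon>' F1 F2 za zb zu"
    and A3: "A3 F1 F2 g \<sigma> za zu \<Phi>0 \<alpha>0"
  shows "\<exists>\<epsilon>0>0. \<exists>(\<Gamma>a :: real \<Rightarrow> real \<Rightarrow> ('n, 'm) phase) (\<Gamma>u :: real \<Rightarrow> real \<Rightarrow> ('n, 'm) phase)
           (\<alpha> :: real \<Rightarrow> real) (\<Phi>up :: real \<Rightarrow> real \<Rightarrow> ('n, 'm) phase).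
      (\<forall>\<epsilon>. \<bar>\<epsilon>\<bar> < \<epsilon>0 \<longrightarrow>
         hamiltonian_solution (Heps F1 F2 g \<sigma> \<epsilon>) (\<Gamma>a \<epsilon>) \<and>
         hyperbolic_trajectory (\<lambda>t. ham_field (Heps F1 F2 g \<sigma> \<epsilon> t)) (\<Gamma>a \<epsilon>) \<and>
         hamiltonian_solution (Heps F1 F2 g \<sigma> \<epsilon>) (\<Gamma>u \<epsilon>) \<and>
         hyperbolic_trajectory (\<lambda>t. ham_field (Heps F1 F2 g \<sigma> \<epsilon> t)) (\<Gamma>u \<epsilon>) \<and>
         bdd_above (range (\<lambda>t. norm (\<Gamma>a \<epsilon> t - (za, 0)))) \<and>
         bdd_above (range (\<lambda>t. norm (\<Gamma>u \<epsilon> t - (zu, 0)))) \<and>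
         hamiltonian_solution (Heps F1 F2 g \<sigma> \<epsilon>) (\<Phi>up \<epsilon>) \<and>
         bdd_above (range (\<lambda>t. norm (\<Phi>up \<epsilon> t - \<Phi>0 (t - \<alpha> \<epsilon>)))) \<and>
         ((\<lambda>t. norm (\<Phi>up \<epsilon> t - \<Gamma>a \<epsilon> t)) \<longlongrightarrow> 0) at_bot \<and>
         ((\<lambda>t. norm (\<Phi>up \<epsilon> t - \<Gamma>u \<epsilon> t)) \<longlongrightarrow> 0) at_top) \<and>
      (\<lambda>\<epsilon>. (SUP t. norm (\<Gamma>a \<epsilon> t - (za, 0))) + (SUP t. norm (\<Gamma>u \<epsilon> t - (zu, 0))))
        \<in> O[nhds 0](\<lambda>\<epsilon>. \<epsilon>) \<and>
      (\<lambda>\<epsilon>. \<alpha> \<epsilon> - \<alpha>0) \<in> O[nhds 0](\<lambda>\<epsilon>. \<epsilon>) \<and>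
      (\<lambda>\<epsilon>. SUP t. norm (\<Phi>up \<epsilon> t - \<Phi>0 (t - \<alpha> \<epsilon>))) \<in> O[nhds 0](\<lambda>\<epsilon>. \<epsilon>) \<and>
      (\<forall>Na Nu. open Na \<and> za \<in> Na \<and> open Nu \<and> zu \<in> Nu \<longrightarrow>
         (\<forall>\<^sub>F \<epsilon> in nhds 0.
            (\<forall>\<^sub>F t in at_bot. fst (\<Phi>up \<epsilon> t) \<in> Na) \<and> (\<forall>\<^sub>F t in at_top. fst (\<Phi>up \<epsilon> t) \<in> Nu)))"
proof -
  note a1 = A3[unfolded A3_def]
  note a2 = conjunct2[OF a1] and Phi0 = conjunct1[OF a1]
  note a3 = conjunct2[OF a2]
  note a4 = conjunct2[OF a3] and lim = conjunct1[OF a2] conjunct1[OF a3]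
  note a5 = conjunct2[OF a4]
  note a6 = conjunct2[OF a5] and hypa = conjunct1[OF a5]
  note a7 = conjunct2[OF a6] and hypu = conjunct1[OF a6]
  note a8 = conjunct2[OF a7] and trans = conjunct1[OF a7]
  note m0 = conjunct1[OF a8] and dm = conjunct2[OF a8]
  from conjunct1[OF a4] obtain U where u1: "open U \<and> range \<Phi>0 \<union> {(za, 0), (zu, 0)} \<subseteq> U \<and>
        (\<forall>\<Phi>\<in>U. H0 F1 F2 \<sigma> differentiable (at \<Phi>)) \<and>
        (\<forall>t. \<forall>\<Phi>\<in>U. H1 g t differentiable (at \<Phi>)) \<and>
        Cb_on 3 (fst ` U) (diffusion \<sigma>) \<and>
        Cb_on 2 U (Fham F1 F2 \<sigma>) \<and>
        Cb_on 2 (UNIV \<times> U) (\<lambda>(t, \<Phi>). Gham g t \<Phi>)"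
    by (rule exE)
  note u2 = conjunct2[OF u1]
  note u3 = conjunct2[OF u2] and U = conjunct1[OF u1] conjunct1[OF u2]
  note u4 = conjunct2[OF u3] and H0_diff = bspec[OF conjunct1[OF u3]]
  note u5 = conjunct2[OF u4]
  note u6 = conjunct2[OF conjunct2[OF u5]]
  note CbF = conjunct1[OF conjunct2[OF u5]] and CbG = u6
  have H1_diff: "\<And>t \<Phi>. \<Phi> \<in> U \<Longrightarrow> H1 g t differentiable (at \<Phi>)"
    using conjunct1[OF u4] by (simp only: Ball_def)
  obtain D where D: "(melnikov F1 F2 g \<sigma> \<Phi>0 has_real_derivative D) (at \<alpha>0)" "D \<noteq> 0" using dm by (elim exE conjE) (rule that)
  let ?pa = "(za, 0) :: ('n, 'm) phase" and ?pu = "(zu, 0) :: ('n, 'm) phase"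
  let ?F = "Fham F1 F2 \<sigma>" and ?G = "Gham g"
  define DF where "DF x = Blinfun (frechet_derivative (Fham F1 F2 \<sigma>) (at x))" for x
  define DG where "DG t x = Blinfun (frechet_derivative (Gham g t) (at x))" for t x
  obtain M where S: "perturbed_system ?F ?G DF DG U M"
    using Cb_on_2_imp_perturbed_system[OF U(1) CbF CbG] unfolding DF_def[abs_def] DG_def[abs_def] by blast
  interpret S: perturbed_system ?F ?G DF DG U M by (rule S)
  have z: "(\<Phi>0 has_vector_derivative ?F (\<Phi>0 t)) (at t)" for t
    using Phi0 by (simp add: hamiltonian_solution_def Fham_def)
  have zc: "continuous_on UNIV \<Phi>0"
    by (intro continuous_at_imp_continuous_on ballI has_vector_derivative_continuous[OF z])
  obtain \<rho> where \<rho>: "\<rho> > 0" "\<And>t. cball (\<Phi>0 t) \<rho> \<subseteq> U" "cball ?pa \<rho> \<subseteq> U" "cball ?pu \<rho> \<subseteq> U"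
    using orbit_tube[OF zc lim U] by blast
  have C: "perturbed_curve ?F ?G DF DG U M \<Phi>0 \<rho>"
    by (intro perturbed_curve.intro S perturbed_curve_axioms.intro zc \<rho>)
  interpret C: perturbed_curve ?F ?G DF DG U M \<Phi>0 \<rho> by (rule C)
  have pU: "?pa \<in> U" "?pu \<in> U" using U(2) by simp_all
  obtain Ka where inva: "bounded_inverse (\<lambda>_. DF ?pa) Ka"
    using hyperbolic_equilibrium_bounded_inverse[OF hypa] unfolding DF_def by blast
  obtain Ku where invu: "bounded_inverse (\<lambda>_. DF ?pu) Ku"
    using hyperbolic_equilibrium_bounded_inverse[OF hypu] unfolding DF_def by blast
  \<comment> \<open>A saddle has an eigenvalue with positive real part and a stable equilibrium has
    none, so the two limits differ and the orbit is not constant.\<close>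
  have ne: "?pa \<noteq> ?pu"
  proof
    assume "?pa = ?pu"
    then have "stable_hyperbolic_equilibrium (drift F1 F2) zu" "saddle_equilibrium (drift F1 F2) zu"
      using A2 by (simp_all add: A2_def)
    then obtain c where "complex_eigenvalue (frechet_derivative (drift F1 F2) (at zu)) c" "Re c > 0" "Re c < 0"
      unfolding saddle_equilibrium_def stable_hyperbolic_equilibrium_def by blast
    then show False by simp
  qed
  have H_pa: "H0 F1 F2 \<sigma> ?pa = 0" by (simp add: H0_def zero_prod_def)
  obtain \<beta> :: "(real \<Rightarrow>\<^sub>C ('n, 'm) phase) \<Rightarrow> real" and R e where \<beta>: "bounded_linear \<beta>" and R: "bounded_linear R"
    and \<beta>_eq: "\<And>h. \<beta> h = (\<integral>t. grad (H0 F1 F2 \<sigma>) (\<Phi>0 t) \<bullet> apply_bcontfun h t \<partial>lborel)"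
    and sol: "\<And>h. solves (\<lambda>t. DF (\<Phi>0 t)) (apply_bcontfun (h - \<beta> h *\<^sub>R e)) (apply_bcontfun (R h))"
    using heteroclinic_fredholm[OF C[unfolded Fham_def] H0_diff z[unfolded Fham_def] lim pU ne inva invu H_pa
        eq_refl[OF trans[unfolded Fham_def, symmetric]]] by blast
  \<comment> \<open>At zero deviation and \<epsilon> = 1 the forcing is \<open>G\<close> along the
    orbit at time t + \<alpha>, so the functional \<open>\<beta>\<close> returns the Melnikov
    integral itself.\<close>
  have m: "melnikov F1 F2 g \<sigma> \<Phi>0 \<alpha> = \<beta> (C.forcing 1 \<alpha> 0)" for \<alpha>
    using \<rho>(1) by (simp add: \<beta>_eq melnikov_def C.forcing)
  obtain \<epsilon>3 C3 where \<epsilon>3: "\<epsilon>3 > 0" "C3 \<ge> 0" and up0: "\<forall>\<epsilon>. \<bar>\<epsilon>\<bar> \<le> \<epsilon>3 \<longrightarrow> (\<exists>\<alpha> \<Phi>. \<bar>\<alpha> - \<alpha>0\<bar> \<le> C3 * \<bar>\<epsilon>\<bar> \<and>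
     (\<forall>t. \<Phi> t \<in> U) \<and> (\<forall>t. norm (\<Phi> t - \<Phi>0 (t - \<alpha>)) \<le> C3 * \<bar>\<epsilon>\<bar>) \<and>
     (\<forall>t. (\<Phi> has_vector_derivative ?F (\<Phi> t) + \<epsilon> *\<^sub>R ?G t (\<Phi> t)) (at t)))"
    using C.melnikov_persistence[OF z \<beta> R sol m m0 D] by (elim exE conjE) (rule that)
  have Fa: "?F ?pa = 0" and Fu: "?F ?pu = 0" using hypa hypu by (simp_all add: hyperbolic_equilibrium_def)
  obtain \<epsilon>a Ca where \<epsilon>a: "\<epsilon>a > 0" "Ca \<ge> 0" and a0: "\<forall>\<epsilon>. \<bar>\<epsilon>\<bar> \<le> \<epsilon>a \<longrightarrow> (\<exists>\<Gamma>. (\<forall>t. \<Gamma> t \<in> U) \<and>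
     (\<forall>t. norm (\<Gamma> t - ?pa) \<le> Ca * \<bar>\<epsilon>\<bar>) \<and> (\<forall>t. (\<Gamma> has_vector_derivative ?F (\<Gamma> t) + \<epsilon> *\<^sub>R ?G t (\<Gamma> t)) (at t)) \<and>
     exponential_dichotomy (\<lambda>t. blinfun_apply (DF (\<Gamma> t) + \<epsilon> *\<^sub>R DG t (\<Gamma> t))))"
    using S.hyperbolic_trajectory_persists[OF Fa \<rho>(3,1) inva] by (elim exE conjE) (rule that)
  obtain \<epsilon>u Cu where \<epsilon>u: "\<epsilon>u > 0" "Cu \<ge> 0" and u0: "\<forall>\<epsilon>. \<bar>\<epsilon>\<bar> \<le> \<epsilon>u \<longrightarrow> (\<exists>\<Gamma>. (\<forall>t. \<Gamma> t \<in> U) \<and>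
     (\<forall>t. norm (\<Gamma> t - ?pu) \<le> Cu * \<bar>\<epsilon>\<bar>) \<and> (\<forall>t. (\<Gamma> has_vector_derivative ?F (\<Gamma> t) + \<epsilon> *\<^sub>R ?G t (\<Gamma> t)) (at t)) \<and>
     exponential_dichotomy (\<lambda>t. blinfun_apply (DF (\<Gamma> t) + \<epsilon> *\<^sub>R DG t (\<Gamma> t))))"
    using S.hyperbolic_trajectory_persists[OF Fu \<rho>(4,1) invu] by (elim exE conjE) (rule that)
  define K where "K = max Ca (max Cu C3)"
  have K: "K \<ge> 0" "\<And>\<epsilon>. Ca * \<bar>\<epsilon>\<bar> \<le> K * \<bar>\<epsilon>\<bar>" "\<And>\<epsilon>. Cu * \<bar>\<epsilon>\<bar> \<le> K * \<bar>\<epsilon>\<bar>" "\<And>\<epsilon>. C3 * \<bar>\<epsilon>\<bar> \<le> K * \<bar>\<epsilon>\<bar>"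
    using \<epsilon>a(2) by (simp_all add: K_def mult_right_mono le_max_iff_disj)
  obtain \<epsilon>4 where \<epsilon>4: "\<epsilon>4 > 0" and bot: "\<forall>\<epsilon> \<alpha> \<Phi> \<Gamma>. \<bar>\<epsilon>\<bar> \<le> \<epsilon>4 \<and>
     (\<forall>t. (\<Phi> has_vector_derivative ?F (\<Phi> t) + \<epsilon> *\<^sub>R ?G t (\<Phi> t)) (at t)) \<and>
     (\<forall>t. (\<Gamma> has_vector_derivative ?F (\<Gamma> t) + \<epsilon> *\<^sub>R ?G t (\<Gamma> t)) (at t)) \<and>
     (\<forall>t. norm (\<Phi> t - \<Phi>0 (t - \<alpha>)) \<le> K * \<bar>\<epsilon>\<bar>) \<and> (\<forall>t. norm (\<Gamma> t - ?pa) \<le> K * \<bar>\<epsilon>\<bar>) \<longrightarrow>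
     ((\<lambda>t. norm (\<Phi> t - \<Gamma> t)) \<longlongrightarrow> 0) at_bot"
    using S.approach_at_bot[OF inva \<rho>(3,1) K(1) lim(1)] by (elim exE conjE) (rule that)
  obtain \<epsilon>5 where \<epsilon>5: "\<epsilon>5 > 0" and top: "\<forall>\<epsilon> \<alpha> \<Phi> \<Gamma>. \<bar>\<epsilon>\<bar> \<le> \<epsilon>5 \<and>
     (\<forall>t. (\<Phi> has_vector_derivative ?F (\<Phi> t) + \<epsilon> *\<^sub>R ?G t (\<Phi> t)) (at t)) \<and>
     (\<forall>t. (\<Gamma> has_vector_derivative ?F (\<Gamma> t) + \<epsilon> *\<^sub>R ?G t (\<Gamma> t)) (at t)) \<and>
     (\<forall>t. norm (\<Phi> t - \<Phi>0 (t - \<alpha>)) \<le> K * \<bar>\<epsilon>\<bar>) \<and> (\<forall>t. norm (\<Gamma> t - ?pu) \<le> K * \<bar>\<epsilon>\<bar>) \<longrightarrow>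
     ((\<lambda>t. norm (\<Phi> t - \<Gamma> t)) \<longlongrightarrow> 0) at_top"
    using S.approach_at_top[OF invu \<rho>(4,1) K(1) lim(2)] by (elim exE conjE) (rule that)
  define \<epsilon>0 where "\<epsilon>0 = min \<epsilon>3 (min \<epsilon>a (min \<epsilon>u (min \<epsilon>4 \<epsilon>5)))"
  have \<epsilon>0: "\<epsilon>0 > 0" using \<epsilon>3 \<epsilon>a \<epsilon>u \<epsilon>4 \<epsilon>5 by (simp add: \<epsilon>0_def)
  have small: "\<bar>\<epsilon>\<bar> \<le> \<epsilon>3" "\<bar>\<epsilon>\<bar> \<le> \<epsilon>a" "\<bar>\<epsilon>\<bar> \<le> \<epsilon>u" "\<bar>\<epsilon>\<bar> \<le> \<epsilon>4" "\<bar>\<epsilon>\<bar> \<le> \<epsilon>5" if "\<bar>\<epsilon>\<bar> < \<epsilon>0" for \<epsilon>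
    using that by (simp_all add: \<epsilon>0_def)
  define sys where "sys \<epsilon> w \<longleftrightarrow> (\<forall>t. w t \<in> U) \<and> (\<forall>t. (w has_vector_derivative ?F (w t) + \<epsilon> *\<^sub>R ?G t (w t)) (at t))" for \<epsilon> w
  define hyp where "hyp \<epsilon> p w \<longleftrightarrow> sys \<epsilon> w \<and> (\<forall>t. norm (w t - p) \<le> K * \<bar>\<epsilon>\<bar>) \<and>
     exponential_dichotomy (\<lambda>t. blinfun_apply (DF (w t) + \<epsilon> *\<^sub>R DG t (w t)))" for \<epsilon> p w
  define con where "con \<epsilon> a w \<longleftrightarrow> sys \<epsilon> w \<and> \<bar>a - \<alpha>0\<bar> \<le> K * \<bar>\<epsilon>\<bar> \<and> (\<forall>t. norm (w t - \<Phi>0 (t - a)) \<le> K * \<bar>\<epsilon>\<bar>)" for \<epsilon> a w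
  \<comment> \<open>The guard stands under the existential quantifier, so that choice yields a
    function on all reals, with arbitrary values for large \<epsilon>.\<close>
  have "\<forall>\<epsilon>. \<exists>w. \<bar>\<epsilon>\<bar> < \<epsilon>0 \<longrightarrow> hyp \<epsilon> ?pa w"
  proof
    fix \<epsilon>
    show "\<exists>w. \<bar>\<epsilon>\<bar> < \<epsilon>0 \<longrightarrow> hyp \<epsilon> ?pa w"
      using a0[rule_format, OF small(2)] order_trans[OF _ K(2)] unfolding hyp_def sys_def by meson
  qed
  then obtain \<Gamma>a where Ga: "\<And>\<epsilon>. \<bar>\<epsilon>\<bar> < \<epsilon>0 \<Longrightarrow> hyp \<epsilon> ?pa (\<Gamma>a \<epsilon>)" by metis
  have "\<forall>\<epsilon>. \<exists>w. \<bar>\<epsilon>\<bar> < \<epsilon>0 \<longrightarrow> hyp \<epsilon> ?pu w"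
  proof
    fix \<epsilon>
    show "\<exists>w. \<bar>\<epsilon>\<bar> < \<epsilon>0 \<longrightarrow> hyp \<epsilon> ?pu w"
      using u0[rule_format, OF small(3)] order_trans[OF _ K(3)] unfolding hyp_def sys_def by meson
  qed
  then obtain \<Gamma>u where Gu: "\<And>\<epsilon>. \<bar>\<epsilon>\<bar> < \<epsilon>0 \<Longrightarrow> hyp \<epsilon> ?pu (\<Gamma>u \<epsilon>)" by metis
  have "\<forall>\<epsilon>. \<exists>a w. \<bar>\<epsilon>\<bar> < \<epsilon>0 \<longrightarrow> con \<epsilon> a w"
  proof
    fix \<epsilon>
    show "\<exists>a w. \<bar>\<epsilon>\<bar> < \<epsilon>0 \<longrightarrow> con \<epsilon> a w"
      using up0[rule_format, OF small(1)] order_trans[OF _ K(4)] unfolding con_def sys_def by meson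
  qed
  then obtain \<alpha> \<Phi>up where con: "\<And>\<epsilon>. \<bar>\<epsilon>\<bar> < \<epsilon>0 \<Longrightarrow> con \<epsilon> (\<alpha> \<epsilon>) (\<Phi>up \<epsilon>)" by metis
  have sysI: "hamiltonian_solution (Heps F1 F2 g \<sigma> \<epsilon>) w" if "sys \<epsilon> w" for \<epsilon> w
    using that unfolding sys_def by (intro hamiltonian_solution_HepsI[OF U(1) H0_diff H1_diff]) simp_all
  have hypI: "hyperbolic_trajectory (\<lambda>t. ham_field (Heps F1 F2 g \<sigma> \<epsilon> t)) w" if "hyp \<epsilon> p w" for \<epsilon> p w
    using that unfolding hyp_def sys_def
    by (intro hyperbolic_trajectory_HepsI[OF U(1) H0_diff H1_diff S]) simp_all
  have Ga_le: "norm (\<Gamma>a \<epsilon> t - ?pa) \<le> K * \<bar>\<epsilon>\<bar>" and Gu_le: "norm (\<Gamma>u \<epsilon> t - ?pu) \<le> K * \<bar>\<epsilon>\<bar>"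
    and up_le: "norm (\<Phi>up \<epsilon> t - \<Phi>0 (t - \<alpha> \<epsilon>)) \<le> K * \<bar>\<epsilon>\<bar>" and \<alpha>_le: "\<bar>\<alpha> \<epsilon> - \<alpha>0\<bar> \<le> K * \<bar>\<epsilon>\<bar>"
    if "\<bar>\<epsilon>\<bar> < \<epsilon>0" for \<epsilon> t
    using Ga[OF that] Gu[OF that] con[OF that] by (simp_all add: hyp_def con_def)
  have ev: "\<forall>\<^sub>F \<epsilon> in nhds 0. \<bar>\<epsilon>\<bar> < r" if "r > 0" for r :: real
    using that by (intro eventually_nhds_metric[THEN iffD2] exI[of _ r]) (simp add: dist_real_def)
  show ?thesis
  proof (rule exI[of _ \<epsilon>0], intro conjI, rule \<epsilon>0, rule exI[of _ \<Gamma>a], rule exI[of _ \<Gamma>u], rule exI[of _ \<alpha>],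
      rule exI[of _ \<Phi>up], intro conjI)
    show "\<forall>\<epsilon>. \<bar>\<epsilon>\<bar> < \<epsilon>0 \<longrightarrow>
         hamiltonian_solution (Heps F1 F2 g \<sigma> \<epsilon>) (\<Gamma>a \<epsilon>) \<and>
         hyperbolic_trajectory (\<lambda>t. ham_field (Heps F1 F2 g \<sigma> \<epsilon> t)) (\<Gamma>a \<epsilon>) \<and>
         hamiltonian_solution (Heps F1 F2 g \<sigma> \<epsilon>) (\<Gamma>u \<epsilon>) \<and>
         hyperbolic_trajectory (\<lambda>t. ham_field (Heps F1 F2 g \<sigma> \<epsilon> t)) (\<Gamma>u \<epsilon>) \<and>
         bdd_above (range (\<lambda>t. norm (\<Gamma>a \<epsilon> t - (za, 0)))) \<and>
         bdd_above (range (\<lambda>t. norm (\<Gamma>u \<epsilon> t - (zu, 0)))) \<and>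
         hamiltonian_solution (Heps F1 F2 g \<sigma> \<epsilon>) (\<Phi>up \<epsilon>) \<and>
         bdd_above (range (\<lambda>t. norm (\<Phi>up \<epsilon> t - \<Phi>0 (t - \<alpha> \<epsilon>)))) \<and>
         ((\<lambda>t. norm (\<Phi>up \<epsilon> t - \<Gamma>a \<epsilon> t)) \<longlongrightarrow> 0) at_bot \<and>
         ((\<lambda>t. norm (\<Phi>up \<epsilon> t - \<Gamma>u \<epsilon> t)) \<longlongrightarrow> 0) at_top"
    proof (intro allI impI)
      fix \<epsilon> assume e: "\<bar>\<epsilon>\<bar> < \<epsilon>0"
      have s: "sys \<epsilon> (\<Gamma>a \<epsilon>)" "sys \<epsilon> (\<Gamma>u \<epsilon>)" "sys \<epsilon> (\<Phi>up \<epsilon>)"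
        using Ga[OF e] Gu[OF e] con[OF e] by (simp_all add: hyp_def con_def)
      show "hamiltonian_solution (Heps F1 F2 g \<sigma> \<epsilon>) (\<Gamma>a \<epsilon>) \<and>
         hyperbolic_trajectory (\<lambda>t. ham_field (Heps F1 F2 g \<sigma> \<epsilon> t)) (\<Gamma>a \<epsilon>) \<and>
         hamiltonian_solution (Heps F1 F2 g \<sigma> \<epsilon>) (\<Gamma>u \<epsilon>) \<and>
         hyperbolic_trajectory (\<lambda>t. ham_field (Heps F1 F2 g \<sigma> \<epsilon> t)) (\<Gamma>u \<epsilon>) \<and>
         bdd_above (range (\<lambda>t. norm (\<Gamma>a \<epsilon> t - (za, 0)))) \<and>
         bdd_above (range (\<lambda>t. norm (\<Gamma>u \<epsilon> t - (zu, 0)))) \<and>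
         hamiltonian_solution (Heps F1 F2 g \<sigma> \<epsilon>) (\<Phi>up \<epsilon>) \<and>
         bdd_above (range (\<lambda>t. norm (\<Phi>up \<epsilon> t - \<Phi>0 (t - \<alpha> \<epsilon>)))) \<and>
         ((\<lambda>t. norm (\<Phi>up \<epsilon> t - \<Gamma>a \<epsilon> t)) \<longlongrightarrow> 0) at_bot \<and>
         ((\<lambda>t. norm (\<Phi>up \<epsilon> t - \<Gamma>u \<epsilon> t)) \<longlongrightarrow> 0) at_top"
      proof (intro conjI sysI s hypI[OF Ga[OF e]] hypI[OF Gu[OF e]])
        show "bdd_above (range (\<lambda>t. norm (\<Gamma>a \<epsilon> t - (za, 0))))" by (rule bdd_aboveI2[OF Ga_le[OF e]])
        show "bdd_above (range (\<lambda>t. norm (\<Gamma>u \<epsilon> t - (zu, 0))))" by (rule bdd_aboveI2[OF Gu_le[OF e]])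
        show "bdd_above (range (\<lambda>t. norm (\<Phi>up \<epsilon> t - \<Phi>0 (t - \<alpha> \<epsilon>))))" by (rule bdd_aboveI2[OF up_le[OF e]])
        show "((\<lambda>t. norm (\<Phi>up \<epsilon> t - \<Gamma>a \<epsilon> t)) \<longlongrightarrow> 0) at_bot"
          using s small(4)[OF e] Ga_le[OF e] up_le[OF e] unfolding sys_def
          by (intro bot[THEN spec, THEN spec, THEN spec, THEN spec, THEN mp]) blast
        show "((\<lambda>t. norm (\<Phi>up \<epsilon> t - \<Gamma>u \<epsilon> t)) \<longlongrightarrow> 0) at_top"
          using s small(5)[OF e] Gu_le[OF e] up_le[OF e] unfolding sys_def
          by (intro top[THEN spec, THEN spec, THEN spec, THEN spec, THEN mp]) blast
      qed
    qed
    show "(\<lambda>\<epsilon>. (SUP t. norm (\<Gamma>a \<epsilon> t - (za, 0))) + (SUP t. norm (\<Gamma>u \<epsilon> t - (zu, 0)))) \<in> O[nhds 0](\<lambda>\<epsilon>. \<epsilon>)"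
      by (intro sum_in_bigo(1) SUP_in_bigo[OF \<epsilon>0 _ Ga_le] SUP_in_bigo[OF \<epsilon>0 _ Gu_le] norm_ge_zero)
    show "(\<lambda>\<epsilon>. \<alpha> \<epsilon> - \<alpha>0) \<in> O[nhds 0](\<lambda>\<epsilon>. \<epsilon>)"
      by (rule bigoI[where c = K], rule eventually_mono[OF ev[OF \<epsilon>0]]) (simp add: \<alpha>_le)
    show "(\<lambda>\<epsilon>. SUP t. norm (\<Phi>up \<epsilon> t - \<Phi>0 (t - \<alpha> \<epsilon>))) \<in> O[nhds 0](\<lambda>\<epsilon>. \<epsilon>)"
      by (intro SUP_in_bigo[OF \<epsilon>0 _ up_le] norm_ge_zero)
    have close: "fst (\<Phi>up \<epsilon> t) \<in> N"
      if N: "ball p r \<subseteq> N" and e: "\<bar>\<epsilon>\<bar> < \<epsilon>0" "K * \<bar>\<epsilon>\<bar> < r / 2" and n: "dist (\<Phi>0 (t - \<alpha> \<epsilon>)) (p, 0) < r / 2" for N p r \<epsilon> t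
    proof -
      have "dist (\<Phi>up \<epsilon> t) (p, 0) < r"
        using dist_triangle[of "\<Phi>up \<epsilon> t" "(p, 0)" "\<Phi>0 (t - \<alpha> \<epsilon>)"] up_le[OF e(1), of t] e(2) n
        by (simp add: dist_norm)
      then have "dist p (fst (\<Phi>up \<epsilon> t)) < r"
        using dist_fst_le[of "\<Phi>up \<epsilon> t" "(p, 0)"] by (simp add: dist_commute)
      then show ?thesis using N by (simp add: subset_eq)
    qed
    show "\<forall>Na Nu. open Na \<and> za \<in> Na \<and> open Nu \<and> zu \<in> Nu \<longrightarrow>
         (\<forall>\<^sub>F \<epsilon> in nhds 0. (\<forall>\<^sub>F t in at_bot. fst (\<Phi>up \<epsilon> t) \<in> Na) \<and> (\<forall>\<^sub>F t in at_top. fst (\<Phi>up \<epsilon> t) \<in> Nu))"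
    proof (intro allI impI)
      fix Na Nu assume N: "open Na \<and> za \<in> Na \<and> open Nu \<and> zu \<in> Nu"
      obtain ra where ra: "ra > 0" "ball za ra \<subseteq> Na" using N openE by blast
      obtain ru where ru: "ru > 0" "ball zu ru \<subseteq> Nu" using N openE by blast
      have "\<forall>\<^sub>F t in at_bot. dist (\<Phi>0 t) (za, 0) < ra / 2" using lim(1) ra by (intro tendstoD) simp_all
      then obtain T1 where T1: "\<And>t. t \<le> T1 \<Longrightarrow> dist (\<Phi>0 t) (za, 0) < ra / 2"
        unfolding eventually_at_bot_linorder by blast
      have "\<forall>\<^sub>F t in at_top. dist (\<Phi>0 t) (zu, 0) < ru / 2" using lim(2) ru by (intro tendstoD) simp_all
      then obtain T2 where T2: "\<And>t. t \<ge> T2 \<Longrightarrow> dist (\<Phi>0 t) (zu, 0) < ru / 2"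
        unfolding eventually_at_top_linorder by blast
      \<comment> \<open>K + 1 in place of K keeps the divisor positive when K = 0. Half of each
        radius is left for the distance of the unperturbed orbit from its limit.\<close>
      define r where "r = min \<epsilon>0 (min (ra / 2) (ru / 2) / (K + 1))"
      have r: "r > 0" using \<epsilon>0 ra ru K(1) by (simp add: r_def)
      show "\<forall>\<^sub>F \<epsilon> in nhds 0. (\<forall>\<^sub>F t in at_bot. fst (\<Phi>up \<epsilon> t) \<in> Na) \<and> (\<forall>\<^sub>F t in at_top. fst (\<Phi>up \<epsilon> t) \<in> Nu)"
        using ev[OF r]
      proof eventually_elim
        case (elim \<epsilon>)
        then have e: "\<bar>\<epsilon>\<bar> < \<epsilon>0" and "\<bar>\<epsilon>\<bar> < min (ra / 2) (ru / 2) / (K + 1)" by (simp_all add: r_def)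
        then have "(K + 1) * \<bar>\<epsilon>\<bar> < min (ra / 2) (ru / 2)"
          using K(1) by (simp add: pos_less_divide_eq mult.commute)
        moreover have "K * \<bar>\<epsilon>\<bar> \<le> (K + 1) * \<bar>\<epsilon>\<bar>" by (simp add: distrib_right)
        ultimately have Ke: "K * \<bar>\<epsilon>\<bar> < ra / 2" "K * \<bar>\<epsilon>\<bar> < ru / 2" by simp_all
        have "\<forall>\<^sub>F t in at_bot. fst (\<Phi>up \<epsilon> t) \<in> Na"
          unfolding eventually_at_bot_linorder
          by (intro exI[of _ "T1 + \<alpha> \<epsilon>"] allI impI close[OF ra(2) e Ke(1)] T1) simp
        moreover have "\<forall>\<^sub>F t in at_top. fst (\<Phi>up \<epsilon> t) \<in> Nu"
          unfolding eventually_at_top_linorder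
          by (intro exI[of _ "T2 + \<alpha> \<epsilon>"] allI impI close[OF ru(2) e Ke(2)] T2) simp
        ultimately show ?case by blast
      qed
    qed
  qed
qed

end
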